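(* Let $K\ge1$, let $P(x)=\sum_{k=0}^Kp_kx^k$, $p_K\neq0$, be a polynomial with real coefficients, and let $H$ be the self-adjoint Hankel operator in $L^2(\mathbb{R}_+)$ with kernel $h(t)=P(\ln t)\,t^{-1}$. Then: (1) The point $0$ is not an eigenvalue of $H$. (2) If $K$ is odd, then $\operatorname{spec}(H)=\mathbb{R}$. (3) If $K$ is even and $p_K>0$, then $\operatorname{spec}_{\rm ess}(H)=[0,\infty)$.
   Context: $H$ is the closure in $L^2(\mathbb{R}_+)$ of the operator $(H_0f)(t)=\int_0^\infty h(t+s)f(s)\,ds$ defined on the set $\mathcal{D}_0$ of functions $f$ on $\mathbb{R}_+$ satisfying $|f(t)|\le C\,t^{-1/2}(1+|\ln t|)^{-n}$ for some $C$ and some $n>K+1$; the operator $H_0$ is essentially self-adjoint. *)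

theory Defs
  imports "HOL-Analysis.Analysis" "HOL-Computational_Algebra.Polynomial"
begin

text \<open>
  Elements of the complex Hilbert space \<open>L\<^sup>2(M)\<close> are represented by functions; equality in
  \<open>L\<^sup>2(M)\<close> is equality almost everywhere.
\<close>

definition L2_space :: "'a measure \<Rightarrow> ('a \<Rightarrow> complex) set" where
  "L2_space M = {f \<in> borel_measurable M. integrable M (\<lambda>x. (cmod (f x))\<^sup>2)}"

definition L2_norm :: "'a measure \<Rightarrow> ('a \<Rightarrow> complex) \<Rightarrow> real" where
  "L2_norm M f = sqrt (LINT x|M. (cmod (f x))\<^sup>2)"

definition L2_converges :: "'a measure \<Rightarrow> (nat \<Rightarrow> 'a \<Rightarrow> complex) \<Rightarrow> ('a \<Rightarrow> complex) \<Rightarrow> bool" where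
  "L2_converges M F f \<longleftrightarrow>
     (\<forall>n. F n \<in> L2_space M) \<and> f \<in> L2_space M \<and>
     (\<lambda>n. L2_norm M (\<lambda>x. F n x - f x)) \<longlonglongrightarrow> 0"

text \<open>
  A (possibly unbounded) operator in \<open>L\<^sup>2(M)\<close> is represented by its graph, a set of pairs
  \<open>(f, g)\<close> with \<open>f\<close> in the domain and \<open>g = T f\<close>. The closure of an operator is the closure of
  its graph in \<open>L\<^sup>2(M) \<times> L\<^sup>2(M)\<close>; limits being determined only almost everywhere, the closed
  graph contains all representatives of its elements.
\<close>

type_synonym 'a L2_operator = "(('a \<Rightarrow> complex) \<times> ('a \<Rightarrow> complex)) set"

definition closure_op :: "'a measure \<Rightarrow> 'a L2_operator \<Rightarrow> 'a L2_operator" where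
  "closure_op M T =
     {(f, g). \<exists>F G. (\<forall>n. (F n, G n) \<in> T) \<and> L2_converges M F f \<and> L2_converges M G g}"

definition eigenspace :: "'a measure \<Rightarrow> 'a L2_operator \<Rightarrow> complex \<Rightarrow> ('a \<Rightarrow> complex) set" where
  "eigenspace M T z = {f. \<exists>g. (f, g) \<in> T \<and> (AE x in M. g x = z * f x)}"

definition is_eigenvalue :: "'a measure \<Rightarrow> 'a L2_operator \<Rightarrow> complex \<Rightarrow> bool" where
  "is_eigenvalue M T z \<longleftrightarrow> (\<exists>f\<in>eigenspace M T z. \<not> (AE x in M. f x = 0))"

definition finite_multiplicity :: "'a measure \<Rightarrow> 'a L2_operator \<Rightarrow> complex \<Rightarrow> bool" where
  "finite_multiplicity M T z \<longleftrightarrow>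
     (\<exists>B. finite B \<and> B \<subseteq> eigenspace M T z \<and>
        (\<forall>f\<in>eigenspace M T z. \<exists>c. AE x in M. f x = (\<Sum>b\<in>B. c b * b x)))"

text \<open>
  \<open>z\<close> is in the resolvent set iff \<open>T - z\<close> maps the domain of \<open>T\<close> one-to-one onto \<open>L\<^sup>2(M)\<close> with
  bounded inverse. Injectivity is contained in the estimate.
\<close>

definition resolvent_set :: "'a measure \<Rightarrow> 'a L2_operator \<Rightarrow> complex set" where
  "resolvent_set M T = {z.
     (\<forall>g\<in>L2_space M. \<exists>(f, k)\<in>T. AE x in M. k x - z * f x = g x) \<and>
     (\<exists>C. \<forall>(f, k)\<in>T. L2_norm M f \<le> C * L2_norm M (\<lambda>x. k x - z * f x))}"

definition spectrum :: "'a measure \<Rightarrow> 'a L2_operator \<Rightarrow> complex set" where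
  "spectrum M T = - resolvent_set M T"

text \<open>
  The essential spectrum of a self-adjoint operator: the spectrum without the isolated
  eigenvalues of finite multiplicity.
\<close>

definition essential_spectrum :: "'a measure \<Rightarrow> 'a L2_operator \<Rightarrow> complex set" where
  "essential_spectrum M T = spectrum M T -
     {z. z isolated_in spectrum M T \<and> is_eigenvalue M T z \<and> finite_multiplicity M T z}"

definition half_line :: "real measure" where
  "half_line = restrict_space lborel {0<..}"

definition hankel_kernel :: "real poly \<Rightarrow> real \<Rightarrow> real" where
  "hankel_kernel P t = poly P (ln t) / t"

definition hankel_initial_domain :: "nat \<Rightarrow> (real \<Rightarrow> complex) set" where
  "hankel_initial_domain K = {f \<in> borel_measurable half_line.
     \<exists>(C::real) (n::real). n > real K + 1 \<and>
       (\<forall>t>0. cmod (f t) \<le> C * t powr (- 1 / 2) * (1 + \<bar>ln t\<bar>) powr (- n))}"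

definition hankel_op0 :: "real poly \<Rightarrow> real L2_operator" where
  "hankel_op0 P =
     (\<lambda>f. (f, \<lambda>t. LINT s|half_line. complex_of_real (hankel_kernel P (t + s)) * f s)) `
       hankel_initial_domain (degree P)"

definition hankel_op :: "real poly \<Rightarrow> real L2_operator" where
  "hankel_op P = closure_op half_line (hankel_op0 P)"

end

theory Submission
  imports Defs "HOL-Probability.Probability" "HOL-Complex_Analysis.Complex_Analysis"
begin

text \<open>
  The kernel is a superposition of exponentials: \<open>P (ln t) / t\<close> is the Laplace transform of
  \<open>Q (- ln x)\<close> for a polynomial \<open>Q\<close> with the same leading term as \<open>P\<close> (\<open>ex_laplace_density\<close>). Hence
  \<open>H = L Q(- ln x) L\<close> with the Laplace transform \<open>L\<close> (\<open>hankel_factorization\<close>), an identity that holds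
  for the quadratic form as well. The Mellin transform on the critical line, a multiple of a unitary map
  from \<open>L\<^sup>2(\<real>)\<close> onto \<open>L\<^sup>2(\<real>\<^sub>+)\<close>, turns \<open>L\<close> into multiplication by \<open>gam s = \<Gamma> (1/2 + i s)\<close> followed by a
  reflection and \<open>ln x\<close> into a derivative. So \<open>H\<close> becomes the differential operator
  \<open>gam (- s) Q(i d/ds) gam s\<close>, where \<open>gam s gam (- s) = \<pi> / cosh (\<pi> s)\<close> decays exponentially
  (\<open>hankel_mellin\<close>).

  Self-adjointness. On Mellin transforms of test functions the deficiency subspaces are trivial. A vector in
  one of them yields a weak solution of \<open>Q(- i d/ds) \<beta> = z (cosh (\<pi> s) / \<pi>) \<beta>\<close>; the formal energy identity
  \<open>Im (z \<integral> cosh (\<pi> s) \<bar>\<beta>\<bar>\<^sup>2) = 0\<close> forces \<open>\<beta> = 0\<close>, and it is justified by mollification, because the weight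
  \<open>cosh (\<pi> s)\<close> changes by a bounded factor under bounded translations (\<open>weak_solution_trivial\<close>). The
  Mellin transforms of test functions therefore form a core, and the operator defined on the larger
  initial domain, being symmetric, has the same closure (\<open>hankel_eq_core\<close>).

  Injectivity. Each of the three factors in \<open>L Q(- ln x) L\<close> is injective (\<open>hankel_injective\<close>).

  Spectrum. The classical symbol \<open>Q(\<xi>) \<pi> / cosh (\<pi> s)\<close> takes each nonzero value \<open>l\<close> of the sign of \<open>Q(\<xi>)\<close> at
  points with \<open>\<xi>\<close> arbitrarily large. Wave packets concentrated at such points are approximate
  eigenfunctions for \<open>l\<close> (\<open>wave_packet\<close>). For odd degree both signs occur, which gives all of \<open>\<real>\<close>; for even
  degree and positive leading coefficient this gives \<open>[0, \<infinity>)\<close>.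

  Essential spectrum for even degree. Then \<open>Q\<close> is negative only on a bounded set, so the form of \<open>H\<close> is
  bounded below by \<open>- m \<integral> \<bar>L f\<bar>\<^sup>2\<close> over a compact interval in \<open>(0, \<infinity>)\<close>, and this is the form of a compact
  operator (\<open>compactly_bounded_below\<close>). Consequently the negative spectrum consists of eigenvalues of finite
  multiplicity that can accumulate only at \<open>0\<close> (\<open>essential_spectrum_nonneg\<close>), while points of the half-line
  \<open>[0, \<infinity>)\<close> are not isolated in the spectrum.
\<close>

section \<open>The space \<open>L\<^sup>2\<close>\<close>

lemma borel_measurable_cnj [measurable (raw)]:
  "f \<in> borel_measurable M \<Longrightarrow> (\<lambda>x. cnj (f x)) \<in> borel_measurable M"
  by (rule measurable_compose[OF _ borel_measurable_continuous_onI]) (auto intro: continuous_intros)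

definition L2_inner :: "'a measure \<Rightarrow> ('a \<Rightarrow> complex) \<Rightarrow> ('a \<Rightarrow> complex) \<Rightarrow> complex" where
  "L2_inner M f g = (LINT x|M. f x * cnj (g x))"

lemma L2_spaceI:
  assumes "f \<in> borel_measurable M" "integrable M (\<lambda>x. (cmod (f x))\<^sup>2)"
  shows "f \<in> L2_space M"
  using assms by (simp add: L2_space_def)

lemma L2_measurable [measurable_dest]: "f \<in> L2_space M \<Longrightarrow> f \<in> borel_measurable M"
  by (simp add: L2_space_def)

lemma L2_square_integrable: "f \<in> L2_space M \<Longrightarrow> integrable M (\<lambda>x. (cmod (f x))\<^sup>2)"
  by (simp add: L2_space_def)

lemma L2_space_bound:
  assumes "g \<in> L2_space M" "f \<in> borel_measurable M" "AE x in M. cmod (f x) \<le> C * cmod (g x)"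
  shows "f \<in> L2_space M"
proof (rule L2_spaceI)
  show "integrable M (\<lambda>x. (cmod (f x))\<^sup>2)"
  proof (rule Bochner_Integration.integrable_bound)
    show "integrable M (\<lambda>x. C\<^sup>2 * (cmod (g x))\<^sup>2)"
      using L2_square_integrable[OF assms(1)] by simp
    show "AE x in M. norm ((cmod (f x))\<^sup>2) \<le> norm (C\<^sup>2 * (cmod (g x))\<^sup>2)"
      using assms(3) 
    proof eventually_elim
      case (elim x)
      then have "(cmod (f x))\<^sup>2 \<le> (C * cmod (g x))\<^sup>2" by (intro power_mono) auto
      then show ?case by (simp add: power_mult_distrib)
    qed
  qed (use assms(2) in measurable)
qed (use assms in simp)

lemma L2_inner_integrable:
  assumes [measurable]: "f \<in> L2_space M" "g \<in> L2_space M"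
  shows "integrable M (\<lambda>x. f x * cnj (g x))"
proof (rule Bochner_Integration.integrable_bound)
  show "integrable M (\<lambda>x. (cmod (f x))\<^sup>2 + (cmod (g x))\<^sup>2)"
    using assms by (intro Bochner_Integration.integrable_add L2_square_integrable)
  have "a * b \<le> a\<^sup>2 + b\<^sup>2" if "a \<ge> 0" "b \<ge> 0" for a b :: real
    using sum_squares_bound[of a b] that mult_nonneg_nonneg[OF that] by linarith
  then show "AE x in M. norm (f x * cnj (g x)) \<le> norm ((cmod (f x))\<^sup>2 + (cmod (g x))\<^sup>2)"
    by (auto simp: norm_mult)
qed measurable

lemma L2_cmod_mult_integrable:
  assumes "f \<in> L2_space M" "g \<in> L2_space M"
  shows "integrable M (\<lambda>x. cmod (f x) * cmod (g x))"
  using integrable_norm[OF L2_inner_integrable[OF assms]] by (simp add: norm_mult)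

lemma L2_add:
  assumes [measurable]: "f \<in> L2_space M" "g \<in> L2_space M"
  shows "(\<lambda>x. f x + g x) \<in> L2_space M"
proof (rule L2_spaceI)
  show "integrable M (\<lambda>x. (cmod (f x + g x))\<^sup>2)"
  proof (rule Bochner_Integration.integrable_bound)
    show "integrable M (\<lambda>x. 2 * (cmod (f x))\<^sup>2 + 2 * (cmod (g x))\<^sup>2)"
      using assms by (intro Bochner_Integration.integrable_add integrable_mult_right L2_square_integrable)
    show "AE x in M. norm ((cmod (f x + g x))\<^sup>2) \<le> norm (2 * (cmod (f x))\<^sup>2 + 2 * (cmod (g x))\<^sup>2)"
    proof (rule AE_I2)
      fix x
      have "(cmod (f x + g x))\<^sup>2 \<le> (cmod (f x) + cmod (g x))\<^sup>2"
        by (intro power_mono norm_triangle_ineq) auto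
      also have "\<dots> \<le> 2 * (cmod (f x))\<^sup>2 + 2 * (cmod (g x))\<^sup>2"
        using sum_squares_bound[of "cmod (f x)" "cmod (g x)"] by (simp add: power2_sum)
      finally show "norm ((cmod (f x + g x))\<^sup>2) \<le> norm (2 * (cmod (f x))\<^sup>2 + 2 * (cmod (g x))\<^sup>2)"
        by simp
    qed
  qed measurable
qed measurable

lemma L2_scale:
  assumes "f \<in> L2_space M"
  shows "(\<lambda>x. c * f x) \<in> L2_space M"
  by (rule L2_space_bound[OF assms, where C = "cmod c"]) (use assms in \<open>auto simp: norm_mult\<close>)

lemma L2_combination:
  assumes "f \<in> L2_space M" "g \<in> L2_space M"
  shows "(\<lambda>x. a * f x + b * g x) \<in> L2_space M"
  using assms by (intro L2_add L2_scale)

lemma L2_diff: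
  assumes "f \<in> L2_space M" "g \<in> L2_space M"
  shows "(\<lambda>x. f x - g x) \<in> L2_space M"
  using L2_combination[OF assms, of 1 "-1"] by simp

lemma L2_zero: "(\<lambda>x. 0) \<in> L2_space M"
  by (simp add: L2_space_def)

lemma L2_sum:
  assumes "\<And>i. i \<in> I \<Longrightarrow> f i \<in> L2_space M"
  shows "(\<lambda>x. \<Sum>i\<in>I. f i x) \<in> L2_space M"
  using assms by (induction I rule: infinite_finite_induct) (auto simp: L2_zero L2_add)

lemma L2_AE_cong:
  assumes "f \<in> L2_space M" "g \<in> borel_measurable M" "AE x in M. f x = g x"
  shows "g \<in> L2_space M"
  by (rule L2_space_bound[OF assms(1,2), where C = 1]) (use assms(3) in auto)

lemma L2_norm_nonneg [simp]: "0 \<le> L2_norm M f"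
  by (simp add: L2_norm_def)

lemma L2_norm_square: "(L2_norm M f)\<^sup>2 = (LINT x|M. (cmod (f x))\<^sup>2)"
  by (simp add: L2_norm_def)

lemma L2_norm_zero: "L2_norm M (\<lambda>x. 0) = 0"
  by (simp add: L2_norm_def)

lemma L2_norm_scale: "L2_norm M (\<lambda>x. c * f x) = cmod c * L2_norm M f"
  by (simp add: L2_norm_def norm_mult power_mult_distrib real_sqrt_mult)

lemma L2_norm_minus_commute: "L2_norm M (\<lambda>x. f x - g x) = L2_norm M (\<lambda>x. g x - f x)"
  by (simp add: L2_norm_def norm_minus_commute)

lemma L2_norm_AE_cong:
  assumes "f \<in> borel_measurable M" "g \<in> borel_measurable M" "AE x in M. f x = g x"
  shows "L2_norm M f = L2_norm M g"
proof -
  have "(LINT x|M. (cmod (f x))\<^sup>2) = (LINT x|M. (cmod (g x))\<^sup>2)"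
    by (rule integral_cong_AE) (use assms in auto)
  then show ?thesis by (simp add: L2_norm_def)
qed

lemma L2_norm_mono:
  assumes "g \<in> L2_space M" "f \<in> borel_measurable M" "AE x in M. cmod (f x) \<le> cmod (g x)"
  shows "L2_norm M f \<le> L2_norm M g"
proof -
  have "(LINT x|M. (cmod (f x))\<^sup>2) \<le> (LINT x|M. (cmod (g x))\<^sup>2)"
  proof (rule integral_mono_AE)
    show "integrable M (\<lambda>x. (cmod (f x))\<^sup>2)"
      by (rule L2_square_integrable, rule L2_space_bound[OF assms(1,2), of 1]) (use assms(3) in auto)
    show "AE x in M. (cmod (f x))\<^sup>2 \<le> (cmod (g x))\<^sup>2"
      using assms(3) by eventually_elim (auto intro: power_mono)
  qed (use assms in \<open>auto intro: L2_square_integrable\<close>)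
  then show ?thesis by (simp add: L2_norm_def)
qed

lemma L2_norm_eq_0_AE:
  assumes "f \<in> L2_space M" "L2_norm M f = 0"
  shows "AE x in M. f x = 0"
proof -
  have "(LINT x|M. (cmod (f x))\<^sup>2) = 0" using assms(2) L2_norm_square[of M f] by simp
  then have "AE x in M. (cmod (f x))\<^sup>2 = 0"
    by (subst (asm) integral_nonneg_eq_0_iff_AE[OF L2_square_integrable[OF assms(1)]]) auto
  then show ?thesis by simp
qed

lemma L2_Cauchy_Schwarz_real:
  assumes [measurable]: "f \<in> L2_space M" "g \<in> L2_space M"
  shows "(LINT x|M. cmod (f x) * cmod (g x)) \<le> L2_norm M f * L2_norm M g"
proof -
  let ?I = "LINT x|M. cmod (f x) * cmod (g x)"
  have "(\<integral>\<^sup>+x. ennreal (cmod (f x)) * ennreal (cmod (g x)) \<partial>M)\<^sup>2 \<le>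
      (\<integral>\<^sup>+x. (ennreal (cmod (f x)))\<^sup>2 \<partial>M) * (\<integral>\<^sup>+x. (ennreal (cmod (g x)))\<^sup>2 \<partial>M)"
    by (rule Cauchy_Schwarz_nn_integral) measurable
  moreover have "(\<integral>\<^sup>+x. ennreal (cmod (f x)) * ennreal (cmod (g x)) \<partial>M) = ennreal ?I"
    by (simp add: ennreal_mult[symmetric] nn_integral_eq_integral[OF L2_cmod_mult_integrable[OF assms]])
  moreover have "(\<integral>\<^sup>+x. (ennreal (cmod (h x)))\<^sup>2 \<partial>M) = ennreal ((L2_norm M h)\<^sup>2)" 
    if "h \<in> L2_space M" for h
    using nn_integral_eq_integral[OF L2_square_integrable[OF that]]
    by (simp add: ennreal_power L2_norm_square)
  ultimately have "ennreal (?I\<^sup>2) \<le> ennreal ((L2_norm M f)\<^sup>2 * (L2_norm M g)\<^sup>2)"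
    using assms by (simp add: ennreal_power ennreal_mult)
  then have "?I\<^sup>2 \<le> (L2_norm M f * L2_norm M g)\<^sup>2"
    by (simp add: power_mult_distrib)
  then show ?thesis by (rule power2_le_imp_le) simp
qed

lemma L2_Cauchy_Schwarz:
  assumes "f \<in> L2_space M" "g \<in> L2_space M"
  shows "cmod (L2_inner M f g) \<le> L2_norm M f * L2_norm M g"
proof -
  have "cmod (L2_inner M f g) \<le> (LINT x|M. cmod (f x * cnj (g x)))"
    unfolding L2_inner_def by (rule integral_norm_bound)
  also have "\<dots> \<le> L2_norm M f * L2_norm M g"
    using L2_Cauchy_Schwarz_real[OF assms] by (simp add: norm_mult)
  finally show ?thesis .
qed

lemma L2_inner_commute: "L2_inner M g f = cnj (L2_inner M f g)"
proof -
  have "cnj (L2_inner M f g) = (LINT x|M. cnj (f x * cnj (g x)))"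
    by (simp add: L2_inner_def del: complex_cnj_mult)
  then show ?thesis by (simp add: L2_inner_def mult.commute)
qed

lemma L2_inner_self: "L2_inner M f f = of_real ((L2_norm M f)\<^sup>2)"
  unfolding L2_inner_def L2_norm_square
  by (subst integral_complex_of_real[symmetric]) (simp add: complex_norm_square del: of_real_power)

lemma L2_inner_combination_left:
  assumes "f \<in> L2_space M" "g \<in> L2_space M" "h \<in> L2_space M"
  shows "L2_inner M (\<lambda>x. a * f x + b * g x) h = a * L2_inner M f h + b * L2_inner M g h"
  unfolding L2_inner_def using L2_inner_integrable[OF assms(1,3)] L2_inner_integrable[OF assms(2,3)]
  by (simp add: distrib_right mult.assoc)

lemma L2_inner_combination_right:
  assumes "f \<in> L2_space M" "g \<in> L2_space M" "h \<in> L2_space M"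
  shows "L2_inner M h (\<lambda>x. a * f x + b * g x) = cnj a * L2_inner M h f + cnj b * L2_inner M h g"
  using arg_cong[OF L2_inner_combination_left[OF assms, of a b], of cnj]
  by (simp add: L2_inner_commute[symmetric])

lemma L2_inner_diff_left:
  assumes "f \<in> L2_space M" "g \<in> L2_space M" "h \<in> L2_space M"
  shows "L2_inner M (\<lambda>x. f x - g x) h = L2_inner M f h - L2_inner M g h"
  using L2_inner_combination_left[OF assms, of 1 "-1"] by simp

lemma L2_inner_diff_right:
  assumes "f \<in> L2_space M" "g \<in> L2_space M" "h \<in> L2_space M"
  shows "L2_inner M h (\<lambda>x. f x - g x) = L2_inner M h f - L2_inner M h g"
  using L2_inner_combination_right[OF assms, of 1 "-1"] by simp

lemma L2_norm_add_square:
  assumes "f \<in> L2_space M" "g \<in> L2_space M"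
  shows "(L2_norm M (\<lambda>x. f x + g x))\<^sup>2 =
    (L2_norm M f)\<^sup>2 + (L2_norm M g)\<^sup>2 + 2 * Re (L2_inner M f g)"
proof -
  have fg: "(\<lambda>x. f x + g x) \<in> L2_space M" by (rule L2_add[OF assms])
  have "L2_inner M (\<lambda>x. f x + g x) (\<lambda>x. f x + g x)
     = L2_inner M f f + L2_inner M g g + (L2_inner M f g + L2_inner M g f)"
    using L2_inner_combination_left[OF assms fg, of 1 1]
      L2_inner_combination_right[OF assms assms(1), of 1 1]
      L2_inner_combination_right[OF assms assms(2), of 1 1] by simp
  from arg_cong[OF this, of Re] show ?thesis
    by (simp only: L2_inner_self L2_inner_commute[of M g f]) simp
qed

lemma L2_triangle:
  assumes "f \<in> L2_space M" "g \<in> L2_space M"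
  shows "L2_norm M (\<lambda>x. f x + g x) \<le> L2_norm M f + L2_norm M g"
proof (rule power2_le_imp_le)
  have "Re (L2_inner M f g) \<le> L2_norm M f * L2_norm M g"
    using complex_Re_le_cmod L2_Cauchy_Schwarz[OF assms] by (rule order_trans)
  then show "(L2_norm M (\<lambda>x. f x + g x))\<^sup>2 \<le> (L2_norm M f + L2_norm M g)\<^sup>2"
    unfolding L2_norm_add_square[OF assms] by (simp add: power2_sum)
qed simp

lemma L2_triangle_diff:
  assumes "f \<in> L2_space M" "g \<in> L2_space M" "h \<in> L2_space M"
  shows "L2_norm M (\<lambda>x. f x - h x) \<le> L2_norm M (\<lambda>x. f x - g x) + L2_norm M (\<lambda>x. g x - h x)"
  using L2_triangle[OF L2_diff[OF assms(1,2)] L2_diff[OF assms(2,3)]] by simp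

lemma L2_triangle_sub:
  assumes "f \<in> L2_space M" "g \<in> L2_space M"
  shows "L2_norm M (\<lambda>x. f x - g x) \<le> L2_norm M f + L2_norm M g"
  using L2_triangle[OF assms(1) L2_scale[OF assms(2), of "-1"]] L2_norm_scale[of M "-1" g] by simp

lemma L2_norm_diff_ge:
  assumes "f \<in> L2_space M" "g \<in> L2_space M"
  shows "\<bar>L2_norm M f - L2_norm M g\<bar> \<le> L2_norm M (\<lambda>x. f x - g x)"
  using L2_triangle[OF L2_diff[OF assms] assms(2)] L2_triangle[OF L2_diff[OF assms(2,1)] assms(1)]
    L2_norm_minus_commute[of M f g] by simp

subsection \<open>Convergence\<close>

lemma L2_convergesD:
  assumes "L2_converges M F f"
  shows "F n \<in> L2_space M" "f \<in> L2_space M" "(\<lambda>n. L2_norm M (\<lambda>x. F n x - f x)) \<longlonglongrightarrow> 0"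
  using assms by (auto simp: L2_converges_def)

lemma L2_converges_const: "f \<in> L2_space M \<Longrightarrow> L2_converges M (\<lambda>_. f) f"
  by (simp add: L2_converges_def L2_norm_zero)

lemma L2_converges_norm:
  assumes "L2_converges M F f"
  shows "(\<lambda>n. L2_norm M (F n)) \<longlonglongrightarrow> L2_norm M f"
proof (rule LIM_zero_cancel, rule Lim_null_comparison)
  show "\<forall>\<^sub>F n in sequentially. norm (L2_norm M (F n) - L2_norm M f) \<le> L2_norm M (\<lambda>x. F n x - f x)"
    using L2_norm_diff_ge L2_convergesD(1,2)[OF assms] by (intro always_eventually) auto
qed (rule L2_convergesD(3)[OF assms])

lemma L2_converges_inner_left:
  assumes "L2_converges M F f" "g \<in> L2_space M"
  shows "(\<lambda>n. L2_inner M (F n) g) \<longlonglongrightarrow> L2_inner M f g"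
proof (rule LIM_zero_cancel, rule Lim_null_comparison)
  show "\<forall>\<^sub>F n in sequentially. norm (L2_inner M (F n) g - L2_inner M f g)
      \<le> L2_norm M (\<lambda>x. F n x - f x) * L2_norm M g"
    using L2_Cauchy_Schwarz[OF L2_diff assms(2)] L2_convergesD(1,2)[OF assms(1)]
    by (intro always_eventually) (auto simp: L2_inner_diff_left[symmetric] assms)
  show "(\<lambda>n. L2_norm M (\<lambda>x. F n x - f x) * L2_norm M g) \<longlonglongrightarrow> 0"
    by (rule tendsto_mult_left_zero[OF L2_convergesD(3)[OF assms(1)]])
qed

lemma L2_converges_inner:
  assumes "L2_converges M F f" "L2_converges M G g"
  shows "(\<lambda>n. L2_inner M (F n) (G n)) \<longlonglongrightarrow> L2_inner M f g"
proof -
  note F = L2_convergesD[OF assms(1)] and G = L2_convergesD[OF assms(2)]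
  have "(\<lambda>n. L2_inner M (F n) (G n) - L2_inner M (F n) g) \<longlonglongrightarrow> 0"
  proof (rule Lim_null_comparison)
    show "\<forall>\<^sub>F n in sequentially. norm (L2_inner M (F n) (G n) - L2_inner M (F n) g)
      \<le> L2_norm M (F n) * L2_norm M (\<lambda>x. G n x - g x)"
      using L2_Cauchy_Schwarz[OF F(1) L2_diff[OF G(1,2)]]
      by (intro always_eventually) (auto simp: L2_inner_diff_right[symmetric] F G)
    show "(\<lambda>n. L2_norm M (F n) * L2_norm M (\<lambda>x. G n x - g x)) \<longlonglongrightarrow> 0"
      using tendsto_mult[OF L2_converges_norm[OF assms(1)] G(3)] by simp
  qed
  from tendsto_add[OF this L2_converges_inner_left[OF assms(1) G(2)]] show ?thesis by simp
qed

lemma L2_converges_combination: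
  assumes "L2_converges M F f" "L2_converges M G g"
  shows "L2_converges M (\<lambda>n x. a * F n x + b * G n x) (\<lambda>x. a * f x + b * g x)"
proof -
  note F = L2_convergesD[OF assms(1)] and G = L2_convergesD[OF assms(2)]
  have "(\<lambda>n. L2_norm M (\<lambda>x. (a * F n x + b * G n x) - (a * f x + b * g x))) \<longlonglongrightarrow> 0"
  proof (rule Lim_null_comparison)
    have "L2_norm M (\<lambda>x. (a * F n x + b * G n x) - (a * f x + b * g x))
      \<le> cmod a * L2_norm M (\<lambda>x. F n x - f x) + cmod b * L2_norm M (\<lambda>x. G n x - g x)" for n
    proof -
      have "(\<lambda>x. (a * F n x + b * G n x) - (a * f x + b * g x)) =
          (\<lambda>x. a * (F n x - f x) + b * (G n x - g x))"
        by (auto simp: algebra_simps)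
      then show ?thesis
        using L2_triangle[OF L2_scale[OF L2_diff[OF F(1,2)]] L2_scale[OF L2_diff[OF G(1,2)]], of a n b n]
        by (simp only: L2_norm_scale)
    qed
    then show "\<forall>\<^sub>F n in sequentially. norm (L2_norm M (\<lambda>x. (a * F n x + b * G n x) - (a * f x + b * g x)))
      \<le> cmod a * L2_norm M (\<lambda>x. F n x - f x) + cmod b * L2_norm M (\<lambda>x. G n x - g x)"
      by (intro always_eventually) simp
    show "(\<lambda>n. cmod a * L2_norm M (\<lambda>x. F n x - f x) + cmod b * L2_norm M (\<lambda>x. G n x - g x)) \<longlonglongrightarrow> 0"
      using tendsto_add[OF tendsto_mult_right_zero[OF F(3)] tendsto_mult_right_zero[OF G(3)]] by simp
  qed
  then show ?thesis unfolding L2_converges_def using F G by (auto intro: L2_combination)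
qed

lemma L2_converges_AE_cong:
  assumes "L2_converges M F f"
    and "\<And>n. G n \<in> borel_measurable M" "\<And>n. AE x in M. F n x = G n x"
    and "g \<in> borel_measurable M" "AE x in M. f x = g x"
  shows "L2_converges M G g"
proof -
  note F = L2_convergesD[OF assms(1)]
  have [measurable]: "F n \<in> borel_measurable M" "f \<in> borel_measurable M" for n 
    using F by (auto dest: L2_measurable)
  have "L2_norm M (\<lambda>x. G n x - g x) = L2_norm M (\<lambda>x. F n x - f x)" for n
    by (rule L2_norm_AE_cong) (use assms(2,3)[of n] assms(4,5) in auto)
  then show ?thesis
    unfolding L2_converges_def
    using F(3) L2_AE_cong[OF F(1) assms(2,3)] L2_AE_cong[OF F(2) assms(4,5)] by auto
qed

subsection \<open>Completeness and orthogonal projection\<close>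

text \<open>
  Fatou's lemma for the square integrals.
\<close>

lemma L2_norm_le_of_AE_lim:
  assumes F: "\<And>n. F n \<in> L2_space M" and [measurable]: "f \<in> borel_measurable M"
    and lim: "AE x in M. (\<lambda>n. F n x) \<longlonglongrightarrow> f x"
    and bound: "\<And>n. n \<ge> N \<Longrightarrow> L2_norm M (F n) \<le> c" and c: "0 \<le> c"
  shows "f \<in> L2_space M" "L2_norm M f \<le> c"
proof -
  have [measurable]: "F n \<in> borel_measurable M" for n using F by (rule L2_measurable)
  have "(\<integral>\<^sup>+x. ennreal ((cmod (f x))\<^sup>2) \<partial>M) = (\<integral>\<^sup>+x. liminf (\<lambda>n. ennreal ((cmod (F n x))\<^sup>2)) \<partial>M)"
  proof (rule nn_integral_cong_AE)
    show "AE x in M. ennreal ((cmod (f x))\<^sup>2) = liminf (\<lambda>n. ennreal ((cmod (F n x))\<^sup>2))"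
      using lim
    proof eventually_elim
      case (elim x)
      then have "(\<lambda>n. ennreal ((cmod (F n x))\<^sup>2)) \<longlonglongrightarrow> ennreal ((cmod (f x))\<^sup>2)"
        by (intro tendsto_intros) auto
      then show ?case by (rule lim_imp_Liminf[symmetric, OF sequentially_bot])
    qed
  qed
  also have "\<dots> \<le> liminf (\<lambda>n. \<integral>\<^sup>+x. ennreal ((cmod (F n x))\<^sup>2) \<partial>M)"
    by (rule nn_integral_liminf) measurable
  also have "\<dots> \<le> liminf (\<lambda>n. ennreal (c\<^sup>2))"
  proof (rule Liminf_mono)
    show "\<forall>\<^sub>F n in sequentially. (\<integral>\<^sup>+x. ennreal ((cmod (F n x))\<^sup>2) \<partial>M) \<le> ennreal (c\<^sup>2)"
      using eventually_ge_at_top[of N]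
    proof eventually_elim
      case (elim n)
      then show ?case
        using nn_integral_eq_integral[OF L2_square_integrable[OF F[of n]]] bound[of n]
        by (auto simp: L2_norm_square[symmetric] intro!: ennreal_leI power_mono)
    qed
  qed
  finally have *: "(\<integral>\<^sup>+x. ennreal ((cmod (f x))\<^sup>2) \<partial>M) \<le> ennreal (c\<^sup>2)" by (simp add: Liminf_const)
  have "integrable M (\<lambda>x. (cmod (f x))\<^sup>2)"
    by (rule integrableI_nonneg) (use * in \<open>auto simp: less_top[symmetric] top_unique\<close>)
  then show f: "f \<in> L2_space M" by (intro L2_spaceI) measurable
  have "ennreal ((L2_norm M f)\<^sup>2) \<le> ennreal (c\<^sup>2)"
    using * nn_integral_eq_integral[OF L2_square_integrable[OF f]] by (simp add: L2_norm_square)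
  then show "L2_norm M f \<le> c" using c by (auto intro: power2_le_imp_le)
qed

text \<open>
  Riesz--Fischer: along a subsequence whose increments have norm at most \<open>2\<^sup>-\<^sup>n\<close> the increments are
  absolutely summable almost everywhere, because the partial sums of their moduli are bounded in
  \<open>L\<^sup>2\<close>; Fatou's lemma identifies the pointwise limit as the limit in norm.
\<close>

lemma L2_complete:
  assumes F: "\<And>n. F n \<in> L2_space M"
    and Cauchy: "\<And>e. e > 0 \<Longrightarrow> \<exists>N. \<forall>m\<ge>N. \<forall>n\<ge>N. L2_norm M (\<lambda>x. F m x - F n x) < e"
  shows "\<exists>f. L2_converges M F f"
proof -
  have [measurable]: "F n \<in> borel_measurable M" for n using F by (rule L2_measurable)
  have "\<exists>r. \<forall>k. (\<forall>m\<ge>r k. \<forall>n\<ge>r k. L2_norm M (\<lambda>x. F m x - F n x) < (1/2)^k) \<and> r k < r (Suc k)"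
  proof (rule dependent_nat_choice)
    show "\<exists>r. \<forall>m\<ge>r. \<forall>n\<ge>r. L2_norm M (\<lambda>x. F m x - F n x) < (1/2)^0"
      using Cauchy[of 1] by auto
  next
    fix r k
    obtain N where "\<forall>m\<ge>N. \<forall>n\<ge>N. L2_norm M (\<lambda>x. F m x - F n x) < (1/2)^Suc k"
      using Cauchy[of "(1/2)^Suc k"] by auto
    then show "\<exists>s. (\<forall>m\<ge>s. \<forall>n\<ge>s. L2_norm M (\<lambda>x. F m x - F n x) < (1/2)^Suc k) \<and> r < s"
      by (intro exI[of _ "max N (Suc r)"]) auto
  qed
  then obtain r where r: "\<And>k m n. m \<ge> r k \<Longrightarrow> n \<ge> r k \<Longrightarrow> L2_norm M (\<lambda>x. F m x - F n x) < (1/2)^k"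
    and r_less: "\<And>k. r k < r (Suc k)" by blast
  have mono_r: "strict_mono r" using r_less by (rule strict_monoI_Suc)
  define d where "d k x = F (r (Suc k)) x - F (r k) x" for k x
  have d_L2: "d k \<in> L2_space M" for k unfolding d_def[abs_def] by (intro L2_diff F)
  have [measurable]: "d k \<in> borel_measurable M" for k using d_L2 by (rule L2_measurable)
  have d_norm: "L2_norm M (d k) \<le> (1/2)^k" for k
    unfolding d_def[abs_def] using r[of k "r (Suc k)" "r k"] r_less[of k] by simp
  define S where "S n x = complex_of_real (\<Sum>k<n. cmod (d k x))" for n x
  have S: "S n \<in> L2_space M \<and> L2_norm M (S n) \<le> (\<Sum>k<n. (1/2)^k)" for n
  proof (induction n)
    case 0 then show ?case by (simp add: S_def[abs_def] L2_zero L2_norm_zero)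
  next
    case (Suc n)
    have c: "(\<lambda>x. complex_of_real (cmod (d n x))) \<in> L2_space M"
      by (rule L2_space_bound[OF d_L2[of n], of _ 1]) auto
    have c': "L2_norm M (\<lambda>x. complex_of_real (cmod (d n x))) \<le> (1/2)^n"
      using d_norm[of n] by (simp add: L2_norm_def)
    have eq: "S (Suc n) = (\<lambda>x. S n x + complex_of_real (cmod (d n x)))"
      by (auto simp: S_def)
    show ?case unfolding eq using L2_add[OF _ c, of "S n"] L2_triangle[OF _ c, of "S n"] c' Suc by auto
  qed
  have S_le: "L2_norm M (S n) \<le> 2" for n
  proof -
    have "(\<Sum>k<n. (1/2::real)^k) \<le> (\<Sum>k. (1/2)^k)"
      by (rule sum_le_suminf) (auto intro: summable_geometric)
    also have "\<dots> = 2" by (subst suminf_geometric) auto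
    finally show ?thesis using S[of n] by linarith
  qed
  have "(\<integral>\<^sup>+x. (SUP n. ennreal ((cmod (S n x))\<^sup>2)) \<partial>M) = (SUP n. \<integral>\<^sup>+x. ennreal ((cmod (S n x))\<^sup>2) \<partial>M)"
  proof (rule nn_integral_monotone_convergence_SUP)
    show "incseq (\<lambda>n x. ennreal ((cmod (S n x))\<^sup>2))"
      by (rule incseq_SucI)
         (auto simp: S_def le_fun_def sum_nonneg add_nonneg_nonneg simp del: of_real_sum of_real_add
           simp flip: of_real_add intro!: ennreal_leI power_mono)
    show "(\<lambda>x. ennreal ((cmod (S n x))\<^sup>2)) \<in> borel_measurable M" for n
      unfolding S_def by measurable
  qed
  also have "\<dots> \<le> ennreal 4"
  proof (rule SUP_least)
    fix n
    show "(\<integral>\<^sup>+x. ennreal ((cmod (S n x))\<^sup>2) \<partial>M) \<le> ennreal 4"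
      using nn_integral_eq_integral[OF L2_square_integrable, of "S n" M] S[of n] 
        power_mono[OF S_le[of n], of 2]
      by (simp add: L2_norm_square[symmetric] flip: ennreal_numeral del: ennreal_numeral)
  qed
  finally have fin: "(\<integral>\<^sup>+x. (SUP n. ennreal ((cmod (S n x))\<^sup>2)) \<partial>M) \<le> ennreal 4" .
  have "AE x in M. (SUP n. ennreal ((cmod (S n x))\<^sup>2)) \<noteq> \<infinity>"
    by (rule nn_integral_noteq_infinite)
      (use fin in \<open>auto simp: S_def less_top[symmetric] top_unique simp del: of_real_sum\<close>)
  then have conv: "AE x in M. convergent (\<lambda>k. F (r k) x)"
  proof eventually_elim
    case (elim x)
    then obtain B where B: "(SUP n. ennreal ((cmod (S n x))\<^sup>2)) = ennreal B" "B \<ge> 0"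
      by (cases "SUP n. ennreal ((cmod (S n x))\<^sup>2)") auto
    have "(\<Sum>k<n. cmod (d k x)) \<le> sqrt B" for n
    proof -
      have "ennreal ((cmod (S n x))\<^sup>2) \<le> ennreal B" unfolding B(1)[symmetric] by (rule SUP_upper) auto
      then have "(\<Sum>k<n. cmod (d k x))\<^sup>2 \<le> B"
        using B(2) by (simp add: S_def sum_nonneg del: of_real_sum)
      then show ?thesis using real_le_rsqrt by blast
    qed
    then have "(\<Sum>k\<le>n. cmod (d k x)) \<le> sqrt B" for n
      unfolding lessThan_Suc_atMost[symmetric] .
    then have "summable (\<lambda>k. cmod (d k x))"
      by (intro bounded_imp_summable) auto
    then have "summable (\<lambda>k. d k x)" by (rule summable_norm_cancel)
    then have "convergent (\<lambda>n. \<Sum>k<n. d k x)" by (simp add: summable_iff_convergent)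
    moreover have "(\<Sum>k<n. d k x) = F (r n) x - F (r 0) x" for n
      unfolding d_def by (rule sum_lessThan_telescope)
    ultimately have "convergent (\<lambda>n. F (r n) x - F (r 0) x)" by simp
    then have "convergent (\<lambda>n. (F (r n) x - F (r 0) x) + F (r 0) x)"
      by (intro convergent_add convergent_const)
    then show ?case by simp
  qed
  define f where "f x = lim (\<lambda>k. F (r k) x)" for x
  have [measurable]: "f \<in> borel_measurable M" unfolding f_def[abs_def] by measurable
  have lim: "AE x in M. (\<lambda>k. F (r k) x) \<longlonglongrightarrow> f x"
    using conv by eventually_elim (simp add: f_def convergent_LIMSEQ_iff)
  have key: "(\<lambda>x. f x - F m x) \<in> L2_space M \<and> L2_norm M (\<lambda>x. f x - F m x) \<le> (1/2)^k" if "m \<ge> r k" for m k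
  proof -
    have "L2_norm M (\<lambda>x. F (r n) x - F m x) \<le> (1/2)^k" if "n \<ge> k" for n
      using r[of k "r n" m] \<open>m \<ge> r k\<close> strict_mono_leD[OF mono_r that] by simp
    moreover have "AE x in M. (\<lambda>n. F (r n) x - F m x) \<longlonglongrightarrow> f x - F m x"
      using lim by eventually_elim (auto intro: tendsto_intros)
    ultimately show ?thesis
      using L2_norm_le_of_AE_lim[of "\<lambda>n x. F (r n) x - F m x" M "\<lambda>x. f x - F m x" k "(1/2)^k"]
      by (auto intro: L2_diff F)
  qed
  have f: "f \<in> L2_space M" using L2_add[OF conjunct1[OF key[of 0 "r 0"]] F[of "r 0"]] by simp
  have "(\<lambda>n. L2_norm M (\<lambda>x. F n x - f x)) \<longlonglongrightarrow> 0"
  proof (rule LIMSEQ_I)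
    fix e :: real assume "e > 0"
    then obtain k where "(1/2::real)^k < e" using real_arch_pow_inv[of e "1/2"] by auto
    then have "norm (L2_norm M (\<lambda>x. F m x - f x) - 0) < e" if "m \<ge> r k" for m
      using key[OF that] by (subst L2_norm_minus_commute) auto
    then show "\<exists>n0. \<forall>m\<ge>n0. norm (L2_norm M (\<lambda>x. F m x - f x) - 0) < e" by blast
  qed
  then show ?thesis using F f unfolding L2_converges_def by blast
qed

lemma L2_orthogonal_of_minimal:
  assumes g: "g \<in> L2_space M" and v: "v \<in> L2_space M"
    and min: "\<And>c. (L2_norm M g)\<^sup>2 \<le> (L2_norm M (\<lambda>x. g x + c * v x))\<^sup>2"
  shows "L2_inner M g v = 0"
proof (rule ccontr)
  define a where "a = L2_inner M g v"
  assume "L2_inner M g v \<noteq> 0"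
  then have a: "cmod a > 0" by (simp add: a_def)
  define t where "t = 1 / ((L2_norm M v)\<^sup>2 + 1)"
  have pos: "(L2_norm M v)\<^sup>2 + 1 > 0" by (simp add: add_nonneg_pos)
  then have t: "t > 0" "t * (L2_norm M v)\<^sup>2 < 1" by (auto simp: t_def field_simps)
  have "(L2_norm M (\<lambda>x. g x + (- (of_real t * a)) * v x))\<^sup>2
    = (L2_norm M g)\<^sup>2 + (t * cmod a)\<^sup>2 * (L2_norm M v)\<^sup>2 + 2 * Re (L2_inner M g (\<lambda>x. (- (of_real t * a)) * v x))"
    using t by (subst L2_norm_add_square[OF g L2_scale[OF v]])
      (simp only: L2_norm_scale, simp add: norm_mult power_mult_distrib)
  also have "L2_inner M g (\<lambda>x. (- (of_real t * a)) * v x) = - (of_real t * cnj a) * a"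
    using L2_inner_combination_right[OF v v g, of "- (of_real t * a)" 0] by (simp add: a_def)
  also have "Re (- (of_real t * cnj a) * a) = - t * (cmod a)\<^sup>2"
    by (simp add: cmod_power2) (simp add: power2_eq_square algebra_simps)
  finally have "2 * t * (cmod a)\<^sup>2 \<le> (t * cmod a)\<^sup>2 * (L2_norm M v)\<^sup>2"
    using min[of "- (of_real t * a)"] by simp
  then have "t * (cmod a)\<^sup>2 * 2 \<le> t * (cmod a)\<^sup>2 * (t * (L2_norm M v)\<^sup>2)"
    by (simp add: power2_eq_square algebra_simps)
  then have "2 \<le> t * (L2_norm M v)\<^sup>2"
    using t a by (subst (asm) mult_le_cancel_left_pos) auto
  then show False using t by simp
qed

text \<open>
  Existence of the orthogonal projection onto the closure of a linear subspace: by the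
  parallelogram identity a minimizing sequence for the distance is Cauchy.
\<close>

lemma L2_projection:
  assumes g: "g \<in> L2_space M" and V: "V \<subseteq> L2_space M" and ne: "V \<noteq> {}"
    and lin: "\<And>u v a b. u \<in> V \<Longrightarrow> v \<in> V \<Longrightarrow> (\<lambda>x. a * u x + b * v x) \<in> V"
  shows "\<exists>F f. (\<forall>n. F n \<in> V) \<and> L2_converges M F f \<and> (\<forall>v\<in>V. L2_inner M (\<lambda>x. g x - f x) v = 0)"
proof -
  define D where "D v = L2_norm M (\<lambda>x. g x - v x)" for v
  define m where "m = (INF v\<in>V. D v)"
  have bdd: "bdd_below (D ` V)" by (rule bdd_belowI[of _ 0]) (auto simp: D_def)
  have m_le: "m \<le> D v" if "v \<in> V" for v unfolding m_def using bdd that by (rule cINF_lower)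
  have m0: "0 \<le> m" unfolding m_def using ne by (intro cINF_greatest) (auto simp: D_def)
  have "\<exists>v\<in>V. D v < m + 1 / Suc n" for n
    using cINF_less_iff[OF ne bdd, of "m + 1 / Suc n"] unfolding m_def by simp
  then obtain F where FV: "\<And>n. F n \<in> V" and F_less: "\<And>n. D (F n) < m + 1 / Suc n" by metis
  have F: "F n \<in> L2_space M" for n using FV V by auto
  have gF: "(\<lambda>x. g x - F n x) \<in> L2_space M" for n by (rule L2_diff[OF g F])
  have par: "(L2_norm M (\<lambda>x. F j x - F k x))\<^sup>2 \<le> 2 * (D (F j))\<^sup>2 + 2 * (D (F k))\<^sup>2 - 4 * m\<^sup>2" for j k
  proof -
    let ?a = "\<lambda>x. g x - F k x" and ?b = "\<lambda>x. g x - F j x"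
    have 1: "(L2_norm M (\<lambda>x. ?a x + ?b x))\<^sup>2 = (D (F k))\<^sup>2 + (D (F j))\<^sup>2 + 2 * Re (L2_inner M ?a ?b)"
      by (subst L2_norm_add_square[OF gF gF]) (simp add: D_def)
    have inn: "L2_inner M ?a (\<lambda>x. -1 * ?b x) = - L2_inner M ?a ?b"
      using L2_inner_combination_right[OF gF[of j] gF[of j] gF[of k], where a = "-1" and b = 0] by simp
    have 2: "(L2_norm M (\<lambda>x. ?a x + -1 * ?b x))\<^sup>2 = (D (F k))\<^sup>2 + (D (F j))\<^sup>2 - 2 * Re (L2_inner M ?a ?b)"
      by (subst L2_norm_add_square[OF gF L2_scale[OF gF]]) (simp only: L2_norm_scale inn, simp add: D_def)
    have 3: "(\<lambda>x. ?a x + -1 * ?b x) = (\<lambda>x. F j x - F k x)" by auto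
    have "m \<le> D (\<lambda>x. (1/2) * F j x + (1/2) * F k x)" by (intro m_le lin FV)
    also have "\<dots> = L2_norm M (\<lambda>x. (1/2) * (?a x + ?b x))"
      unfolding D_def by (intro arg_cong[where f = "L2_norm M"]) (auto simp: field_simps)
    also have "\<dots> = L2_norm M (\<lambda>x. ?a x + ?b x) / 2" by (subst L2_norm_scale) simp
    finally have "2 * m \<le> L2_norm M (\<lambda>x. ?a x + ?b x)" by simp
    then have "(2 * m)\<^sup>2 \<le> (L2_norm M (\<lambda>x. ?a x + ?b x))\<^sup>2" using m0 by (intro power_mono) auto
    then show ?thesis using 1 2 unfolding 3 by (simp add: power2_eq_square)
  qed
  have "(\<lambda>n. (m + 1 / Suc n)\<^sup>2) \<longlonglongrightarrow> (m + 0)\<^sup>2"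
    by (intro tendsto_intros LIMSEQ_Suc lim_inverse_n')
  then have lim: "(\<lambda>n. (m + 1 / Suc n)\<^sup>2) \<longlonglongrightarrow> m\<^sup>2" by simp
  have "\<exists>f. L2_converges M F f"
  proof (rule L2_complete[OF F])
    fix e :: real assume e: "e > 0"
    then have "e\<^sup>2 / 4 > 0" by simp
    from order_tendstoD(2)[OF lim, of "m\<^sup>2 + e\<^sup>2 / 4"] this obtain N 
      where N: "\<And>n. n \<ge> N \<Longrightarrow> (m + 1 / Suc n)\<^sup>2 < m\<^sup>2 + e\<^sup>2 / 4"
      by (auto simp: eventually_sequentially)
    have DN: "(D (F n))\<^sup>2 < m\<^sup>2 + e\<^sup>2 / 4" if "n \<ge> N" for n
    proof -
      have "(D (F n))\<^sup>2 \<le> (m + 1 / Suc n)\<^sup>2"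
        using F_less[of n] by (intro power_mono) (auto simp: D_def)
      then show ?thesis using N[OF that] by simp
    qed
    have "L2_norm M (\<lambda>x. F j x - F k x) < e" if "j \<ge> N" "k \<ge> N" for j k
    proof (rule power2_less_imp_less)
      show "(L2_norm M (\<lambda>x. F j x - F k x))\<^sup>2 < e\<^sup>2"
        using par[of j k] DN[OF that(1)] DN[OF that(2)] by simp
    qed (use e in simp)
    then show "\<exists>N. \<forall>m\<ge>N. \<forall>n\<ge>N. L2_norm M (\<lambda>x. F m x - F n x) < e" by blast
  qed
  then obtain f where f: "L2_converges M F f" ..
  have gf: "(\<lambda>x. g x - f x) \<in> L2_space M" by (rule L2_diff[OF g L2_convergesD(2)[OF f]])
  have shift: "L2_converges M (\<lambda>n x. g x - F n x - h x) (\<lambda>x. g x - f x - h x)" if h: "h \<in> L2_space M" for h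
    using L2_converges_combination[OF L2_converges_combination[OF L2_converges_const[OF g] f, of 1 "-1"] 
        L2_converges_const[OF h], of 1 "-1"] by simp
  have Df: "D f \<le> m"
  proof (rule LIMSEQ_le)
    show "(\<lambda>n. D (F n)) \<longlonglongrightarrow> D f"
      using L2_converges_norm[OF shift[OF L2_zero]] by (simp add: D_def)
    show "(\<lambda>n. m + 1 / Suc n) \<longlonglongrightarrow> m"
      using tendsto_add[OF tendsto_const LIMSEQ_Suc[OF lim_inverse_n'], of m] by simp
    show "\<exists>N. \<forall>n\<ge>N. D (F n) \<le> m + 1 / Suc n" using F_less by (intro exI[of _ 0] allI impI less_imp_le)
  qed
  have "L2_inner M (\<lambda>x. g x - f x) v = 0" if v: "v \<in> V" for v
  proof (rule L2_orthogonal_of_minimal[OF gf])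
    show vL: "v \<in> L2_space M" using v V by auto
    fix c
    have lim: "(\<lambda>n. L2_norm M (\<lambda>x. g x - F n x - (- c) * v x)) \<longlonglongrightarrow> L2_norm M (\<lambda>x. g x - f x - (- c) * v x)"
      by (rule L2_converges_norm[OF shift[OF L2_scale[OF vL]]])
    have "m \<le> L2_norm M (\<lambda>x. g x - F n x - (- c) * v x)" for n
      using m_le[OF lin[OF FV[of n] v, of 1 "-c"]] by (simp add: D_def algebra_simps)
    then have "m \<le> L2_norm M (\<lambda>x. g x - f x - (- c) * v x)"
      by (intro LIMSEQ_le_const[OF lim]) auto
    with Df show "(L2_norm M (\<lambda>x. g x - f x))\<^sup>2 \<le> (L2_norm M (\<lambda>x. g x - f x + c * v x))\<^sup>2"
      by (intro power_mono) (auto simp: D_def)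
  qed
  then show ?thesis using FV f by blast
qed

section \<open>Closed symmetric operators and their spectra\<close>

text \<open>
  Operators are relations between representatives of \<open>L\<^sup>2\<close> classes. Closedness, applied to constant
  sequences, makes them insensitive to changes on null sets (\<open>AE_closed\<close>).
\<close>

locale closed_symmetric_operator =
  fixes M :: "'a measure" and T :: "'a L2_operator"
  assumes in_L2: "(f, g) \<in> T \<Longrightarrow> f \<in> L2_space M \<and> g \<in> L2_space M"
    and nonempty: "T \<noteq> {}"
    and combination: "(f, g) \<in> T \<Longrightarrow> (f', g') \<in> T \<Longrightarrow>
      (\<lambda>x. a * f x + b * f' x, \<lambda>x. a * g x + b * g' x) \<in> T"
    and closed: "(\<And>n. (F n, G n) \<in> T) \<Longrightarrow> L2_converges M F f \<Longrightarrow> L2_converges M G g \<Longrightarrow> (f, g) \<in> T"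
    and symmetric: "(f, g) \<in> T \<Longrightarrow> (f', g') \<in> T \<Longrightarrow> L2_inner M g f' = L2_inner M f g'"
begin

lemma dom_L2: "(f, g) \<in> T \<Longrightarrow> f \<in> L2_space M"
  and ran_L2: "(f, g) \<in> T \<Longrightarrow> g \<in> L2_space M"
  using in_L2 by auto

lemma shifted_L2: "(f, g) \<in> T \<Longrightarrow> (\<lambda>x. g x - z * f x) \<in> L2_space M"
  by (intro L2_diff L2_scale dom_L2 ran_L2)

lemma diff: "(f, g) \<in> T \<Longrightarrow> (f', g') \<in> T \<Longrightarrow> (\<lambda>x. f x - f' x, \<lambda>x. g x - g' x) \<in> T"
  using combination[of f g f' g' 1 "-1"] by simp

lemma scale: "(f, g) \<in> T \<Longrightarrow> (\<lambda>x. c * f x, \<lambda>x. c * g x) \<in> T"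
  using combination[of f g f g c 0] by simp

lemma AE_closed:
  assumes "(f, g) \<in> T" "f' \<in> borel_measurable M" "AE x in M. f x = f' x"
    "g' \<in> borel_measurable M" "AE x in M. g x = g' x"
  shows "(f', g') \<in> T"
proof (rule closed[where F = "\<lambda>_. f" and G = "\<lambda>_. g"])
  note fg = in_L2[OF assms(1)]
  show "L2_converges M (\<lambda>_. f) f'"
    by (rule L2_converges_AE_cong[OF L2_converges_const[of f]]) (use fg assms in \<open>auto dest: L2_measurable\<close>)
  show "L2_converges M (\<lambda>_. g) g'"
    by (rule L2_converges_AE_cong[OF L2_converges_const[of g]]) (use fg assms in \<open>auto dest: L2_measurable\<close>)
qed (rule assms(1))

lemma inner_shifted:
  assumes "(f, g) \<in> T" "w \<in> L2_space M"
  shows "L2_inner M (\<lambda>x. g x - z * f x) w = L2_inner M g w - z * L2_inner M f w"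
  using L2_inner_combination_left[OF ran_L2[OF assms(1)] dom_L2[OF assms(1)] assms(2), of 1 "-z"] by simp

text \<open>
  The form \<open>\<langle>T f, f\<rangle>\<close> is real, so \<open>\<langle>(T - z) f, f\<rangle>\<close> has imaginary part \<open>- Im z \<parallel>f\<parallel>\<^sup>2\<close>.
\<close>

lemma lower_bound_nonreal:
  assumes "(f, g) \<in> T"
  shows "\<bar>Im z\<bar> * L2_norm M f \<le> L2_norm M (\<lambda>x. g x - z * f x)"
proof (cases "L2_norm M f = 0")
  case False
  then have pos: "L2_norm M f > 0" using L2_norm_nonneg[of M f] by linarith
  have "cnj (L2_inner M g f) = L2_inner M g f"
    using symmetric[OF assms assms] by (simp add: L2_inner_commute[symmetric])
  then have "Im (L2_inner M g f) = 0" by (simp add: complex_eq_iff)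
  then have "Im (L2_inner M (\<lambda>x. g x - z * f x) f) = - Im z * (L2_norm M f)\<^sup>2"
    by (simp add: inner_shifted[OF assms dom_L2[OF assms]] L2_inner_self del: of_real_power)
  then have "\<bar>Im z\<bar> * (L2_norm M f)\<^sup>2 = \<bar>Im (L2_inner M (\<lambda>x. g x - z * f x) f)\<bar>"
    by (simp add: abs_mult)
  also have "\<dots> \<le> L2_norm M (\<lambda>x. g x - z * f x) * L2_norm M f"
    using abs_Im_le_cmod L2_Cauchy_Schwarz[OF shifted_L2[OF assms] dom_L2[OF assms]] by (rule order_trans)
  finally show ?thesis using pos by (simp add: power2_eq_square)
qed simp

text \<open>
  A lower bound makes the range of \<open>T - z\<close> closed, since \<open>T\<close> is closed; so the range is all of
  \<open>L\<^sup>2\<close> once its orthogonal complement is trivial.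
\<close>

lemma resolventI:
  assumes bound: "\<And>f g. (f, g) \<in> T \<Longrightarrow> L2_norm M f \<le> C * L2_norm M (\<lambda>x. g x - z * f x)"
    and trivial: "\<And>w. w \<in> L2_space M \<Longrightarrow> (\<And>f g. (f, g) \<in> T \<Longrightarrow> L2_inner M (\<lambda>x. g x - z * f x) w = 0) \<Longrightarrow>
      AE x in M. w x = 0"
  shows "z \<in> resolvent_set M T"
proof -
  define V where "V = {(\<lambda>x. g x - z * f x) | f g. (f, g) \<in> T}"
  have VL: "V \<subseteq> L2_space M" unfolding V_def by (auto intro: shifted_L2)
  have V_ne: "V \<noteq> {}" using nonempty unfolding V_def by auto
  have lin: "(\<lambda>x. a * u x + b * v x) \<in> V" if "u \<in> V" "v \<in> V" for u v a b
  proof -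
    from that(1)[unfolded V_def mem_Collect_eq] obtain f g
      where u: "u = (\<lambda>x. g x - z * f x) \<and> (f, g) \<in> T" by (elim exE)
    from that(2)[unfolded V_def mem_Collect_eq] obtain f' g'
      where v: "v = (\<lambda>x. g' x - z * f' x) \<and> (f', g') \<in> T" by (elim exE)
    note * = conjunct2[OF u] conjunct2[OF v] conjunct1[OF u] conjunct1[OF v]
    have "(\<lambda>x. a * u x + b * v x) = (\<lambda>x. (a * g x + b * g' x) - z * (a * f x + b * f' x))"
      unfolding * by (auto simp: algebra_simps)
    then show ?thesis using combination[OF *(1,2), of a b] unfolding V_def mem_Collect_eq
      by (intro exI[of _ "\<lambda>x. a * f x + b * f' x"] exI[of _ "\<lambda>x. a * g x + b * g' x"] conjI)
  qed
  have "\<exists>(f, k)\<in>T. AE x in M. k x - z * f x = h x" if h: "h \<in> L2_space M" for h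
  proof -
    obtain R k where RV: "\<And>n. R n \<in> V" and R: "L2_converges M R k"
      and orth: "\<And>v. v \<in> V \<Longrightarrow> L2_inner M (\<lambda>x. h x - k x) v = 0"
      using L2_projection[OF h VL V_ne lin] by blast
    note k = L2_convergesD(2)[OF R]
    have hk: "AE x in M. h x - k x = 0"
    proof (rule trivial[OF L2_diff[OF h k]])
      fix f g assume "(f, g) \<in> T"
      then have "(\<lambda>x. g x - z * f x) \<in> V" by (auto simp: V_def)
      from orth[OF this] show "L2_inner M (\<lambda>x. g x - z * f x) (\<lambda>x. h x - k x) = 0"
        by (subst L2_inner_commute) simp
    qed
    have "\<exists>f g. (f, g) \<in> T \<and> R n = (\<lambda>x. g x - z * f x)" for n using RV[of n] by (auto simp: V_def)
    then obtain F G where FG: "\<And>n. (F n, G n) \<in> T" and Rn: "\<And>n. R n = (\<lambda>x. G n x - z * F n x)" by metis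
    have F: "F n \<in> L2_space M" for n using FG by (rule dom_L2)
    have "\<exists>f. L2_converges M F f"
    proof (rule L2_complete[OF F])
      fix e :: real assume e: "e > 0"
      then have "e / (2 * (\<bar>C\<bar> + 1)) > 0" by simp
      with L2_convergesD(3)[OF R] obtain N
        where N: "\<And>n. n \<ge> N \<Longrightarrow> L2_norm M (\<lambda>x. R n x - k x) < e / (2 * (\<bar>C\<bar> + 1))"
        unfolding LIMSEQ_iff by fastforce
      have "L2_norm M (\<lambda>x. F m x - F n x) < e" if "m \<ge> N" "n \<ge> N" for m n
      proof -
        let ?d = "L2_norm M (\<lambda>x. R m x - R n x)"
        have "?d \<le> L2_norm M (\<lambda>x. R m x - k x) + L2_norm M (\<lambda>x. k x - R n x)"
          using L2_convergesD(1)[OF R] k by (intro L2_triangle_diff) auto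
        also have "\<dots> < e / (\<bar>C\<bar> + 1)"
          using N[OF that(1)] N[OF that(2)] by (subst (2) L2_norm_minus_commute) (simp add: field_simps)
        finally have d: "?d < e / (\<bar>C\<bar> + 1)" .
        have "L2_norm M (\<lambda>x. F m x - F n x) \<le> C * L2_norm M (\<lambda>x. (G m x - G n x) - z * (F m x - F n x))"
          by (rule bound[OF diff[OF FG FG]])
        also have "(\<lambda>x. (G m x - G n x) - z * (F m x - F n x)) = (\<lambda>x. R m x - R n x)"
          by (auto simp: Rn algebra_simps)
        also have "C * ?d \<le> (\<bar>C\<bar> + 1) * ?d" by (intro mult_right_mono) auto
        also have "\<dots> < e" using d by (simp add: field_simps add_pos_nonneg)
        finally show ?thesis .
      qed
      then show "\<exists>N. \<forall>m\<ge>N. \<forall>n\<ge>N. L2_norm M (\<lambda>x. F m x - F n x) < e" by blast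
    qed
    then obtain f where f: "L2_converges M F f" ..
    have "L2_converges M (\<lambda>n x. 1 * R n x + z * F n x) (\<lambda>x. 1 * k x + z * f x)"
      by (rule L2_converges_combination[OF R f])
    moreover have "(\<lambda>n x. 1 * R n x + z * F n x) = G" by (auto simp: Rn)
    ultimately have G: "L2_converges M G (\<lambda>x. k x + z * f x)" by simp
    have "(f, \<lambda>x. k x + z * f x) \<in> T" by (rule closed[OF FG f G])
    moreover have "AE x in M. (k x + z * f x) - z * f x = h x" using hk by eventually_elim simp
    ultimately show ?thesis by (intro bexI[of _ "(f, \<lambda>x. k x + z * f x)"]) simp_all
  qed
  moreover have "\<exists>C. \<forall>(f, k)\<in>T. L2_norm M f \<le> C * L2_norm M (\<lambda>x. k x - z * f x)"
    using bound by (intro exI[of _ C]) auto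
  ultimately show ?thesis unfolding resolvent_set_def mem_Collect_eq
    by (intro conjI ballI)
qed

text \<open>
  Weyl's criterion: approximate eigenvectors contradict every lower bound for \<open>T - z\<close>.
\<close>

lemma spectrumI:
  assumes "\<And>e. e > 0 \<Longrightarrow> \<exists>f g. (f, g) \<in> T \<and> L2_norm M f > 0 \<and> L2_norm M (\<lambda>x. g x - z * f x) \<le> e * L2_norm M f"
  shows "z \<in> spectrum M T"
proof -
  have False if C: "\<And>f g. (f, g) \<in> T \<Longrightarrow> L2_norm M f \<le> C * L2_norm M (\<lambda>x. g x - z * f x)" for C
  proof -
    define e where "e = 1 / (2 * (\<bar>C\<bar> + 1))"
    have e: "e > 0" by (simp add: e_def add_nonneg_pos)
    obtain f g where fg: "(f, g) \<in> T" and pos: "L2_norm M f > 0"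
      and le: "L2_norm M (\<lambda>x. g x - z * f x) \<le> e * L2_norm M f" using assms[OF e] by blast
    have "L2_norm M f \<le> C * L2_norm M (\<lambda>x. g x - z * f x)" by (rule C[OF fg])
    also have "\<dots> \<le> (\<bar>C\<bar> + 1) * (e * L2_norm M f)" using le by (intro mult_mono) auto
    also have "\<dots> = L2_norm M f / 2"
    proof -
      define D where "D = \<bar>C\<bar> + 1"
      have "D > 0" by (simp add: D_def add_nonneg_pos)
      then show ?thesis unfolding e_def D_def[symmetric] by simp
    qed
    finally show False using pos by simp
  qed
  then show ?thesis unfolding spectrum_def resolvent_set_def by fast
qed

lemma eigenspace_iff:
  "f \<in> eigenspace M T z \<longleftrightarrow> (f, \<lambda>x. z * f x) \<in> T"
proof
  assume "f \<in> eigenspace M T z"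
  then obtain g where g: "(f, g) \<in> T" "AE x in M. g x = z * f x" by (auto simp: eigenspace_def)
  show "(f, \<lambda>x. z * f x) \<in> T"
    by (rule AE_closed[OF g(1)]) (use g(2) dom_L2[OF g(1)] in \<open>auto dest: L2_measurable\<close>)
qed (auto simp: eigenspace_def)

lemma eigenspace_L2: "f \<in> eigenspace M T z \<Longrightarrow> f \<in> L2_space M"
  using dom_L2 by (auto simp: eigenspace_def)

lemma eigenvectors_orthogonal:
  fixes r s :: real
  assumes f: "(f, \<lambda>x. of_real r * f x) \<in> T" and g: "(g, \<lambda>x. of_real s * g x) \<in> T" and "r \<noteq> s"
  shows "L2_inner M f g = 0"
proof -
  note fL = dom_L2[OF f] and gL = dom_L2[OF g]
  have "of_real r * L2_inner M f g = of_real s * L2_inner M f g"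
    using symmetric[OF f g] L2_inner_combination_left[OF fL fL gL, of "of_real r" 0]
      L2_inner_combination_right[OF gL gL fL, of "of_real s" 0] by simp
  then show ?thesis using \<open>r \<noteq> s\<close> by simp
qed

lemma eigenvector_normalized:
  assumes "f \<in> eigenspace M T z" "L2_norm M f \<noteq> 0"
  obtains e where "e \<in> eigenspace M T z" "L2_norm M e = 1" "e = (\<lambda>x. of_real (1 / L2_norm M f) * f x)"
proof
  show "(\<lambda>x. of_real (1 / L2_norm M f) * f x) \<in> eigenspace M T z"
    using scale[of f "\<lambda>x. z * f x" "of_real (1 / L2_norm M f)"] assms(1)
    unfolding eigenspace_iff by (simp add: mult.left_commute)
  show "L2_norm M (\<lambda>x. of_real (1 / L2_norm M f) * f x) = 1"
    using assms(2) by (subst L2_norm_scale) (simp add: norm_divide)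
qed simp

lemma eigenvalue_normalized:
  assumes "is_eigenvalue M T z"
  obtains e where "e \<in> eigenspace M T z" "L2_norm M e = 1"
proof -
  obtain f where f: "f \<in> eigenspace M T z" "\<not> (AE x in M. f x = 0)"
    using assms unfolding is_eigenvalue_def by blast
  have "L2_norm M f \<noteq> 0" using f(2) L2_norm_eq_0_AE[OF eigenspace_L2[OF f(1)]] by auto
  from eigenvector_normalized[OF f(1) this] that show ?thesis by blast
qed

lemma L2_inner_sum_left:
  assumes "finite B" "B \<subseteq> L2_space M" "w \<in> L2_space M"
  shows "L2_inner M (\<lambda>x. \<Sum>b\<in>B. c b * b x) w = (\<Sum>b\<in>B. c b * L2_inner M b w)"
  using assms(1,2)
proof (induction B rule: finite_induct)
  case empty then show ?case by (simp add: L2_inner_def)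
next
  case (insert b B)
  have "L2_inner M (\<lambda>x. c b * b x + 1 * (\<Sum>b\<in>B. c b * b x)) w
      = c b * L2_inner M b w + 1 * L2_inner M (\<lambda>x. \<Sum>b\<in>B. c b * b x) w"
    using insert.prems by (intro L2_inner_combination_left L2_sum L2_scale assms(3)) auto
  then show ?case using insert by simp
qed

lemma eigenspace_sum:
  assumes "finite B" "B \<subseteq> eigenspace M T z" "f \<in> eigenspace M T z"
  shows "(\<lambda>x. f x - (\<Sum>b\<in>B. c b * b x)) \<in> eigenspace M T z"
  using assms(1,2)
proof (induction B rule: finite_induct)
  case empty then show ?case using assms(3) by simp
next
  case (insert b B)
  have *: "((\<lambda>x. f x - (\<Sum>b\<in>B. c b * b x)), \<lambda>x. z * (f x - (\<Sum>b\<in>B. c b * b x))) \<in> T" "(b, \<lambda>x. z * b x) \<in> T"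
    using insert unfolding eigenspace_iff[symmetric] by auto
  from combination[OF *, of 1 "- c b"] show ?case
    using insert(1,2) unfolding eigenspace_iff by (simp add: algebra_simps)
qed

text \<open>Gram--Schmidt: in an eigenspace that no finite set spans, orthonormal vectors never run out.\<close>

lemma infinite_multiplicity_orthonormal:
  assumes "\<not> finite_multiplicity M T z"
  obtains e :: "nat \<Rightarrow> 'a \<Rightarrow> complex" where "\<And>n. e n \<in> eigenspace M T z" "\<And>n. L2_norm M (e n) = 1"
    "\<And>m n. m \<noteq> n \<Longrightarrow> L2_inner M (e m) (e n) = 0"
proof -
  define P where "P f n r \<longleftrightarrow> r \<in> eigenspace M T z \<and> L2_norm M r = 1 \<and> (\<forall>k<n. L2_inner M r (f k) = 0)"
    for f :: "nat \<Rightarrow> 'a \<Rightarrow> complex" and n :: nat and r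
  have "\<exists>e. \<forall>n. P e n (e n)"
  proof (rule dependent_wellorder_choice)
    show "P f n r = P g n r" if "\<And>k. k < n \<Longrightarrow> f k = g k" for r f g n
      using that by (auto simp: P_def)
  next
    fix n and f :: "nat \<Rightarrow> 'a \<Rightarrow> complex"
    assume Pf: "\<And>k. k < n \<Longrightarrow> P f k (f k)"
    have orth: "L2_inner M (f j) (f k) = 0" if "j < n" "k < n" "j \<noteq> k" for j k
      using that Pf[of j] Pf[of k] L2_inner_commute[of M "f j" "f k"]
      by (cases "j < k") (auto simp: P_def)
    define B where "B = f ` {..<n}"
    have B: "finite B" "B \<subseteq> eigenspace M T z" using Pf by (auto simp: B_def P_def)
    then have BL: "B \<subseteq> L2_space M" using eigenspace_L2 by auto
    have "\<not> (\<forall>h\<in>eigenspace M T z. \<exists>c. AE x in M. h x = (\<Sum>b\<in>B. c b * b x))"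
    proof
      assume "\<forall>h\<in>eigenspace M T z. \<exists>c. AE x in M. h x = (\<Sum>b\<in>B. c b * b x)"
      then have "finite_multiplicity M T z"
        unfolding finite_multiplicity_def using B by (intro exI[of _ B] conjI)
      with assms show False ..
    qed
    then have "\<exists>h\<in>eigenspace M T z. \<forall>c. \<not> (AE x in M. h x = (\<Sum>b\<in>B. c b * b x))" by simp
    then obtain h where h: "h \<in> eigenspace M T z" 
      and "\<forall>c. \<not> (AE x in M. h x = (\<Sum>b\<in>B. c b * b x))" ..
    then have nocomb: "\<not> (AE x in M. h x = (\<Sum>b\<in>B. c b * b x))" for c by simp
    have hL: "h \<in> L2_space M" using h by (rule eigenspace_L2)
    define r where "r = (\<lambda>x. h x - (\<Sum>b\<in>B. L2_inner M h b * b x))"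
    have r: "r \<in> eigenspace M T z" unfolding r_def by (rule eigenspace_sum[OF B h])
    then have rL: "r \<in> L2_space M" by (rule eigenspace_L2)
    have "L2_norm M r \<noteq> 0"
      using nocomb[of "L2_inner M h"] L2_norm_eq_0_AE[OF rL] by (auto simp: r_def)
    from eigenvector_normalized[OF r this] obtain e
      where e: "e \<in> eigenspace M T z" "L2_norm M e = 1" "e = (\<lambda>x. of_real (1 / L2_norm M r) * r x)" by metis
    have "L2_inner M e (f k) = 0" if k: "k < n" for k
    proof -
      have fk: "f k \<in> B" "f k \<in> L2_space M" "L2_norm M (f k) = 1" 
        using k Pf[OF k] BL by (auto simp: B_def P_def)
      have zero: "L2_inner M b (f k) = 0" if "b \<in> B" "b \<noteq> f k" for b
        using that orth k unfolding B_def by blast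
      have "L2_inner M r (f k) = L2_inner M h (f k) - (\<Sum>b\<in>B. L2_inner M h b * L2_inner M b (f k))"
        unfolding r_def using BL
        by (subst L2_inner_diff_left) (auto simp: hL fk L2_inner_sum_left[OF B(1) BL fk(2)] intro!: L2_sum L2_scale)
      also have "(\<Sum>b\<in>B. L2_inner M h b * L2_inner M b (f k)) = L2_inner M h (f k)"
        using zero B(1) fk by (subst sum.remove[of B "f k"]) (auto simp: L2_inner_self)
      finally show ?thesis
        using L2_inner_combination_left[OF rL rL fk(2), of "of_real (1 / L2_norm M r)" 0] unfolding e(3) by simp
    qed
    then show "\<exists>r. P f n r" using e unfolding P_def by blast
  qed
  then obtain e where e: "\<And>n. P e n (e n)" by blast
  have "L2_inner M (e m) (e n) = 0" if "m \<noteq> n" for m n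
    using that e[of m] e[of n] L2_inner_commute[of M "e m" "e n"]
    by (cases "m < n") (auto simp: P_def)
  with that show ?thesis using e unfolding P_def by blast
qed

end

text \<open>
  Self-adjointness in the form of von Neumann's criterion: the ranges of \<open>T - z\<close>, \<open>z\<close> nonreal, are dense.
  That the adjoint is contained in \<open>T\<close> is \<open>adjoint_subset\<close>.
\<close>

locale selfadjoint_operator = closed_symmetric_operator +
  assumes deficiency: "Im z \<noteq> 0 \<Longrightarrow> w \<in> L2_space M \<Longrightarrow>
      (\<And>f g. (f, g) \<in> T \<Longrightarrow> L2_inner M (\<lambda>x. g x - z * f x) w = 0) \<Longrightarrow> AE x in M. w x = 0"
begin

lemma nonreal_resolvent:
  assumes "Im z \<noteq> 0"
  shows "z \<in> resolvent_set M T"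
proof (rule resolventI)
  show "L2_norm M f \<le> 1 / \<bar>Im z\<bar> * L2_norm M (\<lambda>x. g x - z * f x)" if "(f, g) \<in> T" for f g
    using lower_bound_nonreal[OF that, of z] assms by (simp add: field_simps)
qed (rule deficiency[OF assms])

lemma spectrum_real: "spectrum M T \<subseteq> \<real>"
  using nonreal_resolvent complex_is_Real_iff unfolding spectrum_def by blast

text \<open>
  Since \<open>T - i\<close> is onto, an adjoint pair \<open>(w, v)\<close> can be compared with a pair \<open>(w', k)\<close> of \<open>T\<close> for which
  \<open>k - i w' = v - i w\<close>. Then \<open>w - w'\<close> is orthogonal to the range of \<open>T + i\<close>, hence zero.
\<close>

lemma adjoint_subset:
  assumes w: "w \<in> L2_space M" and v: "v \<in> L2_space M"
    and adj: "\<And>f g. (f, g) \<in> T \<Longrightarrow> L2_inner M g w = L2_inner M f v"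
  shows "(w, v) \<in> T"
proof -
  have L: "(\<lambda>x. v x - \<i> * w x) \<in> L2_space M" by (intro L2_diff L2_scale v w)
  obtain w' k where wk: "(w', k) \<in> T" and eq: "AE x in M. k x - \<i> * w' x = v x - \<i> * w x"
    using nonreal_resolvent[of \<i>] L unfolding resolvent_set_def by force
  note w'L = dom_L2[OF wk] and kL = ran_L2[OF wk]
  have ww: "AE x in M. w x - w' x = 0"
  proof (rule deficiency[of "-\<i>"])
    show "(\<lambda>x. w x - w' x) \<in> L2_space M" by (rule L2_diff[OF w w'L])
    fix f g assume fg: "(f, g) \<in> T"
    note fL = dom_L2[OF fg] and gL = ran_L2[OF fg]
    have "L2_inner M f (\<lambda>x. v x - \<i> * w x) = L2_inner M f (\<lambda>x. k x - \<i> * w' x)"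
      unfolding L2_inner_def
    proof (rule integral_cong_AE)
      show "AE x in M. f x * cnj (v x - \<i> * w x) = f x * cnj (k x - \<i> * w' x)"
        using eq by eventually_elim simp
    qed (use fL v w w'L kL in \<open>measurable\<close>)
    moreover have "L2_inner M f (\<lambda>x. v x - \<i> * w x) = L2_inner M f v + \<i> * L2_inner M f w"
      using L2_inner_combination_right[OF v w fL, of 1 "-\<i>"] by simp
    moreover have "L2_inner M f (\<lambda>x. k x - \<i> * w' x) = L2_inner M f k + \<i> * L2_inner M f w'"
      using L2_inner_combination_right[OF kL w'L fL, of 1 "-\<i>"] by simp
    ultimately have "L2_inner M g w + \<i> * L2_inner M f w = L2_inner M g w' + \<i> * L2_inner M f w'"
      using adj[OF fg] symmetric[OF fg wk] by simp
    then show "L2_inner M (\<lambda>x. g x - (-\<i>) * f x) (\<lambda>x. w x - w' x) = 0"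
      by (simp only: inner_shifted[OF fg L2_diff[OF w w'L]] L2_inner_diff_right[OF w w'L fL]
          L2_inner_diff_right[OF w w'L gL]) (simp add: algebra_simps)
  qed simp
  show ?thesis
  proof (rule AE_closed[OF wk])
    show "AE x in M. w' x = w x" using ww by eventually_elim simp
    show "AE x in M. k x = v x" using ww eq by eventually_elim (auto simp: algebra_simps)
  qed (use w v in \<open>auto dest: L2_measurable\<close>)
qed

lemma symmetric_extension_trivial:
  assumes "closed_symmetric_operator M S" "T \<subseteq> S"
  shows "S = T"
proof -
  interpret S: closed_symmetric_operator M S by fact
  have "(w, v) \<in> T" if "(w, v) \<in> S" for w v
    by (rule adjoint_subset) (use that S.dom_L2 S.ran_L2 S.symmetric assms(2) in blast)+
  then show ?thesis using assms(2) by auto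
qed

text \<open>
  The orthogonal complement of the range of \<open>T - r\<close> is the kernel of \<open>T - r\<close>.
\<close>

lemma real_resolventI:
  assumes "\<And>f g. (f, g) \<in> T \<Longrightarrow> L2_norm M f \<le> C * L2_norm M (\<lambda>x. g x - of_real r * f x)"
    and "\<not> is_eigenvalue M T (of_real r)"
  shows "of_real r \<in> resolvent_set M T"
proof (rule resolventI[OF assms(1)])
  fix w assume w: "w \<in> L2_space M"
    and orth: "\<And>f g. (f, g) \<in> T \<Longrightarrow> L2_inner M (\<lambda>x. g x - of_real r * f x) w = 0"
  have "(w, \<lambda>x. of_real r * w x) \<in> T"
  proof (rule adjoint_subset[OF w L2_scale[OF w]])
    fix f g assume fg: "(f, g) \<in> T"
    show "L2_inner M g w = L2_inner M f (\<lambda>x. of_real r * w x)"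
      using orth[OF fg] L2_inner_combination_right[OF w w dom_L2[OF fg], of "of_real r" 0]
      by (simp add: inner_shifted[OF fg w])
  qed
  then have "w \<in> eigenspace M T (of_real r)" by (simp only: eigenspace_iff)
  then show "AE x in M. w x = 0"
    using assms(2) unfolding is_eigenvalue_def by (metis (no_types, lifting))
qed

end

text \<open>
  An operator whose quadratic form is bounded below by \<open>- N\<close>, where \<open>N\<close> is the form of a compact
  operator, expressed by the fact that bounded sequences have subsequences that are Cauchy with respect
  to \<open>N\<close>.
\<close>

locale compactly_bounded_below = selfadjoint_operator +
  fixes N :: "('a \<Rightarrow> complex) \<Rightarrow> real"
  assumes form_bound: "(f, g) \<in> T \<Longrightarrow> - N f \<le> Re (L2_inner M g f)"
    and compact: "(\<And>n. (F n, G n) \<in> T) \<Longrightarrow> (\<And>n. L2_norm M (F n) \<le> 1) \<Longrightarrow>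
      \<exists>r :: nat \<Rightarrow> nat. strict_mono r \<and>
        (\<forall>e>0. \<exists>n0. \<forall>m\<ge>n0. \<forall>n\<ge>n0. N (\<lambda>x. F (r m) x - F (r n) x) < e)"
begin

text \<open>
  For orthonormal eigenvectors the form takes the value \<open>\<mu> m + \<mu> n\<close> on the difference of two of
  them, which contradicts compactness of \<open>N\<close> if the eigenvalues stay away from \<open>0\<close>.
\<close>

lemma no_negative_orthonormal_sequence:
  fixes e :: "nat \<Rightarrow> 'a \<Rightarrow> complex" and \<mu> :: "nat \<Rightarrow> real"
  assumes e: "\<And>n. e n \<in> eigenspace M T (of_real (\<mu> n))" and norm: "\<And>n. L2_norm M (e n) = 1"
    and orth: "\<And>m n. m \<noteq> n \<Longrightarrow> L2_inner M (e m) (e n) = 0"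
    and \<mu>: "\<And>n. \<mu> n \<le> - d" and d: "d > 0"
  shows False
proof -
  have eT: "(e n, \<lambda>x. of_real (\<mu> n) * e n x) \<in> T" for n using e eigenspace_iff by blast
  note eL = dom_L2[OF eT]
  have "\<exists>r :: nat \<Rightarrow> nat. strict_mono r \<and>
      (\<forall>\<epsilon>>0. \<exists>n0. \<forall>m\<ge>n0. \<forall>n\<ge>n0. N (\<lambda>x. e (r m) x - e (r n) x) < \<epsilon>)"
    by (rule compact[OF eT]) (simp add: norm)
  then obtain r :: "nat \<Rightarrow> nat" where r: "strict_mono r"
    and "\<forall>\<epsilon>>0. \<exists>n0. \<forall>m\<ge>n0. \<forall>n\<ge>n0. N (\<lambda>x. e (r m) x - e (r n) x) < \<epsilon>"
    by blast
  then obtain n0 where "\<And>m n. m \<ge> n0 \<Longrightarrow> n \<ge> n0 \<Longrightarrow> N (\<lambda>x. e (r m) x - e (r n) x) < d" using d by blast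
  then have Nd: "N (\<lambda>x. e (r (Suc n0)) x - e (r n0) x) < d" by simp
  let ?m = "r (Suc n0)" and ?n = "r n0"
  have ne: "?m \<noteq> ?n" using strict_mono_less[OF r, of n0 "Suc n0"] by simp
  let ?g = "\<lambda>x. of_real (\<mu> ?m) * e ?m x - of_real (\<mu> ?n) * e ?n x"
  have "L2_inner M ?g (\<lambda>x. e ?m x - e ?n x) = of_real (\<mu> ?m) + of_real (\<mu> ?n)"
    using L2_inner_combination_left[OF eL[of ?m] eL[of ?n] L2_diff[OF eL[of ?m] eL[of ?n]], of "of_real (\<mu> ?m)" "- of_real (\<mu> ?n)"]
      orth[OF ne] orth[OF ne[symmetric]] norm
    by (simp add: L2_inner_diff_right[OF eL eL eL] L2_inner_self)
  then have "- N (\<lambda>x. e ?m x - e ?n x) \<le> \<mu> ?m + \<mu> ?n"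
    using form_bound[OF diff[OF eT[of ?m] eT[of ?n]]] by simp
  then show False using Nd \<mu>[of ?m] \<mu>[of ?n] d by linarith
qed

text \<open>
  If \<open>T - r\<close> is not bounded below, there are unit vectors \<open>F n\<close> with \<open>(T - r) F n\<close> tending to \<open>0\<close>. As \<open>r\<close> is
  negative, the form bound estimates \<open>\<bar>r\<bar> \<parallel>F m - F n\<parallel>\<^sup>2\<close> by \<open>N (F m - F n)\<close> plus a small error, so compactness
  of \<open>N\<close> makes a subsequence converge in norm. Its limit is an eigenvector.
\<close>

lemma negative_spectrum_eigenvalue:
  assumes "r < 0" "complex_of_real r \<in> spectrum M T"
  shows "is_eigenvalue M T (of_real r)"
proof (rule ccontr)
  assume nev: "\<not> is_eigenvalue M T (of_real r)"
  let ?S = "\<lambda>f g x. g x - complex_of_real r * f x"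
  have nobound: "\<exists>f g. (f, g) \<in> T \<and> L2_norm M f > C * L2_norm M (?S f g)" for C
    using real_resolventI[OF _ nev, of C] assms(2) unfolding spectrum_def by (metis ComplD not_le)
  have "\<exists>f g. (f, g) \<in> T \<and> L2_norm M f = 1 \<and> L2_norm M (?S f g) < 1 / Suc n" for n
  proof -
    obtain f g where fg: "(f, g) \<in> T" and gt: "L2_norm M f > Suc n * L2_norm M (?S f g)" using nobound by blast
    have "0 \<le> Suc n * L2_norm M (?S f g)" by simp
    with gt have pos: "L2_norm M f > 0" by linarith
    let ?c = "complex_of_real (1 / L2_norm M f)"
    have "L2_norm M (\<lambda>x. ?c * f x) = 1" using pos by (subst L2_norm_scale) (simp add: norm_divide)
    moreover have "(\<lambda>x. ?c * g x - of_real r * (?c * f x)) = (\<lambda>x. ?c * ?S f g x)" by (auto simp: algebra_simps)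
    then have "L2_norm M (?S (\<lambda>x. ?c * f x) (\<lambda>x. ?c * g x)) = L2_norm M (?S f g) / L2_norm M f"
      using pos by (simp only: L2_norm_scale) (simp add: norm_divide)
    moreover have "L2_norm M (?S f g) / L2_norm M f < 1 / Suc n" using gt pos by (simp add: field_simps)
    ultimately show ?thesis using scale[OF fg, of ?c] by (intro exI[of _ "\<lambda>x. ?c * f x"] exI[of _ "\<lambda>x. ?c * g x"]) simp
  qed
  then obtain F G where FG: "\<And>n. (F n, G n) \<in> T" and Fn: "\<And>n. L2_norm M (F n) = 1"
    and Sn: "\<And>n. L2_norm M (?S (F n) (G n)) < 1 / Suc n" by metis
  note FL = dom_L2[OF FG] and GL = ran_L2[OF FG]
  have "\<exists>s :: nat \<Rightarrow> nat. strict_mono s \<and>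
      (\<forall>e>0. \<exists>n0. \<forall>m\<ge>n0. \<forall>n\<ge>n0. N (\<lambda>x. F (s m) x - F (s n) x) < e)"
    by (rule compact[OF FG]) (simp add: Fn)
  then obtain s :: "nat \<Rightarrow> nat" where s: "strict_mono s"
    and N: "\<And>e. e > 0 \<Longrightarrow> \<exists>n0. \<forall>m\<ge>n0. \<forall>n\<ge>n0. N (\<lambda>x. F (s m) x - F (s n) x) < e"
    by blast
  have small: "L2_norm M (?S (F (s n)) (G (s n))) < 1 / Suc n" for n
  proof -
    have "1 / real (Suc (s n)) \<le> 1 / Suc n" using seq_suble[OF s, of n] by (intro divide_left_mono) auto
    then show ?thesis using Sn[of "s n"] by linarith
  qed
  have key: "- r * (L2_norm M (\<lambda>x. F (s m) x - F (s n) x))\<^sup>2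
      \<le> N (\<lambda>x. F (s m) x - F (s n) x) + 2 * (1 / Suc m + 1 / Suc n)" for m n
  proof -
    let ?f = "\<lambda>x. F (s m) x - F (s n) x" and ?g = "\<lambda>x. G (s m) x - G (s n) x"
    have T: "(?f, ?g) \<in> T" by (rule diff[OF FG FG])
    note fL = dom_L2[OF T]
    have f2: "L2_norm M ?f \<le> 2" using L2_triangle_sub[OF FL[of "s m"] FL[of "s n"]] Fn by simp
    have "?S ?f ?g = (\<lambda>x. ?S (F (s m)) (G (s m)) x - ?S (F (s n)) (G (s n)) x)" by (auto simp: algebra_simps)
    then have "L2_norm M (?S ?f ?g) \<le> L2_norm M (?S (F (s m)) (G (s m))) + L2_norm M (?S (F (s n)) (G (s n)))"
      using L2_triangle_sub[OF shifted_L2[OF FG] shifted_L2[OF FG]] by simp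
    then have S2: "L2_norm M (?S ?f ?g) \<le> 1 / Suc m + 1 / Suc n" using small[of m] small[of n] by linarith
    have "- N ?f - r * (L2_norm M ?f)\<^sup>2 \<le> Re (L2_inner M ?g ?f) - r * (L2_norm M ?f)\<^sup>2"
      using form_bound[OF T] by simp
    also have "\<dots> = Re (L2_inner M (?S ?f ?g) ?f)"
      by (simp only: inner_shifted[OF T fL] L2_inner_self) simp
    also have "\<dots> \<le> L2_norm M (?S ?f ?g) * L2_norm M ?f"
      using complex_Re_le_cmod L2_Cauchy_Schwarz[OF shifted_L2[OF T] fL] by (rule order_trans)
    also have "\<dots> \<le> (1 / Suc m + 1 / Suc n) * 2" using S2 f2 by (intro mult_mono) auto
    finally show ?thesis by simp
  qed
  have "\<exists>f. L2_converges M (\<lambda>n. F (s n)) f"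
  proof (rule L2_complete)
    fix e :: real assume e: "e > 0"
    \<comment> \<open>the estimate \<open>key\<close> has one term \<open>N\<close> and two error terms, \<open>\<delta> + 2 (\<delta> + \<delta>)\<close> in all, below \<open>8 \<delta>\<close>\<close>
    define \<delta> where "\<delta> = - r * e\<^sup>2 / 8"
    have \<delta>: "\<delta> > 0" using e assms(1) by (simp add: \<delta>_def mult_neg_pos)
    obtain n0 where n0: "\<And>m n. m \<ge> n0 \<Longrightarrow> n \<ge> n0 \<Longrightarrow> N (\<lambda>x. F (s m) x - F (s n) x) < \<delta>" using N[OF \<delta>] by blast
    obtain n1 where n1: "1 / real (Suc n1) < \<delta>" using nat_approx_posE[OF \<delta>] by metis
    have "L2_norm M (\<lambda>x. F (s m) x - F (s n) x) < e" if "m \<ge> max n0 n1" "n \<ge> max n0 n1" for m n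
    proof -
      have "1 / real (Suc k) < \<delta>" if "k \<ge> n1" for k
      proof -
        have "1 / real (Suc k) \<le> 1 / real (Suc n1)" using that by (intro divide_left_mono) auto
        then show ?thesis using n1 by linarith
      qed
      then have "1 / real (Suc m) < \<delta>" "1 / real (Suc n) < \<delta>" using that by auto
      with key[of m n] n0[of m n] that
      have "- r * (L2_norm M (\<lambda>x. F (s m) x - F (s n) x))\<^sup>2 < 8 * \<delta>" using \<delta> by simp
      then have "- r * (L2_norm M (\<lambda>x. F (s m) x - F (s n) x))\<^sup>2 < - r * e\<^sup>2" by (simp add: \<delta>_def)
      then have "(L2_norm M (\<lambda>x. F (s m) x - F (s n) x))\<^sup>2 < e\<^sup>2" using assms(1) by (simp add: mult_less_cancel_left)
      then show ?thesis using e by (auto intro: power2_less_imp_less)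
    qed
    then show "\<exists>N. \<forall>m\<ge>N. \<forall>n\<ge>N. L2_norm M (\<lambda>x. F (s m) x - F (s n) x) < e" by blast
  qed (rule FL)
  then obtain f where f: "L2_converges M (\<lambda>n. F (s n)) f" ..
  have S0: "L2_converges M (\<lambda>n. ?S (F (s n)) (G (s n))) (\<lambda>x. 0)"
    unfolding L2_converges_def
  proof (intro conjI allI L2_zero shifted_L2[OF FG])
    have "(\<lambda>n. L2_norm M (?S (F (s n)) (G (s n)))) \<longlonglongrightarrow> 0"
    proof (rule Lim_null_comparison)
      show "\<forall>\<^sub>F n in sequentially. norm (L2_norm M (?S (F (s n)) (G (s n)))) \<le> 1 / Suc n"
        using small by (intro always_eventually allI) (simp add: less_imp_le)
    qed (intro LIMSEQ_Suc lim_inverse_n')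
    then show "(\<lambda>n. L2_norm M (\<lambda>x. ?S (F (s n)) (G (s n)) x - 0)) \<longlonglongrightarrow> 0" by simp
  qed
  have "L2_converges M (\<lambda>n x. 1 * ?S (F (s n)) (G (s n)) x + of_real r * F (s n) x) (\<lambda>x. 1 * 0 + of_real r * f x)"
    by (rule L2_converges_combination[OF S0 f])
  then have G: "L2_converges M (\<lambda>n. G (s n)) (\<lambda>x. of_real r * f x)" by simp
  have "(f, \<lambda>x. of_real r * f x) \<in> T" by (rule closed[OF FG f G])
  moreover have "L2_norm M f = 1"
    using L2_converges_norm[OF f] Fn by (simp add: LIMSEQ_const_iff)
  then have "\<not> (AE x in M. f x = 0)"
    using L2_norm_AE_cong[of f M "\<lambda>x. 0"] L2_convergesD(2)[OF f] L2_norm_zero[of M] by (auto dest: L2_measurable)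
  ultimately show False using nev unfolding is_eigenvalue_def eigenspace_iff[symmetric] by (metis (no_types, lifting))
qed

lemma negative_finite_multiplicity:
  assumes "r < 0"
  shows "finite_multiplicity M T (of_real r)"
proof (rule ccontr)
  assume "\<not> finite_multiplicity M T (of_real r)"
  from infinite_multiplicity_orthonormal[OF this] obtain e :: "nat \<Rightarrow> 'a \<Rightarrow> complex"
    where "\<And>n. e n \<in> eigenspace M T (of_real r)" "\<And>n. L2_norm M (e n) = 1"
    "\<And>m n. m \<noteq> n \<Longrightarrow> L2_inner M (e m) (e n) = 0" by blast
  from no_negative_orthonormal_sequence[of e "\<lambda>_. r" "-r"] this assms show False by auto
qed

lemma negative_spectrum_finite:
  assumes d: "d > 0"
  shows "finite {z \<in> spectrum M T. Re z \<le> - d}" (is "finite ?S")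
proof (rule ccontr)
  assume "infinite ?S"
  then obtain s :: "nat \<Rightarrow> complex" where s: "inj s" "range s \<subseteq> ?S" using infinite_countable_subset by blast
  define \<mu> where "\<mu> n = Re (s n)" for n
  have s_eq: "s n = of_real (\<mu> n)" for n
  proof -
    have "s n \<in> \<real>" using s(2) spectrum_real by blast
    then show ?thesis by (simp add: \<mu>_def of_real_Re)
  qed
  have \<mu>: "\<mu> n \<le> - d" for n using s(2) unfolding \<mu>_def by auto
  have "is_eigenvalue M T (of_real (\<mu> n))" for n
  proof (rule negative_spectrum_eigenvalue)
    show "\<mu> n < 0" using \<mu>[of n] d by simp
    show "complex_of_real (\<mu> n) \<in> spectrum M T" using s(2) unfolding s_eq[symmetric] by auto
  qed
  then have "\<exists>e. e \<in> eigenspace M T (of_real (\<mu> n)) \<and> L2_norm M e = 1" for n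
    by (rule eigenvalue_normalized) blast
  then obtain e where e: "\<And>n. e n \<in> eigenspace M T (of_real (\<mu> n))" "\<And>n. L2_norm M (e n) = 1" by metis
  have orth: "L2_inner M (e m) (e n) = 0" if "m \<noteq> n" for m n
  proof (rule eigenvectors_orthogonal[of _ "\<mu> m" _ "\<mu> n"])
    show "\<mu> m \<noteq> \<mu> n" using that injD[OF s(1), of m n] s_eq[of m] s_eq[of n] by auto
  qed (use e eigenspace_iff in blast)+
  show False by (rule no_negative_orthonormal_sequence[of e \<mu> d, OF e]) (use orth \<mu> d in auto)
qed

text \<open>
  By \<open>negative_spectrum_finite\<close> a negative point of the spectrum is isolated in it, and by the preceding
  lemmas it is an eigenvalue of finite multiplicity.
\<close>

lemma essential_spectrum_nonneg:
  "essential_spectrum M T \<subseteq> complex_of_real ` {0..}"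
proof
  fix z assume z: "z \<in> essential_spectrum M T"
  then have zs: "z \<in> spectrum M T" by (simp add: essential_spectrum_def)
  then obtain r where zr: "z = of_real r" using spectrum_real by (auto elim: Reals_cases)
  have "r \<ge> 0"
  proof (rule ccontr)
    assume "\<not> r \<ge> 0" then have r: "r < 0" by simp
    let ?S = "{z \<in> spectrum M T. Re z \<le> - (- r / 2)}"
    have fin: "finite ?S" using r by (intro negative_spectrum_finite) simp
    have "open ({w. Re w < r / 2} - (?S - {z}))"
      using fin by (intro open_Diff open_halfspace_Re_lt finite_imp_closed) auto
    moreover have "({w. Re w < r / 2} - (?S - {z})) \<inter> spectrum M T = {z}"
      using zs zr r by auto
    ultimately have "z isolated_in spectrum M T" using zs unfolding isolated_in_def by blast
    then show False
      using z negative_spectrum_eigenvalue[OF r] negative_finite_multiplicity[OF r] zs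
      unfolding essential_spectrum_def zr by auto
  qed
  then show "z \<in> complex_of_real ` {0..}" using zr by auto
qed

lemma essential_spectrum_eq_nonneg:
  assumes "complex_of_real ` {0..} \<subseteq> spectrum M T"
  shows "essential_spectrum M T = complex_of_real ` {0..}"
proof (rule antisym[OF essential_spectrum_nonneg])
  have "\<not> complex_of_real r isolated_in spectrum M T" if "r \<ge> 0" for r
  proof
    assume "complex_of_real r isolated_in spectrum M T"
    then obtain U where U: "open U" "U \<inter> spectrum M T = {complex_of_real r}" unfolding isolated_in_def by blast
    then obtain e where e: "e > 0" "ball (complex_of_real r) e \<subseteq> U" by (metis IntD1 insertI1 open_contains_ball)
    have "complex_of_real (r + e / 2) \<in> ball (complex_of_real r) e" using e by (simp add: dist_norm)
    moreover have "complex_of_real (r + e / 2) \<in> spectrum M T" using assms that e by (intro subsetD[OF assms] imageI) auto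
    ultimately have "complex_of_real (r + e / 2) = complex_of_real r" using U(2) e(2) by blast
    then show False using e by (simp del: of_real_add)
  qed
  then show "complex_of_real ` {0..} \<subseteq> essential_spectrum M T"
    using assms unfolding essential_spectrum_def by auto
qed

end

section \<open>The half-line in logarithmic coordinates\<close>

lemma space_half_line [simp]: "space half_line = {0<..}"
  by (simp add: half_line_def space_restrict_space)

lemma sets_half_line_iff: "A \<in> sets half_line \<longleftrightarrow> A \<in> sets borel \<and> A \<subseteq> {0<..}"
  by (auto simp: half_line_def sets_restrict_space_iff)

lemma sigma_finite_half_line: "sigma_finite_measure half_line"
  unfolding half_line_def by (rule sigma_finite_measure_restrict_space[OF sigma_finite_lborel]) simp

interpretation half_line: sigma_finite_measure half_line
  by (rule sigma_finite_half_line)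

lemma measurable_half_line [measurable (raw)]:
  assumes "f \<in> borel_measurable borel"
  shows "f \<in> borel_measurable half_line"
  unfolding half_line_def by (rule measurable_restrict_space1) (use assms in simp)

lemma exp_measurable_half_line [measurable]: "exp \<in> lborel \<rightarrow>\<^sub>M half_line"
  unfolding half_line_def by (rule measurable_restrict_space2) auto

text \<open>
  The change of variables \<open>t = exp x\<close>. The substitution rule applies on the compact intervals from
  \<open>exp (- n)\<close> to \<open>exp n\<close>, which exhaust the half-line.
\<close>

lemma half_line_distr: "half_line = distr (density lborel (\<lambda>x. ennreal (exp x))) half_line exp"
proof (rule measure_eqI)
  fix A assume "A \<in> sets half_line"
  then have A [measurable]: "A \<in> sets borel" "A \<in> sets half_line" and pos: "A \<subseteq> {0<..}" by (auto simp: sets_half_line_iff)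
  let ?f = "indicator A :: real \<Rightarrow> real"
  have mono: "indicator {exp (- real n)..exp (real n)} x \<le> (indicator {exp (- real (Suc n))..exp (real (Suc n))} x :: ennreal)"
    for n x
  proof -
    have "{exp (- real n)..exp (real n)} \<subseteq> {exp (- real (Suc n))..exp (real (Suc n))}"
      unfolding atLeastatMost_subset_iff exp_le_cancel_iff by simp
    then show ?thesis by (intro indicator_leI) blast
  qed
  have "emeasure half_line A = (\<integral>\<^sup>+x. (SUP n. ennreal (?f x) * indicator {exp (- real n)..exp (real n)} x) \<partial>lborel)"
  proof -
    have "emeasure half_line A = (\<integral>\<^sup>+x. indicator A x \<partial>lborel)"
      using A pos by (simp add: half_line_def emeasure_restrict_space)
    also have "\<dots> = (\<integral>\<^sup>+x. (SUP n. ennreal (?f x) * indicator {exp (- real n)..exp (real n)} x) \<partial>lborel)"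
    proof (rule nn_integral_cong)
      fix x
      show "indicator A x = (SUP n. ennreal (?f x) * indicator {exp (- real n)..exp (real n)} x)"
      proof (cases "x \<in> A")
        case True
        then have x: "x > 0" using pos by auto
        obtain n :: nat where n: "\<bar>ln x\<bar> \<le> n" using real_arch_simple by blast
        have "exp (- real n) \<le> x" "x \<le> exp (real n)"
          using n x exp_le_cancel_iff[of "- real n" "ln x"] exp_le_cancel_iff[of "ln x" "real n"] by auto
        then have "ennreal (?f x) * indicator {exp (- real n)..exp (real n)} x = 1" using True by simp
        then have "1 \<le> (SUP n. ennreal (?f x) * indicator {exp (- real n)..exp (real n)} x)"
          by (intro SUP_upper2[of n]) auto
        moreover have "(SUP n. ennreal (?f x) * indicator {exp (- real n)..exp (real n)} x) \<le> 1"
          by (rule SUP_least) (auto simp: indicator_def)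
        ultimately show ?thesis using True by (simp add: order_antisym)
      qed simp
    qed
    finally show ?thesis .
  qed
  also have "\<dots> = (SUP n. \<integral>\<^sup>+x. ennreal (?f x) * indicator {exp (- real n)..exp (real n)} x \<partial>lborel)"
    by (rule nn_integral_monotone_convergence_SUP)
       (auto intro!: incseq_SucI le_funI mult_left_mono mono)
  also have "\<dots> = (SUP n. \<integral>\<^sup>+x. ennreal (?f (exp x) * exp x) * indicator {- real n..real n} x \<partial>lborel)"
  proof (rule SUP_cong[OF refl])
    fix n :: nat
    have "(\<integral>\<^sup>+x. ennreal (?f x * indicator {exp (- real n)..exp (real n)} x) \<partial>lborel) = 
       (\<integral>\<^sup>+x. ennreal (?f (exp x) * exp x * indicator {- real n..real n} x) \<partial>lborel)"
      by (rule nn_integral_substitution)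
         (auto intro!: derivative_eq_intros continuous_intros simp: set_borel_measurable_def)
    then show "(\<integral>\<^sup>+x. ennreal (?f x) * indicator {exp (- real n)..exp (real n)} x \<partial>lborel) =
        (\<integral>\<^sup>+x. ennreal (?f (exp x) * exp x) * indicator {- real n..real n} x \<partial>lborel)"
      by (simp add: ennreal_mult' ennreal_indicator)
  qed
  also have "\<dots> = (\<integral>\<^sup>+x. (SUP n. ennreal (?f (exp x) * exp x) * indicator {- real n..real n} x) \<partial>lborel)"
    by (rule nn_integral_monotone_convergence_SUP[symmetric])
       (auto intro!: incseq_SucI simp: le_fun_def indicator_def)
  also have "\<dots> = (\<integral>\<^sup>+x. ennreal (exp x) * indicator A (exp x) \<partial>lborel)"
  proof (rule nn_integral_cong)
    fix x :: real
    obtain n :: nat where n: "\<bar>x\<bar> \<le> n" using real_arch_simple by blast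
    have "(SUP n. ennreal (?f (exp x) * exp x) * indicator {- real n..real n} x) = ennreal (?f (exp x) * exp x)"
    proof (rule antisym)
      show "(SUP n. ennreal (?f (exp x) * exp x) * indicator {- real n..real n} x) \<le> ennreal (?f (exp x) * exp x)"
        by (rule SUP_least) (auto simp: indicator_def)
      show "ennreal (?f (exp x) * exp x) \<le> (SUP n. ennreal (?f (exp x) * exp x) * indicator {- real n..real n} x)"
        using n by (intro SUP_upper2[of n]) (auto simp: indicator_def abs_le_iff)
    qed
    then show "(SUP n. ennreal (?f (exp x) * exp x) * indicator {- real n..real n} x) = ennreal (exp x) * indicator A (exp x)"
      by (simp add: indicator_def)
  qed
  also have "\<dots> = emeasure (distr (density lborel (\<lambda>x. ennreal (exp x))) half_line exp) A"
  proof -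
    have "exp \<in> density lborel (\<lambda>x. ennreal (exp x)) \<rightarrow>\<^sub>M half_line" by simp
    moreover have "exp -` A \<in> sets (borel :: real measure)"
      using measurable_sets[OF exp_measurable_half_line A(2)] by simp
    ultimately show ?thesis
      by (subst emeasure_distr) (auto simp: emeasure_density A indicator_vimage[symmetric] indicator_def intro!: nn_integral_cong)
  qed
  finally show "emeasure half_line A = emeasure (distr (density lborel (\<lambda>x. ennreal (exp x))) half_line exp) A" .
qed simp

lemma integrable_half_line_iff:
  fixes f :: "real \<Rightarrow> 'b::{banach, second_countable_topology}"
  assumes [measurable]: "f \<in> borel_measurable half_line"
  shows "integrable half_line f \<longleftrightarrow> integrable lborel (\<lambda>x. exp x *\<^sub>R f (exp x))"
proof -
  have [measurable]: "(\<lambda>x. f (exp x)) \<in> borel_measurable lborel"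
    by (rule measurable_compose[OF exp_measurable_half_line assms])
  show ?thesis
    by (subst half_line_distr, subst integrable_distr_eq) (simp_all add: integrable_density)
qed

lemma integral_half_line:
  fixes f :: "real \<Rightarrow> 'b::{banach, second_countable_topology}"
  assumes [measurable]: "f \<in> borel_measurable half_line"
  shows "integral\<^sup>L half_line f = (LINT x|lborel. exp x *\<^sub>R f (exp x))"
proof -
  have [measurable]: "(\<lambda>x. f (exp x)) \<in> borel_measurable lborel"
    by (rule measurable_compose[OF exp_measurable_half_line assms])
  show ?thesis
    by (subst half_line_distr, subst integral_distr) (simp_all add: integral_density)
qed

lemma AE_half_lineI:
  assumes "AE x in lborel. P (exp x)" "Measurable.pred half_line P"
  shows "AE t in half_line. P t"
proof -
  have "AE t in distr (density lborel (\<lambda>x. ennreal (exp x))) half_line exp. P t"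
  proof (subst AE_distr_iff)
    show "{x \<in> space half_line. P x} \<in> sets half_line" using assms(2) by (rule predE)
    show "AE x in density lborel (\<lambda>x. ennreal (exp x)). P (exp x)"
      using assms(1) by (subst AE_density) auto
  qed simp
  then show ?thesis by (simp only: half_line_distr[symmetric])
qed

section \<open>Interchange of integrals\<close>

text \<open>
  Fubini's theorem, with joint integrability from a bound on the inner integrals of the modulus.
\<close>

lemma integral_swap:
  fixes h :: "'a \<Rightarrow> 'b \<Rightarrow> complex"
  assumes M: "sigma_finite_measure M" and N: "sigma_finite_measure N"
    and h: "case_prod h \<in> borel_measurable (M \<Otimes>\<^sub>M N)"
    and int: "\<And>x. x \<in> space M \<Longrightarrow> integrable N (h x)"
    and b: "integrable M b" "\<And>x. x \<in> space M \<Longrightarrow> (LINT y|N. cmod (h x y)) \<le> b x"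
  shows "integrable (M \<Otimes>\<^sub>M N) (case_prod h)"
    and "(LINT x|M. LINT y|N. h x y) = (LINT y|N. LINT x|M. h x y)"
    and "integrable N (\<lambda>y. LINT x|M. h x y)"
    and "integrable M (\<lambda>x. LINT y|N. h x y)"
proof -
  interpret pair_sigma_finite M N using M N by (rule pair_sigma_finite.intro)
  note [measurable] = h
  show *: "integrable (M \<Otimes>\<^sub>M N) (case_prod h)"
  proof (rule Fubini_integrable[OF h])
    show "integrable M (\<lambda>x. LINT y|N. norm (case_prod h (x, y)))"
    proof (rule Bochner_Integration.integrable_bound[OF b(1)])
      have "(LINT y|N. cmod (h x y)) \<le> \<bar>b x\<bar>" if "x \<in> space M" for x
        using b(2)[OF that] by linarith
      then show "AE x in M. norm (LINT y|N. norm (case_prod h (x, y))) \<le> norm (b x)"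
        by (intro AE_I2) simp
    qed measurable
    show "AE x in M. integrable N (\<lambda>y. case_prod h (x, y))" using int by (intro AE_I2) simp
  qed
  show "(LINT x|M. LINT y|N. h x y) = (LINT y|N. LINT x|M. h x y)"
    using Fubini_integral[OF *] by simp
  show "integrable N (\<lambda>y. LINT x|M. h x y)" using integrable_snd[OF *] by simp
  show "integrable M (\<lambda>x. LINT y|N. h x y)" using integrable_fst[OF *] by simp
qed

lemma integral_swap_product:
  fixes f :: "'a \<Rightarrow> complex" and g :: "'b \<Rightarrow> complex"
  assumes M: "sigma_finite_measure M" and N: "sigma_finite_measure N"
    and f: "integrable M f" and g: "integrable N g"
    and K: "case_prod K \<in> borel_measurable (M \<Otimes>\<^sub>M N)"
    and bound: "\<And>x y. x \<in> space M \<Longrightarrow> y \<in> space N \<Longrightarrow> cmod (K x y) \<le> B"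
  shows "integrable (M \<Otimes>\<^sub>M N) (\<lambda>(x, y). f x * g y * K x y)"
    and "(LINT x|M. f x * (LINT y|N. g y * K x y)) = (LINT y|N. g y * (LINT x|M. f x * K x y))"
    and "integrable N (\<lambda>y. g y * (LINT x|M. f x * K x y))"
    and "integrable M (\<lambda>x. f x * (LINT y|N. g y * K x y))"
proof -
  interpret M: sigma_finite_measure M by fact
  interpret N: sigma_finite_measure N by fact
  have [measurable]: "f \<in> borel_measurable M" "g \<in> borel_measurable N" using f g by auto
  note [measurable] = K
  have le: "cmod (f x * g y * K x y) \<le> cmod (f x) * B * cmod (g y)" if "x \<in> space M" "y \<in> space N" for x y
    using mult_left_mono[OF bound[OF that], of "cmod (f x) * cmod (g y)"] by (simp add: norm_mult mult_ac)
  have int: "integrable N (\<lambda>y. f x * g y * K x y)" if x: "x \<in> space M" for x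
  proof (rule Bochner_Integration.integrable_bound)
    show "integrable N (\<lambda>y. cmod (f x) * B * cmod (g y))" using g by auto
    show "AE y in N. cmod (f x * g y * K x y) \<le> norm (cmod (f x) * B * cmod (g y))"
      using le[OF x] by (intro AE_I2) (force intro: order_trans)
  qed (use x in measurable)
  have b: "(LINT y|N. cmod (f x * g y * K x y)) \<le> cmod (f x) * B * (LINT y|N. cmod (g y))" if x: "x \<in> space M" for x
  proof -
    have "(LINT y|N. cmod (f x * g y * K x y)) \<le> (LINT y|N. cmod (f x) * B * cmod (g y))"
      using le[OF x] int[OF x] g by (intro integral_mono) auto
    then show ?thesis by simp
  qed
  have meas: "(\<lambda>(x, y). f x * g y * K x y) \<in> borel_measurable (M \<Otimes>\<^sub>M N)" by measurable
  have bi: "integrable M (\<lambda>x. cmod (f x) * B * (LINT y|N. cmod (g y)))" using f by auto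
  note swap = integral_swap[OF M N meas int bi b]
  show "integrable (M \<Otimes>\<^sub>M N) (\<lambda>(x, y). f x * g y * K x y)" by (rule swap(1))
  have 1: "(LINT y|N. f x * g y * K x y) = f x * (LINT y|N. g y * K x y)" for x
    by (simp add: mult.assoc)
  have 2: "(LINT x|M. f x * g y * K x y) = g y * (LINT x|M. f x * K x y)" for y
    by (subst integral_mult_right_zero[symmetric]) (simp add: mult_ac)
  show "(LINT x|M. f x * (LINT y|N. g y * K x y)) = (LINT y|N. g y * (LINT x|M. f x * K x y))"
    using swap(2) unfolding 1 2 .
  show "integrable N (\<lambda>y. g y * (LINT x|M. f x * K x y))" using swap(3) unfolding 2 .
  show "integrable M (\<lambda>x. f x * (LINT y|N. g y * K x y))" using swap(4) unfolding 1 .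
qed

section \<open>The Fourier transform\<close>

definition ft :: "(real \<Rightarrow> complex) \<Rightarrow> real \<Rightarrow> complex" where
  "ft f x = (LINT s|lborel. f s * cis (x * s))"

lemma cis_measurable [measurable]: "cis \<in> borel_measurable borel"
  by (rule borel_measurable_continuous_onI) (rule continuous_on_cis, rule continuous_on_id)

lemma integrable_mult_cis:
  fixes f :: "'a \<Rightarrow> complex"
  assumes "integrable M f" "g \<in> borel_measurable M"
  shows "integrable M (\<lambda>s. f s * cis (g s))"
  by (rule Bochner_Integration.integrable_bound[OF assms(1)]) (use assms in \<open>auto simp: norm_mult\<close>)

lemma ft_measurable [measurable]:
  assumes [measurable]: "f \<in> borel_measurable borel"
  shows "ft f \<in> borel_measurable borel"
  unfolding ft_def by measurable

lemma ft_bound: "integrable lborel f \<Longrightarrow> cmod (ft f x) \<le> (LINT s|lborel. cmod (f s))"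
  unfolding ft_def
  by (rule order_trans[OF integral_norm_bound]) (simp add: norm_mult)

lemma translation_L2:
  fixes f :: "real \<Rightarrow> complex"
  assumes "f \<in> L2_space lborel"
  shows "(\<lambda>s. f (s + h)) \<in> L2_space lborel" "L2_norm lborel (\<lambda>s. f (s + h)) = L2_norm lborel f"
proof -
  have [measurable]: "f \<in> borel_measurable borel" using assms by (auto dest: L2_measurable)
  show "(\<lambda>s. f (s + h)) \<in> L2_space lborel"
    using lborel_integrable_real_affine[OF L2_square_integrable[OF assms], of 1 h]
    by (intro L2_spaceI) (simp_all add: add.commute)
  show "L2_norm lborel (\<lambda>s. f (s + h)) = L2_norm lborel f"
    using lborel_integral_real_affine[of 1 "\<lambda>x. (cmod (f x))\<^sup>2" h] by (simp add: L2_norm_def add.commute)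
qed

lemma integral_gaussian_cis:
  assumes d: "d > 0"
  shows "integrable lborel (\<lambda>x. complex_of_real (exp (- (d * x)\<^sup>2 / 2)))"
    and "(LINT x|lborel. complex_of_real (exp (- (d * x)\<^sup>2 / 2)) * cis (x * s)) =
      of_real (sqrt (2 * pi) / d * exp (- (s / d)\<^sup>2 / 2))"
proof -
  have eq: "exp (- y\<^sup>2 / 2) = sqrt (2 * pi) * std_normal_density y" for y :: real
    by (simp add: std_normal_density_def)
  have int: "integrable lborel (\<lambda>y::real. exp (- y\<^sup>2 / 2))"
    unfolding eq by (intro integrable_mult_right integrable_normal_density) simp
  show "integrable lborel (\<lambda>x. complex_of_real (exp (- (d * x)\<^sup>2 / 2)))"
    using lborel_integrable_real_affine[OF int, of d 0] d by (simp only: integrable_of_real mult.commute add_0)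
  have "(LINT x|lborel. complex_of_real (exp (- (d * x)\<^sup>2 / 2)) * cis (x * s)) =
      (LINT x|lborel. (\<lambda>y. complex_of_real (exp (- y\<^sup>2 / 2)) * cis (y * (s / d))) (0 + d * x))"
    using d by (intro Bochner_Integration.integral_cong) (auto simp: field_simps)
  also have "\<dots> = (1 / d) *\<^sub>R (LINT y|lborel. complex_of_real (exp (- y\<^sup>2 / 2)) * cis (y * (s / d)))"
    using lborel_integral_real_affine[of d "\<lambda>y. complex_of_real (exp (- y\<^sup>2 / 2)) * cis (y * (s / d))" 0] d
    by simp
  also have "(LINT y|lborel. complex_of_real (exp (- y\<^sup>2 / 2)) * cis (y * (s / d))) =
      of_real (sqrt (2 * pi)) * (LINT y|lborel. std_normal_density y *\<^sub>R cis (y * (s / d)))"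
    unfolding eq by (subst integral_mult_right_zero[symmetric]) (simp add: scaleR_conv_of_real mult.assoc)
  also have "(LINT y|lborel. std_normal_density y *\<^sub>R cis (y * (s / d))) = char std_normal_distribution (s / d)"
    unfolding char_def by (subst integral_density) (auto simp: cis_conv_exp mult_ac)
  also have "\<dots> = complex_of_real (exp (- (s / d)\<^sup>2 / 2))"
    by (simp only: char_std_normal_distribution)
  finally show "(LINT x|lborel. complex_of_real (exp (- (d * x)\<^sup>2 / 2)) * cis (x * s)) =
      of_real (sqrt (2 * pi) / d * exp (- (s / d)\<^sup>2 / 2))"
    using d by (simp add: scaleR_conv_of_real field_simps)
qed

definition autocorr :: "(real \<Rightarrow> complex) \<Rightarrow> real \<Rightarrow> complex" where
  "autocorr f h = (LINT s|lborel. f s * cnj (f (s + h)))"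

lemma autocorr_bound:
  assumes "f \<in> L2_space lborel"
  shows "cmod (autocorr f h) \<le> (L2_norm lborel f)\<^sup>2"
  using L2_Cauchy_Schwarz[OF assms translation_L2(1)[OF assms, of h]]
  by (simp add: autocorr_def L2_inner_def translation_L2(2)[OF assms] power2_eq_square)

text \<open>
  The Gaussian weight makes all integrals absolutely convergent; it turns \<open>\<bar>ft f\<bar>\<^sup>2\<close> into a Gaussian
  average of the autocorrelation of \<open>f\<close>. Letting the weight tend to \<open>1\<close> gives Bessel's inequality,
  and Plancherel's identity where the autocorrelation is continuous at \<open>0\<close>.
\<close>

lemma gaussian_average_ft:
  assumes f: "integrable lborel f" and f2: "f \<in> L2_space lborel" and d: "d > 0"
  shows "(LINT x|lborel. complex_of_real (exp (- (d * x)\<^sup>2 / 2) * (cmod (ft f x))\<^sup>2)) =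
    (LINT y|lborel. complex_of_real (2 * pi * std_normal_density y) * autocorr f (d * y))"
proof -
  have [measurable]: "f \<in> borel_measurable borel" using f by auto
  let ?g = "\<lambda>x. complex_of_real (exp (- (d * x)\<^sup>2 / 2))"
  let ?F = "\<lambda>p. f (fst p) * cnj (f (snd p))"
  let ?L2 = "lborel \<Otimes>\<^sub>M lborel :: (real \<times> real) measure"
  have sf: "sigma_finite_measure (lborel :: real measure)" "sigma_finite_measure ?L2"
    unfolding lborel_prod by (rule sigma_finite_lborel)+
  have fc: "integrable lborel (\<lambda>x. cnj (f x))" using f by simp
  have F: "integrable ?L2 ?F"
    using integral_swap_product(1)[OF sf(1) sf(1) f fc, of "\<lambda>_ _. 1" 1] by (simp add: case_prod_beta')
  have square: "complex_of_real ((cmod (ft f x))\<^sup>2) = (LINT p|?L2. ?F p * cis (x * (fst p - snd p)))" for x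
  proof -
    have int: "integrable ?L2 (\<lambda>p. ?F p * cis (x * (fst p - snd p)))"
      by (rule integrable_mult_cis[OF F]) measurable
    have "complex_of_real ((cmod (ft f x))\<^sup>2) = ft f x * cnj (ft f x)" by (simp add: complex_norm_square del: of_real_power)
    also have "cnj (ft f x) = (LINT u|lborel. cnj (f u) * cis (- (x * u)))"
    proof -
      have "cnj (ft f x) = (LINT u|lborel. cnj (f u * cis (x * u)))"
        unfolding ft_def by (simp del: complex_cnj_mult)
      then show ?thesis by (simp add: cis_cnj)
    qed
    also have "ft f x * \<dots> = (LINT s|lborel. f s * cis (x * s) * (LINT u|lborel. cnj (f u) * cis (- (x * u))))"
      unfolding ft_def by simp
    also have "\<dots> = (LINT s|lborel. LINT u|lborel. ?F (s, u) * cis (x * (fst (s, u) - snd (s, u))))"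
      by (intro Bochner_Integration.integral_cong refl, subst integral_mult_right_zero[symmetric])
         (auto intro!: Bochner_Integration.integral_cong simp: mult_ac cis_mult right_diff_distrib)
    also have "\<dots> = (LINT p|?L2. ?F p * cis (x * (fst p - snd p)))"
      by (rule lborel_pair.integral_fst'[OF int])
    finally show ?thesis .
  qed
  have "(LINT x|lborel. complex_of_real (exp (- (d * x)\<^sup>2 / 2) * (cmod (ft f x))\<^sup>2)) =
      (LINT x|lborel. ?g x * (LINT p|?L2. ?F p * cis (x * (fst p - snd p))))"
    unfolding square[symmetric] by simp
  also have "\<dots> = (LINT p|?L2. ?F p * (LINT x|lborel. ?g x * cis (x * (fst p - snd p))))"
    by (rule integral_swap_product(2)[OF sf integral_gaussian_cis(1)[OF d] F, of _ 1])
       (auto simp: case_prod_beta')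
  also have "\<dots> = (LINT p|?L2. ?F p * of_real (sqrt (2 * pi) / d * exp (- ((fst p - snd p) / d)\<^sup>2 / 2)))"
    unfolding integral_gaussian_cis(2)[OF d] ..
  also have "\<dots> = (LINT s|lborel. LINT u|lborel. f s * cnj (f u) * of_real (sqrt (2 * pi) / d * exp (- ((s - u) / d)\<^sup>2 / 2)))"
  proof -
    have "integrable ?L2 (\<lambda>p. ?F p * of_real (sqrt (2 * pi) / d * exp (- ((fst p - snd p) / d)\<^sup>2 / 2)))"
    proof (rule Bochner_Integration.integrable_bound)
      show "integrable ?L2 (\<lambda>p. ?F p * of_real (sqrt (2 * pi) / d))" using F by simp
      show "AE p in ?L2. norm (?F p * of_real (sqrt (2 * pi) / d * exp (- ((fst p - snd p) / d)\<^sup>2 / 2)))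
          \<le> norm (?F p * of_real (sqrt (2 * pi) / d))"
        using d by (intro AE_I2) (auto simp: norm_mult norm_divide intro!: mult_left_mono divide_right_mono mult_left_le)
    qed measurable
    from lborel_pair.integral_fst'[OF this, symmetric] show ?thesis by (simp only: fst_conv snd_conv)
  qed
  also have "\<dots> = (LINT s|lborel. f s * (LINT y|lborel. complex_of_real (2 * pi * std_normal_density y) * cnj (f (s + d * y))))"
  proof (rule Bochner_Integration.integral_cong[OF refl])
    fix s
    have "(LINT u|lborel. f s * cnj (f u) * of_real (sqrt (2 * pi) / d * exp (- ((s - u) / d)\<^sup>2 / 2)))
      = \<bar>d\<bar> *\<^sub>R (LINT y|lborel. f s * cnj (f (s + d * y)) * of_real (sqrt (2 * pi) / d * exp (- ((s - (s + d * y)) / d)\<^sup>2 / 2)))"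
      using d by (intro lborel_integral_real_affine) simp
    also have "\<dots> = (LINT y|lborel. f s * (complex_of_real (2 * pi * std_normal_density y) * cnj (f (s + d * y))))"
    proof (subst integral_scaleR_right[symmetric], rule Bochner_Integration.integral_cong[OF refl])
      fix y
      have "sqrt (2 * pi) * exp (- y\<^sup>2 / 2) = 2 * pi * std_normal_density y"
        by (simp add: std_normal_density_def field_simps)
      then have e: "\<bar>d\<bar> * (sqrt (2 * pi) / d * exp (- ((s - (s + d * y)) / d)\<^sup>2 / 2)) = 2 * pi * std_normal_density y"
        using d by simp
      show "\<bar>d\<bar> *\<^sub>R (f s * cnj (f (s + d * y)) * of_real (sqrt (2 * pi) / d * exp (- ((s - (s + d * y)) / d)\<^sup>2 / 2)))
        = f s * (complex_of_real (2 * pi * std_normal_density y) * cnj (f (s + d * y)))"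
        unfolding e[symmetric] by (simp add: scaleR_conv_of_real mult_ac)
    qed
    finally show "(LINT u|lborel. f s * cnj (f u) * of_real (sqrt (2 * pi) / d * exp (- ((s - u) / d)\<^sup>2 / 2)))
      = f s * (LINT y|lborel. complex_of_real (2 * pi * std_normal_density y) * cnj (f (s + d * y)))"
      by simp
  qed
  also have "\<dots> = (LINT y|lborel. LINT s|lborel. complex_of_real (2 * pi * std_normal_density y) * (f s * cnj (f (s + d * y))))"
  proof -
    let ?h = "\<lambda>y s. complex_of_real (2 * pi * std_normal_density y) * (f s * cnj (f (s + d * y)))"
    have "(LINT y|lborel. LINT s|lborel. ?h y s) = (LINT s|lborel. LINT y|lborel. ?h y s)"
    proof (rule integral_swap(2)[OF sf(1) sf(1)])
      show "case_prod ?h \<in> borel_measurable (lborel \<Otimes>\<^sub>M lborel)" by measurable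
      show "integrable lborel (?h y)" for y
        by (intro integrable_mult_right L2_inner_integrable f2 translation_L2(1))
      show "integrable lborel (\<lambda>y. 2 * pi * std_normal_density y * (L2_norm lborel f)\<^sup>2)"
        by (intro integrable_mult_left integrable_mult_right integrable_normal_density) simp
      fix y
      have "(LINT s|lborel. cmod (?h y s)) = 2 * pi * std_normal_density y * (LINT s|lborel. cmod (f s) * cmod (f (s + d * y)))"
        by (simp add: norm_mult normal_density_nonneg)
      also have "\<dots> \<le> 2 * pi * std_normal_density y * (L2_norm lborel f * L2_norm lborel f)"
        using L2_Cauchy_Schwarz_real[OF f2 translation_L2(1)[OF f2, of "d * y"]]
        by (intro mult_left_mono) (auto simp: translation_L2(2)[OF f2] normal_density_nonneg)
      finally show "(LINT s|lborel. cmod (?h y s)) \<le> 2 * pi * std_normal_density y * (L2_norm lborel f)\<^sup>2"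
        by (simp add: power2_eq_square)
    qed
    also have "\<dots> = (LINT s|lborel. LINT y|lborel. f s * (complex_of_real (2 * pi * std_normal_density y) * cnj (f (s + d * y))))"
      by (simp add: mult_ac)
    finally show ?thesis by simp
  qed
  also have "\<dots> = (LINT y|lborel. complex_of_real (2 * pi * std_normal_density y) * autocorr f (d * y))"
    by (simp add: autocorr_def)
  finally show ?thesis .
qed

lemma Bessel:
  assumes f: "integrable lborel f" and f2: "f \<in> L2_space lborel"
  shows "ft f \<in> L2_space lborel" "(L2_norm lborel (ft f))\<^sup>2 \<le> 2 * pi * (L2_norm lborel f)\<^sup>2"
proof -
  have [measurable]: "f \<in> borel_measurable borel" using f by auto
  define d where "d n = 1 / real (Suc n)" for n
  have d: "d n > 0" for n by (simp add: d_def)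
  define F where "F n x = complex_of_real (exp (- (d n * x)\<^sup>2 / 4)) * ft f x" for n x
  have sq: "(cmod (F n x))\<^sup>2 = exp (- (d n * x)\<^sup>2 / 2) * (cmod (ft f x))\<^sup>2" for n x
    by (simp add: F_def norm_mult power_mult_distrib exp_double[symmetric] flip: exp_of_nat_mult)
  define B where "B = sqrt (2 * pi) * L2_norm lborel f"
  have B: "B \<ge> 0" "B\<^sup>2 = 2 * pi * (L2_norm lborel f)\<^sup>2" by (auto simp: B_def power_mult_distrib)
  have FL: "F n \<in> L2_space lborel" for n
  proof (rule L2_spaceI)
    show "F n \<in> borel_measurable lborel" unfolding F_def by measurable
    show "integrable lborel (\<lambda>x. (cmod (F n x))\<^sup>2)"
    proof (rule Bochner_Integration.integrable_bound)
      show "integrable lborel (\<lambda>x. complex_of_real (exp (- (d n * x)\<^sup>2 / 2)) * complex_of_real ((LINT s|lborel. cmod (f s))\<^sup>2))"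
        by (intro integrable_mult_left integral_gaussian_cis(1)[OF d])
      show "AE x in lborel. norm ((cmod (F n x))\<^sup>2) \<le> norm (complex_of_real (exp (- (d n * x)\<^sup>2 / 2)) * complex_of_real ((LINT s|lborel. cmod (f s))\<^sup>2))"
        using ft_bound[OF f] unfolding sq
        by (intro AE_I2) (auto simp: norm_mult norm_power intro!: mult_left_mono power_mono)
    qed (unfold F_def, measurable)
  qed
  have FB: "L2_norm lborel (F n) \<le> B" for n
  proof (rule power2_le_imp_le[OF _ B(1)])
    have "complex_of_real ((L2_norm lborel (F n))\<^sup>2) = (LINT x|lborel. complex_of_real (exp (- (d n * x)\<^sup>2 / 2) * (cmod (ft f x))\<^sup>2))"
      by (simp add: L2_norm_square sq del: of_real_power of_real_mult)
    also have "\<dots> = (LINT y|lborel. complex_of_real (2 * pi * std_normal_density y) * autocorr f (d n * y))"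
      by (rule gaussian_average_ft[OF f f2 d])
    finally have "(L2_norm lborel (F n))\<^sup>2 = cmod (LINT y|lborel. complex_of_real (2 * pi * std_normal_density y) * autocorr f (d n * y))"
      by (metis norm_of_real abs_of_nonneg zero_le_power2)
    also have "\<dots> \<le> (LINT y|lborel. (L2_norm lborel f)\<^sup>2 * (2 * pi * std_normal_density y))"
    proof (rule order_trans[OF integral_norm_bound], rule integral_mono')
      show "integrable lborel (\<lambda>y. (L2_norm lborel f)\<^sup>2 * (2 * pi * std_normal_density y))"
        by (intro integrable_mult_right integrable_normal_density) simp
      show "cmod (complex_of_real (2 * pi * std_normal_density y) * autocorr f (d n * y)) \<le> (L2_norm lborel f)\<^sup>2 * (2 * pi * std_normal_density y)" for y
        using mult_right_mono[OF autocorr_bound[OF f2]] by (simp add: norm_mult normal_density_nonneg mult.commute)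
    qed (simp add: normal_density_nonneg)
    also have "\<dots> = B\<^sup>2" by (simp add: B)
    finally show "(L2_norm lborel (F n))\<^sup>2 \<le> B\<^sup>2" .
  qed
  have lim: "AE x in lborel. (\<lambda>n. F n x) \<longlonglongrightarrow> ft f x"
  proof (rule AE_I2)
    fix x
    have "(\<lambda>n. complex_of_real (exp (- (d n * x)\<^sup>2 / 4)) * ft f x) \<longlonglongrightarrow> complex_of_real (exp (- (0 * x)\<^sup>2 / 4)) * ft f x"
      unfolding d_def by (intro tendsto_intros LIMSEQ_Suc lim_inverse_n') simp
    then show "(\<lambda>n. F n x) \<longlonglongrightarrow> ft f x" by (simp add: F_def)
  qed
  note * = L2_norm_le_of_AE_lim[OF FL _ lim FB B(1)]
  show "ft f \<in> L2_space lborel" by (rule *) measurable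
  have "L2_norm lborel (ft f) \<le> B" by (rule *) measurable
  then show "(L2_norm lborel (ft f))\<^sup>2 \<le> 2 * pi * (L2_norm lborel f)\<^sup>2"
    unfolding B(2)[symmetric] by (intro power_mono) auto
qed

lemma Plancherel:
  assumes cont: "continuous_on UNIV f" and supp: "\<And>s. \<bar>s\<bar> > r \<Longrightarrow> f s = 0"
    and f: "integrable lborel f" and f2: "f \<in> L2_space lborel"
  shows "(L2_norm lborel (ft f))\<^sup>2 = 2 * pi * (L2_norm lborel f)\<^sup>2"
proof -
  have [measurable]: "f \<in> borel_measurable borel" using f by auto
  obtain B where B: "\<And>s. cmod (f s) \<le> B"
  proof -
    have "compact (f ` {- r..r})" using cont by (intro compact_continuous_image) (auto intro: continuous_on_subset)
    from compact_imp_bounded[OF this, unfolded bounded_iff] obtain B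
      where B: "\<forall>y\<in>f ` {- r..r}. cmod y \<le> B" ..
    have "cmod (f s) \<le> max B 0" for s
    proof (cases "\<bar>s\<bar> > r")
      case False
      then have "f s \<in> f ` {- r..r}" by (intro imageI) auto
      then show ?thesis using B by (auto intro: max.coboundedI1)
    qed (use supp in simp)
    then show ?thesis by (rule that)
  qed
  define d where "d n = 1 / real (Suc n)" for n
  have d: "d n > 0" for n by (simp add: d_def)
  have d0: "d \<longlonglongrightarrow> 0" unfolding d_def by (intro LIMSEQ_Suc lim_inverse_n')
  let ?L = "\<lambda>n. LINT x|lborel. complex_of_real (exp (- (d n * x)\<^sup>2 / 2) * (cmod (ft f x))\<^sup>2)"
  have "?L \<longlonglongrightarrow> (LINT x|lborel. complex_of_real ((cmod (ft f x))\<^sup>2))"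
  proof (rule integral_dominated_convergence)
    show "integrable lborel (\<lambda>x. (cmod (ft f x))\<^sup>2)" by (rule L2_square_integrable[OF Bessel(1)[OF f f2]])
    have "(\<lambda>n. complex_of_real (exp (- (d n * x)\<^sup>2 / 2) * (cmod (ft f x))\<^sup>2)) \<longlonglongrightarrow> complex_of_real (exp (- (0 * x)\<^sup>2 / 2) * (cmod (ft f x))\<^sup>2)" for x
      by (intro tendsto_intros d0) simp
    then show "AE x in lborel. (\<lambda>n. complex_of_real (exp (- (d n * x)\<^sup>2 / 2) * (cmod (ft f x))\<^sup>2)) \<longlonglongrightarrow> complex_of_real ((cmod (ft f x))\<^sup>2)"
      by (intro AE_I2) simp
    show "AE x in lborel. cmod (complex_of_real (exp (- (d n * x)\<^sup>2 / 2) * (cmod (ft f x))\<^sup>2)) \<le> (cmod (ft f x))\<^sup>2" for n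
      by (intro AE_I2) (auto simp: norm_mult norm_power mult_left_le_one_le)
  qed measurable
  moreover have "?L \<longlonglongrightarrow> (LINT y|lborel. complex_of_real (2 * pi * std_normal_density y) * autocorr f 0)"
    unfolding gaussian_average_ft[OF f f2 d]
  proof (rule integral_dominated_convergence)
    show "integrable lborel (\<lambda>y. 2 * pi * std_normal_density y * (L2_norm lborel f)\<^sup>2)"
      by (intro integrable_mult_left integrable_mult_right integrable_normal_density) simp
    show "AE y in lborel. cmod (complex_of_real (2 * pi * std_normal_density y) * autocorr f (d n * y))
        \<le> 2 * pi * std_normal_density y * (L2_norm lborel f)\<^sup>2" for n
      using mult_right_mono[OF autocorr_bound[OF f2]] by (intro AE_I2) (simp add: norm_mult normal_density_nonneg mult.commute)
    have "(\<lambda>n. autocorr f (d n * y)) \<longlonglongrightarrow> autocorr f 0" for y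
      unfolding autocorr_def
    proof (rule integral_dominated_convergence)
      show "integrable lborel (\<lambda>s. B * cmod (f s))" using f by auto
      show "AE s in lborel. cmod (f s * cnj (f (s + d n * y))) \<le> B * cmod (f s)" for n
        using mult_left_mono[OF B, of "cmod (f _)"] by (intro AE_I2) (simp add: norm_mult mult.commute)
      have "(\<lambda>n. f (s + d n * y)) \<longlonglongrightarrow> f (s + 0 * y)" for s
      proof (rule continuous_on_tendsto_compose[OF cont])
        show "(\<lambda>n. s + d n * y) \<longlonglongrightarrow> s + 0 * y" by (intro tendsto_intros d0)
      qed auto
      then show "AE s in lborel. (\<lambda>n. f s * cnj (f (s + d n * y))) \<longlonglongrightarrow> f s * cnj (f (s + 0))"
        by (intro AE_I2 tendsto_intros) simp
    qed measurable
    then show "AE y in lborel. (\<lambda>n. complex_of_real (2 * pi * std_normal_density y) * autocorr f (d n * y))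
       \<longlonglongrightarrow> complex_of_real (2 * pi * std_normal_density y) * autocorr f 0"
      by (intro AE_I2 tendsto_intros)
  qed (unfold autocorr_def, measurable)
  ultimately have "(LINT x|lborel. complex_of_real ((cmod (ft f x))\<^sup>2)) =
      (LINT y|lborel. complex_of_real (2 * pi * std_normal_density y) * autocorr f 0)"
    by (rule LIMSEQ_unique)
  also have "\<dots> = complex_of_real (LINT y|lborel. 2 * pi * std_normal_density y) * autocorr f 0"
    by (simp del: of_real_mult)
  also have "autocorr f 0 = of_real ((L2_norm lborel f)\<^sup>2)"
    using L2_inner_self[of lborel f] by (simp add: autocorr_def L2_inner_def)
  finally have "complex_of_real ((L2_norm lborel (ft f))\<^sup>2) = complex_of_real (2 * pi * (L2_norm lborel f)\<^sup>2)"
    by (simp add: L2_norm_square del: of_real_power)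
  then show ?thesis by (simp only: of_real_eq_iff)
qed

text \<open>
  Injectivity on \<open>L\<^sup>1\<close>: after splitting into real and imaginary, positive and negative parts, this is
  the fact that a probability measure is determined by its characteristic function.
\<close>

lemma ft_injective_real:
  fixes g :: "real \<Rightarrow> real"
  assumes g: "integrable lborel g" and ft0: "\<And>x. ft (\<lambda>s. complex_of_real (g s)) x = 0"
  shows "AE s in lborel. g s = 0"
proof -
  define p where "p s = max (g s) 0" for s
  define q where "q s = max (- g s) 0" for s
  have pq: "integrable lborel p" "integrable lborel q" unfolding p_def q_def using g by auto
  have [measurable]: "p \<in> borel_measurable borel" "q \<in> borel_measurable borel" using pq by auto
  have nonneg: "p s \<ge> 0" "q s \<ge> 0" for s by (auto simp: p_def q_def)
  have diff: "p s - q s = g s" for s by (auto simp: p_def q_def)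
  have eq: "(LINT s|lborel. complex_of_real (p s) * cis (x * s)) = (LINT s|lborel. complex_of_real (q s) * cis (x * s))" for x
  proof -
    have "(LINT s|lborel. complex_of_real (p s) * cis (x * s)) - (LINT s|lborel. complex_of_real (q s) * cis (x * s))
      = (LINT s|lborel. complex_of_real (p s) * cis (x * s) - complex_of_real (q s) * cis (x * s))"
      by (subst Bochner_Integration.integral_diff) (auto intro!: integrable_mult_cis pq)
    also have "\<dots> = ft (\<lambda>s. complex_of_real (g s)) x"
      by (simp add: ft_def diff[symmetric] algebra_simps)
    finally show ?thesis using ft0 by simp
  qed
  define c where "c = (LINT s|lborel. p s)"
  have c: "(LINT s|lborel. q s) = c" using eq[of 0] by (simp add: c_def)
  have c0: "c \<ge> 0" unfolding c_def using nonneg by simp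
  show ?thesis
  proof (cases "c = 0")
    case True
    have "AE s in lborel. p s = 0" "AE s in lborel. q s = 0"
      using True c integral_nonneg_eq_0_iff_AE[OF pq(1)] integral_nonneg_eq_0_iff_AE[OF pq(2)] nonneg
      by (auto simp: c_def)
    then show ?thesis using diff by (auto simp flip: diff elim: eventually_elim2)
  next
    case False
    with c0 have cpos: "c > 0" by simp
    have dist: "real_distribution (density lborel (\<lambda>s. ennreal (r s / c)))"
      if r: "integrable lborel r" "\<And>s. r s \<ge> 0" "(LINT s|lborel. r s) = c" for r :: "real \<Rightarrow> real"
    proof -
      have [measurable]: "r \<in> borel_measurable borel" using r by auto
      have "prob_space (density lborel (\<lambda>s. ennreal (r s / c)))"
      proof (rule prob_spaceI)
        have "emeasure (density lborel (\<lambda>s. ennreal (r s / c))) UNIV = (\<integral>\<^sup>+s. ennreal (r s / c) \<partial>lborel)"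
          by (subst emeasure_density) auto
        also have "\<dots> = ennreal (LINT s|lborel. r s / c)"
          using r cpos by (intro nn_integral_eq_integral) auto
        also have "\<dots> = 1" using r cpos by simp
        finally show "emeasure (density lborel (\<lambda>s. ennreal (r s / c))) (space (density lborel (\<lambda>s. ennreal (r s / c)))) = 1"
          by simp
      qed
      then show ?thesis unfolding real_distribution_def real_distribution_axioms_def by simp
    qed
    have char: "char (density lborel (\<lambda>s. ennreal (r s / c))) x = (LINT s|lborel. complex_of_real (r s) * cis (x * s)) / c"
      if r: "integrable lborel r" "\<And>s. r s \<ge> 0" for r :: "real \<Rightarrow> real" and x
    proof -
      have [measurable]: "r \<in> borel_measurable borel" using r by auto
      have "char (density lborel (\<lambda>s. ennreal (r s / c))) x = (LINT s|lborel. (r s / c) *\<^sub>R iexp (x * s))"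
        unfolding char_def by (rule integral_density) (use r cpos in auto)
      also have "\<dots> = (LINT s|lborel. complex_of_real (r s) * cis (x * s) / c)"
        by (simp add: scaleR_conv_of_real cis_conv_exp)
      finally show ?thesis by simp
    qed
    have "density lborel (\<lambda>s. ennreal (p s / c)) = density lborel (\<lambda>s. ennreal (q s / c))"
      by (rule Levy_uniqueness[OF dist[OF pq(1) nonneg(1) c_def[symmetric]] dist[OF pq(2) nonneg(2) c]])
         (auto simp: fun_eq_iff char[OF pq(1) nonneg(1)] char[OF pq(2) nonneg(2)] eq)
    then have "AE s in lborel. ennreal (p s / c) = ennreal (q s / c)"
      by (subst (asm) sigma_finite_measure.density_unique_iff[OF sigma_finite_lborel]) auto
    then show ?thesis
    proof eventually_elim
      case (elim s)
      then show ?case using nonneg[of s] cpos diff[of s] by (auto simp: ennreal_inj divide_nonneg_pos)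
    qed
  qed
qed

text \<open>
  For complex \<open>f\<close> the transforms of \<open>Re f\<close> and \<open>Im f\<close> are combinations of \<open>ft f x\<close> and \<open>cnj (ft f (- x))\<close>.
\<close>

lemma ft_injective:
  assumes f: "integrable lborel f" and ft0: "\<And>x. ft f x = 0"
  shows "AE s in lborel. f s = 0"
proof -
  have cnj0: "(LINT s|lborel. cnj (f s) * cis (x * s)) = 0" for x
  proof -
    have "cnj (ft f (- x)) = (LINT s|lborel. cnj (f s * cis (- x * s)))"
      unfolding ft_def by (simp del: complex_cnj_mult)
    then show ?thesis using ft0[of "- x"] by (simp add: cis_cnj)
  qed
  have int: "integrable lborel (\<lambda>s. f s * cis (x * s))" "integrable lborel (\<lambda>s. cnj (f s) * cis (x * s))" for x
    using f by (auto intro!: integrable_mult_cis)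
  have "AE s in lborel. Re (f s) = 0"
  proof (rule ft_injective_real)
    fix x
    have "ft (\<lambda>s. complex_of_real (Re (f s))) x = (LINT s|lborel. (f s * cis (x * s) + cnj (f s) * cis (x * s)) / 2)"
      unfolding ft_def by (intro Bochner_Integration.integral_cong refl) (simp add: complex_add_cnj flip: distrib_right)
    then show "ft (\<lambda>s. complex_of_real (Re (f s))) x = 0"
      using int[of x] ft0[of x] cnj0[of x] by (simp add: ft_def)
  qed (use f in simp)
  moreover have "AE s in lborel. Im (f s) = 0"
  proof (rule ft_injective_real)
    fix x
    have im: "complex_of_real (Im z) * w = (z * w - cnj z * w) / (2 * \<i>)" for z w
      by (simp add: complex_eq_iff)
    have "ft (\<lambda>s. complex_of_real (Im (f s))) x = (LINT s|lborel. (f s * cis (x * s) - cnj (f s) * cis (x * s)) / (2 * \<i>))"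
      unfolding ft_def im ..
    then show "ft (\<lambda>s. complex_of_real (Im (f s))) x = 0"
      using int[of x] ft0[of x] cnj0[of x] by (simp add: ft_def)
  qed (use f in simp)
  ultimately show ?thesis by eventually_elim (simp add: complex_eq_iff)
qed

section \<open>Test functions\<close>

fun differentiable_times :: "nat \<Rightarrow> (real \<Rightarrow> complex) \<Rightarrow> bool" where
  "differentiable_times 0 f = True"
| "differentiable_times (Suc n) f =
    (\<exists>g. (\<forall>x. (f has_vector_derivative g x) (at x)) \<and> differentiable_times n g)"

definition smooth :: "(real \<Rightarrow> complex) \<Rightarrow> bool" where
  "smooth f \<longleftrightarrow> (\<forall>n. differentiable_times n f)"

definition dv :: "(real \<Rightarrow> complex) \<Rightarrow> real \<Rightarrow> complex" where
  "dv f x = vector_derivative f (at x)"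

lemma dv_eqI: "(\<And>x. (f has_vector_derivative g x) (at x)) \<Longrightarrow> dv f = g"
  by (auto simp: dv_def fun_eq_iff intro: vector_derivative_at)

lemma smoothD:
  assumes "smooth f"
  shows smooth_has_dv: "(f has_vector_derivative dv f x) (at x)" and smooth_dv: "smooth (dv f)"
proof -
  have *: "differentiable_times n (dv f) \<and> (\<forall>x. (f has_vector_derivative dv f x) (at x))" for n
  proof -
    have "differentiable_times (Suc n) f" using assms unfolding smooth_def by blast
    then obtain g where g: "\<And>x. (f has_vector_derivative g x) (at x)" "differentiable_times n g" by auto
    then show ?thesis using dv_eqI[of f g] by simp
  qed
  show "(f has_vector_derivative dv f x) (at x)" "smooth (dv f)" using * unfolding smooth_def by auto
qed

lemma smoothI:
  assumes "\<And>x. (f has_vector_derivative g x) (at x)" "smooth g"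
  shows "smooth f"
  unfolding smooth_def
proof
  fix n show "differentiable_times n f"
    using assms unfolding smooth_def by (cases n) auto
qed

lemma differentiable_times_Suc: "differentiable_times (Suc n) f \<Longrightarrow> differentiable_times n f"
proof (induction n arbitrary: f)
  case (Suc n)
  then obtain g where "\<forall>x. (f has_vector_derivative g x) (at x)" "differentiable_times (Suc n) g" by auto
  with Suc.IH[of g] show ?case by auto
qed simp

lemma differentiable_times_add:
  "differentiable_times n f \<Longrightarrow> differentiable_times n g \<Longrightarrow> differentiable_times n (\<lambda>x. f x + g x)"
proof (induction n arbitrary: f g)
  case (Suc n)
  then obtain f' g' where f': "\<And>x. (f has_vector_derivative f' x) (at x)" "differentiable_times n f'"
    and g': "\<And>x. (g has_vector_derivative g' x) (at x)" "differentiable_times n g'" by auto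
  show ?case unfolding differentiable_times.simps
    by (rule exI[of _ "\<lambda>x. f' x + g' x"]) (auto intro: has_vector_derivative_add f' g' Suc.IH)
qed simp

lemma differentiable_times_mult:
  "differentiable_times n f \<Longrightarrow> differentiable_times n g \<Longrightarrow> differentiable_times n (\<lambda>x. f x * g x)"
proof (induction n arbitrary: f g)
  case (Suc n)
  then obtain f' g' where f': "\<And>x. (f has_vector_derivative f' x) (at x)" "differentiable_times n f'"
    and g': "\<And>x. (g has_vector_derivative g' x) (at x)" "differentiable_times n g'" by auto
  note fg = Suc.prems[THEN differentiable_times_Suc]
  show ?case unfolding differentiable_times.simps
    by (rule exI[of _ "\<lambda>x. f x * g' x + f' x * g x"])
       (auto intro!: has_vector_derivative_mult f' g' differentiable_times_add Suc.IH fg)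
qed simp

lemma differentiable_times_const: "differentiable_times n (\<lambda>x. c)"
proof (induction n arbitrary: c)
  case (Suc n)
  show ?case unfolding differentiable_times.simps
    by (rule exI[of _ "\<lambda>x. 0"]) (auto intro: Suc derivative_eq_intros)
qed simp

lemma differentiable_times_affine:
  "differentiable_times n f \<Longrightarrow> differentiable_times n (\<lambda>x. f (a * x + b))"
proof (induction n arbitrary: f)
  case (Suc n)
  then obtain f' where f': "\<And>x. (f has_vector_derivative f' x) (at x)" "differentiable_times n f'" by auto
  have "((\<lambda>x. f (a * x + b)) has_vector_derivative of_real a * f' (a * x + b)) (at x)" for x
  proof -
    have "((\<lambda>x. a * x + b) has_real_derivative a) (at x)" by (auto intro!: derivative_eq_intros)
    then have "((\<lambda>x. a * x + b) has_vector_derivative a) (at x)" by (simp add: has_real_derivative_iff_has_vector_derivative)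
    from vector_diff_chain_at[OF this f'(1)] show ?thesis by (simp add: o_def scaleR_conv_of_real)
  qed
  then show ?case unfolding differentiable_times.simps
    by (intro exI[of _ "\<lambda>x. of_real a * f' (a * x + b)"] conjI allI differentiable_times_mult
        differentiable_times_const Suc.IH f')
qed simp

text \<open>
  The induction runs over all holomorphic functions at once, since the derivative of the restriction to
  a line is a multiple of the restriction of the holomorphic derivative.
\<close>

lemma differentiable_times_holomorphic:
  assumes "open S" "\<And>x. z + w * of_real x \<in> S"
  shows "f holomorphic_on S \<Longrightarrow> differentiable_times n (\<lambda>x. f (z + w * of_real x))"
proof (induction n arbitrary: f)
  case (Suc n)
  have "((\<lambda>x. f (z + w * of_real x)) has_vector_derivative w * deriv f (z + w * of_real x)) (at x)" for x
  proof -
    have "((\<lambda>x. z + w * of_real x) has_vector_derivative w) (at x)"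
      by (auto intro!: derivative_eq_intros)
    moreover have "(f has_field_derivative deriv f (z + w * of_real x)) (at (z + w * of_real x))"
      by (rule holomorphic_derivI[OF Suc.prems assms])
    ultimately show ?thesis
      using field_vector_diff_chain_at by (fastforce simp: o_def)
  qed
  then show ?case unfolding differentiable_times.simps
    by (intro exI[of _ "\<lambda>x. w * deriv f (z + w * of_real x)"] conjI allI differentiable_times_mult
        differentiable_times_const Suc.IH holomorphic_deriv Suc.prems assms)
qed simp

lemma smooth_const: "smooth (\<lambda>x. c)" 
  and smooth_add: "smooth f \<Longrightarrow> smooth g \<Longrightarrow> smooth (\<lambda>x. f x + g x)"
  and smooth_mult: "smooth f \<Longrightarrow> smooth g \<Longrightarrow> smooth (\<lambda>x. f x * g x)"
  and smooth_affine: "smooth f \<Longrightarrow> smooth (\<lambda>x. f (a * x + b))"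
  unfolding smooth_def
  by (simp_all add: differentiable_times_const differentiable_times_add differentiable_times_mult differentiable_times_affine)

lemma smooth_holomorphic:
  "f holomorphic_on S \<Longrightarrow> open S \<Longrightarrow> (\<And>x. z + w * of_real x \<in> S) \<Longrightarrow> smooth (\<lambda>x. f (z + w * of_real x))"
  unfolding smooth_def using differentiable_times_holomorphic by blast

lemma smooth_cis: "smooth (\<lambda>x. cis (c * x))"
  using smooth_holomorphic[of exp UNIV 0 "\<i> * of_real c"] holomorphic_on_exp
  by (simp add: cis_conv_exp mult.assoc)

lemma dv_cis: "dv (\<lambda>x. cis (c * x)) = (\<lambda>x. \<i> * of_real c * cis (c * x))"
proof (rule dv_eqI)
  fix x
  have "((\<lambda>z. exp (\<i> * of_real c * z)) has_field_derivative \<i> * of_real c * exp (\<i> * of_real c * of_real x)) (at (of_real x))"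
    by (auto intro!: derivative_eq_intros)
  from field_vector_diff_chain_at[OF has_vector_derivative_of_real[OF DERIV_ident[of "at x"]] this]
  show "((\<lambda>x. cis (c * x)) has_vector_derivative \<i> * of_real c * cis (c * x)) (at x)"
    by (simp add: o_def cis_conv_exp mult.assoc)
qed

lemma dv_add: "smooth f \<Longrightarrow> smooth g \<Longrightarrow> dv (\<lambda>x. f x + g x) = (\<lambda>x. dv f x + dv g x)"
  by (rule dv_eqI) (auto intro: has_vector_derivative_add smooth_has_dv)

lemma dv_mult: "smooth f \<Longrightarrow> smooth g \<Longrightarrow> dv (\<lambda>x. f x * g x) = (\<lambda>x. f x * dv g x + dv f x * g x)"
  by (rule dv_eqI) (auto intro: has_vector_derivative_mult smooth_has_dv)

lemma dv_cmult: "smooth f \<Longrightarrow> dv (\<lambda>x. c * f x) = (\<lambda>x. c * dv f x)"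
  by (rule dv_eqI) (auto intro: has_vector_derivative_mult_right smooth_has_dv)

lemma dv_affine: "smooth f \<Longrightarrow> dv (\<lambda>x. f (a * x + b)) = (\<lambda>x. of_real a * dv f (a * x + b))"
proof (rule dv_eqI)
  fix x assume f: "smooth f"
  have "((\<lambda>x. a * x + b) has_real_derivative a) (at x)" by (auto intro!: derivative_eq_intros)
  then have "((\<lambda>x. a * x + b) has_vector_derivative a) (at x)" by (simp add: has_real_derivative_iff_has_vector_derivative)
  from vector_diff_chain_at[OF this smooth_has_dv[OF f]]
  show "((\<lambda>x. f (a * x + b)) has_vector_derivative of_real a * dv f (a * x + b)) (at x)"
    by (simp add: o_def scaleR_conv_of_real)
qed

lemma smooth_continuous: "smooth f \<Longrightarrow> continuous_on UNIV f"
  by (rule continuous_at_imp_continuous_on) (auto intro: has_vector_derivative_continuous smooth_has_dv)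

definition test :: "(real \<Rightarrow> complex) \<Rightarrow> bool" where
  "test f \<longleftrightarrow> smooth f \<and> (\<exists>r. \<forall>x. r < \<bar>x\<bar> \<longrightarrow> f x = 0)"

lemma test_smooth: "test f \<Longrightarrow> smooth f" by (simp add: test_def)

lemma test_mult: "test f \<Longrightarrow> smooth g \<Longrightarrow> test (\<lambda>x. f x * g x)"
  and test_mult': "test f \<Longrightarrow> smooth g \<Longrightarrow> test (\<lambda>x. g x * f x)"
  by (auto simp: test_def intro: smooth_mult)

lemma test_cmult: "test f \<Longrightarrow> test (\<lambda>x. c * f x)"
  by (rule test_mult'[OF _ smooth_const])

lemma test_zero: "test (\<lambda>x. 0)"
  by (simp add: test_def smooth_const)

lemma test_add:
  assumes "test f" "test g"
  shows "test (\<lambda>x. f x + g x)"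
proof -
  obtain r s where "\<forall>x. r < \<bar>x\<bar> \<longrightarrow> f x = 0" "\<forall>x. s < \<bar>x\<bar> \<longrightarrow> g x = 0" using assms by (auto simp: test_def)
  then have "\<forall>x. max r s < \<bar>x\<bar> \<longrightarrow> f x + g x = 0" by auto
  then show ?thesis using assms smooth_add unfolding test_def by blast
qed

lemma test_affine:
  assumes "test f" "a \<noteq> 0"
  shows "test (\<lambda>x. f (a * x + b))"
proof -
  obtain r where r: "\<forall>x. r < \<bar>x\<bar> \<longrightarrow> f x = 0" using assms by (auto simp: test_def)
  have "f (a * x + b) = 0" if "(\<bar>r\<bar> + \<bar>b\<bar>) / \<bar>a\<bar> < \<bar>x\<bar>" for x
  proof -
    have "\<bar>r\<bar> + \<bar>b\<bar> < \<bar>a * x\<bar>" using that assms(2) by (simp add: abs_mult field_simps)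
    then have "r < \<bar>a * x + b\<bar>" by linarith
    then show ?thesis using r by blast
  qed
  then show ?thesis using assms smooth_affine unfolding test_def by blast
qed

lemma test_uminus: "test f \<Longrightarrow> test (\<lambda>x. f (- x))"
  using test_affine[of f "-1" 0] by simp

lemma test_dv:
  assumes "test f"
  shows "test (dv f)"
proof -
  obtain r where r: "\<And>x. r < \<bar>x\<bar> \<Longrightarrow> f x = 0" using assms by (auto simp: test_def)
  have "dv f x = 0" if x: "r < \<bar>x\<bar>" for x
  proof -
    have "open {x :: real. r < \<bar>x\<bar>}" by (intro open_Collect_less continuous_intros)
    then have "((\<lambda>x. 0) has_vector_derivative dv f x) (at x)"
      using r x by (intro has_vector_derivative_transform_within_open[OF smooth_has_dv[OF test_smooth[OF assms]], of "{x. r < \<bar>x\<bar>}"]) auto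
    moreover have "((\<lambda>x. 0 :: complex) has_vector_derivative 0) (at x)" by (auto intro: derivative_eq_intros)
    ultimately show ?thesis by (rule vector_derivative_unique_at)
  qed
  then show ?thesis using assms smooth_dv unfolding test_def by blast
qed

lemma test_bounded:
  assumes "test f"
  obtains B where "\<And>x. cmod (f x) \<le> B" "B \<ge> 0"
proof -
  obtain r where r: "\<And>x. r < \<bar>x\<bar> \<Longrightarrow> f x = 0" using assms by (auto simp: test_def)
  have "compact (f ` {- r..r})"
    by (intro compact_continuous_image continuous_on_subset[OF smooth_continuous[OF test_smooth[OF assms]]]) auto
  from compact_imp_bounded[OF this, unfolded bounded_iff] obtain B
    where B: "\<forall>y\<in>f ` {- r..r}. cmod y \<le> B" ..
  have "cmod (f s) \<le> max B 0" for s
  proof (cases "\<bar>s\<bar> > r")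
    case False
    then have "f s \<in> f ` {- r..r}" by (intro imageI) auto
    then show ?thesis using B by (auto intro: max.coboundedI1)
  qed (use r in simp)
  then show ?thesis using that[of "max B 0"] by simp
qed

lemma test_measurable [measurable_dest]: "test f \<Longrightarrow> f \<in> borel_measurable borel"
  by (intro borel_measurable_continuous_onI smooth_continuous test_smooth)

lemma test_integrable:
  assumes "test f"
  shows "integrable lborel f"
proof -
  obtain B where B: "\<And>x. cmod (f x) \<le> B" using assms test_bounded by metis
  obtain r where r: "\<And>x. r < \<bar>x\<bar> \<Longrightarrow> f x = 0" using assms by (auto simp: test_def)
  show ?thesis
  proof (rule Bochner_Integration.integrable_bound)
    show "integrable lborel (\<lambda>x. B * indicator {- r..r} x)"
      by (intro integrable_mult_right integrable_real_indicator) (auto simp: emeasure_lborel_Icc_eq)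
    show "AE x in lborel. norm (f x) \<le> norm (B * indicator {- r..r} x)"
    proof (rule AE_I2)
      fix x
      show "norm (f x) \<le> norm (B * indicator {- r..r} x)"
        using r[of x] B[of x] by (cases "x \<in> {- r..r}") (auto simp: abs_le_iff not_le)
    qed
  qed (use assms in \<open>simp add: test_measurable\<close>)
qed

lemma test_L2:
  assumes "test f"
  shows "f \<in> L2_space lborel"
proof -
  obtain B where B: "\<And>x. cmod (f x) \<le> B" using assms test_bounded by metis
  note [measurable] = test_measurable[OF assms]
  show ?thesis
  proof (rule L2_spaceI)
    show "integrable lborel (\<lambda>x. (cmod (f x))\<^sup>2)"
    proof (rule Bochner_Integration.integrable_bound)
      show "integrable lborel (\<lambda>x. B * cmod (f x))" using test_integrable[OF assms] by simp
      show "AE x in lborel. norm ((cmod (f x))\<^sup>2) \<le> norm (B * cmod (f x))"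
        using B order_trans[OF norm_ge_zero B]
        by (intro AE_I2) (auto simp: power2_eq_square abs_mult intro!: mult_right_mono)
    qed measurable
  qed simp
qed

lemma integral_dv_test:
  assumes "test f"
  shows "(LINT x|lborel. dv f x) = 0"
proof -
  obtain r where "\<And>x. r < \<bar>x\<bar> \<Longrightarrow> f x = 0" using assms by (auto simp: test_def)
  obtain r' where "\<And>x. r' < \<bar>x\<bar> \<Longrightarrow> dv f x = 0" using test_dv[OF assms] by (auto simp: test_def)
  define R where "R = max (max r r') 0 + 1"
  have f: "f R = 0" "f (- R) = 0" and d: "\<And>x. x \<notin> {- R..R} \<Longrightarrow> dv f x = 0"
    using \<open>\<And>x. r < \<bar>x\<bar> \<Longrightarrow> f x = 0\<close> \<open>\<And>x. r' < \<bar>x\<bar> \<Longrightarrow> dv f x = 0\<close> by (auto simp: R_def)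
  have "has_bochner_integral lborel (\<lambda>x. indicator {- R..R} x *\<^sub>R dv f x) (f R - f (- R))"
    by (rule has_bochner_integral_FTC_Icc)
       (auto intro!: has_vector_derivative_at_within smooth_has_dv test_smooth assms
         continuous_on_subset[OF smooth_continuous[OF smooth_dv[OF test_smooth[OF assms]]]] simp: R_def)
  moreover have "(\<lambda>x. indicator {- R..R} x *\<^sub>R dv f x) = dv f"
    using d by (auto simp: indicator_def fun_eq_iff)
  ultimately show ?thesis using f by (simp add: has_bochner_integral_iff)
qed

lemma integral_by_parts_test:
  assumes f: "test f" and g: "smooth g"
  shows "(LINT x|lborel. dv f x * g x) = - (LINT x|lborel. f x * dv g x)"
proof -
  have "0 = (LINT x|lborel. dv (\<lambda>x. f x * g x) x)" by (rule integral_dv_test[symmetric, OF test_mult[OF f g]])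
  also have "\<dots> = (LINT x|lborel. f x * dv g x) + (LINT x|lborel. dv f x * g x)"
    unfolding dv_mult[OF test_smooth[OF f] g]
    by (intro Bochner_Integration.integral_add test_integrable test_mult test_dv f g smooth_dv)
  finally show ?thesis by (simp add: eq_neg_iff_add_eq_0 add.commute)
qed

subsection \<open>Bump functions\<close>

text \<open>
  The function \<open>exp (- 1 / x)\<close> for positive \<open>x\<close>, extended by zero, and its products with powers of \<open>1 / x\<close>. The
  linear span of this family is closed under differentiation, which reduces smoothness to the
  first derivative.
\<close>

definition flat :: "nat \<Rightarrow> real \<Rightarrow> complex" where
  "flat n x = (if x > 0 then of_real (exp (- inverse x) * inverse x ^ n) else 0)"

text \<open>
  One term of the exponential series of \<open>1 / x\<close>. The quadratic bound gives derivative \<open>0\<close> at the origin.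
\<close>

lemma flat_bound: "cmod (flat n x) \<le> fact (n + 2) * x\<^sup>2"
proof (cases "x > 0")
  case True
  have "inverse x ^ (n + 2) / fact (n + 2) \<le> exp (inverse x)"
    using exp_ge_add_one_self
  proof -
    have "(\<Sum>k<n+3. inverse x ^ k /\<^sub>R fact k) \<le> exp (inverse x)"
      unfolding exp_def using True by (intro sum_le_suminf summable_exp_generic) auto
    moreover have "inverse x ^ (n+2) /\<^sub>R fact (n+2) \<le> (\<Sum>k<n+3. inverse x ^ k /\<^sub>R fact k)"
      using True by (intro member_le_sum) auto
    ultimately show ?thesis by (simp add: divide_inverse mult.commute)
  qed
  then have "inverse x ^ (n + 2) \<le> fact (n + 2) * exp (inverse x)" by (simp add: divide_le_eq mult.commute)
  then have le: "exp (- inverse x) * x\<^sup>2 * inverse x ^ (n + 2) \<le> exp (- inverse x) * x\<^sup>2 * (fact (n + 2) * exp (inverse x))"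
    by (intro mult_left_mono) auto
  have p: "x\<^sup>2 * inverse x ^ (n + 2) = inverse x ^ n"
    using True by (simp add: power_add power2_eq_square field_simps)
  have e: "exp (- inverse x) * exp (inverse x) = 1" by (simp flip: exp_add)
  have "exp (- inverse x) * inverse x ^ n \<le> fact (n + 2) * x\<^sup>2 * (exp (- inverse x) * exp (inverse x))"
    using le unfolding mult.assoc p by (simp only: mult_ac)
  then have "exp (- inverse x) * inverse x ^ n \<le> fact (n + 2) * x\<^sup>2" unfolding e by simp
  then show ?thesis using True by (simp add: flat_def norm_mult norm_power norm_inverse)
qed (simp add: flat_def)

lemma flat_derivative: "(flat n has_vector_derivative (- of_nat n * flat (n + 1) x + flat (n + 2) x)) (at x)"
proof -
  consider "x > 0" | "x < 0" | "x = 0" by linarith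
  then show ?thesis
  proof cases
    case 1
    define u where "u y = exp (- inverse y) * inverse y ^ n" for y :: real
    have "(u has_real_derivative (- real n * (exp (- inverse x) * inverse x ^ (n + 1)) + exp (- inverse x) * inverse x ^ (n + 2))) (at x)"
    proof -
      have inv: "(inverse has_real_derivative - (inverse x)\<^sup>2) (at x)"
        using DERIV_inverse[of x UNIV] 1 by (simp add: power2_eq_square)
      have "((\<lambda>y. inverse y ^ n) has_real_derivative of_nat n * (- (inverse x)\<^sup>2 * inverse x ^ (n - Suc 0))) (at x)"
        by (rule DERIV_power[OF inv])
      also have "of_nat n * (- (inverse x)\<^sup>2 * inverse x ^ (n - Suc 0)) = - real n * inverse x ^ (n + 1)"
        by (cases n) (auto simp: power2_eq_square algebra_simps)
      finally have pow: "((\<lambda>y. inverse y ^ n) has_real_derivative - real n * inverse x ^ (n + 1)) (at x)" .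
      have "((\<lambda>y. exp (- inverse y)) has_real_derivative exp (- inverse x) * (- (- (inverse x)\<^sup>2))) (at x)"
        by (intro DERIV_fun_exp DERIV_minus inv)
      from DERIV_mult[OF this pow] show ?thesis
        unfolding u_def by (simp add: power2_eq_square algebra_simps)
    qed
    from has_vector_derivative_transform_within_open[OF has_vector_derivative_of_real[OF this], of "{0<..}" "flat n"]
    show ?thesis using 1 by (simp add: flat_def u_def)
  next
    case 2
    have "((\<lambda>x. 0 :: complex) has_vector_derivative 0) (at x)" by (auto intro: derivative_eq_intros)
    then show ?thesis
      by (rule has_vector_derivative_transform_within_open[where S = "{..<0}", THEN has_vector_derivative_eq_rhs])
         (use 2 in \<open>auto simp: flat_def\<close>)
  next
    case 3
    have "(flat n has_vector_derivative 0) (at 0)"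
      unfolding has_vector_derivative_def has_derivative_at
    proof (intro conjI)
      show "(\<lambda>h. norm (flat n (0 + h) - flat n 0 - h *\<^sub>R 0) / norm h) \<midarrow>0\<rightarrow> 0"
      proof (rule Lim_null_comparison)
        show "\<forall>\<^sub>F h in at 0. norm (norm (flat n (0 + h) - flat n 0 - h *\<^sub>R 0) / norm h) \<le> fact (n + 2) * \<bar>h\<bar>"
        proof (rule always_eventually, rule allI)
          fix h :: real
          have "cmod (flat n h) / \<bar>h\<bar> \<le> fact (n + 2) * h\<^sup>2 / \<bar>h\<bar>"
            by (intro divide_right_mono flat_bound) auto
          also have "\<dots> = fact (n + 2) * \<bar>h\<bar>"
            by (cases "h = 0") (auto simp: power2_eq_square abs_if simp del: fact_Suc)
          finally show "norm (norm (flat n (0 + h) - flat n 0 - h *\<^sub>R 0) / norm h) \<le> fact (n + 2) * \<bar>h\<bar>"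
            by (cases "h = 0") (simp_all add: flat_def[of n 0] del: fact_Suc)
        qed
        have "((\<lambda>h. fact (n + 2) * \<bar>h\<bar>) \<longlongrightarrow> fact (n + 2) * \<bar>0 :: real\<bar>) (at 0)" by (intro tendsto_intros)
        then show "((\<lambda>h. fact (n + 2) * \<bar>h\<bar>) \<longlongrightarrow> (0 :: real)) (at 0)" by simp
      qed
    qed (simp add: bounded_linear_zero)
    then show ?thesis using 3 by (simp add: flat_def)
  qed
qed

lemma smooth_flat: "smooth (flat n)"
proof -
  have "differentiable_times k (flat n)" for k n
  proof (induction k arbitrary: n)
    case (Suc k)
    show ?case unfolding differentiable_times.simps
      by (rule exI[of _ "\<lambda>x. - of_nat n * flat (n + 1) x + flat (n + 2) x"])
         (intro conjI allI flat_derivative differentiable_times_add differentiable_times_mult differentiable_times_const Suc.IH)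
  qed simp
  then show ?thesis by (simp add: smooth_def)
qed

definition bump :: "real \<Rightarrow> real \<Rightarrow> real" where
  "bump d x = (if \<bar>x\<bar> < d then exp (- inverse (d - x)) * exp (- inverse (d + x)) else 0)"

lemma bump_nonneg: "bump d x \<ge> 0"
  and bump_even: "bump d (- x) = bump d x"
  and bump_eq_0: "\<bar>x\<bar> \<ge> d \<Longrightarrow> bump d x = 0"
  and bump_pos: "\<bar>x\<bar> < d \<Longrightarrow> bump d x > 0"
  by (auto simp: bump_def)

lemma test_bump: "test (\<lambda>x. complex_of_real (bump d x))"
proof -
  have "(\<lambda>x. complex_of_real (bump d x)) = (\<lambda>x. flat 0 (- 1 * x + d) * flat 0 (1 * x + d))"
    by (auto simp: fun_eq_iff bump_def flat_def add.commute abs_less_iff)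
  then have "smooth (\<lambda>x. complex_of_real (bump d x))"
    using smooth_mult[OF smooth_affine[OF smooth_flat[of 0], of "-1" d] smooth_affine[OF smooth_flat[of 0], of 1 d]]
    by simp
  then show ?thesis unfolding test_def using bump_eq_0[of d] by (auto intro!: exI[of _ d])
qed

subsection \<open>Polynomials in the operator \<open>i d/dx\<close>\<close>

definition iD :: "(real \<Rightarrow> complex) \<Rightarrow> real \<Rightarrow> complex" where
  "iD f x = \<i> * dv f x"

text \<open>
  Defined by Horner's scheme, which evaluates \<open>p\<close> at the operator \<open>iD\<close>.
\<close>

definition poly_iD :: "real poly \<Rightarrow> (real \<Rightarrow> complex) \<Rightarrow> real \<Rightarrow> complex" where
  "poly_iD p = fold_coeffs (\<lambda>a r f x. of_real a * f x + r (iD f) x) p (\<lambda>f x. 0)"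

lemma poly_iD_0 [simp]: "poly_iD 0 f = (\<lambda>x. 0)"
  by (simp add: poly_iD_def)

lemma poly_iD_pCons: "poly_iD (pCons a p) f = (\<lambda>x. of_real a * f x + poly_iD p (iD f) x)"
  by (cases "a = 0 \<and> p = 0") (auto simp: poly_iD_def)

lemma smooth_iD: "smooth f \<Longrightarrow> smooth (iD f)"
  unfolding iD_def[abs_def] by (intro smooth_mult smooth_const smooth_dv)

lemma test_iD: "test f \<Longrightarrow> test (iD f)"
  unfolding iD_def[abs_def] by (intro test_cmult test_dv)

lemma test_poly_iD: "test f \<Longrightarrow> test (poly_iD p f)"
proof (induction p arbitrary: f rule: pCons_induct)
  case (pCons a p)
  show ?case unfolding poly_iD_pCons
    by (intro test_add test_cmult pCons.prems pCons.IH test_iD)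
qed (simp add: test_zero)

lemma test_iD_funpow: "test f \<Longrightarrow> test ((iD ^^ n) f)"
  by (induction n) (auto intro: test_iD)

lemma iD_add: "smooth f \<Longrightarrow> smooth g \<Longrightarrow> iD (\<lambda>x. f x + g x) = (\<lambda>x. iD f x + iD g x)"
  by (simp add: iD_def[abs_def] dv_add distrib_left)

lemma iD_cmult: "smooth f \<Longrightarrow> iD (\<lambda>x. c * f x) = (\<lambda>x. c * iD f x)"
  by (simp add: iD_def[abs_def] dv_cmult mult.left_commute)

lemma iD_translate: "smooth f \<Longrightarrow> iD (\<lambda>x. f (x + b)) = (\<lambda>x. iD f (x + b))"
  using dv_affine[of f 1 b] by (simp add: iD_def[abs_def])

lemma iD_modulate:
  assumes "smooth f"
  shows "iD (\<lambda>x. cis (- R * x) * f x) = (\<lambda>x. cis (- R * x) * (of_real R * f x + iD f x))"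
  unfolding iD_def[abs_def] dv_mult[OF smooth_cis assms] dv_cis
  by (auto simp: algebra_simps)

lemma poly_iD_add_fun:
  "smooth f \<Longrightarrow> smooth g \<Longrightarrow> poly_iD p (\<lambda>x. f x + g x) = (\<lambda>x. poly_iD p f x + poly_iD p g x)"
  by (induction p arbitrary: f g rule: pCons_induct)
     (simp_all add: poly_iD_pCons iD_add smooth_iD algebra_simps)

lemma poly_iD_cmult_fun: "smooth f \<Longrightarrow> poly_iD p (\<lambda>x. c * f x) = (\<lambda>x. c * poly_iD p f x)"
  by (induction p arbitrary: f rule: pCons_induct)
     (simp_all add: poly_iD_pCons iD_cmult smooth_iD algebra_simps)

lemma poly_iD_translate: "smooth f \<Longrightarrow> poly_iD p (\<lambda>x. f (x + b)) = (\<lambda>x. poly_iD p f (x + b))"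
  by (induction p arbitrary: f rule: pCons_induct)
     (simp_all add: poly_iD_pCons iD_translate smooth_iD)

lemma poly_iD_add: "poly_iD (p + q) f = (\<lambda>x. poly_iD p f x + poly_iD q f x)"
  by (induction p q arbitrary: f rule: poly_induct2) (simp_all add: poly_iD_pCons algebra_simps)

lemma poly_iD_smult: "poly_iD (smult c p) f = (\<lambda>x. of_real c * poly_iD p f x)"
  by (induction p arbitrary: f rule: pCons_induct) (simp_all add: poly_iD_pCons algebra_simps)

text \<open>
  Conjugation by a plane wave shifts \<open>i d/dx\<close> by the frequency of the wave.
\<close>

lemma poly_iD_modulate:
  assumes "smooth f"
  shows "poly_iD p (\<lambda>x. cis (- R * x) * f x) = (\<lambda>x. cis (- R * x) * poly_iD (pcompose p [:R, 1:]) f x)"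
  using assms
proof (induction p arbitrary: f rule: pCons_induct)
  case (pCons a p)
  let ?q = "pcompose p [:R, 1:]"
  have "poly_iD (pcompose (pCons a p) [:R, 1:]) f =
      (\<lambda>x. of_real a * f x + (of_real R * poly_iD ?q f x + poly_iD ?q (iD f) x))"
    by (simp add: pcompose_pCons poly_iD_add poly_iD_smult poly_iD_pCons)
  moreover have "poly_iD ?q (\<lambda>x. of_real R * f x + iD f x) =
      (\<lambda>x. of_real R * poly_iD ?q f x + poly_iD ?q (iD f) x)"
    using pCons.prems by (simp add: poly_iD_add_fun poly_iD_cmult_fun smooth_mult smooth_const smooth_iD)
  ultimately show ?case
    unfolding poly_iD_pCons[of a p] iD_modulate[OF pCons.prems]
      pCons.IH[OF smooth_add[OF smooth_mult[OF smooth_const pCons.prems] smooth_iD[OF pCons.prems]]]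
    by (simp add: algebra_simps)
qed simp

lemma poly_iD_sum:
  assumes "degree p \<le> n"
  shows "poly_iD p f x = (\<Sum>j\<le>n. of_real (coeff p j) * (iD ^^ j) f x)"
  using assms
proof (induction p arbitrary: f n rule: pCons_induct)
  case (pCons a p)
  show ?case
  proof (cases n)
    case 0
    then have "p = 0" using pCons.prems by (auto split: if_splits)
    then show ?thesis using 0 by (simp add: poly_iD_pCons)
  next
    case (Suc m)
    then have "degree p \<le> m" using pCons.prems by (auto split: if_splits)
    from pCons.IH[OF this, of "iD f"] show ?thesis
      unfolding Suc sum.atMost_Suc_shift by (simp add: poly_iD_pCons funpow_swap1)
  qed
qed simp

text \<open>
  The symmetry \<open>cnj (f (- x)) = f x\<close> means that the Fourier transform of \<open>f\<close> is real; it is preserved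
  because the coefficients of \<open>p\<close> are real.
\<close>

lemma poly_iD_hermitian:
  assumes "smooth f" "\<And>x. cnj (f (- x)) = f x"
  shows "cnj (poly_iD p f (- x)) = poly_iD p f x"
  using assms
proof (induction p arbitrary: f rule: pCons_induct)
  case (pCons a p)
  have "cnj (iD f (- x)) = iD f x" for x
  proof -
    have "((\<lambda>x. f (- x)) has_vector_derivative - dv f (- x)) (at x)" for x
      using dv_affine[of f "-1" 0] smooth_has_dv[OF smooth_affine[OF pCons.prems(1), of "-1" 0]] pCons.prems(1) by simp
    from has_vector_derivative_cnj[OF this]
    have "(f has_vector_derivative cnj (- dv f (- x))) (at x)" by (simp only: pCons.prems(2))
    then have "dv f x = cnj (- dv f (- x))" unfolding dv_def[of f x] by (rule vector_derivative_at)
    then show ?thesis by (simp add: iD_def)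
  qed
  from pCons.IH[OF smooth_iD[OF pCons.prems(1)] this] pCons.prems(2) show ?case
    by (simp add: poly_iD_pCons)
qed simp

lemma ft_iD:
  assumes "test f"
  shows "ft (iD f) x = of_real x * ft f x"
proof -
  have "(LINT s|lborel. dv f s * cis (x * s)) = - (LINT s|lborel. f s * (\<i> * of_real x * cis (x * s)))"
    using integral_by_parts_test[OF assms smooth_cis[of x]] by (simp add: dv_cis)
  also have "(LINT s|lborel. f s * (\<i> * of_real x * cis (x * s))) = \<i> * of_real x * ft f x"
    unfolding ft_def by (subst integral_mult_right_zero[symmetric]) (simp add: mult_ac)
  finally have "(LINT s|lborel. dv f s * cis (x * s)) = - (\<i> * of_real x * ft f x)" .
  moreover have "ft (iD f) x = \<i> * (LINT s|lborel. dv f s * cis (x * s))"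
    unfolding ft_def iD_def by (subst integral_mult_right_zero[symmetric]) (simp add: mult_ac)
  ultimately show ?thesis by (simp flip: mult.assoc)
qed

lemma ft_add: "integrable lborel f \<Longrightarrow> integrable lborel g \<Longrightarrow> ft (\<lambda>s. f s + g s) x = ft f x + ft g x"
  unfolding ft_def distrib_right
  by (rule Bochner_Integration.integral_add) (auto intro: integrable_mult_cis)

lemma ft_cmult: "ft (\<lambda>s. c * f s) x = c * ft f x"
  unfolding ft_def by (subst integral_mult_right_zero[symmetric]) (simp add: mult_ac)

lemma ft_poly_iD:
  assumes "test f"
  shows "ft (poly_iD p f) x = of_real (poly p x) * ft f x"
  using assms
proof (induction p arbitrary: f rule: pCons_induct)
  case 0
  then show ?case by (simp add: ft_def)
next
  case (pCons a p)
  have "ft (poly_iD (pCons a p) f) x = ft (\<lambda>x. of_real a * f x) x + ft (poly_iD p (iD f)) x"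
    unfolding poly_iD_pCons using pCons.prems
    by (intro ft_add test_integrable test_cmult test_poly_iD test_iD)
  then show ?case using pCons.IH[OF test_iD[OF pCons.prems]] pCons.prems
    by (simp add: ft_cmult ft_iD algebra_simps)
qed

text \<open>
  The product with \<open>x ^ m\<close> is again the transform of a test function, hence bounded.
\<close>

lemma ft_decay:
  assumes "test f"
  obtains C where "\<And>x. cmod (ft f x) * (1 + \<bar>x\<bar>) ^ m \<le> C" "C \<ge> 0"
proof -
  define g where "g = poly_iD (monom 1 m) f"
  have g: "test g" "ft g x = of_real (x ^ m) * ft f x" for x
    unfolding g_def using assms by (auto simp: ft_poly_iD poly_monom intro: test_poly_iD)
  define C where "C = 2 ^ m * ((LINT s|lborel. cmod (f s)) + (LINT s|lborel. cmod (g s)))"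
  have "cmod (ft f x) * (1 + \<bar>x\<bar>) ^ m \<le> C" for x
  proof -
    have "(1 + \<bar>x\<bar>) ^ m \<le> (2 * max 1 \<bar>x\<bar>) ^ m" by (intro power_mono) auto
    also have "\<dots> \<le> 2 ^ m * (1 + \<bar>x\<bar> ^ m)" by (auto simp: power_mult_distrib max_def)
    finally have "cmod (ft f x) * (1 + \<bar>x\<bar>) ^ m \<le> cmod (ft f x) * (2 ^ m * (1 + \<bar>x\<bar> ^ m))"
      by (intro mult_left_mono) auto
    also have "\<dots> = 2 ^ m * (cmod (ft f x) + cmod (ft g x))"
      by (simp add: g norm_mult norm_power algebra_simps)
    also have "\<dots> \<le> C" unfolding C_def
      by (intro mult_left_mono add_mono ft_bound test_integrable assms g) auto
    finally show ?thesis .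
  qed
  moreover have "C \<ge> 0" by (simp add: C_def)
  ultimately show ?thesis by (rule that)
qed

lemma ft_translate:
  assumes "test f"
  shows "ft (\<lambda>s. f (s - h)) x = cis (x * h) * ft f x"
proof -
  have "ft f x = (LINT s|lborel. f (- h + 1 * s) * cis (x * (- h + 1 * s)))"
    unfolding ft_def by (subst lborel_integral_real_affine[where t = "-h" and c = 1]) simp_all
  also have "\<dots> = cis (- (x * h)) * ft (\<lambda>s. f (s - h)) x"
  proof -
    have "cis (x * (- h + 1 * s)) = cis (- (x * h)) * cis (x * s)" for s
      by (simp add: cis_mult algebra_simps)
    then show ?thesis unfolding ft_def by (subst integral_mult_right_zero[symmetric]) (simp add: mult_ac)
  qed
  finally show ?thesis by (simp add: cis_mult flip: mult.assoc)
qed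

section \<open>Mellin and Laplace transforms on the half-line\<close>

lemma half_line_absolutely_integrable:
  fixes f :: "real \<Rightarrow> 'b::euclidean_space"
  assumes f: "f absolutely_integrable_on {0<..}" and [measurable]: "f \<in> borel_measurable borel"
  shows "integrable half_line f" "integral\<^sup>L half_line f = integral {0<..} f"
proof -
  have *: "integrable lebesgue (\<lambda>x. indicator {0<..} x *\<^sub>R f x)" using f by (simp add: set_integrable_def)
  show "integrable half_line f" unfolding half_line_def
    using * by (subst integrable_restrict_space) (auto simp: integrable_completion)
  have "integral\<^sup>L half_line f = (LINT x|lebesgue. indicator {0<..} x *\<^sub>R f x)"
    unfolding half_line_def by (subst integral_restrict_space) (auto simp: integral_completion)
  also have "\<dots> = integral {0<..} f"
    using set_lebesgue_integral_eq_integral(2)[OF f] by (simp add: set_lebesgue_integral_def)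
  finally show "integral\<^sup>L half_line f = integral {0<..} f" .
qed

lemma half_line_measurable_fst [measurable]: "fst \<in> borel_measurable (half_line \<Otimes>\<^sub>M N)"
  and half_line_measurable_snd [measurable]: "snd \<in> borel_measurable (N \<Otimes>\<^sub>M half_line)"
  by (rule measurable_compose[OF measurable_fst measurable_half_line[of "\<lambda>x. x"]], simp)
     (rule measurable_compose[OF measurable_snd measurable_half_line[of "\<lambda>x. x"]], simp)

lemma integral_half_line_scale:
  fixes f :: "real \<Rightarrow> complex"
  assumes f: "integrable half_line f" and c: "c > 0" and [measurable]: "f \<in> borel_measurable borel"
  shows "integrable half_line (\<lambda>t. f (c * t))"
    and "(LINT t|half_line. f (c * t)) = (LINT t|half_line. f t) / of_real c"
proof -
  have e: "exp x *\<^sub>R f (c * exp x) = (1 / of_real c) * ((\<lambda>y. exp y *\<^sub>R f (exp y)) (ln c + 1 * x))" for x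
    using c by (simp add: exp_add scaleR_conv_of_real)
  have m: "(\<lambda>t. f (c * t)) \<in> borel_measurable half_line" by measurable
  have "integrable lborel (\<lambda>y. exp y *\<^sub>R f (exp y))"
    using f by (subst (asm) integrable_half_line_iff) auto
  then have "integrable lborel (\<lambda>x. (1 / of_real c) * ((\<lambda>y. exp y *\<^sub>R f (exp y)) (ln c + 1 * x)))"
    by (intro integrable_mult_right lborel_integrable_real_affine) auto
  then show "integrable half_line (\<lambda>t. f (c * t))"
    unfolding integrable_half_line_iff[OF m] e .
  have "(LINT t|half_line. f (c * t)) = (LINT x|lborel. (1 / of_real c) * ((\<lambda>y. exp y *\<^sub>R f (exp y)) (ln c + 1 * x)))"
    unfolding e[symmetric] by (rule integral_half_line[OF m])
  also have "\<dots> = (1 / of_real c) * (LINT y|lborel. exp y *\<^sub>R f (exp y))"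
    unfolding integral_mult_right_zero using lborel_integral_real_affine[of 1 "\<lambda>y. exp y *\<^sub>R f (exp y)" "ln c"] by simp
  also have "(LINT y|lborel. exp y *\<^sub>R f (exp y)) = (LINT t|half_line. f t)"
    by (rule integral_half_line[symmetric]) measurable
  finally show "(LINT t|half_line. f (c * t)) = (LINT t|half_line. f t) / of_real c"
    by simp
qed

lemma integrable_inverse_power:
  assumes p: "p > 1"
  shows "integrable lborel (\<lambda>x :: real. (1 + \<bar>x\<bar>) powr (- p))"
proof -
  define g where "g y = indicator {1..} y * y powr (- p)" for y :: real
  have "(\<lambda>y. y powr (- p)) absolutely_integrable_on {1..}"
    using has_integral_powr_to_inf[of "- p" 1] p
    by (intro nonnegative_absolutely_integrable_1) (auto simp: integrable_on_def)
  then have "integrable lebesgue g" by (simp add: set_integrable_def g_def[abs_def])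
  then have g: "integrable lborel g" unfolding g_def[abs_def] by (subst (asm) integrable_completion) auto
  have "integrable lborel (\<lambda>x. g (1 + 1 * x))" "integrable lborel (\<lambda>x. g (1 + (-1) * x))"
    by (rule lborel_integrable_real_affine[OF g], simp)+
  from Bochner_Integration.integrable_add[OF this] show ?thesis
    by (rule Bochner_Integration.integrable_bound) (auto simp: g_def indicator_def abs_if)
qed

lemma integrable_log_weight:
  assumes p: "p > 1"
  shows "integrable half_line (\<lambda>t. (1 + \<bar>ln t\<bar>) powr (- p) / t)"
  using integrable_inverse_power[OF p] by (subst integrable_half_line_iff) auto

text \<open>
  The unitary identification of \<open>L\<^sup>2(\<real>\<^sub>+)\<close> with \<open>L\<^sup>2(\<real>)\<close> in the logarithmic coordinate; the factor is the square
  root of the Jacobian.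
\<close>

definition log_pull :: "(real \<Rightarrow> complex) \<Rightarrow> real \<Rightarrow> complex" where
  "log_pull u x = of_real (exp (x / 2)) * u (exp x)"

lemma log_pull_measurable [measurable]:
  assumes "u \<in> borel_measurable half_line"
  shows "log_pull u \<in> borel_measurable borel"
proof -
  have "(\<lambda>x. u (exp x)) \<in> borel_measurable lborel"
    by (rule measurable_compose[OF exp_measurable_half_line assms])
  then have [measurable]: "(\<lambda>x. u (exp x)) \<in> borel_measurable borel" by simp
  show ?thesis unfolding log_pull_def by measurable
qed

lemma exp_half_square: "exp (x / 2) * exp (x / 2) = exp (x :: real)"
  by (simp flip: exp_add)

lemma L2_norm_log_pull:
  assumes "u \<in> borel_measurable half_line"
  shows "L2_norm half_line u = L2_norm lborel (log_pull u)"
    and "log_pull u \<in> L2_space lborel \<longleftrightarrow> u \<in> L2_space half_line"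
proof -
  note [measurable] = assms
  have e: "exp x *\<^sub>R (cmod (u (exp x)))\<^sup>2 = (cmod (log_pull u x))\<^sup>2" for x
    by (simp add: log_pull_def norm_mult power_mult_distrib power2_eq_square exp_half_square)
  have m: "(\<lambda>t. (cmod (u t))\<^sup>2) \<in> borel_measurable half_line" by measurable
  show "L2_norm half_line u = L2_norm lborel (log_pull u)"
    unfolding L2_norm_def integral_half_line[OF m] e ..
  show "log_pull u \<in> L2_space lborel \<longleftrightarrow> u \<in> L2_space half_line"
    unfolding L2_space_def using integrable_half_line_iff[OF m, unfolded e] assms by simp
qed

lemma L2_inner_log_pull:
  assumes [measurable]: "u \<in> borel_measurable half_line" "v \<in> borel_measurable half_line"
  shows "L2_inner half_line u v = L2_inner lborel (log_pull u) (log_pull v)"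
proof -
  have "exp x *\<^sub>R (u (exp x) * cnj (v (exp x))) = log_pull u x * cnj (log_pull v x)" for x
  proof -
    have "complex_of_real (exp x) = of_real (exp (x / 2)) * of_real (exp (x / 2))"
      by (simp only: of_real_mult[symmetric] exp_half_square)
    then show ?thesis by (simp add: log_pull_def scaleR_conv_of_real)
  qed
  moreover have "(\<lambda>t. u t * cnj (v t)) \<in> borel_measurable half_line" by measurable
  ultimately show ?thesis unfolding L2_inner_def by (simp add: integral_half_line)
qed

text \<open>
  The inverse Mellin transform on the line with real part \<open>1/2\<close>, without the factor \<open>1 / (2 \<pi>)\<close>. In the
  logarithmic coordinate it is the Fourier transform (\<open>log_pull_mellin\<close>).
\<close>

definition mellin :: "(real \<Rightarrow> complex) \<Rightarrow> real \<Rightarrow> complex" where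
  "mellin \<phi> t = of_real (t powr (- 1 / 2)) * ft \<phi> (ln t)"

lemma mellin_measurable [measurable]:
  assumes [measurable]: "\<phi> \<in> borel_measurable borel"
  shows "mellin \<phi> \<in> borel_measurable borel"
proof -
  have [measurable]: "(\<lambda>t. ft \<phi> (ln t)) \<in> borel_measurable borel"
    by (rule measurable_compose[OF _ ft_measurable[OF assms]]) simp
  show ?thesis unfolding mellin_def[abs_def] by measurable
qed

lemma exp_powr_half: "exp x powr (- 1 / 2) = exp (- (x / 2) :: real)"
  by (simp add: powr_def)

lemma log_pull_mellin: "log_pull (mellin \<phi>) = ft \<phi>"
proof
  fix x
  have "exp (x / 2) * exp (- (x / 2)) = (1 :: real)" by (simp flip: exp_add)
  then have "complex_of_real (exp (x / 2)) * complex_of_real (exp (- (x / 2))) = 1"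
    by (metis of_real_1 of_real_mult)
  then show "log_pull (mellin \<phi>) x = ft \<phi> x"
    unfolding log_pull_def mellin_def exp_powr_half ln_exp mult.assoc[symmetric] by simp
qed

lemma mellin_L2:
  assumes "test \<phi>"
  shows "mellin \<phi> \<in> L2_space half_line"
    and "L2_norm half_line (mellin \<phi>) = sqrt (2 * pi) * L2_norm lborel \<phi>"
proof -
  have [measurable]: "\<phi> \<in> borel_measurable borel" by (rule test_measurable[OF assms])
  have m: "mellin \<phi> \<in> borel_measurable half_line" by measurable
  have "ft \<phi> \<in> L2_space lborel" by (rule Bessel(1)[OF test_integrable test_L2]) (rule assms)+
  then show "mellin \<phi> \<in> L2_space half_line"
    using L2_norm_log_pull(2)[OF m] by (simp add: log_pull_mellin)
  obtain r where "\<And>x. r < \<bar>x\<bar> \<Longrightarrow> \<phi> x = 0" using assms by (auto simp: test_def)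
  from Plancherel[OF smooth_continuous[OF test_smooth[OF assms]] this test_integrable[OF assms] test_L2[OF assms]]
  have "(L2_norm lborel (ft \<phi>))\<^sup>2 = (sqrt (2 * pi) * L2_norm lborel \<phi>)\<^sup>2" by (simp add: power_mult_distrib)
  then have "L2_norm lborel (ft \<phi>) = sqrt (2 * pi) * L2_norm lborel \<phi>"
    by (rule power2_eq_imp_eq) auto
  then show "L2_norm half_line (mellin \<phi>) = sqrt (2 * pi) * L2_norm lborel \<phi>"
    using L2_norm_log_pull(1)[OF m] by (simp add: log_pull_mellin)
qed

lemma mellin_decay:
  assumes "test \<phi>"
  obtains C where "\<And>t. cmod (mellin \<phi> t) \<le> C * t powr (- 1 / 2) / (1 + \<bar>ln t\<bar>) ^ m" "C \<ge> 0"
proof -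
  obtain C where C: "\<And>x. cmod (ft \<phi> x) * (1 + \<bar>x\<bar>) ^ m \<le> C" "C \<ge> 0" using ft_decay[OF assms] by metis
  have "cmod (mellin \<phi> t) \<le> C * t powr (- 1 / 2) / (1 + \<bar>ln t\<bar>) ^ m" for t
  proof -
    have "0 < (1 + \<bar>ln t\<bar>) ^ m" by (intro zero_less_power) auto
    then have "cmod (ft \<phi> (ln t)) \<le> C / (1 + \<bar>ln t\<bar>) ^ m" using C(1)[of "ln t"] by (simp add: pos_le_divide_eq)
    then have "t powr (- 1 / 2) * cmod (ft \<phi> (ln t)) \<le> t powr (- 1 / 2) * (C / (1 + \<bar>ln t\<bar>) ^ m)"
      by (intro mult_left_mono) auto
    then show ?thesis by (simp add: mellin_def norm_mult mult.commute)
  qed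
  then show ?thesis using C(2) that by blast
qed

lemma mellin_uminus: "t > 0 \<Longrightarrow> mellin (\<lambda>s. \<phi> (- s)) t = of_real (t powr (- 1 / 2)) * ft \<phi> (- ln t)"
  unfolding mellin_def ft_def
  by (subst lborel_integral_real_affine[where c = "-1" and t = 0]) simp_all

text \<open>
  Multiplication by \<open>- ln t\<close> is \<open>i d/ds\<close> in the Mellin representation, once the reflection brought in by the
  Laplace transform is taken into account.
\<close>

lemma poly_mult_mellin:
  assumes "test \<eta>" "t > 0"
  shows "of_real (poly Q (- ln t)) * mellin (\<lambda>s. \<eta> (- s)) t = mellin (\<lambda>s. poly_iD Q \<eta> (- s)) t"
  using assms by (simp add: mellin_uminus ft_poly_iD)

subsection \<open>The Laplace transform\<close>

definition laplace :: "(real \<Rightarrow> complex) \<Rightarrow> real \<Rightarrow> complex" where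
  "laplace u x = (LINT t|half_line. of_real (exp (- (x * t))) * u t)"

lemma exponential_L2:
  assumes "x > 0"
  shows "(\<lambda>t. complex_of_real (exp (- (x * t)))) \<in> L2_space half_line"
    and "L2_norm half_line (\<lambda>t. complex_of_real (exp (- (x * t)))) = 1 / sqrt (2 * x)"
proof -
  have hi: "((\<lambda>t. exp (- (2 * x) * t)) has_integral 1 / (2 * x)) {0<..}"
    using has_integral_exp_minus_to_infinity[of "2 * x" 0] assms
    by (subst has_integral_spike_set_eq[of _ "{0..}"]) (auto intro: negligible_subset[of "{0}"])
  have abs: "(\<lambda>t. exp (- (2 * x) * t)) absolutely_integrable_on {0<..}"
    using hi by (intro nonnegative_absolutely_integrable_1) (auto simp: integrable_on_def)
  have sq: "(cmod (complex_of_real (exp (- (x * t)))))\<^sup>2 = exp (- (2 * x) * t)" for t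
    by (simp flip: exp_of_nat_mult)
  note * = half_line_absolutely_integrable[OF abs]
  show "(\<lambda>t. complex_of_real (exp (- (x * t)))) \<in> L2_space half_line"
    by (rule L2_spaceI) (use *(1) in \<open>simp_all only: sq, measurable\<close>)
  show "L2_norm half_line (\<lambda>t. complex_of_real (exp (- (x * t)))) = 1 / sqrt (2 * x)"
    unfolding L2_norm_def sq using *(2) integral_unique[OF hi] by (simp add: real_sqrt_divide)
qed

lemma laplace_integrable:
  assumes u: "u \<in> L2_space half_line" and x: "x > 0"
  shows "integrable half_line (\<lambda>t. of_real (exp (- (x * t))) * u t)"
proof -
  have [measurable]: "u \<in> borel_measurable half_line" by (rule L2_measurable[OF u])
  show ?thesis
  by (rule Bochner_Integration.integrable_bound[OF L2_cmod_mult_integrable[OF exponential_L2(1)[OF x] u]])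
     (auto simp: norm_mult)
qed

lemma laplace_bound:
  assumes u: "u \<in> L2_space half_line" and x: "x > 0"
  shows "(LINT t|half_line. exp (- (x * t)) * cmod (u t)) \<le> L2_norm half_line u / sqrt (2 * x)"
    and "cmod (laplace u x) \<le> L2_norm half_line u / sqrt (2 * x)"
proof -
  show *: "(LINT t|half_line. exp (- (x * t)) * cmod (u t)) \<le> L2_norm half_line u / sqrt (2 * x)"
    using L2_Cauchy_Schwarz_real[OF exponential_L2(1)[OF x] u] exponential_L2(2)[OF x] by simp
  show "cmod (laplace u x) \<le> L2_norm half_line u / sqrt (2 * x)"
    unfolding laplace_def
    by (rule order_trans[OF integral_norm_bound order_trans[OF _ *]]) (simp add: norm_mult)
qed

lemma laplace_measurable [measurable]:
  assumes [measurable]: "u \<in> borel_measurable half_line"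
  shows "laplace u \<in> borel_measurable borel"
proof -
  have [measurable]: "(\<lambda>p. snd p) \<in> borel_measurable (borel \<Otimes>\<^sub>M half_line)"
    by (rule measurable_compose[OF measurable_snd]) measurable
  have "(\<lambda>p. complex_of_real (exp (- (fst p * snd p))) * u (snd p)) \<in> borel_measurable (borel \<Otimes>\<^sub>M half_line)"
    by measurable
  then show ?thesis unfolding laplace_def[abs_def]
    by (intro half_line.borel_measurable_lebesgue_integral) (simp add: case_prod_beta')
qed

text \<open>
  The Mellin transform of the exponential function on the critical line.
\<close>

definition gam :: "real \<Rightarrow> complex" where
  "gam s = Gamma (1 / 2 + \<i> * of_real s)"

lemma half_plus_not_nonpos: "1 / 2 + \<i> * of_real s \<notin> \<int>\<^sub>\<le>\<^sub>0"
  by (auto elim!: nonpos_Ints_cases simp: complex_eq_iff)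

lemma gam_nonzero: "gam s \<noteq> 0"
  unfolding gam_def by (rule Gamma_nonzero[OF half_plus_not_nonpos])

lemma smooth_gam: "smooth gam"
proof -
  have "smooth (\<lambda>s. Gamma (1 / 2 + \<i> * of_real s))"
  proof (rule smooth_holomorphic)
    show "Gamma holomorphic_on {z. Re z > 0}"
      by (rule holomorphic_Gamma) (auto elim!: nonpos_Ints_cases)
  qed (auto intro: open_halfspace_Re_gt)
  then show ?thesis by (simp add: gam_def[abs_def])
qed

lemma smooth_inverse_gam: "smooth (\<lambda>s. 1 / gam s)"
  using smooth_holomorphic[of rGamma UNIV "1 / 2" \<i>] holomorphic_rGamma
  by (simp add: gam_def rGamma_inverse_Gamma inverse_eq_divide)

lemma cnj_gam: "cnj (gam s) = gam (- s)"
  by (simp add: gam_def cnj_Gamma)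

text \<open>
  Euler's reflection formula at \<open>1/2 + i s\<close>.
\<close>

lemma gam_mult_uminus: "gam s * gam (- s) = of_real (pi / cosh (pi * s))"
proof -
  let ?z = "1 / 2 + \<i> * of_real s"
  have "gam s * gam (- s) = Gamma ?z * Gamma (1 - ?z)" by (simp add: gam_def)
  also have "\<dots> = of_real pi / sin (of_real pi * ?z)" by (rule Gamma_reflection_complex)
  also have "of_real pi * ?z = of_real pi / 2 + \<i> * of_real (pi * s)" by (simp add: algebra_simps)
  also have "sin (of_real pi / 2 + \<i> * of_real (pi * s)) = cos (\<i> * of_real (pi * s))"
    by (simp add: sin_add flip: of_real_divide)
  also have "\<dots> = of_real (cosh (pi * s))"
  proof -
    have "complex_of_real (cosh (pi * s)) = cosh (of_real (pi * s))"
      by (simp add: cosh_field_def flip: exp_of_real)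
    then show ?thesis by (simp only: cosh_conv_cos)
  qed
  finally show ?thesis by simp
qed

lemma cmod_gam_square: "(cmod (gam s))\<^sup>2 = pi / cosh (pi * s)"
proof -
  have "complex_of_real ((cmod (gam s))\<^sup>2) = of_real (pi / cosh (pi * s))"
    using gam_mult_uminus[of s] by (simp add: complex_norm_square cnj_gam del: of_real_power)
  then show ?thesis by (simp only: of_real_eq_iff)
qed

text \<open>
  Euler's integral, rescaled by \<open>x\<close>.
\<close>

lemma mellin_exponential:
  assumes x: "x > 0"
  shows "integrable half_line (\<lambda>t. complex_of_real (exp (- (x * t)) * t powr (- 1 / 2)) * cis (s * ln t))"
    and "(LINT t|half_line. complex_of_real (exp (- (x * t)) * t powr (- 1 / 2)) * cis (s * ln t)) =
      of_real (x powr (- 1 / 2)) * cis (- (s * ln x)) * gam s"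
proof -
  let ?z = "1 / 2 + \<i> * of_real s"
  define f where "f t = complex_of_real (exp (- t) * t powr (- 1 / 2)) * cis (s * ln t)" for t
  have [measurable]: "f \<in> borel_measurable borel" unfolding f_def by measurable
  have eq: "complex_of_real t powr (?z - 1) / of_real (exp t) = f t" if "t > 0" for t
  proof -
    have "complex_of_real t powr (?z - 1) = exp (of_real (- 1 / 2 * ln t) + \<i> * of_real (s * ln t))"
      using that by (simp add: powr_def Ln_of_real algebra_simps)
    also have "\<dots> = exp (of_real (- 1 / 2 * ln t)) * exp (\<i> * of_real (s * ln t))" by (rule exp_add)
    also have "exp (complex_of_real (- 1 / 2 * ln t)) = of_real (t powr (- 1 / 2))"
      using that by (simp only: exp_of_real powr_def) simp
    also have "exp (\<i> * of_real (s * ln t)) = cis (s * ln t)" by (simp only: cis_conv_exp)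
    finally show ?thesis by (simp add: f_def exp_minus field_simps)
  qed
  have abs: "f absolutely_integrable_on {0<..}"
  proof -
    have "(\<lambda>t. complex_of_real t powr (?z - 1) / of_real (exp (1 * t))) absolutely_integrable_on {0<..}"
      by (rule absolutely_integrable_Gamma_integral) simp_all
    moreover have "complex_of_real t powr (?z - 1) / of_real (exp (1 * t)) = f t" if "t \<in> {0<..}" for t
      using eq[of t] that by (simp only: greaterThan_iff mult_1)
    ultimately show ?thesis using set_integrable_cong[OF refl refl] by (metis (no_types, lifting))
  qed
  note int = half_line_absolutely_integrable[OF abs]
  have "((\<lambda>t. complex_of_real t powr (?z - 1) / of_real (exp t)) has_integral Gamma ?z) {0<..}"
    using Gamma_integral_complex[of ?z]
    by (subst has_integral_spike_set_eq[of _ "{0..}"]) (auto intro: negligible_subset[of "{0}"])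
  then have "(f has_integral Gamma ?z) {0<..}" 
    by (rule has_integral_eq[rotated]) (simp only: eq greaterThan_iff)
  then have f: "(LINT t|half_line. f t) = gam s" using int(2) by (simp add: integral_unique gam_def)
  have scaled: "complex_of_real (exp (- (x * t)) * t powr (- 1 / 2)) * cis (s * ln t) =
      of_real (x powr (1 / 2)) * cis (- (s * ln x)) * f (x * t)" if "t > 0" for t
  proof -
    have rearrange: "a * c * (E * (b * T) * (d * u)) = (a * b) * (c * d) * (E * T * u)" for a b c d E T u :: complex
      by (simp add: mult_ac)
    have 1: "(x * t) powr (- 1 / 2) = x powr (- 1 / 2) * t powr (- 1 / 2)" using x that by (simp add: powr_mult)
    have "x powr (1 / 2) * x powr (- 1 / 2) = 1" using x by (simp flip: powr_add)
    then have 2: "complex_of_real (x powr (1 / 2)) * of_real (x powr (- 1 / 2)) = 1" by (metis of_real_1 of_real_mult)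
    have 3: "cis (s * ln (x * t)) = cis (s * ln x) * cis (s * ln t)"
      using x that by (simp add: ln_mult cis_mult algebra_simps)
    have 4: "cis (- (s * ln x)) * cis (s * ln x) = 1" by (simp add: cis_mult)
    show ?thesis unfolding f_def 1 3 of_real_mult rearrange 2 4 by simp
  qed
  have "integrable half_line (\<lambda>t. of_real (x powr (1 / 2)) * cis (- (s * ln x)) * f (x * t))"
    by (intro integrable_mult_right integral_half_line_scale(1) int(1) x) measurable
  then show "integrable half_line (\<lambda>t. complex_of_real (exp (- (x * t)) * t powr (- 1 / 2)) * cis (s * ln t))"
    by (rule Bochner_Integration.integrable_cong[THEN iffD1, rotated 2]) (simp_all only: space_half_line greaterThan_iff scaled)
  have "(LINT t|half_line. complex_of_real (exp (- (x * t)) * t powr (- 1 / 2)) * cis (s * ln t)) =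
      (LINT t|half_line. of_real (x powr (1 / 2)) * cis (- (s * ln x)) * f (x * t))"
    by (rule Bochner_Integration.integral_cong) (simp_all only: space_half_line greaterThan_iff scaled)
  also have "\<dots> = of_real (x powr (1 / 2)) * cis (- (s * ln x)) * (gam s / of_real x)"
    using integral_half_line_scale(2)[OF int(1) x] by (simp add: f)
  also have "\<dots> = of_real (x powr (1 / 2) / x) * cis (- (s * ln x)) * gam s" by simp
  also have "x powr (1 / 2) / x = x powr (- 1 / 2)"
    using x powr_diff[of x "1 / 2" 1] by simp
  finally show "(LINT t|half_line. complex_of_real (exp (- (x * t)) * t powr (- 1 / 2)) * cis (s * ln t)) =
      of_real (x powr (- 1 / 2)) * cis (- (s * ln x)) * gam s" .
qed

text \<open>The Mellin transform turns the Laplace transform into multiplication by \<open>gam\<close> and a reflection.\<close>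

lemma laplace_mellin:
  assumes \<phi>: "test \<phi>" and x: "x > 0"
  shows "laplace (mellin \<phi>) x = mellin (\<lambda>s. gam (- s) * \<phi> (- s)) x"
proof -
  let ?f = "\<lambda>t. complex_of_real (exp (- (x * t)) * t powr (- 1 / 2))"
  have [measurable]: "\<phi> \<in> borel_measurable borel" by (rule test_measurable[OF \<phi>])
  have f: "integrable half_line ?f" using mellin_exponential(1)[OF x, of 0] by simp
  have "laplace (mellin \<phi>) x = (LINT t|half_line. ?f t * (LINT s|lborel. \<phi> s * cis (s * ln t)))"
    by (simp add: laplace_def mellin_def ft_def mult_ac)
  also have "\<dots> = (LINT s|lborel. \<phi> s * (LINT t|half_line. ?f t * cis (s * ln t)))"
    by (rule integral_swap_product(2)[OF sigma_finite_half_line sigma_finite_lborel f test_integrable[OF \<phi>], of _ 1])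
       (auto simp: case_prod_beta')
  also have "\<dots> = (LINT s|lborel. of_real (x powr (- 1 / 2)) * ((gam s * \<phi> s) * cis (- ln x * s)))"
    unfolding mellin_exponential(2)[OF x] by (simp add: mult_ac)
  also have "\<dots> = of_real (x powr (- 1 / 2)) * ft (\<lambda>s. gam s * \<phi> s) (- ln x)"
    by (simp only: ft_def integral_mult_right_zero)
  also have "\<dots> = mellin (\<lambda>s. gam (- s) * \<phi> (- s)) x"
    using mellin_uminus[OF x, of "\<lambda>s. gam s * \<phi> s"] by simp
  finally show ?thesis .
qed

text \<open>
  The Laplace transform is symmetric; absolute convergence holds as soon as one factor has
  a logarithmic decay beyond the critical power \<open>t\<^sup>-\<^sup>1\<^sup>/\<^sup>2\<close>.
\<close>

lemma laplace_symmetric: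
  assumes g[measurable]: "g \<in> borel_measurable half_line"
    and bound: "\<And>t. t > 0 \<Longrightarrow> cmod (g t) \<le> C * t powr (- 1 / 2) / (1 + \<bar>ln t\<bar>) ^ 2"
    and u: "u \<in> L2_space half_line"
  shows "(LINT t|half_line. laplace g t * u t) = (LINT x|half_line. g x * laplace u x)"
    and "integrable half_line (\<lambda>x. g x * laplace u x)"
proof -
  have [measurable]: "u \<in> borel_measurable half_line" by (rule L2_measurable[OF u])
  let ?h = "\<lambda>x t. g x * (of_real (exp (- (x * t))) * u t)"
  have b: "(LINT t|half_line. cmod (?h x t)) \<le> C * L2_norm half_line u * ((1 + \<bar>ln x\<bar>) powr (- 2) / x)"
    if x: "x > 0" for x
  proof -
    have "(LINT t|half_line. cmod (?h x t)) = cmod (g x) * (LINT t|half_line. exp (- (x * t)) * cmod (u t))"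
      by (simp add: norm_mult)
    also have "\<dots> \<le> (C * x powr (- 1 / 2) / (1 + \<bar>ln x\<bar>) ^ 2) * (L2_norm half_line u / sqrt (2 * x))"
      using bound[OF x] laplace_bound(1)[OF u x] order_trans[OF norm_ge_zero bound[OF x]]
      by (intro mult_mono) auto
    also have "\<dots> \<le> (C * x powr (- 1 / 2) / (1 + \<bar>ln x\<bar>) ^ 2) * (L2_norm half_line u / sqrt x)"
      using x order_trans[OF norm_ge_zero bound[OF x]] by (intro mult_left_mono divide_left_mono) auto
    also have "\<dots> = C * L2_norm half_line u * ((1 + \<bar>ln x\<bar>) powr (- 2) / x)"
    proof -
      have "x powr (- 1 / 2) / sqrt x = 1 / x"
        using x by (simp add: powr_minus_divide powr_half_sqrt)
      moreover have "(1 + \<bar>ln x\<bar>) powr (- 2) = 1 / (1 + \<bar>ln x\<bar>) ^ 2"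
        using powr_realpow[of "1 + \<bar>ln x\<bar>" 2] by (simp add: powr_minus_divide)
      moreover have "(C * x powr (- 1 / 2) / (1 + \<bar>ln x\<bar>) ^ 2) * (L2_norm half_line u / sqrt x) =
          C * L2_norm half_line u * ((1 / (1 + \<bar>ln x\<bar>) ^ 2) * (x powr (- 1 / 2) / sqrt x))" by simp
      ultimately show ?thesis by simp
    qed
    finally show ?thesis .
  qed
  have int: "integrable half_line (?h x)" if "x > 0" for x
    by (intro integrable_mult_right laplace_integrable u that)
  have bi: "integrable half_line (\<lambda>x. C * L2_norm half_line u * ((1 + \<bar>ln x\<bar>) powr (- 2) / x))"
    by (intro integrable_mult_right integrable_log_weight) simp
  have hm: "case_prod ?h \<in> borel_measurable (half_line \<Otimes>\<^sub>M half_line)"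
    by measurable
  note swap = integral_swap[OF sigma_finite_half_line sigma_finite_half_line hm _ bi]
  have 1: "(LINT t|half_line. ?h x t) = g x * laplace u x" for x
    by (simp add: laplace_def)
  have 2: "(LINT x|half_line. ?h x t) = laplace g t * u t" for t
    unfolding laplace_def by (subst integral_mult_left_zero[symmetric]) (simp add: mult_ac)
  show "(LINT t|half_line. laplace g t * u t) = (LINT x|half_line. g x * laplace u x)"
    using swap(2) int b unfolding 1 2 by simp
  show "integrable half_line (\<lambda>x. g x * laplace u x)"
    using swap(4) int b unfolding 1 by simp
qed

section \<open>Uniqueness and duality for the Mellin transform\<close>

lemma ft_continuous:
  assumes f: "integrable lborel f"
  shows "isCont (ft f) x"
  unfolding continuous_at_sequentially o_def
proof (intro allI impI)
  fix y :: "nat \<Rightarrow> real" assume y: "y \<longlonglongrightarrow> x"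
  have [measurable]: "f \<in> borel_measurable borel" using f by auto
  show "(\<lambda>n. ft f (y n)) \<longlonglongrightarrow> ft f x"
    unfolding ft_def
  proof (rule integral_dominated_convergence)
    show "integrable lborel (\<lambda>s. cmod (f s))" using f by simp
    have "(\<lambda>n. f s * cis (y n * s)) \<longlonglongrightarrow> f s * cis (x * s)" for s
      by (intro tendsto_intros tendsto_cis y)
    then show "AE s in lborel. (\<lambda>n. f s * cis (y n * s)) \<longlonglongrightarrow> f s * cis (x * s)" by simp
  qed (auto simp: norm_mult)
qed

lemma integral_bump_pos:
  assumes d: "d > 0"
  shows "integrable lborel (bump d)" "(LINT x|lborel. bump d x) > 0"
proof -
  show int: "integrable lborel (bump d)"
    using integrable_norm[OF test_integrable[OF test_bump[of d]]] by (simp add: bump_nonneg)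
  have "(LINT x|lborel. bump d x) \<noteq> 0"
  proof
    assume "(LINT x|lborel. bump d x) = 0"
    then have "AE x in lborel. bump d x = 0"
      using integral_nonneg_eq_0_iff_AE[OF int] by (simp add: bump_nonneg)
    then have "AE x in lborel. x \<notin> {-d<..<d}"
      by eventually_elim (use bump_pos[of _ d] in \<open>force simp: abs_less_iff\<close>)
    then have "emeasure lborel {-d<..<d} = 0"
      by (subst (asm) AE_iff_measurable[of "{-d<..<d}"]) auto
    then show False using d by simp
  qed
  moreover have "(LINT x|lborel. bump d x) \<ge> 0" by (simp add: bump_nonneg)
  ultimately show "(LINT x|lborel. bump d x) > 0" by linarith
qed

text \<open>
  Mellin transforms of test functions are total: translating \<open>\<phi>\<close> modulates \<open>mellin \<phi>\<close>, so the
  function \<open>S * mellin \<phi>\<close> has vanishing Fourier transform in logarithmic coordinates; modulating \<open>\<phi>\<close>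
  translates \<open>ft \<phi>\<close>, so every point lies where some \<open>mellin \<phi>\<close> does not vanish.
\<close>

lemma mellin_total:
  assumes [measurable]: "S \<in> borel_measurable half_line"
    and int: "\<And>\<phi>. test \<phi> \<Longrightarrow> integrable half_line (\<lambda>t. mellin \<phi> t * S t)"
    and zero: "\<And>\<phi>. test \<phi> \<Longrightarrow> (LINT t|half_line. mellin \<phi> t * S t) = 0"
  shows "AE t in half_line. S t = 0"
proof -
  let ?b = "\<lambda>s. complex_of_real (bump 1 s)"
  define \<eta> where "\<eta> a s = cis (- a * s) * ?b s" for a s
  have \<eta>: "test (\<eta> a)" for a unfolding \<eta>_def[abs_def] by (rule test_mult'[OF test_bump smooth_cis])
  have ft\<eta>: "ft (\<eta> a) x = ft ?b (x - a)" for a x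
  proof -
    have "cis (- a * s) * ?b s * cis (x * s) = ?b s * cis ((x - a) * s)" for s
    proof -
      have "cis (- a * s) * cis (x * s) = cis ((x - a) * s)" by (simp add: cis_mult algebra_simps)
      then show ?thesis by (metis mult.commute mult.left_commute)
    qed
    then show ?thesis unfolding ft_def \<eta>_def by (simp only:)
  qed
  define g where "g a x = exp x *\<^sub>R (mellin (\<eta> a) (exp x) * S (exp x))" for a x
  have meas: "(\<lambda>t. mellin \<phi> t * S t) \<in> borel_measurable half_line" if "test \<phi>" for \<phi>
    using test_measurable[OF that] by measurable
  have g: "integrable lborel (g a)" for a
    using int[OF \<eta>] unfolding integrable_half_line_iff[OF meas[OF \<eta>]] g_def[abs_def] .
  have "ft (g a) h = 0" for a h
  proof -
    let ?\<psi> = "\<lambda>s. \<eta> a (s - h)"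
    have \<psi>: "test ?\<psi>" using test_affine[OF \<eta>[of a], of 1 "- h"] by simp
    have "mellin ?\<psi> (exp x) = cis (h * x) * mellin (\<eta> a) (exp x)" for x
      by (simp add: mellin_def ft_translate[OF \<eta>] mult_ac)
    then have "ft (g a) h = (LINT x|lborel. exp x *\<^sub>R (mellin ?\<psi> (exp x) * S (exp x)))"
      unfolding ft_def g_def by (simp add: scaleR_conv_of_real mult_ac)
    also have "\<dots> = 0" using zero[OF \<psi>] unfolding integral_half_line[OF meas[OF \<psi>]] .
    finally show ?thesis .
  qed
  then have g0: "AE x in lborel. g a x = 0" for a by (rule ft_injective[OF g])
  have b0: "ft ?b 0 \<noteq> 0"
  proof -
    have "ft ?b 0 = complex_of_real (LINT s|lborel. bump 1 s)" by (simp add: ft_def)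
    then show ?thesis using integral_bump_pos(2)[of 1] by simp
  qed
  have "isCont (ft ?b) 0" by (rule ft_continuous[OF test_integrable[OF test_bump]])
  from continuous_at_avoid[OF this b0] obtain r where r: "r > 0" "\<And>y. dist 0 y < r \<Longrightarrow> ft ?b y \<noteq> 0" by blast
  have "AE x in lborel. \<forall>a\<in>\<rat>. g a x = 0"
    using g0 by (subst AE_ball_countable[OF countable_rat]) simp
  then have "AE x in lborel. S (exp x) = 0"
  proof eventually_elim
    case (elim x)
    obtain a where a: "a \<in> \<rat>" "x - r < a" "a < x" using Rats_dense_in_real[of "x - r" x] r by auto
    then have "ft (\<eta> a) x \<noteq> 0" unfolding ft\<eta> using r(2)[of "x - a"] by (simp add: dist_norm)
    then have "mellin (\<eta> a) (exp x) \<noteq> 0" by (simp add: mellin_def)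
    moreover have "g a x = 0" using elim a by blast
    ultimately show ?case by (simp add: g_def)
  qed
  then show ?thesis by (rule AE_half_lineI) measurable
qed

lemma ft_diff: "integrable lborel f \<Longrightarrow> integrable lborel g \<Longrightarrow> ft (\<lambda>s. f s - g s) x = ft f x - ft g x"
  unfolding ft_def left_diff_distrib
  by (rule Bochner_Integration.integral_diff) (auto intro: integrable_mult_cis)

lemma Bessel_norm:
  assumes "integrable lborel f" "f \<in> L2_space lborel"
  shows "L2_norm lborel (ft f) \<le> sqrt (2 * pi) * L2_norm lborel f"
  by (rule power2_le_imp_le) (use Bessel(2)[OF assms] in \<open>auto simp: power_mult_distrib\<close>)

text \<open>
  The Fourier transform of an \<open>L\<^sup>2\<close> function, as a limit of Fourier transforms of truncations.
  Its translations are continuous in norm because they correspond to modulations of \<open>g\<close>.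
\<close>

lemma L2_fourier_transform:
  assumes g: "g \<in> L2_space lborel"
  obtains \<tau> where "\<tau> \<in> L2_space lborel"
    "\<And>\<phi>. test \<phi> \<Longrightarrow> (LINT x|lborel. ft \<phi> x * g x) = (LINT s|lborel. \<phi> s * \<tau> s)"
    "\<And>h. h \<longlonglongrightarrow> 0 \<Longrightarrow> (\<lambda>n. L2_norm lborel (\<lambda>s. \<tau> (s + h n) - \<tau> s)) \<longlonglongrightarrow> 0"
proof -
  have [measurable]: "g \<in> borel_measurable borel" using L2_measurable[OF g] by simp
  define G where "G n x = indicator {- real n..real n} x * g x" for n x
  have GL: "G n \<in> L2_space lborel" for n
    unfolding G_def by (rule L2_space_bound[OF g, of _ 1]) (auto simp: norm_mult indicator_def)
  have Gint: "integrable lborel (G n)" for n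
  proof -
    have "(\<lambda>x. indicator {- real n..real n} x :: complex) \<in> L2_space lborel"
    proof (rule L2_spaceI)
      have "(\<lambda>x. (cmod (indicator {- real n..real n} x))\<^sup>2) = indicator {- real n..real n}"
        by (auto simp: indicator_def fun_eq_iff)
      then show "integrable lborel (\<lambda>x. (cmod (indicator {- real n..real n} x))\<^sup>2)" by simp
    qed simp
    from L2_inner_integrable[OF GL this] show ?thesis
      by (rule Bochner_Integration.integrable_cong[THEN iffD1, rotated 2]) (auto simp: G_def indicator_def)
  qed
  have Gconv: "L2_converges lborel G g"
    unfolding L2_converges_def
  proof (intro conjI allI GL g)
    have "(\<lambda>n. LINT x|lborel. (cmod (G n x - g x))\<^sup>2) \<longlonglongrightarrow> (LINT x|(lborel :: real measure). 0)"
    proof (rule integral_dominated_convergence)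
      show "integrable lborel (\<lambda>x. (cmod (g x))\<^sup>2)" by (rule L2_square_integrable[OF g])
      show "AE x in lborel. norm ((cmod (G n x - g x))\<^sup>2) \<le> (cmod (g x))\<^sup>2" for n
        by (intro AE_I2) (auto simp: G_def indicator_def)
      have "(\<lambda>n. (cmod (G n x - g x))\<^sup>2) \<longlonglongrightarrow> 0" for x
      proof (rule tendsto_eventually)
        obtain N :: nat where "\<bar>x\<bar> \<le> N" using real_arch_simple by blast
        then show "\<forall>\<^sub>F n in sequentially. (cmod (G n x - g x))\<^sup>2 = 0"
          by (intro eventually_sequentiallyI[of N]) (auto simp: G_def indicator_def abs_le_iff)
      qed
      then show "AE x in lborel. (\<lambda>n. (cmod (G n x - g x))\<^sup>2) \<longlonglongrightarrow> 0" by simp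
    qed (unfold G_def, measurable)
    then have "(\<lambda>n. sqrt (LINT x|lborel. (cmod (G n x - g x))\<^sup>2)) \<longlonglongrightarrow> sqrt 0"
      by (intro tendsto_real_sqrt) simp
    then show "(\<lambda>n. L2_norm lborel (\<lambda>x. G n x - g x)) \<longlonglongrightarrow> 0" by (simp add: L2_norm_def)
  qed
  have TL: "ft (G n) \<in> L2_space lborel" for n by (rule Bessel(1)[OF Gint GL])
  have "\<exists>\<tau>. L2_converges lborel (\<lambda>n. ft (G n)) \<tau>"
  proof (rule L2_complete[OF TL])
    fix e :: real assume e: "e > 0"
    then have "e / (2 * sqrt (2 * pi)) > 0" by simp
    with L2_convergesD(3)[OF Gconv] obtain N
      where N: "\<And>n. n \<ge> N \<Longrightarrow> L2_norm lborel (\<lambda>x. G n x - g x) < e / (2 * sqrt (2 * pi))"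
      unfolding LIMSEQ_iff by fastforce
    have "L2_norm lborel (\<lambda>x. ft (G m) x - ft (G n) x) < e" if "m \<ge> N" "n \<ge> N" for m n
    proof -
      have "L2_norm lborel (\<lambda>x. ft (G m) x - ft (G n) x) = L2_norm lborel (ft (\<lambda>x. G m x - G n x))"
      proof -
        have "(\<lambda>x. ft (G m) x - ft (G n) x) = ft (\<lambda>x. G m x - G n x)"
          by (rule ext) (rule ft_diff[OF Gint Gint, symmetric])
        then show ?thesis by simp
      qed
      also have "\<dots> \<le> sqrt (2 * pi) * L2_norm lborel (\<lambda>x. G m x - G n x)"
        by (rule Bessel_norm[OF Bochner_Integration.integrable_diff[OF Gint Gint] L2_diff[OF GL GL]])
      also have "\<dots> \<le> sqrt (2 * pi) * (L2_norm lborel (\<lambda>x. G m x - g x) + L2_norm lborel (\<lambda>x. g x - G n x))"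
        by (intro mult_left_mono L2_triangle_diff GL g) simp
      also have "L2_norm lborel (\<lambda>x. g x - G n x) = L2_norm lborel (\<lambda>x. G n x - g x)"
        by (rule L2_norm_minus_commute)
      also have "sqrt (2 * pi) * (L2_norm lborel (\<lambda>x. G m x - g x) + L2_norm lborel (\<lambda>x. G n x - g x)) <
          sqrt (2 * pi) * (e / (2 * sqrt (2 * pi)) + e / (2 * sqrt (2 * pi)))"
        using N[OF that(1)] N[OF that(2)] by (intro mult_strict_left_mono add_strict_mono) auto
      also have "\<dots> = e" by (simp add: field_simps)
      finally show ?thesis .
    qed
    then show "\<exists>N. \<forall>m\<ge>N. \<forall>n\<ge>N. L2_norm lborel (\<lambda>x. ft (G m) x - ft (G n) x) < e" by blast
  qed
  then obtain \<tau> where \<tau>: "L2_converges lborel (\<lambda>n. ft (G n)) \<tau>" ..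
  note \<tau>L = L2_convergesD(2)[OF \<tau>]
  have dual: "(LINT x|lborel. ft \<phi> x * g x) = (LINT s|lborel. \<phi> s * \<tau> s)" if \<phi>: "test \<phi>" for \<phi>
  proof -
    have [measurable]: "\<phi> \<in> borel_measurable borel" by (rule test_measurable[OF \<phi>])
    have ftL: "ft \<phi> \<in> L2_space lborel" by (rule Bessel(1)[OF test_integrable[OF \<phi>] test_L2[OF \<phi>]])
    have cL: "(\<lambda>x. cnj (f x)) \<in> L2_space lborel" if f: "f \<in> L2_space lborel" for f :: "real \<Rightarrow> complex"
      by (rule L2_space_bound[OF f, of _ 1]) (use L2_measurable[OF f] in auto)
    have eq: "L2_inner lborel (G n) (\<lambda>x. cnj (ft \<phi> x)) = L2_inner lborel (ft (G n)) (\<lambda>s. cnj (\<phi> s))" for n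
    proof -
      have "(LINT x|lborel. G n x * (LINT s|lborel. \<phi> s * cis (x * s))) =
          (LINT s|lborel. \<phi> s * (LINT x|lborel. G n x * cis (x * s)))"
        by (rule integral_swap_product(2)[OF sigma_finite_lborel sigma_finite_lborel Gint test_integrable[OF \<phi>], of _ 1])
           (auto simp: case_prod_beta')
      then show ?thesis by (simp add: L2_inner_def ft_def mult.commute)
    qed
    have "(\<lambda>n. L2_inner lborel (G n) (\<lambda>x. cnj (ft \<phi> x))) \<longlonglongrightarrow> L2_inner lborel g (\<lambda>x. cnj (ft \<phi> x))"
      by (rule L2_converges_inner_left[OF Gconv cL[OF ftL]])
    moreover have "(\<lambda>n. L2_inner lborel (G n) (\<lambda>x. cnj (ft \<phi> x))) \<longlonglongrightarrow> L2_inner lborel \<tau> (\<lambda>s. cnj (\<phi> s))"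
      unfolding eq by (rule L2_converges_inner_left[OF \<tau> cL[OF test_L2[OF \<phi>]]])
    ultimately have "L2_inner lborel g (\<lambda>x. cnj (ft \<phi> x)) = L2_inner lborel \<tau> (\<lambda>s. cnj (\<phi> s))"
      by (rule LIMSEQ_unique)
    then show ?thesis by (simp add: L2_inner_def mult.commute)
  qed
  have trans: "(\<lambda>n. L2_norm lborel (\<lambda>s. \<tau> (s + h n) - \<tau> s)) \<longlonglongrightarrow> 0" if h: "h \<longlonglongrightarrow> 0" for h :: "nat \<Rightarrow> real"
  proof -
    let ?D = "\<lambda>k x. g x * (cis (k * x) - 1)"
    have D_le: "cmod (?D k x) \<le> 2 * cmod (g x)" for k x
    proof -
      have "cmod (cis (k * x) - 1) \<le> 2" using norm_triangle_ineq4[of "cis (k * x)" 1] by simp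
      from mult_left_mono[OF this, of "cmod (g x)"] show ?thesis by (simp add: norm_mult mult.commute)
    qed
    have DL: "?D k \<in> L2_space lborel" for k
      by (rule L2_space_bound[OF g, of _ 2]) (use D_le in auto)
    have le: "L2_norm lborel (\<lambda>s. \<tau> (s + k) - \<tau> s) \<le> sqrt (2 * pi) * L2_norm lborel (?D k)" for k
    proof (rule LIMSEQ_le_const2)
      have *: "ft (G n) (s + k) - ft (G n) s = ft (\<lambda>x. G n x * cis (k * x) - G n x) s" for n s
        using ft_diff[OF integrable_mult_cis[OF Gint[of n], of "\<lambda>x. k * x"] Gint[of n], of s]
        by (simp add: ft_def cis_mult distrib_right mult.assoc add.commute)
      have "L2_converges lborel (\<lambda>n s. ft (G n) (s + k)) (\<lambda>s. \<tau> (s + k))"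
        unfolding L2_converges_def
        using translation_L2(1)[OF TL] translation_L2(1)[OF \<tau>L]
          translation_L2(2)[OF L2_diff[OF TL \<tau>L], of _ k] L2_convergesD(3)[OF \<tau>] by simp
      from L2_converges_norm[OF L2_converges_combination[OF this \<tau>, of 1 "-1"]]
      show "(\<lambda>n. L2_norm lborel (\<lambda>s. ft (G n) (s + k) - ft (G n) s)) \<longlonglongrightarrow> L2_norm lborel (\<lambda>s. \<tau> (s + k) - \<tau> s)" by simp
      have "L2_norm lborel (\<lambda>s. ft (G n) (s + k) - ft (G n) s) \<le> sqrt (2 * pi) * L2_norm lborel (?D k)" for n
      proof -
        have int: "integrable lborel (\<lambda>x. G n x * cis (k * x) - G n x)"
          by (intro Bochner_Integration.integrable_diff integrable_mult_cis Gint) measurable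
        have le: "cmod (G n x * cis (k * x) - G n x) \<le> cmod (?D k x)" for x
          by (auto simp: G_def indicator_def right_diff_distrib)
        have L: "(\<lambda>x. G n x * cis (k * x) - G n x) \<in> L2_space lborel"
          by (rule L2_space_bound[OF DL, of _ 1 k]) (use le int in auto)
        have "L2_norm lborel (ft (\<lambda>x. G n x * cis (k * x) - G n x)) \<le> sqrt (2 * pi) * L2_norm lborel (\<lambda>x. G n x * cis (k * x) - G n x)"
          by (rule Bessel_norm[OF int L])
        also have "\<dots> \<le> sqrt (2 * pi) * L2_norm lborel (?D k)"
          using le L2_measurable[OF L] by (intro mult_left_mono L2_norm_mono DL) auto
        finally show ?thesis unfolding *[abs_def] .
      qed
      then show "\<exists>N. \<forall>n\<ge>N. L2_norm lborel (\<lambda>s. ft (G n) (s + k) - ft (G n) s) \<le> sqrt (2 * pi) * L2_norm lborel (?D k)" by blast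
    qed
    have "(\<lambda>n. LINT x|lborel. (cmod (?D (h n) x))\<^sup>2) \<longlonglongrightarrow> (LINT x|(lborel :: real measure). 0)"
    proof (rule integral_dominated_convergence)
      show "integrable lborel (\<lambda>x. 4 * (cmod (g x))\<^sup>2)" using L2_square_integrable[OF g] by simp
      have "(cmod (?D (h n) x))\<^sup>2 \<le> 4 * (cmod (g x))\<^sup>2" for n x
      proof -
        have "(cmod (?D (h n) x))\<^sup>2 \<le> (2 * cmod (g x))\<^sup>2"
          by (intro power_mono D_le) simp
        then show ?thesis by (simp add: power_mult_distrib)
      qed
      then show "AE x in lborel. norm ((cmod (?D (h n) x))\<^sup>2) \<le> 4 * (cmod (g x))\<^sup>2" for n by (intro AE_I2) simp
      have "(\<lambda>n. (cmod (?D (h n) x))\<^sup>2) \<longlonglongrightarrow> (cmod (g x * (cis (0 * x) - 1)))\<^sup>2" for x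
        by (intro tendsto_intros tendsto_cis h)
      then show "AE x in lborel. (\<lambda>n. (cmod (?D (h n) x))\<^sup>2) \<longlonglongrightarrow> 0" by simp
    qed measurable
    then have "(\<lambda>n. sqrt (LINT x|lborel. (cmod (?D (h n) x))\<^sup>2)) \<longlonglongrightarrow> sqrt 0"
      by (intro tendsto_real_sqrt) simp
    then have "(\<lambda>n. sqrt (2 * pi) * L2_norm lborel (?D (h n))) \<longlonglongrightarrow> 0"
      unfolding L2_norm_def by (intro tendsto_mult_right_zero) simp
    then show ?thesis
      by (rule Lim_null_comparison[rotated]) (use le in \<open>auto intro: always_eventually\<close>)
  qed
  show ?thesis by (rule that[OF \<tau>L dual trans])
qed

section \<open>Weak solutions are trivial for nonreal spectral parameter\<close>

lemma cosh_add_le: "cosh (a + b) \<le> cosh a * exp \<bar>b\<bar>" for a b :: real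
proof -
  have "exp (a + b) + exp (- (a + b)) \<le> (exp a + exp (- a)) * exp \<bar>b\<bar>"
    unfolding distrib_right exp_add[symmetric] by (intro add_mono) auto
  then show ?thesis by (simp add: cosh_field_def)
qed

text \<open>
  The weight \<open>\<bar>gam\<bar>\<^sup>2 = \<pi> / cosh (\<pi> s)\<close> changes by at most an exponential factor under translation. This
  uniform bound makes mollification possible although \<open>1 / gam\<close> is unbounded.
\<close>

lemma gam_ratio_bound: "cmod (gam w / gam (w + h)) \<le> exp (pi * \<bar>h\<bar>)"
proof (rule power2_le_imp_le)
  have "(cmod (gam w / gam (w + h)))\<^sup>2 = cosh (pi * w + pi * h) / cosh (pi * w)"
    by (simp add: norm_divide power_divide cmod_gam_square distrib_left)
  also have "\<dots> \<le> exp (pi * \<bar>h\<bar>)"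
    using cosh_add_le[of "pi * w" "pi * h"] by (simp add: divide_le_eq mult.commute abs_mult)
  also have "\<dots> \<le> (exp (pi * \<bar>h\<bar>))\<^sup>2"
    using self_le_power[of "exp (pi * \<bar>h\<bar>)" 2] by simp
  finally show "(cmod (gam w / gam (w + h)))\<^sup>2 \<le> (exp (pi * \<bar>h\<bar>))\<^sup>2" .
qed simp

lemma gam_measurable [measurable]: "gam \<in> borel_measurable borel"
  by (intro borel_measurable_continuous_onI smooth_continuous smooth_gam)

lemma gam_L2: "gam \<in> L2_space lborel"
proof (rule L2_spaceI)
  show "integrable lborel (\<lambda>s. (cmod (gam s))\<^sup>2)"
  proof (rule Bochner_Integration.integrable_bound)
    show "integrable lborel (\<lambda>s :: real. 4 * pi * (1 + \<bar>s\<bar>) powr (- 2))"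
      by (intro integrable_mult_right integrable_inverse_power) simp
    have "(cmod (gam s))\<^sup>2 \<le> 4 * pi * (1 + \<bar>s\<bar>) powr (- 2)" for s
    proof -
      let ?y = "pi * \<bar>s\<bar>"
      have y: "\<bar>s\<bar> \<le> ?y" using pi_gt3 mult_right_mono[of 1 pi "\<bar>s\<bar>"] by simp
      have "(1 + \<bar>s\<bar>)\<^sup>2 \<le> 2 * (1 + ?y + ?y\<^sup>2 / 2)"
        using y power_mono[OF y, of 2] by (simp add: power2_sum)
      also have "\<dots> \<le> 2 * exp ?y" by (intro mult_left_mono exp_lower_Taylor_quadratic) auto
      also have "exp ?y \<le> 2 * cosh (pi * s)"
        by (cases "s \<ge> 0") (simp_all add: cosh_field_def)
      finally have le: "(1 + \<bar>s\<bar>)\<^sup>2 \<le> 4 * cosh (pi * s)" by simp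
      have pos: "(1 + \<bar>s\<bar>)\<^sup>2 > 0" by (intro zero_less_power) auto
      have "pi / cosh (pi * s) \<le> pi / ((1 + \<bar>s\<bar>)\<^sup>2 / 4)"
        using le pos by (intro divide_left_mono mult_pos_pos) auto
      also have "\<dots> = 4 * pi * (1 + \<bar>s\<bar>) powr (- 2)"
        using powr_realpow[of "1 + \<bar>s\<bar>" 2] by (simp add: powr_minus_divide)
      finally show ?thesis by (simp add: cmod_gam_square)
    qed
    then show "AE s in lborel. norm ((cmod (gam s))\<^sup>2) \<le> norm (4 * pi * (1 + \<bar>s\<bar>) powr (- 2))"
      by (intro AE_I2) simp
  qed measurable
qed measurable

text \<open>
  With \<open>\<beta> w = gam (- w) * \<tau> w\<close> the integrand is \<open>cnj (\<beta> w)\<close> times the value of \<open>(cosh (\<pi> s) / \<pi>) \<beta> s\<close> at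
  \<open>s = w + h\<close>. So this is a correlation whose value at \<open>0\<close> is the weighted energy
  of \<open>\<beta>\<close>.
\<close>

definition gam_corr :: "(real \<Rightarrow> complex) \<Rightarrow> real \<Rightarrow> complex" where
  "gam_corr \<tau> h = (LINT w|lborel. cnj (\<tau> w) * (gam w / gam (w + h)) * \<tau> (w + h))"

lemma gam_corr_integrand:
  assumes \<tau>: "\<tau> \<in> L2_space lborel" and \<sigma>: "\<sigma> \<in> L2_space lborel"
  shows "integrable lborel (\<lambda>w. cnj (\<tau> w) * (gam w / gam (w + h)) * \<sigma> w)"
    and "(LINT w|lborel. cmod (cnj (\<tau> w) * (gam w / gam (w + h)) * \<sigma> w)) \<le>
      exp (pi * \<bar>h\<bar>) * (L2_norm lborel \<tau> * L2_norm lborel \<sigma>)"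
proof -
  have [measurable]: "\<tau> \<in> borel_measurable borel" "\<sigma> \<in> borel_measurable borel"
    using L2_measurable[OF \<tau>] L2_measurable[OF \<sigma>] by auto
  have le: "cmod (cnj (\<tau> w) * (gam w / gam (w + h)) * \<sigma> w) \<le> exp (pi * \<bar>h\<bar>) * (cmod (\<tau> w) * cmod (\<sigma> w))" for w
  proof -
    have "cmod (cnj (\<tau> w) * (gam w / gam (w + h)) * \<sigma> w) = cmod (gam w / gam (w + h)) * (cmod (\<tau> w) * cmod (\<sigma> w))"
      by (simp add: norm_mult norm_divide)
    also have "\<dots> \<le> exp (pi * \<bar>h\<bar>) * (cmod (\<tau> w) * cmod (\<sigma> w))"
      by (intro mult_right_mono gam_ratio_bound) auto
    finally show ?thesis .
  qed
  have int: "integrable lborel (\<lambda>w. exp (pi * \<bar>h\<bar>) * (cmod (\<tau> w) * cmod (\<sigma> w)))"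
    by (intro integrable_mult_right L2_cmod_mult_integrable \<tau> \<sigma>)
  show "integrable lborel (\<lambda>w. cnj (\<tau> w) * (gam w / gam (w + h)) * \<sigma> w)"
    by (rule Bochner_Integration.integrable_bound[OF int]) (use le in auto)
  have "(LINT w|lborel. cmod (cnj (\<tau> w) * (gam w / gam (w + h)) * \<sigma> w)) \<le>
      (LINT w|lborel. exp (pi * \<bar>h\<bar>) * (cmod (\<tau> w) * cmod (\<sigma> w)))"
    by (rule integral_mono'[OF int]) (use le in auto)
  also have "\<dots> \<le> exp (pi * \<bar>h\<bar>) * (L2_norm lborel \<tau> * L2_norm lborel \<sigma>)"
    using L2_Cauchy_Schwarz_real[OF \<tau> \<sigma>] by simp
  finally show "(LINT w|lborel. cmod (cnj (\<tau> w) * (gam w / gam (w + h)) * \<sigma> w)) \<le>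
      exp (pi * \<bar>h\<bar>) * (L2_norm lborel \<tau> * L2_norm lborel \<sigma>)" .
qed

lemma gam_corr_zero: "gam_corr \<tau> 0 = of_real ((L2_norm lborel \<tau>)\<^sup>2)"
  using L2_inner_self[of lborel \<tau>] by (simp add: gam_corr_def gam_nonzero L2_inner_def mult.commute)

text \<open>
  The translate of \<open>\<tau>\<close> is replaced by \<open>\<tau>\<close> with an error controlled by continuity of translations in norm;
  then the ratio of the weights converges boundedly to \<open>1\<close>.
\<close>

lemma gam_corr_continuous:
  assumes \<tau>: "\<tau> \<in> L2_space lborel"
    and trans: "\<And>h. h \<longlonglongrightarrow> 0 \<Longrightarrow> (\<lambda>n. L2_norm lborel (\<lambda>s. \<tau> (s + h n) - \<tau> s)) \<longlonglongrightarrow> 0"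
  shows "isCont (gam_corr \<tau>) 0"
  unfolding continuous_at_sequentially o_def
proof (intro allI impI)
  fix y :: "nat \<Rightarrow> real" assume y: "y \<longlonglongrightarrow> 0"
  have [measurable]: "\<tau> \<in> borel_measurable borel" using L2_measurable[OF \<tau>] by auto
  have dL: "(\<lambda>w. \<tau> (w + y n) - \<tau> w) \<in> L2_space lborel" for n by (intro L2_diff translation_L2 \<tau>)
  obtain B where B: "\<And>n. \<bar>y n\<bar> \<le> B" 
    using Bseq_def convergent_imp_Bseq[OF convergentI[OF y]] by (metis real_norm_def)
  let ?r = "\<lambda>n w. gam w / gam (w + y n)"
  have split: "gam_corr \<tau> (y n) = (LINT w|lborel. cnj (\<tau> w) * ?r n w * \<tau> w) +
      (LINT w|lborel. cnj (\<tau> w) * ?r n w * (\<tau> (w + y n) - \<tau> w))" for n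
  proof -
    have "cnj (\<tau> w) * ?r n w * \<tau> (w + y n) = cnj (\<tau> w) * ?r n w * \<tau> w + cnj (\<tau> w) * ?r n w * (\<tau> (w + y n) - \<tau> w)" for w
      by (simp only: right_diff_distrib) simp
    then show ?thesis unfolding gam_corr_def
      by (simp only: Bochner_Integration.integral_add[OF gam_corr_integrand(1)[OF \<tau> \<tau>] gam_corr_integrand(1)[OF \<tau> dL]])
  qed
  have "(\<lambda>n. LINT w|lborel. cnj (\<tau> w) * ?r n w * (\<tau> (w + y n) - \<tau> w)) \<longlonglongrightarrow> 0"
  proof (rule Lim_null_comparison)
    have "cmod (LINT w|lborel. cnj (\<tau> w) * ?r n w * (\<tau> (w + y n) - \<tau> w)) \<le>
        exp (pi * B) * (L2_norm lborel \<tau> * L2_norm lborel (\<lambda>w. \<tau> (w + y n) - \<tau> w))" for n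
    proof -
      have "cmod (LINT w|lborel. cnj (\<tau> w) * ?r n w * (\<tau> (w + y n) - \<tau> w)) \<le>
        exp (pi * \<bar>y n\<bar>) * (L2_norm lborel \<tau> * L2_norm lborel (\<lambda>w. \<tau> (w + y n) - \<tau> w))"
        by (rule order_trans[OF integral_norm_bound gam_corr_integrand(2)[OF \<tau> dL]])
      also have "\<dots> \<le> exp (pi * B) * (L2_norm lborel \<tau> * L2_norm lborel (\<lambda>w. \<tau> (w + y n) - \<tau> w))"
        using B[of n] by (intro mult_right_mono) auto
      finally show ?thesis .
    qed
    then show "\<forall>\<^sub>F n in sequentially. norm (LINT w|lborel. cnj (\<tau> w) * ?r n w * (\<tau> (w + y n) - \<tau> w)) \<le>
        exp (pi * B) * (L2_norm lborel \<tau> * L2_norm lborel (\<lambda>w. \<tau> (w + y n) - \<tau> w))"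
      by (intro always_eventually) auto
    show "(\<lambda>n. exp (pi * B) * (L2_norm lborel \<tau> * L2_norm lborel (\<lambda>w. \<tau> (w + y n) - \<tau> w))) \<longlonglongrightarrow> 0"
      by (intro tendsto_mult_right_zero trans y)
  qed
  moreover have "(\<lambda>n. LINT w|lborel. cnj (\<tau> w) * ?r n w * \<tau> w) \<longlonglongrightarrow> (LINT w|lborel. cnj (\<tau> w) * 1 * \<tau> w)"
  proof (rule integral_dominated_convergence)
    show "integrable lborel (\<lambda>w. exp (pi * B) * (cmod (\<tau> w) * cmod (\<tau> w)))"
      by (intro integrable_mult_right L2_cmod_mult_integrable \<tau>)
    have "cmod (cnj (\<tau> w) * ?r n w * \<tau> w) \<le> exp (pi * B) * (cmod (\<tau> w) * cmod (\<tau> w))" for n w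
    proof -
      have "cmod (?r n w) \<le> exp (pi * B)"
        by (rule order_trans[OF gam_ratio_bound]) (use B[of n] in simp)
      then have "cmod (?r n w) * (cmod (\<tau> w) * cmod (\<tau> w)) \<le> exp (pi * B) * (cmod (\<tau> w) * cmod (\<tau> w))"
        by (intro mult_right_mono) auto
      then show ?thesis by (simp only: norm_mult complex_mod_cnj mult_ac)
    qed
    then show "AE w in lborel. cmod (cnj (\<tau> w) * ?r n w * \<tau> w) \<le> exp (pi * B) * (cmod (\<tau> w) * cmod (\<tau> w))" for n
      by (intro AE_I2)
    have "(\<lambda>n. ?r n w) \<longlonglongrightarrow> gam w / gam (w + 0)" for w
      by (intro tendsto_intros gam_nonzero continuous_on_tendsto_compose[OF smooth_continuous[OF smooth_gam]] y) auto
    then have "(\<lambda>n. ?r n w) \<longlonglongrightarrow> 1" for w by (simp add: gam_nonzero)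
    then show "AE w in lborel. (\<lambda>n. cnj (\<tau> w) * ?r n w * \<tau> w) \<longlonglongrightarrow> cnj (\<tau> w) * 1 * \<tau> w"
      by (intro AE_I2 tendsto_intros)
  qed measurable
  ultimately have "(\<lambda>n. gam_corr \<tau> (y n)) \<longlonglongrightarrow> (LINT w|lborel. cnj (\<tau> w) * 1 * \<tau> w) + 0"
    unfolding split by (intro tendsto_add)
  moreover have "(LINT w|lborel. cnj (\<tau> w) * 1 * \<tau> w) + 0 = gam_corr \<tau> 0"
    by (simp add: gam_corr_def gam_nonzero)
  ultimately show "(\<lambda>n. gam_corr \<tau> (y n)) \<longlonglongrightarrow> gam_corr \<tau> 0" by simp
qed

text \<open>
  The energy identity. With \<open>\<beta> = gam (- s) \<tau> s\<close> the hypothesis says that \<open>Q(-i d/ds) \<beta> = z (cosh (\<pi> s) / \<pi>) \<beta>\<close>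
  weakly. Test it with translates of an even real bump, multiply by \<open>cnj \<beta>\<close> and integrate: the left-hand side is a
  hermitian form and hence real, while the right-hand side is \<open>z\<close> times an average of \<open>gam_corr \<tau>\<close> near \<open>0\<close>, whose value
  at \<open>0\<close> is the square of the norm of \<open>\<tau>\<close>.
\<close>

lemma weak_solution_trivial:
  assumes \<tau>: "\<tau> \<in> L2_space lborel"
    and trans: "\<And>h. h \<longlonglongrightarrow> 0 \<Longrightarrow> (\<lambda>n. L2_norm lborel (\<lambda>s. \<tau> (s + h n) - \<tau> s)) \<longlonglongrightarrow> 0"
    and z: "Im z \<noteq> 0"
    and weak: "\<And>\<eta>. test \<eta> \<Longrightarrow>
      (LINT s|lborel. gam (- s) * poly_iD Q \<eta> s * \<tau> s) = z * (LINT s|lborel. \<eta> s / gam s * \<tau> s)"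
  shows "AE s in lborel. \<tau> s = 0"
proof -
  have [measurable]: "\<tau> \<in> borel_measurable borel" using L2_measurable[OF \<tau>] by auto
  define \<beta> where "\<beta> s = gam (- s) * \<tau> s" for s
  have \<beta>_meas: "\<beta> \<in> borel_measurable borel" unfolding \<beta>_def[abs_def] by measurable
  have \<beta>: "integrable lborel \<beta>"
  proof -
    have *: "integrable lborel (\<lambda>s. cmod (gam s) * cmod (\<tau> s))" by (rule L2_cmod_mult_integrable[OF gam_L2 \<tau>])
    have "cmod (gam (- s)) = cmod (gam s)" for s using cnj_gam[of s] by (metis complex_mod_cnj)
    then show ?thesis
      by (intro Bochner_Integration.integrable_bound[OF *]) (use \<beta>_meas in \<open>auto simp: \<beta>_def norm_mult\<close>)
  qed
  have c\<beta>: "integrable lborel (\<lambda>s. cnj (\<beta> s))" using \<beta> by simp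
  let ?k = "gam_corr \<tau>"
  have main: "Im (z * (LINT h|lborel. of_real (bump d h) * ?k h)) = 0"
    and int_k: "integrable lborel (\<lambda>h. of_real (bump d h) * ?k h)" if d: "0 < d" "d \<le> 1" for d
  proof -
    define A where "A x = complex_of_real (bump d x)" for x
    define B where "B = poly_iD Q A"
    have A: "test A" unfolding A_def by (rule test_bump)
    have B: "test B" unfolding B_def by (rule test_poly_iD[OF A])
    have [measurable]: "A \<in> borel_measurable borel" "B \<in> borel_measurable borel"
      using A B by (auto intro: test_measurable)
    have herm: "cnj (B (- x)) = B x" for x
      unfolding B_def by (rule poly_iD_hermitian[OF test_smooth[OF A]]) (simp add: A_def bump_even)
    obtain b where b: "\<And>x. cmod (B x) \<le> b" using test_bounded[OF B] by metis
    let ?I = "LINT w|lborel. cnj (\<beta> w) * (LINT s|lborel. \<beta> s * B (s - w))"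
    have swap: "?I = (LINT s|lborel. \<beta> s * (LINT w|lborel. cnj (\<beta> w) * B (s - w)))"
      by (rule integral_swap_product(2)[OF sigma_finite_lborel sigma_finite_lborel c\<beta> \<beta>, of _ b])
         (use b in \<open>auto simp: case_prod_beta'\<close>)
    \<comment> \<open>conjugation exchanges the two variables of the double integral, since \<open>B\<close> is hermitian\<close>
    have conj: "cnj ?I = (LINT w|lborel. \<beta> w * (LINT s|lborel. cnj (\<beta> s) * B (w - s)))"
    proof -
      have "cnj ?I = (LINT w|lborel. cnj (cnj (\<beta> w) * (LINT s|lborel. \<beta> s * B (s - w))))"
        by (simp del: complex_cnj_mult)
      also have "\<dots> = (LINT w|lborel. \<beta> w * (LINT s|lborel. cnj (\<beta> s * B (s - w))))"
        by (simp del: complex_cnj_mult add: complex_cnj_mult[of "cnj _"])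
      also have "\<dots> = (LINT w|lborel. \<beta> w * (LINT s|lborel. cnj (\<beta> s) * B (w - s)))"
      proof -
        have "cnj (B (s - w)) = B (w - s)" for s w using herm[of "w - s"] by simp
        then show ?thesis by simp
      qed
      finally show ?thesis .
    qed
    have fixed: "Im X = 0" if "cnj X = X" for X using that by (simp add: complex_eq_iff)
    have real: "Im ?I = 0" by (rule fixed[OF HOL.trans[OF conj swap[symmetric]]])
    define H where "H h w = A h * (cnj (\<tau> w) * (gam w / gam (w + h)) * \<tau> (w + h))" for h w
    \<comment> \<open>the hypothesis for the translate of \<open>A\<close> by \<open>w\<close>\<close>
    have inner: "cnj (\<beta> w) * (LINT s|lborel. \<beta> s * B (s - w)) = z * (LINT h|lborel. H h w)" for w
    proof -
      let ?\<eta> = "\<lambda>s. A (s + (- w))"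
      have \<eta>: "test ?\<eta>" using test_affine[OF A, of 1 "- w"] by simp
      have "(LINT s|lborel. \<beta> s * B (s - w)) = (LINT s|lborel. gam (- s) * poly_iD Q ?\<eta> s * \<tau> s)"
        unfolding poly_iD_translate[OF test_smooth[OF A]] B_def \<beta>_def by (simp add: mult_ac)
      also have "\<dots> = z * (LINT s|lborel. A (s - w) / gam s * \<tau> s)" using weak[OF \<eta>] by simp
      also have "(LINT s|lborel. A (s - w) / gam s * \<tau> s) = (LINT h|lborel. A h / gam (w + h) * \<tau> (w + h))"
        by (subst lborel_integral_real_affine[where c = 1 and t = w]) simp_all
      also have "cnj (\<beta> w) * (z * \<dots>) = z * (LINT h|lborel. cnj (\<beta> w) * (A h / gam (w + h) * \<tau> (w + h)))"
        by (subst integral_mult_right_zero) (rule mult.left_commute)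
      also have "(\<lambda>h. cnj (\<beta> w) * (A h / gam (w + h) * \<tau> (w + h))) = (\<lambda>h. H h w)"
        by (simp add: fun_eq_iff \<beta>_def H_def cnj_gam)
      finally show ?thesis .
    qed
    have tr: "(\<lambda>w. \<tau> (w + h)) \<in> L2_space lborel" "L2_norm lborel (\<lambda>w. \<tau> (w + h)) = L2_norm lborel \<tau>" for h
      by (rule translation_L2[OF \<tau>])+
    have Hm: "case_prod H \<in> borel_measurable (lborel \<Otimes>\<^sub>M lborel)" unfolding H_def by measurable
    have Hint: "integrable lborel (H h)" for h
      unfolding H_def by (intro integrable_mult_right gam_corr_integrand(1) \<tau> tr)
    have Hb: "(LINT w|lborel. cmod (H h w)) \<le> bump d h * (exp pi * (L2_norm lborel \<tau> * L2_norm lborel \<tau>))" for h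
    proof (cases "\<bar>h\<bar> \<ge> d")
      case True
      then show ?thesis by (simp add: H_def A_def bump_eq_0)
    next
      case False
      have "(LINT w|lborel. cmod (H h w)) = bump d h * (LINT w|lborel. cmod (cnj (\<tau> w) * (gam w / gam (w + h)) * \<tau> (w + h)))"
        unfolding H_def A_def norm_mult[of "complex_of_real _"] by (simp add: bump_nonneg)
      also have "\<dots> \<le> bump d h * (exp (pi * \<bar>h\<bar>) * (L2_norm lborel \<tau> * L2_norm lborel \<tau>))"
        using gam_corr_integrand(2)[OF \<tau> tr(1), of h h] by (intro mult_left_mono) (simp_all add: tr bump_nonneg)
      also have "\<dots> \<le> bump d h * (exp pi * (L2_norm lborel \<tau> * L2_norm lborel \<tau>))"
        using False d by (intro mult_left_mono mult_right_mono) (auto simp: bump_nonneg)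
      finally show ?thesis .
    qed
    have Hbi: "integrable lborel (\<lambda>h. bump d h * (exp pi * (L2_norm lborel \<tau> * L2_norm lborel \<tau>)))"
      by (intro integrable_mult_left integral_bump_pos d)
    note Hswap = integral_swap[OF sigma_finite_lborel sigma_finite_lborel Hm Hint Hbi Hb]
    have Hk: "(LINT w|lborel. H h w) = of_real (bump d h) * ?k h" for h
      unfolding H_def gam_corr_def A_def by (rule integral_mult_right_zero)
    have "?I = z * (LINT w|lborel. LINT h|lborel. H h w)"
      unfolding inner by (rule integral_mult_right_zero)
    also have "(LINT w|lborel. LINT h|lborel. H h w) = (LINT h|lborel. of_real (bump d h) * ?k h)"
      using Hswap(2) unfolding Hk by simp
    finally show "Im (z * (LINT h|lborel. of_real (bump d h) * ?k h)) = 0" using real by simp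
    show "integrable lborel (\<lambda>h. of_real (bump d h) * ?k h)" using Hswap(4) unfolding Hk .
  qed
  have "L2_norm lborel \<tau> = 0"
  proof (rule ccontr)
    assume "L2_norm lborel \<tau> \<noteq> 0"
    define c where "c = Im z * (L2_norm lborel \<tau>)\<^sup>2"
    have c: "c \<noteq> 0" using z \<open>L2_norm lborel \<tau> \<noteq> 0\<close> by (simp add: c_def)
    \<comment> \<open>near \<open>0\<close> the imaginary part of \<open>z * gam_corr \<tau> h\<close> keeps the sign of its value \<open>c\<close> at \<open>0\<close>\<close>
    let ?F = "\<lambda>h. sgn c * Im (z * ?k h)"
    have F0: "?F 0 = \<bar>c\<bar>" by (simp add: gam_corr_zero c_def abs_sgn mult.commute del: of_real_power)
    have "isCont (gam_corr \<tau>) 0" by (rule gam_corr_continuous[OF \<tau>]) (rule trans)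
    then have "isCont ?F 0" by (intro continuous_mult continuous_Im continuous_const)
    then have "(?F \<longlongrightarrow> \<bar>c\<bar>) (at 0)" unfolding isCont_def F0 .
    from order_tendstoD(1)[OF this, of "\<bar>c\<bar> / 2"] c
    obtain d0 where d0: "d0 > 0" "\<And>h. h \<noteq> 0 \<Longrightarrow> \<bar>h\<bar> < d0 \<Longrightarrow> \<bar>c\<bar> / 2 < ?F h"
      by (auto simp: eventually_at dist_norm)
    define d where "d = min 1 d0"
    have d: "0 < d" "d \<le> 1" using d0 by (auto simp: d_def)
    have F: "\<bar>c\<bar> / 2 \<le> ?F h" if "\<bar>h\<bar> < d" for h
      using d0(2)[of h] that F0 by (cases "h = 0") (auto simp: d_def)
    have int: "integrable lborel (\<lambda>h. bump d h * ?F h)"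
    proof -
      have "integrable lborel (\<lambda>h. sgn c * Im (z * (of_real (bump d h) * ?k h)))"
        by (intro integrable_mult_right integrable_Im int_k[OF d])
      then show ?thesis by (simp add: mult_ac distrib_left)
    qed
    have "0 < \<bar>c\<bar> / 2 * (LINT h|lborel. bump d h)" using c integral_bump_pos(2)[OF d(1)] by simp
    also have "\<dots> = (LINT h|lborel. bump d h * (\<bar>c\<bar> / 2))" by simp
    also have "\<dots> \<le> (LINT h|lborel. bump d h * ?F h)"
    proof (rule integral_mono[OF _ int])
      show "integrable lborel (\<lambda>h. bump d h * (\<bar>c\<bar> / 2))" by (intro integrable_mult_left integral_bump_pos d)
      fix h show "bump d h * (\<bar>c\<bar> / 2) \<le> bump d h * ?F h"
      proof (cases "\<bar>h\<bar> < d")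
        case True
        show ?thesis by (rule mult_left_mono[OF F[OF True] bump_nonneg])
      qed (simp add: bump_eq_0)
    qed
    also have "(LINT h|lborel. bump d h * ?F h) = (LINT h|lborel. sgn c * Im (z * (of_real (bump d h) * ?k h)))"
      by (rule Bochner_Integration.integral_cong) (simp_all add: mult_ac distrib_left)
    also have "\<dots> = sgn c * (LINT h|lborel. Im (z * (of_real (bump d h) * ?k h)))" by (rule integral_mult_right_zero)
    also have "(LINT h|lborel. Im (z * (of_real (bump d h) * ?k h))) = Im (LINT h|lborel. z * (of_real (bump d h) * ?k h))"
      by (rule integral_Im) (intro integrable_mult_right int_k[OF d])
    also have "(LINT h|lborel. z * (of_real (bump d h) * ?k h)) = z * (LINT h|lborel. of_real (bump d h) * ?k h)"
      by (rule integral_mult_right_zero)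
    finally show False using main[OF d] by simp
  qed
  then show ?thesis by (rule L2_norm_eq_0_AE[OF \<tau>])
qed

section \<open>Hankel kernels as Laplace transforms\<close>

lemma poly_exp_bound:
  fixes p :: "real poly"
  shows "e > 0 \<Longrightarrow> \<exists>C\<ge>0. \<forall>y. \<bar>poly p y\<bar> \<le> C * exp (e * \<bar>y\<bar>)"
proof (induction p arbitrary: e rule: pCons_induct)
  case 0
  then show ?case by (intro exI[of _ 0]) simp
next
  case (pCons a p)
  from pCons.IH[of "e / 2"] pCons.prems obtain C where C: "C \<ge> 0" "\<And>y. \<bar>poly p y\<bar> \<le> C * exp (e / 2 * \<bar>y\<bar>)" by auto
  have "\<bar>poly (pCons a p) y\<bar> \<le> (\<bar>a\<bar> + 2 / e * C) * exp (e * \<bar>y\<bar>)" for y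
  proof -
    have "e / 2 * \<bar>y\<bar> \<le> exp (e / 2 * \<bar>y\<bar>)" using exp_ge_add_one_self[of "e / 2 * \<bar>y\<bar>"] by linarith
    then have y: "\<bar>y\<bar> \<le> 2 / e * exp (e / 2 * \<bar>y\<bar>)" using pCons.prems by (simp add: field_simps)
    have "\<bar>poly (pCons a p) y\<bar> \<le> \<bar>a\<bar> + \<bar>y\<bar> * \<bar>poly p y\<bar>"
      using abs_triangle_ineq[of a "y * poly p y"] by (simp add: abs_mult)
    also have "\<dots> \<le> \<bar>a\<bar> * exp (e * \<bar>y\<bar>) + (2 / e * exp (e / 2 * \<bar>y\<bar>)) * (C * exp (e / 2 * \<bar>y\<bar>))"
      using y C pCons.prems mult_left_mono[of 1 "exp (e * \<bar>y\<bar>)" "\<bar>a\<bar>"] by (intro add_mono mult_mono) auto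
    also have "(2 / e * exp (e / 2 * \<bar>y\<bar>)) * (C * exp (e / 2 * \<bar>y\<bar>)) = 2 / e * C * (exp (e / 2 * \<bar>y\<bar>) * exp (e / 2 * \<bar>y\<bar>))"
      by simp
    also have "exp (e / 2 * \<bar>y\<bar>) * exp (e / 2 * \<bar>y\<bar>) = exp (e * \<bar>y\<bar>)" by (simp flip: exp_add)
    finally show ?thesis by (simp add: algebra_simps)
  qed
  moreover have "\<bar>a\<bar> + 2 / e * C \<ge> 0" using C pCons.prems by simp
  ultimately show ?case by blast
qed

lemma poly_measurable [measurable]: "poly (p :: real poly) \<in> borel_measurable borel"
  by (rule borel_measurable_continuous_onI) (intro continuous_intros)

lemma exp_powr_integrable:
  assumes "a > - 1" "t > 0"
  shows "integrable half_line (\<lambda>x. exp (- (t * x)) * x powr a)"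
proof -
  define f where "f x = complex_of_real x powr (of_real (a + 1) - 1) / of_real (exp (t * x))" for x
  have "f absolutely_integrable_on {0<..}"
    unfolding f_def by (rule absolutely_integrable_Gamma_integral) (use assms in auto)
  then have "(\<lambda>x. norm (f x)) absolutely_integrable_on {0<..}" by (rule absolutely_integrable_norm[unfolded o_def])
  moreover have "norm (f x) = exp (- (t * x)) * x powr a" if "x \<in> {0<..}" for x
    using that by (simp add: f_def norm_divide norm_powr_real_powr exp_minus field_simps)
  ultimately have "(\<lambda>x. exp (- (t * x)) * x powr a) absolutely_integrable_on {0<..}"
    using set_integrable_cong[OF refl refl] by (metis (no_types, lifting))
  then show ?thesis by (rule half_line_absolutely_integrable) measurable
qed

text \<open>
  A polynomial in \<open>ln x\<close> costs less than any power of \<open>x\<close>, both at \<open>0\<close> and at infinity.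
\<close>

lemma poly_ln_integrable:
  fixes p :: "real poly"
  assumes t: "t > 0" and a: "a > - 1"
  shows "integrable half_line (\<lambda>x. exp (- (t * x)) * poly p (- ln x) * x powr a)"
proof -
  define e where "e = (a + 1) / 2"
  have e: "e > 0" "a - e > - 1" "a + e > - 1" using a by (auto simp: e_def field_simps)
  obtain C where C: "C \<ge> 0" "\<And>y. \<bar>poly p y\<bar> \<le> C * exp (e * \<bar>y\<bar>)" using poly_exp_bound[OF e(1), of p] by blast
  show ?thesis
  proof (rule Bochner_Integration.integrable_bound)
    show "integrable half_line (\<lambda>x. C * (exp (- (t * x)) * x powr (a + e) + exp (- (t * x)) * x powr (a - e)))"
      by (intro integrable_mult_right Bochner_Integration.integrable_add exp_powr_integrable e t)
    have "\<bar>exp (- (t * x)) * poly p (- ln x) * x powr a\<bar> \<le> C * (exp (- (t * x)) * x powr (a + e) + exp (- (t * x)) * x powr (a - e))"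
      if x: "x > 0" for x
    proof -
      have "exp (e * \<bar>- ln x\<bar>) \<le> x powr e + x powr (- e)"
        using x by (cases "ln x \<ge> 0") (auto simp: powr_def)
      then have "\<bar>poly p (- ln x)\<bar> \<le> C * (x powr e + x powr (- e))"
        using C(2)[of "- ln x"] mult_left_mono[OF _ C(1)] by (meson order_trans)
      then have "exp (- (t * x)) * x powr a * \<bar>poly p (- ln x)\<bar> \<le> exp (- (t * x)) * x powr a * (C * (x powr e + x powr (- e)))"
        by (intro mult_left_mono) auto
      then show ?thesis by (simp add: abs_mult powr_add powr_diff powr_minus_divide algebra_simps)
    qed
    then show "AE x in half_line. norm (exp (- (t * x)) * poly p (- ln x) * x powr a) \<le>
        norm (C * (exp (- (t * x)) * x powr (a + e) + exp (- (t * x)) * x powr (a - e)))"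
      by (intro AE_I2) (force intro: order_trans)
  qed measurable
qed

lemma poly_ln_integrable0:
  fixes p :: "real poly"
  assumes "t > 0"
  shows "integrable half_line (\<lambda>x. complex_of_real (exp (- (t * x)) * poly p (- ln x)))"
proof -
  have "integrable half_line (\<lambda>x. exp (- (t * x)) * poly p (- ln x) * x powr 0)"
    by (rule poly_ln_integrable) (use assms in auto)
  then have "integrable half_line (\<lambda>x. exp (- (t * x)) * poly p (- ln x))"
    by (rule Bochner_Integration.integrable_cong[THEN iffD1, rotated 2]) auto
  then show ?thesis by (rule integrable_of_real)
qed

definition log_moment :: "nat \<Rightarrow> real" where
  "log_moment k = (LINT x|half_line. exp (- x) * (- ln x) ^ k)"

lemma log_moment_integrable: "integrable half_line (\<lambda>x. exp (- x) * (- ln x) ^ k)"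
proof -
  have "integrable half_line (\<lambda>x. exp (- (1 * x)) * poly (monom 1 k) (- ln x) * x powr 0)"
    by (rule poly_ln_integrable) auto
  then show ?thesis
    by (rule Bochner_Integration.integrable_cong[THEN iffD1, rotated 2]) (auto simp: poly_monom)
qed

lemma log_moment_0: "log_moment 0 = 1"
proof -
  have "((\<lambda>x :: real. exp (- 1 * x)) has_integral exp (- 1 * 0) / 1) {0..}"
    by (rule has_integral_exp_minus_to_infinity) simp
  then have hi: "((\<lambda>x :: real. exp (- x)) has_integral 1) {0<..}"
    by (subst has_integral_spike_set_eq[of _ "{0..}"]) (auto intro: negligible_subset[of "{0}"])
  then have "(\<lambda>x :: real. exp (- x)) absolutely_integrable_on {0<..}"
    by (intro nonnegative_absolutely_integrable_1) (auto simp: integrable_on_def)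
  from half_line_absolutely_integrable(2)[OF this] show ?thesis
    using integral_unique[OF hi] by (simp add: log_moment_def)
qed

definition kernel_of :: "real poly \<Rightarrow> real \<Rightarrow> complex" where
  "kernel_of Q t = (LINT x|half_line. complex_of_real (exp (- (t * x)) * poly Q (- ln x)))"

lemma kernel_of_add:
  assumes t: "t > 0"
  shows "kernel_of (p + q) t = kernel_of p t + kernel_of q t"
proof -
  have "complex_of_real (exp (- (t * x)) * poly (p + q) (- ln x)) =
      of_real (exp (- (t * x)) * poly p (- ln x)) + of_real (exp (- (t * x)) * poly q (- ln x))" for x
    by (simp add: distrib_left)
  then show ?thesis
    by (simp only: kernel_of_def Bochner_Integration.integral_add[OF poly_ln_integrable0[OF t] poly_ln_integrable0[OF t]])
qed

text \<open>
  After the substitution of \<open>x / t\<close> for \<open>x\<close> the logarithm becomes \<open>ln t - ln x\<close>, and the binomial theorem separates the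
  powers of \<open>ln t\<close>.
\<close>

lemma kernel_of_monom:
  assumes t: "t > 0"
  shows "kernel_of (monom c n) t =
    of_real (poly (\<Sum>j\<le>n. monom (c * of_nat (n choose j) * log_moment (n - j)) j) (ln t) / t)"
proof -
  define f where "f x = complex_of_real (exp (- x) * (c * (ln t + - ln x) ^ n))" for x
  have f_sum: "f x = (\<Sum>j\<le>n. complex_of_real (c * of_nat (n choose j) * ln t ^ j) * of_real (exp (- x) * (- ln x) ^ (n - j)))" for x
    unfolding f_def binomial_ring by (simp add: sum_distrib_left mult_ac)
  have int: "integrable half_line (\<lambda>x. complex_of_real (c * of_nat (n choose j) * ln t ^ j) * of_real (exp (- x) * (- ln x) ^ (n - j)))" for j
    by (intro integrable_mult_right integrable_of_real log_moment_integrable)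
  have fint: "integrable half_line f" unfolding f_sum[abs_def] by (intro Bochner_Integration.integrable_sum int)
  have [measurable]: "f \<in> borel_measurable borel" unfolding f_def by measurable
  have "kernel_of (monom c n) t = (LINT x|half_line. f (t * x))"
    unfolding kernel_of_def
    by (rule Bochner_Integration.integral_cong) (use t in \<open>auto simp: f_def poly_monom ln_mult\<close>)
  also have "\<dots> = (LINT x|half_line. f x) / of_real t"
    by (rule integral_half_line_scale(2)[OF fint t]) measurable
  also have "(LINT x|half_line. f x) = (\<Sum>j\<le>n. complex_of_real (c * of_nat (n choose j) * ln t ^ j) * of_real (log_moment (n - j)))"
    unfolding f_sum log_moment_def using int by (subst Bochner_Integration.integral_sum) (auto simp del: of_real_mult of_real_power)
  also have "\<dots> / of_real t = of_real (poly (\<Sum>j\<le>n. monom (c * of_nat (n choose j) * log_moment (n - j)) j) (ln t) / t)"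
    by (simp add: poly_sum poly_monom mult_ac)
  finally show ?thesis .
qed

text \<open>
  The map from \<open>Q\<close> to the polynomial \<open>P\<close> of the kernel is triangular with unit diagonal, since
  \<open>P y\<close> is the mean of \<open>Q (y - ln x)\<close> with respect to the exponential distribution in \<open>x\<close>. So the
  coefficients of \<open>Q\<close> can be found one after the other, starting from the leading one.
\<close>

lemma ex_laplace_density:
  assumes "degree P \<le> n"
  shows "\<exists>Q. degree Q \<le> n \<and> coeff Q n = coeff P n \<and> (\<forall>t>0. kernel_of Q t = of_real (poly P (ln t) / t))"
  using assms
proof (induction n arbitrary: P)
  case 0
  then obtain c where c: "P = [:c:]" using degree_eq_zeroE by auto
  have "kernel_of (monom c 0) t = of_real (poly P (ln t) / t)" if "t > 0" for t
    using kernel_of_monom[OF that, of c 0] by (simp add: c log_moment_0 poly_monom)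
  then show ?case by (intro exI[of _ "monom c 0"]) (simp add: c monom_0)
next
  case (Suc n)
  define c where "c = coeff P (Suc n)"
  define R where "R = (\<Sum>j\<le>Suc n. monom (c * of_nat (Suc n choose j) * log_moment (Suc n - j)) j)"
  have "coeff R (Suc n) = c"
    by (simp add: R_def coeff_sum log_moment_0)
  moreover have "degree R \<le> Suc n"
    unfolding R_def by (intro degree_sum_le) (auto intro: order_trans[OF degree_monom_le])
  ultimately have "degree (P - R) \<le> Suc n" "coeff (P - R) (Suc n) = 0"
    using degree_diff_le[OF Suc.prems, of R] by (simp_all add: c_def)
  then have "degree (P - R) \<le> n"
    by (metis degree_0 le_SucE leading_coeff_0_iff zero_le)
  from Suc.IH[OF this] obtain Q where Q: "degree Q \<le> n" "\<And>t. t > 0 \<Longrightarrow> kernel_of Q t = of_real (poly (P - R) (ln t) / t)"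
    by blast
  have "kernel_of (monom c (Suc n) + Q) t = of_real (poly P (ln t) / t)" if t: "t > 0" for t
    unfolding kernel_of_add[OF t] kernel_of_monom[OF t] Q(2)[OF t] R_def[symmetric] of_real_add[symmetric]
    by (simp flip: add_divide_distrib)
  moreover have "degree (monom c (Suc n) + Q) \<le> Suc n"
    using Q by (intro degree_add_le degree_monom_le) auto
  moreover have "coeff (monom c (Suc n) + Q) (Suc n) = coeff P (Suc n)"
    using Q(1) by (simp add: c_def coeff_eq_0)
  ultimately show ?case by blast
qed

text \<open>
  Fubini's theorem for \<open>exp (- x (t + s)) = exp (- x t) exp (- x s)\<close>. Absolute convergence follows from the bound
  \<open>\<parallel>u\<parallel> / sqrt (2 x)\<close> for the Laplace transform.
\<close>

lemma hankel_factorization: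
  assumes Q: "\<And>t. t > 0 \<Longrightarrow> kernel_of Q t = of_real (hankel_kernel P t)"
    and u: "u \<in> L2_space half_line" and t: "t > 0"
  shows "(LINT s|half_line. of_real (hankel_kernel P (t + s)) * u s) =
    laplace (\<lambda>x. of_real (poly Q (- ln x)) * laplace u x) t"
proof -
  have [measurable]: "u \<in> borel_measurable half_line" by (rule L2_measurable[OF u])
  let ?h = "\<lambda>x s. complex_of_real (exp (- (t * x)) * poly Q (- ln x)) * (of_real (exp (- (x * s))) * u s)"
  have hm: "case_prod ?h \<in> borel_measurable (half_line \<Otimes>\<^sub>M half_line)" by measurable
  have int: "integrable half_line (?h x)" if "x \<in> space half_line" for x
    using that by (intro integrable_mult_right laplace_integrable u) auto
  have b: "(LINT s|half_line. cmod (?h x s)) \<le> \<bar>exp (- (t * x)) * poly Q (- ln x) * x powr (- 1 / 2)\<bar> * L2_norm half_line u"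
    if "x \<in> space half_line" for x
  proof -
    have x: "x > 0" using that by simp
    have "(LINT s|half_line. cmod (?h x s)) = \<bar>exp (- (t * x)) * poly Q (- ln x)\<bar> * (LINT s|half_line. exp (- (x * s)) * cmod (u s))"
      by (simp add: norm_mult abs_mult)
    also have "\<dots> \<le> \<bar>exp (- (t * x)) * poly Q (- ln x)\<bar> * (L2_norm half_line u / sqrt (2 * x))"
      by (intro mult_left_mono laplace_bound(1) u x) simp
    also have "\<dots> \<le> \<bar>exp (- (t * x)) * poly Q (- ln x)\<bar> * (L2_norm half_line u / sqrt x)"
      using x by (intro mult_left_mono divide_left_mono) auto
    also have "L2_norm half_line u / sqrt x = x powr (- 1 / 2) * L2_norm half_line u"
      using x by (simp add: powr_minus_divide powr_half_sqrt)
    finally show ?thesis by (simp add: abs_mult mult.assoc)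
  qed
  have bi: "integrable half_line (\<lambda>x. \<bar>exp (- (t * x)) * poly Q (- ln x) * x powr (- 1 / 2)\<bar> * L2_norm half_line u)"
    by (intro integrable_mult_left integrable_abs poly_ln_integrable t) simp
  note swap = integral_swap(2)[OF sigma_finite_half_line sigma_finite_half_line hm int bi b]
  have "laplace (\<lambda>x. of_real (poly Q (- ln x)) * laplace u x) t = (LINT x|half_line. LINT s|half_line. ?h x s)"
    by (simp add: laplace_def mult.assoc)
  also have "\<dots> = (LINT s|half_line. LINT x|half_line. ?h x s)" by (rule swap)
  also have "\<dots> = (LINT s|half_line. of_real (hankel_kernel P (t + s)) * u s)"
  proof (rule Bochner_Integration.integral_cong[OF refl])
    fix s assume "s \<in> space half_line"
    then have s: "t + s > 0" using t by simp
    have "(LINT x|half_line. ?h x s) = (LINT x|half_line. complex_of_real (exp (- ((t + s) * x)) * poly Q (- ln x)) * u s)"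
      by (intro Bochner_Integration.integral_cong refl)
         (simp add: distrib_right exp_add exp_diff exp_minus field_simps flip: of_real_mult)
    also have "\<dots> = kernel_of Q (t + s) * u s" unfolding kernel_of_def by (rule integral_mult_left_zero)
    finally show "(LINT x|half_line. ?h x s) = of_real (hankel_kernel P (t + s)) * u s" using Q[OF s] by simp
  qed
  finally show ?thesis by simp
qed

lemma laplace_cong: "(\<And>t. t > 0 \<Longrightarrow> u t = v t) \<Longrightarrow> laplace u x = laplace v x"
  unfolding laplace_def by (rule Bochner_Integration.integral_cong) auto

text \<open>In the Mellin representation the Hankel operator is \<open>gam (- s) Q(i d/ds) gam s\<close>.\<close>

lemma hankel_mellin:
  assumes Q: "\<And>t. t > 0 \<Longrightarrow> kernel_of Q t = of_real (hankel_kernel P t)"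
    and \<phi>: "test \<phi>" and t: "t > 0"
  shows "(LINT s|half_line. of_real (hankel_kernel P (t + s)) * mellin \<phi> s) =
    mellin (\<lambda>s. gam (- s) * poly_iD Q (\<lambda>s. gam s * \<phi> s) s) t"
proof -
  define \<eta> where "\<eta> s = gam s * \<phi> s" for s
  have \<eta>: "test \<eta>" unfolding \<eta>_def[abs_def] by (rule test_mult'[OF \<phi> smooth_gam])
  have "laplace (\<lambda>x. of_real (poly Q (- ln x)) * laplace (mellin \<phi>) x) t =
      laplace (mellin (\<lambda>s. poly_iD Q \<eta> (- s))) t"
  proof (rule laplace_cong)
    fix x :: real assume x: "x > 0"
    have "laplace (mellin \<phi>) x = mellin (\<lambda>s. \<eta> (- s)) x"
      using laplace_mellin[OF \<phi> x] by (simp add: \<eta>_def[abs_def])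
    then show "of_real (poly Q (- ln x)) * laplace (mellin \<phi>) x = mellin (\<lambda>s. poly_iD Q \<eta> (- s)) x"
      using poly_mult_mellin[OF \<eta> x] by simp
  qed
  also have "\<dots> = mellin (\<lambda>s. gam (- s) * poly_iD Q \<eta> s) t"
    using laplace_mellin[OF test_uminus[OF test_poly_iD[OF \<eta>]] t] by simp
  finally have "laplace (\<lambda>x. of_real (poly Q (- ln x)) * laplace (mellin \<phi>) x) t =
      mellin (\<lambda>s. gam (- s) * poly_iD Q \<eta> s) t" .
  moreover have "(LINT s|half_line. of_real (hankel_kernel P (t + s)) * mellin \<phi> s) =
      laplace (\<lambda>x. of_real (poly Q (- ln x)) * laplace (mellin \<phi>) x) t"
    by (rule hankel_factorization) (use Q mellin_L2(1)[OF \<phi>] t in auto)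
  ultimately show ?thesis by (simp add: \<eta>_def[abs_def])
qed

section \<open>The Hankel operator is self-adjoint\<close>

lemma closure_op_subset: "(f, g) \<in> T \<Longrightarrow> f \<in> L2_space M \<Longrightarrow> g \<in> L2_space M \<Longrightarrow> (f, g) \<in> closure_op M T"
  unfolding closure_op_def mem_Collect_eq case_prod_conv
  by (intro exI[of _ "\<lambda>_. f"] exI[of _ "\<lambda>_. g"] conjI allI L2_converges_const)

lemma closure_op_L2: "(f, g) \<in> closure_op M T \<Longrightarrow> f \<in> L2_space M \<and> g \<in> L2_space M"
  unfolding closure_op_def by (auto dest: L2_convergesD(2))

text \<open>
  A diagonal argument.
\<close>

lemma closure_op_closed:
  assumes FG: "\<And>n. (F n, G n) \<in> closure_op M T" and f: "L2_converges M F f" and g: "L2_converges M G g"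
  shows "(f, g) \<in> closure_op M T"
proof -
  define near where "near n u v \<longleftrightarrow> (u, v) \<in> T \<and> u \<in> L2_space M \<and> v \<in> L2_space M \<and>
      L2_norm M (\<lambda>x. u x - F n x) < 1 / Suc n \<and> L2_norm M (\<lambda>x. v x - G n x) < 1 / Suc n" for n u v
  have "\<exists>u v. near n u v" for n
  proof -
    obtain U V where UV: "\<And>k. (U k, V k) \<in> T" "L2_converges M U (F n)" "L2_converges M V (G n)"
      using FG[of n] unfolding closure_op_def by blast
    have "\<forall>\<^sub>F k in sequentially. L2_norm M (\<lambda>x. U k x - F n x) < 1 / Suc n"
      "\<forall>\<^sub>F k in sequentially. L2_norm M (\<lambda>x. V k x - G n x) < 1 / Suc n"
      using order_tendstoD(2)[OF L2_convergesD(3)[OF UV(2)]] order_tendstoD(2)[OF L2_convergesD(3)[OF UV(3)]] by auto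
    then have "\<forall>\<^sub>F k in sequentially. L2_norm M (\<lambda>x. U k x - F n x) < 1 / Suc n \<and> L2_norm M (\<lambda>x. V k x - G n x) < 1 / Suc n"
      by (rule eventually_conj)
    then obtain k where "L2_norm M (\<lambda>x. U k x - F n x) < 1 / Suc n" "L2_norm M (\<lambda>x. V k x - G n x) < 1 / Suc n"
      using eventually_happens'[OF sequentially_bot] by blast
    then have "near n (U k) (V k)"
      unfolding near_def by (intro conjI UV(1) L2_convergesD(1)[OF UV(2)] L2_convergesD(1)[OF UV(3)])
    then show ?thesis by (intro exI)
  qed
  then obtain U V where near: "\<And>n. near n (U n) (V n)" by metis
  have UV: "\<And>n. (U n, V n) \<in> T" "\<And>n. U n \<in> L2_space M" "\<And>n. V n \<in> L2_space M"
    "\<And>n. L2_norm M (\<lambda>x. U n x - F n x) < 1 / Suc n" "\<And>n. L2_norm M (\<lambda>x. V n x - G n x) < 1 / Suc n"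
    using near unfolding near_def by simp_all
  have conv: "L2_converges M W h"
    if W: "\<And>n. W n \<in> L2_space M" "\<And>n. L2_norm M (\<lambda>x. W n x - E n x) < 1 / Suc n" and E: "L2_converges M E h" for W E h
    unfolding L2_converges_def
  proof (intro conjI allI W L2_convergesD(2)[OF E])
    show "(\<lambda>n. L2_norm M (\<lambda>x. W n x - h x)) \<longlonglongrightarrow> 0"
    proof (rule Lim_null_comparison)
      have "L2_norm M (\<lambda>x. W n x - h x) \<le> 1 / Suc n + L2_norm M (\<lambda>x. E n x - h x)" for n
        using L2_triangle_diff[OF W(1) L2_convergesD(1,2)[OF E], of n n] W(2)[of n] by linarith
      then show "\<forall>\<^sub>F n in sequentially. norm (L2_norm M (\<lambda>x. W n x - h x)) \<le> 1 / Suc n + L2_norm M (\<lambda>x. E n x - h x)"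
        by (intro always_eventually) simp
      show "(\<lambda>n. 1 / Suc n + L2_norm M (\<lambda>x. E n x - h x)) \<longlonglongrightarrow> 0"
        using tendsto_add[OF LIMSEQ_Suc[OF lim_inverse_n'] L2_convergesD(3)[OF E]] by simp
    qed
  qed
  show ?thesis unfolding closure_op_def mem_Collect_eq case_prod_conv
    by (intro exI[of _ U] exI[of _ V] conjI allI UV(1) conv[OF UV(2,4) f] conv[OF UV(3,5) g])
qed

text \<open>
  Closures of symmetric operators are closed symmetric operators. Linearity is a condition on the points
  of the space of \<open>M\<close>, because Hankel integrals at \<open>t \<le> 0\<close> need not converge and are not linear there; and
  symmetry is a condition on pairs in \<open>L\<^sup>2\<close>.
\<close>

lemma closure_op_symmetric:
  assumes ne: "\<exists>f g. (f, g) \<in> T \<and> f \<in> L2_space M \<and> g \<in> L2_space M"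
    and lin: "\<And>f g f' g' a b. (f, g) \<in> T \<Longrightarrow> (f', g') \<in> T \<Longrightarrow> \<exists>k. (\<lambda>x. a * f x + b * f' x, k) \<in> T \<and>
      k \<in> borel_measurable M \<and> (\<forall>x\<in>space M. k x = a * g x + b * g' x)"
    and sym: "\<And>f g f' g'. (f, g) \<in> T \<Longrightarrow> (f', g') \<in> T \<Longrightarrow> f \<in> L2_space M \<Longrightarrow> g \<in> L2_space M \<Longrightarrow>
      f' \<in> L2_space M \<Longrightarrow> g' \<in> L2_space M \<Longrightarrow> L2_inner M g f' = L2_inner M f g'"
  shows "closed_symmetric_operator M (closure_op M T)"
proof
  show "f \<in> L2_space M \<and> g \<in> L2_space M" if "(f, g) \<in> closure_op M T" for f g
    by (rule closure_op_L2[OF that])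
  show "closure_op M T \<noteq> {}" using ne closure_op_subset[of _ _ T M] by blast
  show "(f, g) \<in> closure_op M T" if "\<And>n. (F n, G n) \<in> closure_op M T" "L2_converges M F f" "L2_converges M G g" for F G f g
    by (rule closure_op_closed[OF that])
next
  fix f g f' g' a b assume fg: "(f, g) \<in> closure_op M T" "(f', g') \<in> closure_op M T"
  obtain F G where F: "\<And>n. (F n, G n) \<in> T" "L2_converges M F f" "L2_converges M G g"
    using fg(1) unfolding closure_op_def by blast
  obtain F' G' where F': "\<And>n. (F' n, G' n) \<in> T" "L2_converges M F' f'" "L2_converges M G' g'"
    using fg(2) unfolding closure_op_def by blast
  define comb where "comb n h \<longleftrightarrow> (\<lambda>x. a * F n x + b * F' n x, h) \<in> T \<and> h \<in> borel_measurable M \<and>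
      (\<forall>x\<in>space M. h x = a * G n x + b * G' n x)" for n h
  have "\<exists>h. comb n h" for n
    unfolding comb_def by (rule lin[OF F(1) F'(1)])
  then obtain k where comb: "\<And>n. comb n (k n)" by metis
  have k: "\<And>n. (\<lambda>x. a * F n x + b * F' n x, k n) \<in> T" "\<And>n. k n \<in> borel_measurable M"
    "\<And>n x. x \<in> space M \<Longrightarrow> k n x = a * G n x + b * G' n x"
    using comb unfolding comb_def by simp_all
  have "L2_converges M k (\<lambda>x. a * g x + b * g' x)"
  proof (rule L2_converges_AE_cong[OF L2_converges_combination[OF F(3) F'(3), of a b]])
    show "AE x in M. a * G n x + b * G' n x = k n x" for n using k(3) by (intro AE_I2) simp
    show "(\<lambda>x. a * g x + b * g' x) \<in> borel_measurable M"
      by (rule L2_measurable[OF L2_convergesD(2)[OF L2_converges_combination[OF F(3) F'(3)]]])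
  qed (use k in auto)
  then show "(\<lambda>x. a * f x + b * f' x, \<lambda>x. a * g x + b * g' x) \<in> closure_op M T"
    unfolding closure_op_def mem_Collect_eq case_prod_conv
    by (intro exI[of _ "\<lambda>n x. a * F n x + b * F' n x"] exI[of _ k] conjI allI k(1) L2_converges_combination[OF F(2) F'(2)])
  have "L2_inner M (G n) (F' n) = L2_inner M (F n) (G' n)" for n
    by (rule sym[OF F(1) F'(1)]) (use L2_convergesD(1) F F' in blast)+
  then show "L2_inner M g f' = L2_inner M f g'"
    using L2_converges_inner[OF F(3) F'(2)] L2_converges_inner[OF F(2) F'(3)] by (simp add: LIMSEQ_unique)
qed

subsection \<open>The initial domain\<close>

definition hankel0 :: "real poly \<Rightarrow> (real \<Rightarrow> complex) \<Rightarrow> real \<Rightarrow> complex" where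
  "hankel0 P f t = (LINT s|half_line. complex_of_real (hankel_kernel P (t + s)) * f s)"

lemma hankel_op0_iff: "(f, g) \<in> hankel_op0 P \<longleftrightarrow> f \<in> hankel_initial_domain (degree P) \<and> g = hankel0 P f"
  unfolding hankel_op0_def hankel0_def[abs_def] by auto

lemma poly_power_bound:
  fixes p :: "real poly"
  obtains C where "C \<ge> 0" "\<And>y. \<bar>poly p y\<bar> \<le> C * (1 + \<bar>y\<bar>) ^ degree p"
proof
  show "(\<Sum>i\<le>degree p. \<bar>coeff p i\<bar>) \<ge> 0" by (rule sum_nonneg) simp
  fix y
  have "\<bar>poly p y\<bar> \<le> (\<Sum>i\<le>degree p. \<bar>coeff p i * y ^ i\<bar>)" unfolding poly_altdef by (rule sum_abs)
  also have "\<dots> \<le> (\<Sum>i\<le>degree p. \<bar>coeff p i\<bar> * (1 + \<bar>y\<bar>) ^ degree p)"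
  proof (rule sum_mono)
    fix i assume "i \<in> {..degree p}"
    have "\<bar>y\<bar> ^ i \<le> (1 + \<bar>y\<bar>) ^ i" by (rule power_mono) auto
    also have "\<dots> \<le> (1 + \<bar>y\<bar>) ^ degree p" using \<open>i \<in> {..degree p}\<close> by (intro power_increasing) auto
    finally show "\<bar>coeff p i * y ^ i\<bar> \<le> \<bar>coeff p i\<bar> * (1 + \<bar>y\<bar>) ^ degree p"
      by (simp add: abs_mult power_abs mult_left_mono)
  qed
  finally show "\<bar>poly p y\<bar> \<le> (\<Sum>i\<le>degree p. \<bar>coeff p i\<bar>) * (1 + \<bar>y\<bar>) ^ degree p"
    by (simp add: sum_distrib_right)
qed

text \<open>
  Since \<open>t + s\<close> lies between the maximum of \<open>t\<close> and \<open>s\<close> and twice that maximum, the logarithm of the sum is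
  controlled by a product of separate weights.
\<close>

lemma abs_ln_add_bound:
  fixes t s :: real
  assumes "t > 0" "s > 0"
  shows "1 + \<bar>ln (t + s)\<bar> \<le> 2 * ((1 + \<bar>ln t\<bar>) * (1 + \<bar>ln s\<bar>))"
proof -
  define m where "m = max t s"
  have m: "m > 0" "m \<le> t + s" "t + s \<le> 2 * m" using assms by (auto simp: m_def)
  have "ln m \<le> ln (t + s)" using m by simp
  moreover have "ln (t + s) \<le> ln 2 + ln m" using m by (subst ln_mult_pos[symmetric]) auto
  moreover have "ln (2 :: real) \<le> 1" using ln_le_minus_one[of "2 :: real"] by simp
  moreover have "\<bar>ln m\<bar> \<le> \<bar>ln t\<bar> + \<bar>ln s\<bar>" by (auto simp: m_def max_def)
  ultimately have "\<bar>ln (t + s)\<bar> \<le> 1 + (\<bar>ln t\<bar> + \<bar>ln s\<bar>)" by linarith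
  moreover have "0 \<le> \<bar>ln t\<bar> * \<bar>ln s\<bar>" by simp
  moreover have "2 * ((1 + \<bar>ln t\<bar>) * (1 + \<bar>ln s\<bar>)) = 2 + 2 * \<bar>ln t\<bar> + 2 * \<bar>ln s\<bar> + 2 * (\<bar>ln t\<bar> * \<bar>ln s\<bar>)"
    by (simp add: algebra_simps)
  ultimately show ?thesis using abs_ge_zero[of "ln t"] abs_ge_zero[of "ln s"] by linarith
qed

lemma hankel_kernel_bound:
  obtains C where "C \<ge> 0" "\<And>t s. t > 0 \<Longrightarrow> s > 0 \<Longrightarrow> \<bar>hankel_kernel P (t + s)\<bar> \<le>
    C * ((t powr (- 1 / 2) * (1 + \<bar>ln t\<bar>) ^ degree P) * (s powr (- 1 / 2) * (1 + \<bar>ln s\<bar>) ^ degree P))"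
proof -
  obtain C where C: "C \<ge> 0" "\<And>y. \<bar>poly P y\<bar> \<le> C * (1 + \<bar>y\<bar>) ^ degree P" using poly_power_bound[of P] by metis
  have "\<bar>hankel_kernel P (t + s)\<bar> \<le> C * 2 ^ degree P * ((t powr (- 1 / 2) * (1 + \<bar>ln t\<bar>) ^ degree P) * (s powr (- 1 / 2) * (1 + \<bar>ln s\<bar>) ^ degree P))"
    if ts: "t > 0" "s > 0" for t s
  proof -
    have "\<bar>poly P (ln (t + s))\<bar> \<le> C * (1 + \<bar>ln (t + s)\<bar>) ^ degree P" by (rule C(2))
    also have "\<dots> \<le> C * (2 * ((1 + \<bar>ln t\<bar>) * (1 + \<bar>ln s\<bar>))) ^ degree P"
      by (intro mult_left_mono power_mono abs_ln_add_bound ts C) auto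
    finally have p: "\<bar>poly P (ln (t + s))\<bar> \<le> C * (2 * ((1 + \<bar>ln t\<bar>) * (1 + \<bar>ln s\<bar>))) ^ degree P" .
    have "sqrt t * sqrt s \<le> t + s"
    proof -
      have "sqrt t * sqrt s \<le> (t + s) / 2" using arith_geo_mean_sqrt[of t s] ts by (simp add: real_sqrt_mult)
      then show ?thesis using ts by simp
    qed
    then have "1 / (t + s) \<le> 1 / (sqrt t * sqrt s)" using ts by (intro divide_left_mono) auto
    also have "\<dots> = t powr (- 1 / 2) * s powr (- 1 / 2)" using ts by (simp add: powr_minus_divide powr_half_sqrt)
    finally have d: "1 / (t + s) \<le> t powr (- 1 / 2) * s powr (- 1 / 2)" .
    have "\<bar>hankel_kernel P (t + s)\<bar> = \<bar>poly P (ln (t + s))\<bar> * (1 / (t + s))"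
      using ts by (simp add: hankel_kernel_def)
    also have "\<dots> \<le> (C * (2 * ((1 + \<bar>ln t\<bar>) * (1 + \<bar>ln s\<bar>))) ^ degree P) * (t powr (- 1 / 2) * s powr (- 1 / 2))"
      using p d ts by (intro mult_mono) auto
    finally show ?thesis by (simp add: power_mult_distrib mult_ac)
  qed
  then show ?thesis using C(1) by (intro that[of "C * 2 ^ degree P"]) auto
qed

lemma hankel_kernel_measurable [measurable]: "hankel_kernel P \<in> borel_measurable borel"
  unfolding hankel_kernel_def[abs_def] by measurable

text \<open>
  By \<open>hankel_kernel_bound\<close> the kernel is dominated by a product of two such weights, and by
  \<open>initial_domain_integrable\<close> functions in the initial domain are integrable against them.
\<close>

definition log_weight :: "nat \<Rightarrow> real \<Rightarrow> real" where
  "log_weight K t = t powr (- 1 / 2) * (1 + \<bar>ln t\<bar>) ^ K"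

lemma log_weight_measurable [measurable]: "log_weight K \<in> borel_measurable borel"
  unfolding log_weight_def[abs_def] by measurable

lemma initial_domain_integrable:
  assumes "f \<in> hankel_initial_domain K"
  shows "integrable half_line (\<lambda>t. log_weight K t * cmod (f t))"
proof -
  obtain C n where f[measurable]: "f \<in> borel_measurable half_line" and n: "n > real K + 1"
    and bd: "\<And>t. t > 0 \<Longrightarrow> cmod (f t) \<le> C * t powr (- 1 / 2) * (1 + \<bar>ln t\<bar>) powr (- n)"
    using assms unfolding hankel_initial_domain_def by auto
  show ?thesis
  proof (rule Bochner_Integration.integrable_bound)
    show "integrable half_line (\<lambda>t. C * ((1 + \<bar>ln t\<bar>) powr (- (n - K)) / t))"
      by (intro integrable_mult_right integrable_log_weight) (use n in simp)
    have "log_weight K t * cmod (f t) \<le> C * ((1 + \<bar>ln t\<bar>) powr (- (n - K)) / t)" if t: "t > 0" for t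
    proof -
      have "log_weight K t * cmod (f t) \<le> log_weight K t * (C * t powr (- 1 / 2) * (1 + \<bar>ln t\<bar>) powr (- n))"
        using bd[OF t] by (intro mult_left_mono) (auto simp: log_weight_def)
      also have "\<dots> = C * (((1 + \<bar>ln t\<bar>) powr K * (1 + \<bar>ln t\<bar>) powr (- n)) * (t powr (- 1 / 2) * t powr (- 1 / 2)))"
        by (simp add: log_weight_def powr_realpow add_pos_nonneg mult_ac)
      also have "(1 + \<bar>ln t\<bar>) powr K * (1 + \<bar>ln t\<bar>) powr (- n) = (1 + \<bar>ln t\<bar>) powr (- (n - K))"
        by (simp flip: powr_add)
      also have "t powr (- 1 / 2) * t powr (- 1 / 2) = 1 / t"
        using t by (simp add: powr_minus_divide flip: powr_add)
      finally show ?thesis by simp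
    qed
    note le = this
    show "AE t in half_line. norm (log_weight K t * cmod (f t)) \<le> norm (C * ((1 + \<bar>ln t\<bar>) powr (- (n - K)) / t))"
    proof (intro AE_I2)
      fix t :: real assume "t \<in> space half_line"
      then have "log_weight K t * cmod (f t) \<le> C * ((1 + \<bar>ln t\<bar>) powr (- (n - K)) / t)" by (intro le) simp
      moreover have "0 \<le> log_weight K t * cmod (f t)" by (simp add: log_weight_def)
      ultimately show "norm (log_weight K t * cmod (f t)) \<le> norm (C * ((1 + \<bar>ln t\<bar>) powr (- (n - K)) / t))"
        unfolding real_norm_def by (metis abs_of_nonneg abs_ge_self order_trans)
    qed
  qed measurable
qed

lemma hankel0_integrable:
  assumes f: "f \<in> hankel_initial_domain (degree P)"
  obtains C where "C \<ge> 0"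
    "\<And>t. t > 0 \<Longrightarrow> integrable half_line (\<lambda>s. complex_of_real (hankel_kernel P (t + s)) * f s)"
    "\<And>t. t > 0 \<Longrightarrow> (LINT s|half_line. cmod (complex_of_real (hankel_kernel P (t + s)) * f s)) \<le> C * log_weight (degree P) t"
proof -
  let ?w = "log_weight (degree P)"
  have [measurable]: "f \<in> borel_measurable half_line" using f by (simp add: hankel_initial_domain_def)
  obtain C where C: "C \<ge> 0" "\<And>t s. t > 0 \<Longrightarrow> s > 0 \<Longrightarrow> \<bar>hankel_kernel P (t + s)\<bar> \<le> C * (?w t * ?w s)"
    using hankel_kernel_bound[of P] unfolding log_weight_def by metis
  note int = initial_domain_integrable[OF f]
  have le: "cmod (complex_of_real (hankel_kernel P (t + s)) * f s) \<le> C * ?w t * (?w s * cmod (f s))" if "t > 0" "s > 0" for t s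
    using mult_right_mono[OF C(2)[OF that], of "cmod (f s)"] by (simp add: norm_mult mult_ac)
  have w: "?w t \<ge> 0" for t by (simp add: log_weight_def)
  show ?thesis
  proof (rule that)
    show "C * (LINT s|half_line. ?w s * cmod (f s)) \<ge> 0" using C w by (intro mult_nonneg_nonneg integral_nonneg_AE) auto
    fix t :: real assume t: "t > 0"
    have bi: "integrable half_line (\<lambda>s. C * ?w t * (?w s * cmod (f s)))" by (intro integrable_mult_right int)
    show "integrable half_line (\<lambda>s. complex_of_real (hankel_kernel P (t + s)) * f s)"
    proof (rule Bochner_Integration.integrable_bound[OF bi])
      show "AE s in half_line. norm (complex_of_real (hankel_kernel P (t + s)) * f s) \<le> norm (C * ?w t * (?w s * cmod (f s)))"
        unfolding real_norm_def by (intro AE_I2 order_trans[OF le[OF t] abs_ge_self]) simp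
    qed measurable
    have "(LINT s|half_line. cmod (complex_of_real (hankel_kernel P (t + s)) * f s)) \<le> (LINT s|half_line. C * ?w t * (?w s * cmod (f s)))"
      by (rule integral_mono'[OF bi]) (use le[OF t] C w in auto)
    also have "\<dots> = C * ?w t * (LINT s|half_line. ?w s * cmod (f s))" by (rule integral_mult_right_zero)
    finally show "(LINT s|half_line. cmod (complex_of_real (hankel_kernel P (t + s)) * f s)) \<le> C * (LINT s|half_line. ?w s * cmod (f s)) * ?w t"
      by (simp only: mult_ac)
  qed
qed

lemma hankel0_measurable:
  assumes "f \<in> borel_measurable half_line"
  shows "hankel0 P f \<in> borel_measurable half_line"
proof -
  note [measurable] = assms
  have "(\<lambda>p. complex_of_real (hankel_kernel P (fst p + snd p)) * f (snd p)) \<in> borel_measurable (half_line \<Otimes>\<^sub>M half_line)"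
    by measurable
  then show ?thesis unfolding hankel0_def[abs_def]
    by (intro half_line.borel_measurable_lebesgue_integral) (simp add: case_prod_beta')
qed

lemma hankel0_symmetric:
  assumes f: "f \<in> hankel_initial_domain (degree P)" and g: "g \<in> hankel_initial_domain (degree P)"
  shows "L2_inner half_line (hankel0 P f) g = L2_inner half_line f (hankel0 P g)"
proof -
  have [measurable]: "f \<in> borel_measurable half_line" "g \<in> borel_measurable half_line"
    using f g by (auto simp: hankel_initial_domain_def)
  let ?k = "\<lambda>t s. complex_of_real (hankel_kernel P (t + s))"
  let ?h = "\<lambda>t s. cnj (g t) * (?k t s * f s)"
  obtain C where C: "C \<ge> 0" "\<And>t. t > 0 \<Longrightarrow> integrable half_line (\<lambda>s. ?k t s * f s)"
    "\<And>t. t > 0 \<Longrightarrow> (LINT s|half_line. cmod (?k t s * f s)) \<le> C * log_weight (degree P) t"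
    using hankel0_integrable[OF f] by metis
  have hm: "case_prod ?h \<in> borel_measurable (half_line \<Otimes>\<^sub>M half_line)" by measurable
  have int: "integrable half_line (?h t)" if "t \<in> space half_line" for t
    using that by (intro integrable_mult_right C(2)) simp
  have bi: "integrable half_line (\<lambda>t. C * (log_weight (degree P) t * cmod (g t)))"
    by (intro integrable_mult_right initial_domain_integrable g)
  have b: "(LINT s|half_line. cmod (?h t s)) \<le> C * (log_weight (degree P) t * cmod (g t))" if "t \<in> space half_line" for t
  proof -
    have "(LINT s|half_line. cmod (?h t s)) = cmod (g t) * (LINT s|half_line. cmod (?k t s * f s))"
      by (simp only: norm_mult complex_mod_cnj integral_mult_right_zero)
    also have "\<dots> \<le> cmod (g t) * (C * log_weight (degree P) t)" using C(3) that by (intro mult_left_mono) auto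
    finally show ?thesis by (simp add: mult_ac)
  qed
  note swap = integral_swap(2)[OF sigma_finite_half_line sigma_finite_half_line hm int bi b]
  have "L2_inner half_line (hankel0 P f) g = (LINT t|half_line. LINT s|half_line. ?h t s)"
    unfolding L2_inner_def hankel0_def by (simp only: integral_mult_right_zero mult.commute)
  also have "\<dots> = (LINT s|half_line. LINT t|half_line. ?h t s)" by (rule swap)
  also have "\<dots> = (LINT s|half_line. f s * cnj (hankel0 P g s))"
  proof (rule Bochner_Integration.integral_cong[OF refl])
    fix s
    have "cnj (hankel0 P g s) = (LINT t|half_line. cnj (?k s t * g t))"
      unfolding hankel0_def by (simp del: complex_cnj_mult)
    also have "f s * \<dots> = (LINT t|half_line. f s * cnj (?k s t * g t))" by (rule integral_mult_right_zero[symmetric])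
    also have "(\<lambda>t. f s * cnj (?k s t * g t)) = (\<lambda>t. ?h t s)" by (simp add: fun_eq_iff add.commute)
    finally show "(LINT t|half_line. ?h t s) = f s * cnj (hankel0 P g s)" by simp
  qed
  finally show ?thesis by (simp add: L2_inner_def)
qed

lemma initial_domain_combination:
  assumes "f \<in> hankel_initial_domain K" "g \<in> hankel_initial_domain K"
  shows "(\<lambda>t. a * f t + b * g t) \<in> hankel_initial_domain K"
proof -
  obtain C n where f[measurable]: "f \<in> borel_measurable half_line" and n: "n > real K + 1"
    and bf: "\<And>t. t > 0 \<Longrightarrow> cmod (f t) \<le> C * t powr (- 1 / 2) * (1 + \<bar>ln t\<bar>) powr (- n)"
    using assms(1) unfolding hankel_initial_domain_def by auto
  obtain D m where g[measurable]: "g \<in> borel_measurable half_line" and m: "m > real K + 1"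
    and bg: "\<And>t. t > 0 \<Longrightarrow> cmod (g t) \<le> D * t powr (- 1 / 2) * (1 + \<bar>ln t\<bar>) powr (- m)"
    using assms(2) unfolding hankel_initial_domain_def by auto
  define l where "l = min n m"
  have up: "cmod (h t) \<le> \<bar>E\<bar> * t powr (- 1 / 2) * (1 + \<bar>ln t\<bar>) powr (- l)"
    if "cmod (h t) \<le> E * t powr (- 1 / 2) * (1 + \<bar>ln t\<bar>) powr (- k)" "l \<le> k" for h :: "real \<Rightarrow> complex" and E k t
  proof -
    have "E * t powr (- 1 / 2) * (1 + \<bar>ln t\<bar>) powr (- k) \<le> \<bar>E\<bar> * t powr (- 1 / 2) * (1 + \<bar>ln t\<bar>) powr (- l)"
    proof (rule mult_mono)
      show "(1 + \<bar>ln t\<bar>) powr (- k) \<le> (1 + \<bar>ln t\<bar>) powr (- l)" using that(2) by (intro powr_mono) auto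
    qed (auto intro!: mult_right_mono)
    then show ?thesis using that(1) by linarith
  qed
  have "cmod (a * f t + b * g t) \<le> (cmod a * \<bar>C\<bar> + cmod b * \<bar>D\<bar>) * t powr (- 1 / 2) * (1 + \<bar>ln t\<bar>) powr (- l)" if t: "t > 0" for t
  proof -
    have "cmod (a * f t + b * g t) \<le> cmod a * cmod (f t) + cmod b * cmod (g t)"
      using norm_triangle_ineq[of "a * f t" "b * g t"] by (simp add: norm_mult)
    also have "\<dots> \<le> cmod a * (\<bar>C\<bar> * t powr (- 1 / 2) * (1 + \<bar>ln t\<bar>) powr (- l)) + cmod b * (\<bar>D\<bar> * t powr (- 1 / 2) * (1 + \<bar>ln t\<bar>) powr (- l))"
      by (intro add_mono mult_left_mono up[where h = f and E = C and k = n and t = t, OF bf[OF t]] up[where h = g and E = D and k = m and t = t, OF bg[OF t]]) (auto simp: l_def)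
    finally show ?thesis by (simp add: algebra_simps)
  qed
  moreover have "l > real K + 1" using n m by (simp add: l_def)
  moreover have "(\<lambda>t. a * f t + b * g t) \<in> borel_measurable half_line" by measurable
  ultimately show ?thesis unfolding hankel_initial_domain_def by blast
qed

text \<open>
  Mellin transforms of test functions decay relative to \<open>t\<^sup>-\<^sup>1\<^sup>/\<^sup>2\<close> faster than any power of the logarithm.
\<close>

lemma mellin_initial_domain:
  assumes "test \<phi>"
  shows "mellin \<phi> \<in> hankel_initial_domain K"
proof -
  have [measurable]: "\<phi> \<in> borel_measurable borel" by (rule test_measurable[OF assms])
  obtain C where C: "\<And>t. cmod (mellin \<phi> t) \<le> C * t powr (- 1 / 2) / (1 + \<bar>ln t\<bar>) ^ (K + 2)"
    using mellin_decay[OF assms, of "K + 2"] by metis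
  have "(1 + \<bar>ln t\<bar>) powr (- real (K + 2)) = 1 / (1 + \<bar>ln t\<bar>) ^ (K + 2)" for t :: real
    by (subst powr_minus_divide, subst powr_realpow) (auto simp: add_pos_nonneg)
  then have "cmod (mellin \<phi> t) \<le> C * t powr (- 1 / 2) * (1 + \<bar>ln t\<bar>) powr (- real (K + 2))" for t
    using C[of t] by simp
  moreover have "mellin \<phi> \<in> borel_measurable half_line" by measurable
  moreover have "real (K + 2) > real K + 1" by simp
  ultimately show ?thesis unfolding hankel_initial_domain_def by blast
qed

lemma hankel_closed_symmetric: "closed_symmetric_operator half_line (hankel_op P)"
  unfolding hankel_op_def
proof (rule closure_op_symmetric)
  have "mellin (\<lambda>s. 0) = (\<lambda>t. 0)" by (simp add: fun_eq_iff mellin_def ft_def)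
  then have "(\<lambda>t. 0, hankel0 P (\<lambda>t. 0)) \<in> hankel_op0 P"
    using mellin_initial_domain[OF test_zero] by (simp add: hankel_op0_iff)
  moreover have "hankel0 P (\<lambda>t. 0) = (\<lambda>t. 0)" by (simp add: hankel0_def[abs_def])
  ultimately show "\<exists>f g. (f, g) \<in> hankel_op0 P \<and> f \<in> L2_space half_line \<and> g \<in> L2_space half_line"
    by (metis L2_zero)
next
  fix f g f' g' a b assume "(f, g) \<in> hankel_op0 P" "(f', g') \<in> hankel_op0 P"
  then have f: "f \<in> hankel_initial_domain (degree P)" "f' \<in> hankel_initial_domain (degree P)"
    and g: "g = hankel0 P f" "g' = hankel0 P f'" by (auto simp: hankel_op0_iff)
  let ?c = "\<lambda>x. a * f x + b * f' x"
  have c: "?c \<in> hankel_initial_domain (degree P)" by (rule initial_domain_combination[OF f])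
  then have "?c \<in> borel_measurable half_line" by (simp add: hankel_initial_domain_def)
  moreover have "hankel0 P ?c t = a * g t + b * g' t" if "t > 0" for t
  proof -
    let ?k = "\<lambda>s. complex_of_real (hankel_kernel P (t + s))"
    have int: "integrable half_line (\<lambda>s. a * (?k s * f s))" "integrable half_line (\<lambda>s. b * (?k s * f' s))"
      using hankel0_integrable[OF f(1)] hankel0_integrable[OF f(2)] that by (metis integrable_mult_right)+
    have "?k s * ?c s = a * (?k s * f s) + b * (?k s * f' s)" for s by (simp add: algebra_simps)
    then show ?thesis unfolding g hankel0_def
      by (simp only: Bochner_Integration.integral_add[OF int] integral_mult_right_zero)
  qed
  ultimately show "\<exists>k. (?c, k) \<in> hankel_op0 P \<and> k \<in> borel_measurable half_line \<and> (\<forall>x\<in>space half_line. k x = a * g x + b * g' x)"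
    using c hankel0_measurable by (intro exI[of _ "hankel0 P ?c"]) (simp add: hankel_op0_iff)
next
  fix f g f' g' assume "(f, g) \<in> hankel_op0 P" "(f', g') \<in> hankel_op0 P"
  then show "L2_inner half_line g f' = L2_inner half_line f g'"
    using hankel0_symmetric by (auto simp: hankel_op0_iff)
qed

lemma mellin_combination:
  assumes "test \<phi>" "test \<psi>"
  shows "mellin (\<lambda>s. a * \<phi> s + b * \<psi> s) = (\<lambda>t. a * mellin \<phi> t + b * mellin \<psi> t)"
  unfolding mellin_def ft_add[OF test_integrable[OF test_cmult[OF assms(1)]] test_integrable[OF test_cmult[OF assms(2)]]] ft_cmult
  by (simp add: fun_eq_iff algebra_simps)

lemma laplace_cnj: "laplace (\<lambda>t. cnj (u t)) x = cnj (laplace u x)"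
proof -
  have "cnj (laplace u x) = (LINT t|half_line. cnj (of_real (exp (- (x * t))) * u t))"
    unfolding laplace_def by (simp del: complex_cnj_mult)
  then show ?thesis by (simp add: laplace_def)
qed

lemma L2_cnj: "f \<in> L2_space M \<Longrightarrow> (\<lambda>x. cnj (f x)) \<in> L2_space M"
  by (rule L2_space_bound[of f M _ 1]) (auto dest: L2_measurable)

lemma laplace_mellin_symmetric:
  assumes \<psi>: "test \<psi>" and u: "u \<in> L2_space half_line"
  shows "(LINT t|half_line. laplace (mellin \<psi>) t * u t) = (LINT x|half_line. mellin \<psi> x * laplace u x)"
    and "integrable half_line (\<lambda>x. mellin \<psi> x * laplace u x)"
proof -
  obtain C where C: "\<And>t. cmod (mellin \<psi> t) \<le> C * t powr (- 1 / 2) / (1 + \<bar>ln t\<bar>) ^ 2" using mellin_decay[OF \<psi>] by metis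
  have m: "mellin \<psi> \<in> borel_measurable half_line" by (rule L2_measurable[OF mellin_L2(1)[OF \<psi>]])
  show "(LINT t|half_line. laplace (mellin \<psi>) t * u t) = (LINT x|half_line. mellin \<psi> x * laplace u x)"
    and "integrable half_line (\<lambda>x. mellin \<psi> x * laplace u x)"
    by (rule laplace_symmetric[OF m C u])+
qed

text \<open>
  Every \<open>mellin \<phi>\<close> is the Laplace transform of some \<open>mellin \<psi>\<close>, because division by \<open>gam\<close> preserves test functions;
  so \<open>u\<close> is orthogonal to a total set.
\<close>

lemma laplace_injective:
  assumes u: "u \<in> L2_space half_line" and zero: "AE x in half_line. laplace u x = 0"
  shows "AE t in half_line. u t = 0"
proof (rule mellin_total)
  show "u \<in> borel_measurable half_line" by (rule L2_measurable[OF u])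
  fix \<phi> assume \<phi>: "test \<phi>"
  show "integrable half_line (\<lambda>t. mellin \<phi> t * u t)"
    using L2_inner_integrable[OF mellin_L2(1)[OF \<phi>] L2_cnj[OF u]] by simp
  define \<psi> where "\<psi> s = \<phi> (- s) * (1 / gam s)" for s
  have \<psi>: "test \<psi>" unfolding \<psi>_def[abs_def] by (intro test_mult test_uminus \<phi> smooth_inverse_gam)
  have "(LINT t|half_line. mellin \<phi> t * u t) = (LINT t|half_line. laplace (mellin \<psi>) t * u t)"
  proof (rule Bochner_Integration.integral_cong[OF refl])
    fix t assume "t \<in> space half_line"
    then have "laplace (mellin \<psi>) t = mellin (\<lambda>s. gam (- s) * \<psi> (- s)) t" by (intro laplace_mellin \<psi>) simp
    also have "(\<lambda>s. gam (- s) * \<psi> (- s)) = \<phi>" by (simp add: \<psi>_def gam_nonzero fun_eq_iff)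
    finally show "mellin \<phi> t * u t = laplace (mellin \<psi>) t * u t" by simp
  qed
  also have "\<dots> = (LINT x|half_line. mellin \<psi> x * laplace u x)" by (rule laplace_mellin_symmetric(1)[OF \<psi> u])
  also have "\<dots> = (LINT x|half_line. 0)"
  proof (rule integral_cong_AE)
    show "AE x in half_line. mellin \<psi> x * laplace u x = 0" using zero by eventually_elim simp
  qed (use laplace_mellin_symmetric(2)[OF \<psi> u] in auto)
  finally show "(LINT t|half_line. mellin \<phi> t * u t) = 0" by simp
qed

text \<open>
  Here \<open>Q\<close> is the density, in the variable \<open>- ln x\<close>, of the kernel as a Laplace transform.
\<close>

locale hankel_polynomial =
  fixes P Q :: "real poly"
  assumes kernel: "t > 0 \<Longrightarrow> kernel_of Q t = of_real (hankel_kernel P t)"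
    and Q_nonzero: "Q \<noteq> 0"
begin

definition mult_gam :: "(real \<Rightarrow> complex) \<Rightarrow> real \<Rightarrow> complex" where
  "mult_gam \<phi> s = gam s * \<phi> s"

text \<open>
  The operator \<open>gam (- s) Q(i d/ds) gam s\<close>, which represents the Hankel operator on the Mellin side.
\<close>

definition symbol :: "(real \<Rightarrow> complex) \<Rightarrow> real \<Rightarrow> complex" where
  "symbol \<phi> s = gam (- s) * poly_iD Q (mult_gam \<phi>) s"

lemma test_mult_gam: "test \<phi> \<Longrightarrow> test (mult_gam \<phi>)"
  unfolding mult_gam_def[abs_def] by (rule test_mult'[OF _ smooth_gam])

lemma test_symbol: "test \<phi> \<Longrightarrow> test (symbol \<phi>)"
  unfolding symbol_def[abs_def]
  using smooth_affine[OF smooth_gam, of "-1" 0] by (intro test_mult' test_poly_iD test_mult_gam) simp_all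

lemma mult_gam_inverse: "mult_gam (\<lambda>s. \<eta> s * (1 / gam s)) = \<eta>"
  by (simp add: mult_gam_def[abs_def] gam_nonzero)

lemma hankel0_mellin: "test \<phi> \<Longrightarrow> t > 0 \<Longrightarrow> hankel0 P (mellin \<phi>) t = mellin (symbol \<phi>) t"
  unfolding hankel0_def symbol_def[abs_def] mult_gam_def[abs_def]
  by (rule hankel_mellin) (auto simp: kernel)

lemma mellin_symbol:
  assumes \<phi>: "test \<phi>" and t: "t > 0"
  shows "mellin (symbol \<phi>) t = laplace (mellin (\<lambda>s. poly_iD Q (mult_gam \<phi>) (- s))) t"
  using laplace_mellin[OF test_uminus[OF test_poly_iD[OF test_mult_gam[OF \<phi>]]] t]
  by (simp add: symbol_def[abs_def])

lemma mellin_mem_hankel: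
  assumes \<phi>: "test \<phi>"
  shows "(mellin \<phi>, mellin (symbol \<phi>)) \<in> hankel_op P"
proof -
  interpret closed_symmetric_operator half_line "hankel_op P" by (rule hankel_closed_symmetric)
  note L = mellin_L2(1)[OF \<phi>] mellin_L2(1)[OF test_symbol[OF \<phi>]]
  have eq: "AE t in half_line. mellin (symbol \<phi>) t = hankel0 P (mellin \<phi>) t"
    using hankel0_mellin[OF \<phi>] by (intro AE_I2) simp
  have "hankel0 P (mellin \<phi>) \<in> L2_space half_line"
    by (rule L2_AE_cong[OF L(2) hankel0_measurable[OF L2_measurable[OF L(1)]] eq])
  then have "(mellin \<phi>, hankel0 P (mellin \<phi>)) \<in> hankel_op P"
    unfolding hankel_op_def by (intro closure_op_subset L) (simp_all add: hankel_op0_iff mellin_initial_domain \<phi>)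
  then show ?thesis
  proof (rule AE_closed)
    show "AE x in half_line. hankel0 P (mellin \<phi>) x = mellin (symbol \<phi>) x" using eq by eventually_elim simp
  qed (use L in \<open>auto dest: L2_measurable\<close>)
qed

lemma symbol_combination:
  assumes "test \<phi>" "test \<psi>"
  shows "symbol (\<lambda>s. a * \<phi> s + b * \<psi> s) = (\<lambda>s. a * symbol \<phi> s + b * symbol \<psi> s)"
proof -
  have s: "smooth (mult_gam \<phi>)" "smooth (mult_gam \<psi>)" using assms by (auto intro: test_smooth test_mult_gam)
  have "mult_gam (\<lambda>s. a * \<phi> s + b * \<psi> s) = (\<lambda>s. a * mult_gam \<phi> s + b * mult_gam \<psi> s)"
    by (simp add: mult_gam_def fun_eq_iff algebra_simps)
  then show ?thesis
    using s by (simp add: symbol_def[abs_def] poly_iD_add_fun poly_iD_cmult_fun smooth_mult smooth_const algebra_simps)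
qed

definition core :: "real L2_operator" where
  "core = closure_op half_line {(mellin \<phi>, mellin (symbol \<phi>)) | \<phi>. test \<phi>}"

lemma core_closed_symmetric: "closed_symmetric_operator half_line core"
  unfolding core_def
proof (rule closure_op_symmetric)
  let ?T = "{(mellin \<phi>, mellin (symbol \<phi>)) | \<phi>. test \<phi>}"
  show "\<exists>f g. (f, g) \<in> ?T \<and> f \<in> L2_space half_line \<and> g \<in> L2_space half_line"
    using mellin_L2(1)[OF test_zero] mellin_L2(1)[OF test_symbol[OF test_zero]] test_zero by blast
  fix f g f' g' assume "(f, g) \<in> ?T" "(f', g') \<in> ?T"
  then obtain \<phi> \<psi> where \<phi>: "test \<phi>" "f = mellin \<phi>" "g = mellin (symbol \<phi>)"
    and \<psi>: "test \<psi>" "f' = mellin \<psi>" "g' = mellin (symbol \<psi>)" by auto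
  interpret H: closed_symmetric_operator half_line "hankel_op P" by (rule hankel_closed_symmetric)
  show "L2_inner half_line g f' = L2_inner half_line f g'"
    unfolding \<phi> \<psi> by (rule H.symmetric[OF mellin_mem_hankel[OF \<phi>(1)] mellin_mem_hankel[OF \<psi>(1)]])
  fix a b
  let ?c = "\<lambda>s. a * \<phi> s + b * \<psi> s"
  have c: "test ?c" by (intro test_add test_cmult \<phi> \<psi>)
  have "(\<lambda>x. a * f x + b * f' x) = mellin ?c"
    unfolding \<phi> \<psi> mellin_combination[OF \<phi>(1) \<psi>(1)] ..
  moreover have "mellin (symbol ?c) = (\<lambda>x. a * g x + b * g' x)"
    unfolding \<phi> \<psi> symbol_combination[OF \<phi>(1) \<psi>(1)] mellin_combination[OF test_symbol[OF \<phi>(1)] test_symbol[OF \<psi>(1)]] ..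
  moreover have "mellin (symbol ?c) \<in> borel_measurable half_line"
    by (rule L2_measurable[OF mellin_L2(1)[OF test_symbol[OF c]]])
  ultimately show "\<exists>k. (\<lambda>x. a * f x + b * f' x, k) \<in> ?T \<and> k \<in> borel_measurable half_line \<and>
      (\<forall>x\<in>space half_line. k x = a * g x + b * g' x)"
    using c by (intro exI[of _ "mellin (symbol ?c)"]) auto
qed

lemma mellin_mem_core: "test \<phi> \<Longrightarrow> (mellin \<phi>, mellin (symbol \<phi>)) \<in> core"
  unfolding core_def by (intro closure_op_subset mellin_L2(1) test_symbol) auto

lemma core_subset: "core \<subseteq> hankel_op P"
proof
  fix p assume "p \<in> core"
  then obtain f g F G where p: "p = (f, g)" and FG: "\<And>n. (F n, G n) \<in> {(mellin \<phi>, mellin (symbol \<phi>)) | \<phi>. test \<phi>}"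
    and conv: "L2_converges half_line F f" "L2_converges half_line G g"
    unfolding core_def closure_op_def by blast
  interpret H: closed_symmetric_operator half_line "hankel_op P" by (rule hankel_closed_symmetric)
  have "(F n, G n) \<in> hankel_op P" for n using FG[of n] mellin_mem_hankel by auto
  then show "p \<in> hankel_op P" unfolding p using conv by (rule H.closed)
qed

text \<open>
  The Mellin coefficient \<open>\<tau>\<close> of an orthogonal vector is a weak solution. Test functions \<open>\<phi>\<close> are written as
  \<open>\<eta> / gam\<close> in order to free \<open>Q(i d/ds)\<close> from the inner factor \<open>gam\<close>.
\<close>

lemma deficiency_mellin:
  assumes z: "Im z \<noteq> 0" and w: "w \<in> L2_space half_line"
    and orth: "\<And>\<phi>. test \<phi> \<Longrightarrow> L2_inner half_line (\<lambda>t. mellin (symbol \<phi>) t - z * mellin \<phi> t) w = 0"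
  shows "AE t in half_line. w t = 0"
proof -
  have wm: "w \<in> borel_measurable half_line" by (rule L2_measurable[OF w])
  have "log_pull w \<in> L2_space lborel" using L2_norm_log_pull(2)[OF wm] w by simp
  from L2_fourier_transform[OF L2_cnj[OF this]] obtain \<tau>
    where \<tau>: "\<tau> \<in> L2_space lborel"
      and dual: "\<And>\<phi>. test \<phi> \<Longrightarrow> (LINT x|lborel. ft \<phi> x * cnj (log_pull w x)) = (LINT s|lborel. \<phi> s * \<tau> s)"
      and shift: "\<And>h. h \<longlonglongrightarrow> 0 \<Longrightarrow> (\<lambda>n. L2_norm lborel (\<lambda>s. \<tau> (s + h n) - \<tau> s)) \<longlonglongrightarrow> 0"
    by blast
  have inner: "L2_inner half_line (mellin \<phi>) w = (LINT s|lborel. \<phi> s * \<tau> s)" if \<phi>: "test \<phi>" for \<phi>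
  proof -
    have "mellin \<phi> \<in> borel_measurable half_line" by (rule L2_measurable[OF mellin_L2(1)[OF \<phi>]])
    from L2_inner_log_pull[OF this wm] show ?thesis
      using dual[OF \<phi>] by (simp add: log_pull_mellin L2_inner_def)
  qed
  have "AE s in lborel. \<tau> s = 0"
  proof (rule weak_solution_trivial[where Q = Q, OF \<tau> _ z])
    show "(\<lambda>n. L2_norm lborel (\<lambda>s. \<tau> (s + h n) - \<tau> s)) \<longlonglongrightarrow> 0" if "h \<longlonglongrightarrow> 0" for h
      using that by (rule shift)
  next
    fix \<eta> assume \<eta>: "test \<eta>"
    define \<phi> where "\<phi> s = \<eta> s * (1 / gam s)" for s
    have \<phi>: "test \<phi>" unfolding \<phi>_def[abs_def] by (rule test_mult[OF \<eta> smooth_inverse_gam])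
    have sym: "symbol \<phi> = (\<lambda>s. gam (- s) * poly_iD Q \<eta> s)"
      unfolding symbol_def[abs_def] \<phi>_def[abs_def] mult_gam_inverse ..
    have "L2_inner half_line (mellin (symbol \<phi>)) w - z * L2_inner half_line (mellin \<phi>) w = 0"
      using orth[OF \<phi>] L2_inner_combination_left[OF mellin_L2(1)[OF test_symbol[OF \<phi>]] mellin_L2(1)[OF \<phi>] w, of 1 "- z"] by simp
    then show "(LINT s|lborel. gam (- s) * poly_iD Q \<eta> s * \<tau> s) = z * (LINT s|lborel. \<eta> s / gam s * \<tau> s)"
      unfolding inner[OF \<phi>] inner[OF test_symbol[OF \<phi>]] unfolding sym by (simp add: \<phi>_def)
  qed
  then have zero: "L2_inner half_line (mellin \<phi>) w = 0" if "test \<phi>" for \<phi>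
  proof -
    have "(LINT s|lborel. \<phi> s * \<tau> s) = (LINT s|(lborel :: real measure). 0)"
    proof (rule integral_cong_AE)
      show "AE s in lborel. \<phi> s * \<tau> s = 0" using \<open>AE s in lborel. \<tau> s = 0\<close> by eventually_elim simp
    qed (use test_measurable[OF that] L2_measurable[OF \<tau>] in auto)
    then show ?thesis using inner[OF that] by simp
  qed
  have "AE t in half_line. cnj (w t) = 0"
  proof (rule mellin_total)
    show "(\<lambda>t. cnj (w t)) \<in> borel_measurable half_line" using wm by measurable
    show "integrable half_line (\<lambda>t. mellin \<phi> t * cnj (w t))" if "test \<phi>" for \<phi>
      by (rule L2_inner_integrable[OF mellin_L2(1)[OF that] w])
    show "(LINT t|half_line. mellin \<phi> t * cnj (w t)) = 0" if "test \<phi>" for \<phi>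
      using zero[OF that] by (simp add: L2_inner_def)
  qed
  then show ?thesis by simp
qed

lemma core_selfadjoint: "selfadjoint_operator half_line core"
proof -
  interpret closed_symmetric_operator half_line core by (rule core_closed_symmetric)
  show ?thesis
  proof
    fix z w assume z: "Im z \<noteq> 0" and w: "w \<in> L2_space half_line"
      and orth: "\<And>f g. (f, g) \<in> core \<Longrightarrow> L2_inner half_line (\<lambda>x. g x - z * f x) w = 0"
    show "AE x in half_line. w x = 0"
      by (rule deficiency_mellin[OF z w]) (rule orth[OF mellin_mem_core])
  qed
qed

text \<open>
  A self-adjoint operator has no proper symmetric extensions, so the choice of the initial domain between
  Mellin transforms of test functions and \<open>hankel_initial_domain\<close> is immaterial.
\<close>

lemma hankel_eq_core: "hankel_op P = core"
proof -
  interpret selfadjoint_operator half_line core by (rule core_selfadjoint)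
  show ?thesis by (rule symmetric_extension_trivial[OF hankel_closed_symmetric core_subset])
qed

lemma hankel_selfadjoint: "selfadjoint_operator half_line (hankel_op P)"
  unfolding hankel_eq_core by (rule core_selfadjoint)

lemma Q_ln_nonzero: "AE x in half_line. poly Q (- ln x) \<noteq> 0"
proof (rule AE_half_lineI)
  have "finite {y. poly Q y = 0}" by (rule poly_roots_finite[OF Q_nonzero])
  then have "finite (uminus ` {y. poly Q y = 0})" by simp
  then have "uminus ` {y. poly Q y = 0} \<in> null_sets lborel" by (rule finite_imp_null_set_lborel)
  from AE_not_in[OF this] show "AE y in lborel. poly Q (- ln (exp y)) \<noteq> 0"
    by eventually_elim (auto simp: image_iff)
qed measurable

text \<open>
  The operator is the composition of the Laplace transform, multiplication by \<open>poly Q (- ln x)\<close> and the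
  Laplace transform, and each of the three is injective. Elements of the closure have no integral formula, so
  the factorization is applied to \<open>mellin \<phi>\<close> in the pairing with a null vector \<open>f\<close>, where it yields the
  orthogonality of \<open>poly Q (- ln x)\<close> times the Laplace transform of \<open>cnj f\<close> to a total set.
\<close>

lemma hankel_injective: "\<not> is_eigenvalue half_line (hankel_op P) 0"
proof
  interpret closed_symmetric_operator half_line "hankel_op P" by (rule hankel_closed_symmetric)
  assume "is_eigenvalue half_line (hankel_op P) 0"
  then obtain f where f: "f \<in> eigenspace half_line (hankel_op P) 0" and L2_norm_f: "L2_norm half_line f = 1"
    by (rule eigenvalue_normalized)
  then have fT: "(f, \<lambda>x. 0 * f x) \<in> hankel_op P" by (simp only: eigenspace_iff)
  note fL = dom_L2[OF fT]
  let ?u = "\<lambda>t. cnj (f t)"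
  let ?S = "\<lambda>x. of_real (poly Q (- ln x)) * laplace ?u x"
  have um: "?u \<in> borel_measurable half_line" by (rule L2_measurable[OF L2_cnj[OF fL]])
  have key: "integrable half_line (\<lambda>x. mellin \<zeta> x * ?S x) \<and> (LINT x|half_line. mellin \<zeta> x * ?S x) = 0" if \<zeta>: "test \<zeta>" for \<zeta>
  proof -
    define \<eta> where "\<eta> s = \<zeta> (- s)" for s
    have \<eta>: "test \<eta>" unfolding \<eta>_def[abs_def] by (rule test_uminus[OF \<zeta>])
    define \<phi> where "\<phi> s = \<eta> s * (1 / gam s)" for s
    have \<phi>: "test \<phi>" unfolding \<phi>_def[abs_def] by (rule test_mult[OF \<eta> smooth_inverse_gam])
    have mg: "mult_gam \<phi> = \<eta>" unfolding \<phi>_def[abs_def] by (rule mult_gam_inverse)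
    let ?\<psi> = "\<lambda>s. poly_iD Q \<eta> (- s)"
    have \<psi>: "test ?\<psi>" by (intro test_uminus test_poly_iD \<eta>)
    have eq: "mellin ?\<psi> x * laplace ?u x = mellin \<zeta> x * ?S x" if "x \<in> space half_line" for x
      using poly_mult_mellin[OF \<eta>, of x Q] that by (simp add: \<eta>_def mult_ac)
    have "0 = L2_inner half_line (mellin (symbol \<phi>)) f"
      using symmetric[OF mellin_mem_hankel[OF \<phi>] fT] by (simp add: L2_inner_def)
    also have "\<dots> = (LINT t|half_line. laplace (mellin ?\<psi>) t * ?u t)"
      unfolding L2_inner_def by (rule Bochner_Integration.integral_cong) (simp_all add: mellin_symbol[OF \<phi>] mg)
    also have "\<dots> = (LINT x|half_line. mellin ?\<psi> x * laplace ?u x)"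
      by (rule laplace_mellin_symmetric(1)[OF \<psi> L2_cnj[OF fL]])
    also have "\<dots> = (LINT x|half_line. mellin \<zeta> x * ?S x)"
      by (rule Bochner_Integration.integral_cong[OF refl eq])
    finally have "(LINT x|half_line. mellin \<zeta> x * ?S x) = 0" by simp
    moreover have "integrable half_line (\<lambda>x. mellin \<zeta> x * ?S x)"
      using laplace_mellin_symmetric(2)[OF \<psi> L2_cnj[OF fL]]
      by (rule Bochner_Integration.integrable_cong[THEN iffD1, rotated 2]) (rule refl, rule eq)
    ultimately show ?thesis by blast
  qed
  have "AE x in half_line. ?S x = 0"
  proof (rule mellin_total)
    show "?S \<in> borel_measurable half_line" using laplace_measurable[OF um] by measurable
  qed (use key in blast)+
  then have "AE x in half_line. laplace ?u x = 0" using Q_ln_nonzero by eventually_elim simp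
  then have "AE t in half_line. ?u t = 0" by (rule laplace_injective[OF L2_cnj[OF fL]])
  then have "AE t in half_line. f t = 0" by simp
  then have "L2_norm half_line f = L2_norm half_line (\<lambda>x. 0)"
    by (intro L2_norm_AE_cong) (use L2_measurable[OF fL] in auto)
  then show False using L2_norm_f by (simp add: L2_norm_zero)
qed

end

section \<open>Polynomials bounded below: discreteness of the negative spectrum\<close>

lemma laplace_diff:
  assumes "u \<in> L2_space half_line" "v \<in> L2_space half_line" "x > 0"
  shows "laplace (\<lambda>t. u t - v t) x = laplace u x - laplace v x"
  unfolding laplace_def right_diff_distrib
  by (rule Bochner_Integration.integral_diff) (rule laplace_integrable, rule assms, rule assms)+

text \<open>
  The Laplace transform followed by restriction to the interval on which \<open>Q (- ln x)\<close> may be negative.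
\<close>

definition cut_laplace :: "real \<Rightarrow> real \<Rightarrow> (real \<Rightarrow> complex) \<Rightarrow> real \<Rightarrow> complex" where
  "cut_laplace a b u x = indicator {a..b} x * laplace u x"

lemma cut_laplace_diff:
  assumes "u \<in> L2_space half_line" "v \<in> L2_space half_line" "a > 0"
  shows "cut_laplace a b (\<lambda>t. u t - v t) = (\<lambda>x. cut_laplace a b u x - cut_laplace a b v x)"
  using laplace_diff[OF assms(1,2)] assms(3) by (auto simp: cut_laplace_def fun_eq_iff indicator_def)

lemma indicator_L2:
  assumes "0 < a" "a \<le> b"
  shows "(\<lambda>x. complex_of_real (c * indicator {a..b} x)) \<in> L2_space half_line"
    and "L2_norm half_line (\<lambda>x. complex_of_real (c * indicator {a..b} x)) = \<bar>c\<bar> * sqrt (b - a)"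
proof -
  have sq: "(cmod (complex_of_real (c * indicator {a..b} x)))\<^sup>2 = c\<^sup>2 * indicator {a..b} x" for x
    by (auto simp: indicator_def)
  have S: "{a..b} \<in> sets half_line" using assms by (auto simp: sets_half_line_iff)
  have em: "emeasure half_line {a..b} = ennreal (b - a)"
    using assms by (subst half_line_def, subst emeasure_restrict_space) auto
  have meas: "(\<lambda>x. complex_of_real (c * indicator {a..b} x)) \<in> borel_measurable half_line" using S by measurable
  show "(\<lambda>x. complex_of_real (c * indicator {a..b} x)) \<in> L2_space half_line"
    by (rule L2_spaceI[OF meas]) (use S em in \<open>simp only: sq, intro integrable_mult_right integrable_real_indicator, simp_all\<close>)
  have "(LINT x|half_line. c\<^sup>2 * indicator {a..b} x) = c\<^sup>2 * (b - a)"
  proof -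
    have "{a..b} \<inter> {0<..} = {a..b}" using assms by auto
    then show ?thesis using S em assms by (simp add: measure_def)
  qed
  then show "L2_norm half_line (\<lambda>x. complex_of_real (c * indicator {a..b} x)) = \<bar>c\<bar> * sqrt (b - a)"
    unfolding L2_norm_def sq by (simp add: real_sqrt_mult)
qed

lemma L2_norm_cut_le:
  assumes ab: "0 < a" "a \<le> b" and u: "u \<in> borel_measurable half_line"
    and c: "\<And>x. x \<in> {a..b} \<Longrightarrow> cmod (laplace u x) \<le> c" "c \<ge> 0"
  shows "cut_laplace a b u \<in> L2_space half_line" "L2_norm half_line (cut_laplace a b u) \<le> c * sqrt (b - a)"
proof -
  have "cut_laplace a b u \<in> borel_measurable borel"
    using laplace_measurable[OF u] unfolding cut_laplace_def[abs_def] by measurable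
  then have m: "cut_laplace a b u \<in> borel_measurable half_line" by measurable
  have le: "AE x in half_line. cmod (cut_laplace a b u x) \<le> cmod (complex_of_real (c * indicator {a..b} x))"
    using c by (intro AE_I2) (auto simp: cut_laplace_def indicator_def)
  show "cut_laplace a b u \<in> L2_space half_line"
    by (rule L2_space_bound[OF indicator_L2(1)[OF ab] m, of 1 c]) (use le in simp)
  show "L2_norm half_line (cut_laplace a b u) \<le> c * sqrt (b - a)"
    using L2_norm_mono[OF indicator_L2(1)[OF ab] m le] indicator_L2(2)[OF ab, of c] c(2) by simp
qed

lemma cut_laplace_bound:
  assumes ab: "0 < a" "a \<le> b" and u: "u \<in> L2_space half_line"
  shows "cut_laplace a b u \<in> L2_space half_line"
    and "L2_norm half_line (cut_laplace a b u) \<le> L2_norm half_line u / sqrt (2 * a) * sqrt (b - a)"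
proof -
  have "cmod (laplace u x) \<le> L2_norm half_line u / sqrt (2 * a)" if "x \<in> {a..b}" for x
  proof -
    have x: "x \<ge> a" "x > 0" using that ab by auto
    have "cmod (laplace u x) \<le> L2_norm half_line u / sqrt (2 * x)" by (rule laplace_bound(2)[OF u x(2)])
    also have "\<dots> \<le> L2_norm half_line u / sqrt (2 * a)" using x ab by (intro divide_left_mono) auto
    finally show ?thesis .
  qed
  note * = L2_norm_cut_le[OF ab L2_measurable[OF u] this]
  show "cut_laplace a b u \<in> L2_space half_line" using ab by (intro *) auto
  show "L2_norm half_line (cut_laplace a b u) \<le> L2_norm half_line u / sqrt (2 * a) * sqrt (b - a)" using ab by (intro *) auto
qed

text \<open>
  Equicontinuity: the derivative brings down a factor \<open>t\<close>, which half of the exponential decay absorbs.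
\<close>

lemma laplace_lipschitz:
  assumes u: "u \<in> L2_space half_line" and a: "a > 0" and xy: "x \<ge> a" "y \<ge> a"
  shows "cmod (laplace u x - laplace u y) \<le> 2 / a * (L2_norm half_line u / sqrt a) * \<bar>x - y\<bar>"
proof -
  have pos: "x > 0" "y > 0" using a xy by auto
  have um[measurable]: "u \<in> borel_measurable half_line" by (rule L2_measurable[OF u])
  have pw: "\<bar>exp (- (x * t)) - exp (- (y * t))\<bar> \<le> 2 / a * \<bar>x - y\<bar> * exp (- (a / 2 * t))" if t: "t > 0" for t
  proof -
    have main: "\<bar>exp (- (x * t)) - exp (- (y * t))\<bar> \<le> 2 / a * \<bar>x - y\<bar> * exp (- (a / 2 * t))"
      if "x \<ge> a" "x \<le> y" for x y
    proof -
      have "1 - exp (- ((y - x) * t)) \<le> (y - x) * t" using exp_ge_add_one_self[of "- ((y - x) * t)"] by linarith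
      then have 1: "exp (- (x * t)) * (1 - exp (- ((y - x) * t))) \<le> exp (- (a * t)) * ((y - x) * t)"
        using that t by (intro mult_mono) auto
      have 2: "exp (- (x * t)) * (1 - exp (- ((y - x) * t))) = exp (- (x * t)) - exp (- (y * t))"
        by (simp add: right_diff_distrib left_diff_distrib flip: exp_add)
      have "exp (- (a * t)) * t \<le> 2 / a * exp (- (a / 2 * t))"
      proof -
        have "a / 2 * t \<le> exp (a / 2 * t)" using exp_ge_add_one_self[of "a / 2 * t"] by linarith
        then have "exp (- (a * t)) * (a / 2 * t) \<le> exp (- (a * t)) * exp (a / 2 * t)" by (intro mult_left_mono) auto
        also have "\<dots> = exp (- (a / 2 * t))" by (simp flip: exp_add)
        finally show ?thesis using a by (simp add: field_simps)
      qed
      then have 3: "(y - x) * (exp (- (a * t)) * t) \<le> (y - x) * (2 / a * exp (- (a / 2 * t)))"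
        using that by (intro mult_left_mono) auto
      have "exp (- (x * t)) \<ge> exp (- (y * t))" using that t by simp
      then have "\<bar>exp (- (x * t)) - exp (- (y * t))\<bar> = exp (- (x * t)) - exp (- (y * t))" by simp
      also have "\<dots> \<le> (y - x) * (exp (- (a * t)) * t)" using 1 unfolding 2 by (simp only: mult_ac)
      also have "\<dots> \<le> (y - x) * (2 / a * exp (- (a / 2 * t)))" by (rule 3)
      also have "y - x = \<bar>x - y\<bar>" using that by simp
      finally show ?thesis by (simp only: mult_ac)
    qed
    show ?thesis
    proof (cases "x \<le> y")
      case False
      then show ?thesis using main[of y x] xy by (simp add: abs_minus_commute)
    qed (use main xy in simp)
  qed
  have int: "integrable half_line (\<lambda>t. of_real (exp (- (z * t))) * u t)" if "z > 0" for z
    by (rule laplace_integrable[OF u that])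
  have "laplace u x - laplace u y = (LINT t|half_line. of_real (exp (- (x * t))) * u t - of_real (exp (- (y * t))) * u t)"
    unfolding laplace_def using int pos by simp
  also have "cmod \<dots> \<le> (LINT t|half_line. 2 / a * \<bar>x - y\<bar> * (exp (- (a / 2 * t)) * cmod (u t)))"
  proof (rule order_trans[OF integral_norm_bound], rule integral_mono')
    show "integrable half_line (\<lambda>t. 2 / a * \<bar>x - y\<bar> * (exp (- (a / 2 * t)) * cmod (u t)))"
      using integrable_norm[OF int[of "a / 2"]] a by (intro integrable_mult_right) (simp add: norm_mult)
    fix t assume "t \<in> space half_line"
    then have t: "t > 0" by simp
    have "cmod (of_real (exp (- (x * t))) * u t - of_real (exp (- (y * t))) * u t) =
        \<bar>exp (- (x * t)) - exp (- (y * t))\<bar> * cmod (u t)"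
      unfolding left_diff_distrib[symmetric] norm_mult of_real_diff[symmetric] norm_of_real ..
    also have "\<dots> \<le> 2 / a * \<bar>x - y\<bar> * exp (- (a / 2 * t)) * cmod (u t)" by (intro mult_right_mono pw t) simp
    finally show "cmod (of_real (exp (- (x * t))) * u t - of_real (exp (- (y * t))) * u t) \<le>
        2 / a * \<bar>x - y\<bar> * (exp (- (a / 2 * t)) * cmod (u t))" by (simp only: mult.assoc)
  qed (use a in auto)
  also have "\<dots> = 2 / a * \<bar>x - y\<bar> * (LINT t|half_line. exp (- (a / 2 * t)) * cmod (u t))"
    by (rule integral_mult_right_zero)
  also have "\<dots> \<le> 2 / a * \<bar>x - y\<bar> * (L2_norm half_line u / sqrt (2 * (a / 2)))"
    using a by (intro mult_left_mono laplace_bound(1)[OF u]) auto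
  finally show ?thesis by (simp add: mult_ac)
qed

text \<open>On compact subsets of the half-line the Laplace transform is a compact operator, by Arzela--Ascoli.\<close>

lemma cut_laplace_compact:
  fixes F :: "nat \<Rightarrow> real \<Rightarrow> complex"
  assumes ab: "0 < a" "a \<le> b" and F: "\<And>n. F n \<in> L2_space half_line" "\<And>n. L2_norm half_line (F n) \<le> 1"
    and e: "\<And>e. e > 0 \<Longrightarrow> d e > (0 :: real)"
  shows "\<exists>r :: nat \<Rightarrow> nat. strict_mono r \<and>
    (\<forall>e>0. \<exists>n0. \<forall>m\<ge>n0. \<forall>n\<ge>n0. L2_norm half_line (cut_laplace a b (\<lambda>t. F (r m) t - F (r n) t)) < d e)"
proof -
  obtain g r where r: "strict_mono (r :: nat \<Rightarrow> nat)"
    and conv: "\<And>e. 0 < e \<Longrightarrow> \<exists>N. \<forall>n x. n \<ge> N \<and> x \<in> {a..b} \<longrightarrow> norm (laplace (F (r n)) x - g x) < e"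
  proof (rule Arzela_Ascoli[of "{a..b}" "\<lambda>n x. laplace (F n) x" "1 / sqrt (2 * a)"])
    fix n x assume "x \<in> {a..b}"
    then have x: "x \<ge> a" "x > 0" using ab by auto
    have "cmod (laplace (F n) x) \<le> L2_norm half_line (F n) / sqrt (2 * x)" by (rule laplace_bound(2)[OF F(1) x(2)])
    also have "\<dots> \<le> 1 / sqrt (2 * a)" using x ab F(2)[of n] by (intro frac_le) auto
    finally show "norm (laplace (F n) x) \<le> 1 / sqrt (2 * a)" .
  next
    fix x e :: real assume x: "x \<in> {a..b}" and e: "0 < e"
    define L where "L = 2 / a * (1 / sqrt a)"
    have L: "L > 0" using ab by (simp add: L_def)
    have "cmod (laplace (F n) x - laplace (F n) y) < e" if "y \<in> {a..b}" "norm (x - y) < e / L" for n y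
    proof -
      have "cmod (laplace (F n) x - laplace (F n) y) \<le> 2 / a * (L2_norm half_line (F n) / sqrt a) * \<bar>x - y\<bar>"
        using x that ab by (intro laplace_lipschitz F) auto
      also have "\<dots> \<le> L * \<bar>x - y\<bar>" unfolding L_def
        using F(2)[of n] ab by (intro mult_right_mono mult_left_mono divide_right_mono) auto
      also have "\<dots> < e" using that(2) L by (simp add: field_simps)
      finally show ?thesis .
    qed
    then show "\<exists>d. 0 < d \<and> (\<forall>n y. y \<in> {a..b} \<and> norm (x - y) < d \<longrightarrow> norm (laplace (F n) x - laplace (F n) y) < e)"
      using L e by (intro exI[of _ "e / L"]) auto
  qed (use that in auto)
  have "\<exists>n0. \<forall>m\<ge>n0. \<forall>n\<ge>n0. L2_norm half_line (cut_laplace a b (\<lambda>t. F (r m) t - F (r n) t)) < d e" if "e > 0" for e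
  proof -
    define D where "D = sqrt (b - a) + 1"
    have D: "D > 0" unfolding D_def using ab by (intro add_nonneg_pos) auto
    define c where "c = d e / (2 * D)"
    have c: "c > 0" unfolding c_def using e[OF that] D by simp
    then obtain N where N: "\<And>n x. n \<ge> N \<Longrightarrow> x \<in> {a..b} \<Longrightarrow> norm (laplace (F (r n)) x - g x) < c" using conv by blast
    have "L2_norm half_line (cut_laplace a b (\<lambda>t. F (r m) t - F (r n) t)) < d e" if "m \<ge> N" "n \<ge> N" for m n
    proof -
      have "L2_norm half_line (cut_laplace a b (\<lambda>t. F (r m) t - F (r n) t)) \<le> (2 * c) * sqrt (b - a)"
      proof (rule L2_norm_cut_le(2)[OF ab L2_measurable[OF L2_diff[OF F(1) F(1)]]])
        fix x assume x: "x \<in> {a..b}"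
        then have "x > 0" using ab by auto
        have "cmod (laplace (F (r m)) x - laplace (F (r n)) x) \<le> cmod (laplace (F (r m)) x - g x) + cmod (laplace (F (r n)) x - g x)"
          using norm_triangle_ineq4[of "laplace (F (r m)) x - g x" "laplace (F (r n)) x - g x"] by simp
        then show "cmod (laplace (\<lambda>t. F (r m) t - F (r n) t) x) \<le> 2 * c"
          unfolding laplace_diff[OF F(1) F(1) \<open>x > 0\<close>] using N[OF that(1) x] N[OF that(2) x] by linarith
      qed (use c in simp)
      also have "\<dots> < (2 * c) * (sqrt (b - a) + 1)" using c by (intro mult_strict_left_mono) auto
      also have "\<dots> = d e" unfolding c_def D_def[symmetric] using D by simp
      finally show ?thesis .
    qed
    then show ?thesis by blast
  qed
  then show ?thesis using r by blast
qed

lemma even_poly_lower_bound: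
  fixes p :: "real poly"
  assumes "even (degree p)" "degree p \<ge> 1" "lead_coeff p > 0"
  obtains r m where "r \<ge> 0" "m \<ge> 0" "\<And>y. \<bar>y\<bar> > r \<Longrightarrow> poly p y \<ge> 0" "\<And>y. poly p y \<ge> - m"
proof -
  define q where "q = pcompose p [:0, -1:]"
  have q: "lead_coeff q > 0" "poly q y = poly p (- y)" for y
    unfolding q_def using assms by (simp_all add: lead_coeff_comp poly_pcompose)
  obtain r1 where r1: "\<And>y. y \<ge> r1 \<Longrightarrow> poly p y \<ge> lead_coeff p" using poly_pinfty_gt_lc[OF assms(3)] by blast
  obtain r2 where r2: "\<And>y. y \<ge> r2 \<Longrightarrow> poly q y \<ge> lead_coeff q" using poly_pinfty_gt_lc[OF q(1)] by blast
  define r where "r = max 0 (max r1 r2)"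
  have nonneg: "poly p y \<ge> 0" if "\<bar>y\<bar> > r" for y
  proof (cases "y \<ge> 0")
    case True
    then show ?thesis using r1[of y] that assms(3) by (auto simp: r_def)
  next
    case False
    then show ?thesis using r2[of "- y"] that q by (auto simp: r_def)
  qed
  have "continuous_on {- r..r} (poly p)" by (intro continuous_intros)
  then have "compact (poly p ` {- r..r})" by (rule compact_continuous_image) simp
  from compact_imp_bounded[OF this, unfolded bounded_iff] obtain m where m: "\<forall>x\<in>poly p ` {- r..r}. norm x \<le> m" ..
  have "poly p y \<ge> - max m 0" for y
  proof (cases "\<bar>y\<bar> > r")
    case True
    then show ?thesis using nonneg[of y] by simp
  next
    case False
    then have "y \<in> {- r..r}" by auto
    then have "norm (poly p y) \<le> m" using m by blast
    then show ?thesis by simp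
  qed
  then show ?thesis using nonneg by (intro that[of r "max m 0"]) (auto simp: r_def)
qed

context hankel_polynomial begin

text \<open>
  The form of the operator is \<open>\<integral> Q (- ln x) \<bar>L f\<bar>\<^sup>2\<close>, and \<open>Q (- ln x)\<close> is at least \<open>- m\<close> times the indicator of the interval
  from \<open>exp (- r)\<close> to \<open>exp r\<close>.
\<close>

lemma form_mellin:
  assumes \<phi>: "test \<phi>" and r: "r \<ge> 0" "m \<ge> 0" "\<And>y. \<bar>y\<bar> > r \<Longrightarrow> poly Q y \<ge> 0" "\<And>y. poly Q y \<ge> - m"
  shows "- (m * (L2_norm half_line (cut_laplace (exp (- r)) (exp r) (mellin \<phi>)))\<^sup>2) \<le>
    Re (L2_inner half_line (mellin (symbol \<phi>)) (mellin \<phi>))"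
proof -
  let ?u = "mellin \<phi>" and ?\<psi> = "\<lambda>s. poly_iD Q (mult_gam \<phi>) (- s)"
  let ?c = "cut_laplace (exp (- r)) (exp r) ?u"
  have \<eta>: "test (mult_gam \<phi>)" by (rule test_mult_gam[OF \<phi>])
  have \<psi>: "test ?\<psi>" by (intro test_uminus test_poly_iD \<eta>)
  note uL = mellin_L2(1)[OF \<phi>]
  have eq: "mellin ?\<psi> x * laplace (\<lambda>t. cnj (?u t)) x = of_real (poly Q (- ln x) * (cmod (laplace ?u x))\<^sup>2)"
    if "x \<in> space half_line" for x
  proof -
    have x: "x > 0" using that by simp
    have "mellin ?\<psi> x = of_real (poly Q (- ln x)) * laplace ?u x"
      using poly_mult_mellin[OF \<eta> x, of Q] laplace_mellin[OF \<phi> x] by (simp add: mult_gam_def)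
    then show ?thesis by (simp add: laplace_cnj complex_norm_square mult.assoc del: of_real_power)
  qed
  have "L2_inner half_line (mellin (symbol \<phi>)) ?u = (LINT t|half_line. laplace (mellin ?\<psi>) t * cnj (?u t))"
    unfolding L2_inner_def by (rule Bochner_Integration.integral_cong) (simp_all add: mellin_symbol[OF \<phi>])
  also have "\<dots> = (LINT x|half_line. mellin ?\<psi> x * laplace (\<lambda>t. cnj (?u t)) x)"
    by (rule laplace_mellin_symmetric(1)[OF \<psi> L2_cnj[OF uL]])
  also have "\<dots> = (LINT x|half_line. complex_of_real (poly Q (- ln x) * (cmod (laplace ?u x))\<^sup>2))"
    by (rule Bochner_Integration.integral_cong[OF refl eq])
  finally have inner: "Re (L2_inner half_line (mellin (symbol \<phi>)) ?u) = (LINT x|half_line. poly Q (- ln x) * (cmod (laplace ?u x))\<^sup>2)"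
    by (simp del: of_real_mult)
  have "integrable half_line (\<lambda>x. complex_of_real (poly Q (- ln x) * (cmod (laplace ?u x))\<^sup>2))"
    using laplace_mellin_symmetric(2)[OF \<psi> L2_cnj[OF uL]]
    by (rule Bochner_Integration.integrable_cong[THEN iffD1, rotated 2]) (rule refl, rule eq)
  from integrable_Re[OF this] have int: "integrable half_line (\<lambda>x. poly Q (- ln x) * (cmod (laplace ?u x))\<^sup>2)"
    by (simp del: of_real_mult)
  have cL: "?c \<in> L2_space half_line" using r by (intro cut_laplace_bound uL) auto
  have "- (m * (L2_norm half_line ?c)\<^sup>2) = (LINT x|half_line. - m * (cmod (?c x))\<^sup>2)"
    by (simp add: L2_norm_square)
  also have "\<dots> \<le> (LINT x|half_line. poly Q (- ln x) * (cmod (laplace ?u x))\<^sup>2)"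
  proof (rule integral_mono[OF _ int])
    show "integrable half_line (\<lambda>x. - m * (cmod (?c x))\<^sup>2)" by (intro integrable_mult_right L2_square_integrable cL)
    fix x assume "x \<in> space half_line"
    then have x: "x > 0" by simp
    show "- m * (cmod (?c x))\<^sup>2 \<le> poly Q (- ln x) * (cmod (laplace ?u x))\<^sup>2"
    proof (cases "x \<in> {exp (- r)..exp r}")
      case True
      then show ?thesis using mult_right_mono[OF r(4)[of "- ln x"], of "(cmod (laplace ?u x))\<^sup>2"]
        by (simp add: cut_laplace_def)
    next
      case False
      have "\<bar>- ln x\<bar> > r"
      proof (rule ccontr)
        assume "\<not> \<bar>- ln x\<bar> > r"
        then have "- r \<le> ln x" "ln x \<le> r" by auto
        then have "exp (- r) \<le> exp (ln x)" "exp (ln x) \<le> exp r" by (auto simp only: exp_le_cancel_iff)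
        then show False using False x by simp
      qed
      then show ?thesis using r(3)[of "- ln x"] False by (simp add: cut_laplace_def)
    qed
  qed
  finally show ?thesis using inner by simp
qed

text \<open>
  The form bound passes from Mellin transforms of test functions to the closure because \<open>cut_laplace\<close> is
  bounded.
\<close>

lemma compactly_bounded_below:
  assumes r: "r \<ge> 0" "m \<ge> 0" "\<And>y. \<bar>y\<bar> > r \<Longrightarrow> poly Q y \<ge> 0" "\<And>y. poly Q y \<ge> - m"
  shows "compactly_bounded_below half_line (hankel_op P)
    (\<lambda>f. m * (L2_norm half_line (cut_laplace (exp (- r)) (exp r) f))\<^sup>2)"
proof -
  let ?c = "cut_laplace (exp (- r)) (exp r)"
  have ab: "0 < exp (- r)" "exp (- r) \<le> exp r" using r by auto
  interpret selfadjoint_operator half_line "hankel_op P" by (rule hankel_selfadjoint)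
  show ?thesis
  proof
    fix f g assume "(f, g) \<in> hankel_op P"
    then obtain F G where FG: "\<And>n. (F n, G n) \<in> {(mellin \<phi>, mellin (symbol \<phi>)) | \<phi>. test \<phi>}"
      and F: "L2_converges half_line F f" and G: "L2_converges half_line G g"
      unfolding hankel_eq_core core_def closure_op_def by blast
    note FL = L2_convergesD(1,2)[OF F]
    have form: "- (m * (L2_norm half_line (?c (F n)))\<^sup>2) \<le> Re (L2_inner half_line (G n) (F n))" for n
      using FG[of n] form_mellin[OF _ r] by auto
    have "L2_converges half_line (\<lambda>n. ?c (F n)) (?c f)"
      unfolding L2_converges_def
    proof (intro conjI allI cut_laplace_bound(1)[OF ab] FL)
      show "(\<lambda>n. L2_norm half_line (\<lambda>x. ?c (F n) x - ?c f x)) \<longlonglongrightarrow> 0"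
      proof (rule Lim_null_comparison)
        show "\<forall>\<^sub>F n in sequentially. norm (L2_norm half_line (\<lambda>x. ?c (F n) x - ?c f x)) \<le>
            L2_norm half_line (\<lambda>t. F n t - f t) * (1 / sqrt (2 * exp (- r)) * sqrt (exp r - exp (- r)))"
          using cut_laplace_bound(2)[OF ab L2_diff[OF FL]]
          unfolding cut_laplace_diff[OF FL ab(1)] by (intro always_eventually) simp
        show "(\<lambda>n. L2_norm half_line (\<lambda>t. F n t - f t) * (1 / sqrt (2 * exp (- r)) * sqrt (exp r - exp (- r)))) \<longlonglongrightarrow> 0"
          by (rule tendsto_mult_left_zero[OF L2_convergesD(3)[OF F]])
      qed
    qed
    from L2_converges_norm[OF this]
    have "(\<lambda>n. - (m * (L2_norm half_line (?c (F n)))\<^sup>2)) \<longlonglongrightarrow> - (m * (L2_norm half_line (?c f))\<^sup>2)"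
      by (intro tendsto_intros)
    moreover have "(\<lambda>n. Re (L2_inner half_line (G n) (F n))) \<longlonglongrightarrow> Re (L2_inner half_line g f)"
      by (intro tendsto_intros L2_converges_inner G F)
    ultimately show "- (m * (L2_norm half_line (?c f))\<^sup>2) \<le> Re (L2_inner half_line g f)"
      by (rule LIMSEQ_le) (use form in blast)
  next
    fix F G assume FG: "\<And>n :: nat. (F n, G n) \<in> hankel_op P" and F1: "\<And>n. L2_norm half_line (F n) \<le> 1"
    define d where "d e = sqrt (e / (m + 1))" for e :: real
    have d: "d e > 0" if "e > 0" for e using that r by (simp add: d_def)
    obtain s :: "nat \<Rightarrow> nat" where s: "strict_mono s"
      and c: "\<And>e. e > 0 \<Longrightarrow> \<exists>n0. \<forall>k\<ge>n0. \<forall>n\<ge>n0. L2_norm half_line (?c (\<lambda>t. F (s k) t - F (s n) t)) < d e"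
      using cut_laplace_compact[of "exp (- r)" "exp r" F d, OF ab dom_L2[OF FG] F1 d] by blast
    have small: "m * x\<^sup>2 < e" if "0 \<le> x" "x < d e" "e > 0" for x e
    proof -
      have "x\<^sup>2 < (d e)\<^sup>2" using that by (intro power_strict_mono) auto
      then have "x\<^sup>2 < e / (m + 1)" using that r by (simp add: d_def)
      then have "(m + 1) * x\<^sup>2 < e" using r by (simp add: field_simps)
      moreover have "m * x\<^sup>2 \<le> (m + 1) * x\<^sup>2" by (intro mult_right_mono) auto
      ultimately show ?thesis by linarith
    qed
    have "\<forall>e>0. \<exists>n0. \<forall>k\<ge>n0. \<forall>n\<ge>n0. m * (L2_norm half_line (?c (\<lambda>x. F (s k) x - F (s n) x)))\<^sup>2 < e"
    proof (intro allI impI)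
      fix e :: real assume e: "e > 0"
      obtain n0 where n0: "\<forall>k\<ge>n0. \<forall>n\<ge>n0. L2_norm half_line (?c (\<lambda>t. F (s k) t - F (s n) t)) < d e" using c[OF e] ..
      show "\<exists>n0. \<forall>k\<ge>n0. \<forall>n\<ge>n0. m * (L2_norm half_line (?c (\<lambda>x. F (s k) x - F (s n) x)))\<^sup>2 < e"
        using n0 by (intro exI[of _ n0] allI impI small L2_norm_nonneg e) auto
    qed
    then show "\<exists>s :: nat \<Rightarrow> nat. strict_mono s \<and>
        (\<forall>e>0. \<exists>n0. \<forall>k\<ge>n0. \<forall>n\<ge>n0. m * (L2_norm half_line (?c (\<lambda>x. F (s k) x - F (s n) x)))\<^sup>2 < e)"
      using s by (intro exI[of _ s] conjI)
  qed
qed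

end

section \<open>Approximate eigenfunctions\<close>

text \<open>
  By Taylor's formula the coefficient of order \<open>j\<close> of the shifted polynomial is the derivative of \<open>q\<close> of order \<open>j\<close> divided by the
  factorial of \<open>j\<close>; only its degree as a polynomial in the shift matters below.
\<close>

lemma pcompose_shift_coeff:
  fixes q :: "real poly"
  shows "\<exists>c. (\<forall>R. coeff (pcompose q [:R, 1:]) j = poly c R) \<and> (c = 0 \<or> degree c + j \<le> degree q)"
proof (induction q arbitrary: j rule: pCons_induct)
  case 0
  then show ?case by (intro exI[of _ 0]) simp
next
  case (pCons a q)
  obtain c where c: "\<And>R. coeff (pcompose q [:R, 1:]) j = poly c R" "c = 0 \<or> degree c + j \<le> degree q"
    using pCons.IH[of j] by blast
  have shift: "coeff (pcompose (pCons a q) [:R, 1:]) j =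
      (if j = 0 then a else 0) + R * coeff (pcompose q [:R, 1:]) j + (if j = 0 then 0 else coeff (pcompose q [:R, 1:]) (j - 1))" for R
    by (cases j) (simp_all add: pcompose_pCons)
  show ?case
  proof (cases j)
    case 0
    have "degree ([:a:] + pCons 0 c) \<le> degree (pCons a q)"
    proof (cases "c = 0")
      case False
      then have "q \<noteq> 0" using c(1)[of 0] c(1) by (metis coeff_0 pcompose_0 poly_0 poly_all_0_iff_0)
      then show ?thesis using c(2) False 0 by (intro degree_add_le) auto
    qed simp
    then show ?thesis using 0 shift c by (intro exI[of _ "[:a:] + pCons 0 c"]) simp
  next
    case (Suc i)
    obtain d where d: "\<And>R. coeff (pcompose q [:R, 1:]) i = poly d R" "d = 0 \<or> degree d + i \<le> degree q"
      using pCons.IH[of i] by blast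
    have nz: "q \<noteq> 0" if "c \<noteq> 0 \<or> d \<noteq> 0"
      using that c(1) d(1) by (metis coeff_0 pcompose_0 poly_0 poly_all_0_iff_0)
    have "pCons 0 c + d = 0 \<or> degree (pCons 0 c + d) + j \<le> degree (pCons a q)"
    proof (cases "c = 0 \<and> d = 0")
      case False
      then have q: "q \<noteq> 0" using nz by blast
      show ?thesis
      proof (cases "c = 0")
        case True
        then show ?thesis using d(2) q Suc by auto
      next
        case cnz: False
        then have "degree (pCons 0 c) + j \<le> degree (pCons a q)" using c(2) q by simp
        moreover have "degree d + j \<le> degree (pCons a q)" if "d \<noteq> 0" using d(2) that q Suc by simp
        moreover have "degree (pCons 0 c + d) \<le> max (degree (pCons 0 c)) (degree d)" by (rule degree_add_le_max)
        ultimately show ?thesis by (cases "d = 0") auto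
      qed
    qed simp
    then show ?thesis using Suc shift c d by (intro exI[of _ "pCons 0 c + d"]) simp
  qed
qed

lemma shifted_coeff_negligible:
  fixes Q :: "real poly"
  assumes "degree Q \<ge> 1" "j \<ge> 1"
  shows "((\<lambda>R. coeff (pcompose Q [:R, 1:]) j / poly Q R) \<longlongrightarrow> 0) at_infinity"
proof -
  obtain c where c: "\<And>R. coeff (pcompose Q [:R, 1:]) j = poly c R" "c = 0 \<or> degree c + j \<le> degree Q"
    using pcompose_shift_coeff[of Q j] by blast
  have "degree c < degree Q" using c(2) assms by auto
  from poly_divide_tendsto_0_at_infinity[OF this] show ?thesis unfolding c(1) .
qed

lemma L2_norm_sum_le:
  assumes "\<And>i. i \<in> I \<Longrightarrow> f i \<in> L2_space M"
  shows "L2_norm M (\<lambda>x. \<Sum>i\<in>I. f i x) \<le> (\<Sum>i\<in>I. L2_norm M (f i))"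
  using assms
proof (induction I rule: infinite_finite_induct)
  case (insert i I)
  have "L2_norm M (\<lambda>x. f i x + (\<Sum>i\<in>I. f i x)) \<le> L2_norm M (f i) + L2_norm M (\<lambda>x. \<Sum>i\<in>I. f i x)"
    using insert.prems by (intro L2_triangle L2_sum) auto
  then show ?case using insert by simp
qed (simp_all add: L2_norm_zero)

text \<open>
  The reciprocal of \<open>\<bar>gam s\<bar>\<^sup>2\<close>: the level curve of the classical symbol at the value \<open>l\<close> is \<open>Q R = l * inv_symbol s\<close>.
\<close>

definition inv_symbol :: "real \<Rightarrow> real" where
  "inv_symbol s = cosh (pi * s) / pi"

lemma inv_symbol_pos: "inv_symbol s > 0"
  by (simp add: inv_symbol_def)

lemma inv_symbol_shift: "inv_symbol (a + b) \<le> inv_symbol a * exp (pi * \<bar>b\<bar>)"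
  using cosh_add_le[of "pi * a" "pi * b"]
  by (simp add: inv_symbol_def distrib_left abs_mult divide_right_mono)

lemma inv_symbol_onto: "y \<ge> 1 / pi \<Longrightarrow> \<exists>s. inv_symbol s = y"
  by (intro exI[of _ "arcosh (pi * y) / pi"]) (simp add: inv_symbol_def cosh_arcosh_real divide_le_eq mult.commute)

lemma cmod_gam_inv_symbol: "cmod (gam s) = 1 / sqrt (inv_symbol s)" "cmod (gam (- s)) = 1 / sqrt (inv_symbol s)"
proof -
  have "cmod (gam s) = sqrt (1 / inv_symbol s)"
    by (rule real_sqrt_unique[symmetric]) (simp_all add: cmod_gam_square inv_symbol_def)
  then show "cmod (gam s) = 1 / sqrt (inv_symbol s)" by (simp add: real_sqrt_divide)
  moreover have "cmod (gam (- s)) = cmod (gam s)" using cnj_gam[of s] by (metis complex_mod_cnj)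
  ultimately show "cmod (gam (- s)) = 1 / sqrt (inv_symbol s)" by simp
qed

text \<open>
  On the support of a translate of \<open>h\<close> the weight \<open>gam (- s)\<close> is comparable with its value at the centre.
\<close>

lemma gam_weighted_upper:
  assumes h: "test h" and r: "\<And>s. r < \<bar>s\<bar> \<Longrightarrow> h s = 0"
  shows "(\<lambda>s. gam (- s) * h (s - a)) \<in> L2_space lborel"
    and "L2_norm lborel (\<lambda>s. gam (- s) * h (s - a)) \<le> exp (pi * r) / sqrt (inv_symbol a) * L2_norm lborel h"
proof -
  have hm[measurable]: "h \<in> borel_measurable borel" by (rule test_measurable[OF h])
  have hL: "(\<lambda>s. h (s - a)) \<in> L2_space lborel" "L2_norm lborel (\<lambda>s. h (s - a)) = L2_norm lborel h"
    using translation_L2[OF test_L2[OF h], of "- a"] by simp_all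
  let ?c = "exp (pi * r) / sqrt (inv_symbol a)"
  have c: "?c > 0" using inv_symbol_pos[of a] by simp
  have le: "cmod (gam (- s) * h (s - a)) \<le> cmod (of_real ?c * h (s - a))" for s
  proof (cases "r < \<bar>s - a\<bar>")
    case False
    have "inv_symbol a \<le> inv_symbol s * exp (pi * \<bar>a - s\<bar>)" using inv_symbol_shift[of s "a - s"] by simp
    also have "\<dots> \<le> inv_symbol s * (exp (pi * r))\<^sup>2"
    proof (rule mult_left_mono)
      have "pi * \<bar>a - s\<bar> \<le> 2 * (pi * r)" 
        using False mult_left_mono[of "\<bar>a - s\<bar>" r pi] mult_nonneg_nonneg[of pi r] by (simp add: abs_minus_commute)
      then show "exp (pi * \<bar>a - s\<bar>) \<le> (exp (pi * r))\<^sup>2" by (simp flip: exp_of_nat_mult)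
    qed (use inv_symbol_pos in \<open>simp add: less_imp_le\<close>)
    finally have "sqrt (inv_symbol a) \<le> sqrt (inv_symbol s * (exp (pi * r))\<^sup>2)" by (rule real_sqrt_le_mono)
    then have "sqrt (inv_symbol a) \<le> sqrt (inv_symbol s) * exp (pi * r)" by (simp add: real_sqrt_mult)
    then have "1 / sqrt (inv_symbol s) \<le> ?c"
      using inv_symbol_pos[of a] inv_symbol_pos[of s] by (simp add: field_simps)
    then have "cmod (gam (- s)) * cmod (h (s - a)) \<le> ?c * cmod (h (s - a))"
      unfolding cmod_gam_inv_symbol(2) by (rule mult_right_mono) simp
    then show ?thesis unfolding norm_mult norm_of_real abs_of_pos[OF c] .
  qed (simp add: r)
  have m: "(\<lambda>s. gam (- s) * h (s - a)) \<in> borel_measurable lborel" by measurable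
  show "(\<lambda>s. gam (- s) * h (s - a)) \<in> L2_space lborel"
    by (rule L2_space_bound[OF L2_scale[OF hL(1), of "of_real ?c"] m, of 1]) (use le in simp)
  have "L2_norm lborel (\<lambda>s. gam (- s) * h (s - a)) \<le> L2_norm lborel (\<lambda>s. of_real ?c * h (s - a))"
    by (rule L2_norm_mono[OF L2_scale[OF hL(1)] m]) (use le in auto)
  also have "\<dots> = ?c * L2_norm lborel h" unfolding L2_norm_scale hL(2) norm_of_real abs_of_pos[OF c] ..
  finally show "L2_norm lborel (\<lambda>s. gam (- s) * h (s - a)) \<le> ?c * L2_norm lborel h" .
qed

lemma L2_norm_bump_pos:
  assumes d: "d > 0"
  shows "L2_norm lborel (\<lambda>s. complex_of_real (bump d s)) > 0"
proof (rule ccontr)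
  assume "\<not> L2_norm lborel (\<lambda>s. complex_of_real (bump d s)) > 0"
  then have "L2_norm lborel (\<lambda>s. complex_of_real (bump d s)) = 0"
    using L2_norm_nonneg[of lborel "\<lambda>s. complex_of_real (bump d s)"] by linarith
  from L2_norm_eq_0_AE[OF test_L2[OF test_bump] this] have "AE s in lborel. bump d s = 0" by simp
  then have "(LINT s|lborel. bump d s) = (LINT s|(lborel :: real measure). 0)"
    by (intro integral_cong_AE) (use integral_bump_pos(1)[OF d] in auto)
  then show False using integral_bump_pos(2)[OF d] by simp
qed

context hankel_polynomial begin

text \<open>
  A wave packet localized near a point of the level curve \<open>Q(R) \<pi> / cosh (\<pi> a) = l\<close> far out on that curve: \<open>cis (- R s)\<close>
  moves \<open>i d/ds\<close> to \<open>R\<close>, where derivatives of the fixed bump only contribute terms of lower order in \<open>R\<close>, and the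
  narrow support of the bump keeps \<open>cosh (\<pi> s)\<close> close to \<open>cosh (\<pi> a)\<close>.
\<close>

lemma wave_packet:
  fixes l :: real and X :: "nat \<Rightarrow> real"
  assumes deg: "degree Q \<ge> 1" and l: "l \<noteq> 0" and e: "e > 0"
    and X: "filterlim X at_infinity sequentially"
    and XQ: "filterlim (\<lambda>n. poly Q (X n) / l) at_top sequentially"
  shows "\<exists>\<phi>. test \<phi> \<and> L2_norm lborel \<phi> > 0 \<and>
    L2_norm lborel (\<lambda>s. symbol \<phi> s - of_real l * \<phi> s) \<le> e * L2_norm lborel \<phi>"
proof -
  \<comment> \<open>choose the width \<open>d\<close> of the packet so that \<open>\<bar>l\<bar> (exp (\<pi> d) - 1) exp (2 \<pi> d)\<close>, the relative error caused by the variation of the symbol over its support, is below \<open>e / 2\<close>\<close>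
  have "isCont (\<lambda>d. \<bar>l\<bar> * (exp (pi * d) - 1) * (exp (pi * d) * exp (pi * d))) 0" by (intro continuous_intros)
  then have "((\<lambda>d. \<bar>l\<bar> * (exp (pi * d) - 1) * (exp (pi * d) * exp (pi * d))) \<longlongrightarrow> 0) (at 0)" by (simp add: isCont_def)
  from order_tendstoD(2)[OF this, of "e / 2"] e obtain r0
    where r0: "r0 > 0" "\<And>d. d \<noteq> 0 \<Longrightarrow> \<bar>d\<bar> < r0 \<Longrightarrow> \<bar>l\<bar> * (exp (pi * d) - 1) * (exp (pi * d) * exp (pi * d)) < e / 2"
    by (auto simp: eventually_at dist_norm)
  define d where "d = r0 / 2"
  have d: "d > 0" "\<bar>l\<bar> * (exp (pi * d) - 1) * (exp (pi * d) * exp (pi * d)) < e / 2"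
    using r0(1) r0(2)[of d] by (simp_all add: d_def del: exp_less_one_iff)
  define g where "g s = complex_of_real (bump d s)" for s
  have g: "test g" unfolding g_def by (rule test_bump)
  have g_supp: "g s = 0" if "d < \<bar>s\<bar>" for s using that by (simp add: g_def bump_eq_0)
  have gpos: "L2_norm lborel g > 0" unfolding g_def by (rule L2_norm_bump_pos[OF d(1)])
  let ?K = "degree Q"
  define G where "G j = (iD ^^ j) g" for j
  have Gt: "test (G j)" for j unfolding G_def by (rule test_iD_funpow[OF g])
  have "\<exists>\<rho>. \<forall>j. \<forall>s. \<rho> j < \<bar>s\<bar> \<longrightarrow> G j s = 0"
    using Gt unfolding test_def by (intro choice) blast
  then obtain \<rho> where \<rho>: "\<And>j s. \<rho> j < \<bar>s\<bar> \<Longrightarrow> G j s = 0" by blast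
  define r where "r = Max (\<rho> ` {..?K})"
  have r: "G j s = 0" if "r < \<bar>s\<bar>" "j \<le> ?K" for j s
  proof -
    have "\<rho> j \<le> r" unfolding r_def using that(2) by (intro Max_ge) auto
    then show ?thesis using \<rho>[of j s] that(1) by simp
  qed
  define cf where "cf R j = coeff (pcompose Q [:R, 1:]) j" for R j
  \<comment> \<open>\<open>E R\<close> bounds the contribution of derivatives of the bump, relative to the size \<open>sqrt (Q R / l)\<close> of the packet\<close>
  define E where "E R = exp (pi * r) * (\<Sum>j\<in>{1..?K}. \<bar>l\<bar> * \<bar>cf R j / poly Q R\<bar> * L2_norm lborel (G j))" for R
  have "(E \<longlongrightarrow> exp (pi * r) * (\<Sum>j\<in>{1..?K}. \<bar>l\<bar> * \<bar>0\<bar> * L2_norm lborel (G j))) at_infinity"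
    unfolding E_def cf_def by (intro tendsto_intros shifted_coeff_negligible deg) auto
  then have E0: "((\<lambda>n. E (X n)) \<longlongrightarrow> 0) sequentially"
    using filterlim_compose[OF _ X, of E "nhds 0"] by simp
  define e' where "e' = e / 2 * (exp (- (pi * d)) * L2_norm lborel g)"
  have e': "e' > 0" using e gpos by (simp add: e'_def)
  have "\<forall>\<^sub>F n in sequentially. E (X n) < e' \<and> poly Q (X n) / l \<ge> 1"
    using order_tendstoD(2)[OF E0 e'] filterlim_at_top[THEN iffD1, OF XQ, rule_format, of 1] by (rule eventually_conj)
  then obtain n where n: "E (X n) < e'" "poly Q (X n) / l \<ge> 1"
    using eventually_happens'[OF sequentially_bot] by blast
  \<comment> \<open>the packet has frequency \<open>R\<close> and centre \<open>a\<close>, a point of the level curve\<close>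
  define R where "R = X n"
  define y where "y = poly Q R / l"
  have y: "y \<ge> 1" "poly Q R = l * y" using n l by (simp_all add: y_def R_def)
  have "1 / pi \<le> 1" using pi_gt3 by (simp add: divide_le_eq)
  then obtain a where a: "inv_symbol a = y" using inv_symbol_onto[of y] order_trans[OF _ y(1)] by blast
  define \<eta> where "\<eta> s = cis (- R * s) * g (s + (- a))" for s
  have ga: "test (\<lambda>s. g (s + (- a)))" using test_affine[OF g, of 1 "- a"] by simp
  have \<eta>: "test \<eta>" unfolding \<eta>_def[abs_def] by (rule test_mult'[OF ga smooth_cis])
  define \<phi> where "\<phi> s = \<eta> s * (1 / gam s)" for s
  have \<phi>: "test \<phi>" unfolding \<phi>_def[abs_def] by (rule test_mult[OF \<eta> smooth_inverse_gam])
  have symbol: "symbol \<phi> s = gam (- s) * (cis (- R * s) * (\<Sum>j\<le>?K. of_real (cf R j) * G j (s - a)))" for s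
  proof -
    have "poly_iD Q \<eta> s = cis (- R * s) * poly_iD (pcompose Q [:R, 1:]) (\<lambda>s. g (s + (- a))) s"
      unfolding \<eta>_def[abs_def] poly_iD_modulate[OF test_smooth[OF ga]] ..
    also have "poly_iD (pcompose Q [:R, 1:]) (\<lambda>s. g (s + (- a))) s = poly_iD (pcompose Q [:R, 1:]) g (s - a)"
      unfolding poly_iD_translate[OF test_smooth[OF g]] by simp
    also have "\<dots> = (\<Sum>j\<le>?K. of_real (cf R j) * G j (s - a))"
      unfolding cf_def G_def by (rule poly_iD_sum) (simp add: degree_pcompose)
    finally show ?thesis unfolding symbol_def \<phi>_def[abs_def] mult_gam_inverse by simp
  qed
  define \<zeta>1 where "\<zeta>1 s = cis (- R * s) * (\<Sum>j\<in>{1..?K}. of_real (cf R j) * (gam (- s) * G j (s - a)))" for s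
  define \<zeta>2 where "\<zeta>2 s = cis (- R * s) * (of_real (l * (y - inv_symbol s)) * (gam (- s) * g (s - a)))" for s
  \<comment> \<open>\<open>\<zeta>1\<close> collects the derivatives of the bump, \<open>\<zeta>2\<close> the deviation of \<open>inv_symbol s\<close> from its value \<open>y\<close> at \<open>a\<close>\<close>
  have split: "symbol \<phi> s - of_real l * \<phi> s = \<zeta>1 s + \<zeta>2 s" for s
  proof -
    have cf0: "cf R 0 = l * y"
      using poly_pcompose[of Q "[:R, 1:]" 0] y(2) by (simp add: cf_def poly_0_coeff_0)
    have G0: "G 0 = g" by (simp add: G_def)
    have "(\<Sum>j\<le>?K. of_real (cf R j) * G j (s - a)) =
        of_real (l * y) * g (s - a) + (\<Sum>j\<in>{1..?K}. of_real (cf R j) * G j (s - a))"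
      unfolding atMost_atLeast0 sum.atLeast_Suc_atMost[OF le0] One_nat_def cf0 G0 ..
    then have S: "symbol \<phi> s = cis (- R * s) * (gam (- s) * (of_real (l * y) * g (s - a))) + \<zeta>1 s"
      unfolding symbol \<zeta>1_def by (simp add: algebra_simps sum_distrib_left)
    have "1 / gam s = of_real (inv_symbol s) * gam (- s)"
    proof -
      have "gam s * (of_real (inv_symbol s) * gam (- s)) = of_real (inv_symbol s) * of_real (pi / cosh (pi * s))"
        by (simp only: gam_mult_uminus[symmetric] mult_ac)
      also have "\<dots> = 1" by (simp add: inv_symbol_def flip: of_real_mult)
      finally show ?thesis using gam_nonzero[of s] by (simp add: field_simps)
    qed
    then have "of_real l * \<phi> s = cis (- R * s) * (of_real (l * inv_symbol s) * (gam (- s) * g (s - a)))"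
      unfolding \<phi>_def \<eta>_def by (simp add: mult_ac)
    then show ?thesis unfolding S \<zeta>2_def by (simp only: of_real_mult of_real_diff) (simp only: algebra_simps)
  qed
  have sy: "sqrt y > 0" using y by simp
  have cis_norm: "L2_norm lborel (\<lambda>s. cis (- R * s) * h s) = L2_norm lborel h" for h
    by (simp add: L2_norm_def norm_mult)
  have cis_L2: "(\<lambda>s. cis (- R * s) * h s) \<in> L2_space lborel" if "h \<in> L2_space lborel" for h
    by (rule L2_space_bound[OF that, of _ 1]) (use L2_measurable[OF that] in \<open>auto simp: norm_mult\<close>)
  \<comment> \<open>terms with derivatives of the bump\<close>
  have piece: "(\<lambda>s. of_real (cf R j) * (gam (- s) * G j (s - a))) \<in> L2_space lborel"
    "L2_norm lborel (\<lambda>s. of_real (cf R j) * (gam (- s) * G j (s - a))) \<le>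
      \<bar>cf R j\<bar> * (exp (pi * r) / sqrt y * L2_norm lborel (G j))" if "j \<le> ?K" for j
  proof -
    note * = gam_weighted_upper[where r=r and a=a, OF Gt[of j] r[OF _ that], unfolded a]
    show "(\<lambda>s. of_real (cf R j) * (gam (- s) * G j (s - a))) \<in> L2_space lborel" by (intro L2_scale *) 
    show "L2_norm lborel (\<lambda>s. of_real (cf R j) * (gam (- s) * G j (s - a))) \<le>
      \<bar>cf R j\<bar> * (exp (pi * r) / sqrt y * L2_norm lborel (G j))"
      unfolding L2_norm_scale norm_of_real by (intro mult_left_mono *) auto
  qed
  have L1: "\<zeta>1 \<in> L2_space lborel"
    unfolding \<zeta>1_def[abs_def] by (intro cis_L2 L2_sum piece) auto
  have "L2_norm lborel \<zeta>1 \<le> (\<Sum>j\<in>{1..?K}. L2_norm lborel (\<lambda>s. of_real (cf R j) * (gam (- s) * G j (s - a))))"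
    unfolding \<zeta>1_def[abs_def] cis_norm by (rule L2_norm_sum_le) (use piece in auto)
  also have "\<dots> \<le> (\<Sum>j\<in>{1..?K}. \<bar>cf R j\<bar> * (exp (pi * r) / sqrt y * L2_norm lborel (G j)))"
    by (rule sum_mono) (use piece in auto)
  also have "\<dots> = sqrt y * E R"
  proof -
    have "\<bar>cf R j\<bar> * (exp (pi * r) / sqrt y * L2_norm lborel (G j)) =
        sqrt y * (exp (pi * r) * (\<bar>l\<bar> * \<bar>cf R j / poly Q R\<bar> * L2_norm lborel (G j)))" for j
    proof -
      have 1: "\<bar>l\<bar> * \<bar>cf R j / poly Q R\<bar> = \<bar>cf R j\<bar> / y" using y l by (simp add: abs_mult)
      have 2: "1 / sqrt y = sqrt y / y" using y by (simp add: real_div_sqrt field_simps)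
      have "\<bar>cf R j\<bar> * (exp (pi * r) / sqrt y * L2_norm lborel (G j)) =
          1 / sqrt y * (\<bar>cf R j\<bar> * exp (pi * r) * L2_norm lborel (G j))" by simp
      then show ?thesis unfolding 1 2 by simp
    qed
    then show ?thesis unfolding E_def by (simp add: sum_distrib_left)
  qed
  also have "\<dots> \<le> sqrt y * e'" using n(1) sy by (intro mult_left_mono) (auto simp: R_def)
  finally have N1: "L2_norm lborel \<zeta>1 \<le> sqrt y * e'" .
  \<comment> \<open>variation of the symbol over the support of the bump\<close>
  have gw: "(\<lambda>s. gam (- s) * g (s - a)) \<in> L2_space lborel"
    "L2_norm lborel (\<lambda>s. gam (- s) * g (s - a)) \<le> exp (pi * d) / sqrt y * L2_norm lborel g"
    by (rule gam_weighted_upper[where a=a, OF g, unfolded a], erule g_supp)+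
  have near: "\<bar>y - inv_symbol s\<bar> \<le> y * (exp (pi * d) - 1)" if "\<not> d < \<bar>s - a\<bar>" for s
  proof -
    have ed: "exp (pi * \<bar>s - a\<bar>) \<le> exp (pi * d)" using that by simp
    have "inv_symbol s \<le> y * exp (pi * \<bar>s - a\<bar>)" using inv_symbol_shift[of a "s - a"] a by simp
    also have "\<dots> \<le> y * exp (pi * d)" using y by (intro mult_left_mono ed) auto
    finally have up: "inv_symbol s \<le> y * exp (pi * d)" .
    have "y \<le> inv_symbol s * exp (pi * \<bar>a - s\<bar>)" using inv_symbol_shift[of s "a - s"] a by simp
    also have "\<dots> \<le> inv_symbol s * exp (pi * d)"
      using ed inv_symbol_pos[of s] by (intro mult_left_mono) (auto simp: abs_minus_commute)
    finally have "y * exp (- (pi * d)) \<le> inv_symbol s * exp (pi * d) * exp (- (pi * d))" by (intro mult_right_mono) auto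
    then have low: "y * exp (- (pi * d)) \<le> inv_symbol s" by (simp add: mult.assoc flip: exp_add)
    have "1 + 1 \<le> exp (pi * d) + exp (- (pi * d))"
      using exp_ge_add_one_self[of "pi * d"] exp_ge_add_one_self[of "- (pi * d)"] by linarith
    then have "y * (1 - exp (- (pi * d))) \<le> y * (exp (pi * d) - 1)" using y by (intro mult_left_mono) auto
    then show ?thesis using up low by (simp add: abs_le_iff algebra_simps)
  qed
  have le2: "cmod (of_real (l * (y - inv_symbol s)) * (gam (- s) * g (s - a))) \<le>
      cmod (of_real (\<bar>l\<bar> * (y * (exp (pi * d) - 1))) * (gam (- s) * g (s - a)))" for s
  proof (cases "d < \<bar>s - a\<bar>")
    case False
    have "\<bar>l * (y - inv_symbol s)\<bar> \<le> \<bar>\<bar>l\<bar> * (y * (exp (pi * d) - 1))\<bar>"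
      using mult_left_mono[OF near[OF False], of "\<bar>l\<bar>"]
      unfolding abs_mult[of l] by (intro order_trans[OF _ abs_ge_self]) simp
    then show ?thesis unfolding norm_mult[of "complex_of_real _"] norm_of_real by (rule mult_right_mono) simp
  qed (simp add: g_supp)
  have m2: "(\<lambda>s. of_real (l * (y - inv_symbol s)) * (gam (- s) * g (s - a))) \<in> borel_measurable lborel"
  proof -
    have [measurable]: "g \<in> borel_measurable borel" by (rule test_measurable[OF g])
    have [measurable]: "inv_symbol \<in> borel_measurable borel"
      unfolding inv_symbol_def[abs_def] by (intro borel_measurable_continuous_onI continuous_intros) auto
    show ?thesis by measurable
  qed
  have L2: "(\<lambda>s. of_real (l * (y - inv_symbol s)) * (gam (- s) * g (s - a))) \<in> L2_space lborel"
    by (rule L2_space_bound[OF L2_scale[OF gw(1), of "of_real (\<bar>l\<bar> * (y * (exp (pi * d) - 1)))"] m2, of 1]) (simp only: mult_1 le2 AE_I2)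
  have "L2_norm lborel \<zeta>2 \<le> L2_norm lborel (\<lambda>s. of_real (\<bar>l\<bar> * (y * (exp (pi * d) - 1))) * (gam (- s) * g (s - a)))"
    unfolding \<zeta>2_def[abs_def] cis_norm by (rule L2_norm_mono[OF L2_scale[OF gw(1)] m2]) (rule AE_I2, rule le2)
  also have "\<dots> \<le> \<bar>l\<bar> * (y * (exp (pi * d) - 1)) * (exp (pi * d) / sqrt y * L2_norm lborel g)"
  proof -
    have "\<bar>\<bar>l\<bar> * (y * (exp (pi * d) - 1))\<bar> = \<bar>l\<bar> * (y * (exp (pi * d) - 1))"
      using y d by (intro abs_of_nonneg mult_nonneg_nonneg) auto
    then show ?thesis unfolding L2_norm_scale norm_of_real using y d by (intro mult_mono gw) auto
  qed
  also have "\<dots> = sqrt y * (\<bar>l\<bar> * (exp (pi * d) - 1) * (exp (pi * d) * exp (pi * d)) * (exp (- (pi * d)) * L2_norm lborel g))"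
  proof -
    have "exp (pi * d) * exp (- (pi * d)) = 1" by (simp flip: exp_add)
    moreover have "y / sqrt y = sqrt y" using y by (simp add: real_div_sqrt)
    moreover have "\<bar>l\<bar> * (y * (exp (pi * d) - 1)) * (exp (pi * d) / sqrt y * L2_norm lborel g) =
        (y / sqrt y) * (\<bar>l\<bar> * (exp (pi * d) - 1) * exp (pi * d) * L2_norm lborel g)" by simp
    moreover have "sqrt y * (\<bar>l\<bar> * (exp (pi * d) - 1) * (exp (pi * d) * exp (pi * d)) * (exp (- (pi * d)) * L2_norm lborel g)) =
        sqrt y * (\<bar>l\<bar> * (exp (pi * d) - 1) * exp (pi * d) * L2_norm lborel g) * (exp (pi * d) * exp (- (pi * d)))"
      by (simp only: mult_ac)
    ultimately show ?thesis by simp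
  qed
  also have "\<dots> \<le> sqrt y * (e / 2 * (exp (- (pi * d)) * L2_norm lborel g))"
    using d(2) sy by (intro mult_left_mono mult_right_mono) auto
  finally have N2: "L2_norm lborel \<zeta>2 \<le> sqrt y * e'" by (simp add: e'_def)
  \<comment> \<open>lower bound for the norm of the packet\<close>
  have lowphi: "cmod (of_real (sqrt y * exp (- (pi * d))) * g (s - a)) \<le> cmod (\<phi> s)" for s
  proof (cases "d < \<bar>s - a\<bar>")
    case False
    have "y \<le> inv_symbol s * exp (pi * \<bar>a - s\<bar>)" using inv_symbol_shift[of s "a - s"] a by simp
    also have "\<dots> \<le> inv_symbol s * (exp (pi * d))\<^sup>2"
    proof (rule mult_left_mono)
      have "pi * \<bar>a - s\<bar> \<le> 2 * (pi * d)" using False d mult_left_mono[of "\<bar>a - s\<bar>" d pi] by (simp add: abs_minus_commute)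
      then show "exp (pi * \<bar>a - s\<bar>) \<le> (exp (pi * d))\<^sup>2" by (simp flip: exp_of_nat_mult)
    qed (use inv_symbol_pos in \<open>simp add: less_imp_le\<close>)
    finally have "sqrt y \<le> sqrt (inv_symbol s * (exp (pi * d))\<^sup>2)" by (rule real_sqrt_le_mono)
    then have "sqrt y * exp (- (pi * d)) \<le> sqrt (inv_symbol s) * exp (pi * d) * exp (- (pi * d))"
      by (intro mult_right_mono) (auto simp: real_sqrt_mult)
    then have "sqrt y * exp (- (pi * d)) \<le> sqrt (inv_symbol s)" by (simp add: mult.assoc flip: exp_add)
    then have "sqrt y * exp (- (pi * d)) * cmod (g (s - a)) \<le> sqrt (inv_symbol s) * cmod (g (s - a))"
      by (rule mult_right_mono) simp
    moreover have "cmod (\<phi> s) = sqrt (inv_symbol s) * cmod (g (s - a))"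
      unfolding \<phi>_def \<eta>_def using inv_symbol_pos[of s]
      by (simp add: norm_mult norm_divide cmod_gam_inv_symbol)
    ultimately show ?thesis using sy by (simp add: norm_mult)
  qed (simp add: g_supp)
  have gaL: "(\<lambda>s. g (s - a)) \<in> L2_space lborel" "L2_norm lborel (\<lambda>s. g (s - a)) = L2_norm lborel g"
    using translation_L2[OF test_L2[OF g], of "- a"] by simp_all
  have "L2_norm lborel (\<lambda>s. of_real (sqrt y * exp (- (pi * d))) * g (s - a)) \<le> L2_norm lborel \<phi>"
    by (rule L2_norm_mono[OF test_L2[OF \<phi>] L2_measurable[OF L2_scale[OF gaL(1)]]]) (rule AE_I2, rule lowphi)
  then have low: "sqrt y * (exp (- (pi * d)) * L2_norm lborel g) \<le> L2_norm lborel \<phi>"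
    unfolding L2_norm_scale gaL(2) norm_of_real using sy by (simp add: mult.assoc)
  have pos: "0 < sqrt y * (exp (- (pi * d)) * L2_norm lborel g)" using sy gpos by simp
  have \<zeta>2L: "\<zeta>2 \<in> L2_space lborel" unfolding \<zeta>2_def[abs_def] by (rule cis_L2[OF L2])
  have "L2_norm lborel (\<lambda>s. symbol \<phi> s - of_real l * \<phi> s) \<le> L2_norm lborel \<zeta>1 + L2_norm lborel \<zeta>2"
    unfolding split by (rule L2_triangle[OF L1 \<zeta>2L])
  also have "\<dots> \<le> sqrt y * e' + sqrt y * e'" by (rule add_mono[OF N1 N2])
  also have "\<dots> = e * (sqrt y * (exp (- (pi * d)) * L2_norm lborel g))" by (simp add: e'_def)
  also have "\<dots> \<le> e * L2_norm lborel \<phi>" using e by (intro mult_left_mono low) simp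
  finally show ?thesis using \<phi> low pos by (intro exI[of _ \<phi>]) auto
qed

end

section \<open>Location of the spectrum\<close>

lemma filterlim_poly_at_top_sequence:
  fixes p :: "real poly"
  assumes "degree p \<ge> 1" "lead_coeff p > 0"
  shows "filterlim (\<lambda>n. poly p (real n)) at_top sequentially"
proof -
  have "filterlim (\<lambda>n. poly p (real n)) at_infinity sequentially"
    using assms(1) by (intro filterlim_compose[OF filterlim_poly_at_infinity tendsto_of_nat]) simp
  moreover obtain r where r: "\<And>y. y \<ge> r \<Longrightarrow> poly p y \<ge> lead_coeff p"
    using poly_pinfty_gt_lc[OF assms(2)] by blast
  have "\<forall>\<^sub>F n in sequentially. poly p (real n) = \<bar>poly p (real n)\<bar>"
    using eventually_ge_at_top[of "nat \<lceil>r\<rceil>"]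
  proof eventually_elim
    case (elim n)
    then have "lead_coeff p \<le> poly p (real n)" by (intro r) linarith
    then show ?case using assms(2) by linarith
  qed
  ultimately show ?thesis
    unfolding filterlim_at_infinity_conv_norm_at_top real_norm_def by (simp add: filterlim_cong[OF refl refl])
qed

lemma filterlim_signed_real_at_infinity:
  "filterlim (\<lambda>n. real n) at_infinity sequentially" "filterlim (\<lambda>n. - real n) at_infinity sequentially"
proof -
  show "filterlim (\<lambda>n. real n) at_infinity sequentially" by (rule tendsto_of_nat)
  then show "filterlim (\<lambda>n. - real n) at_infinity sequentially" by (simp add: filterlim_at_infinity_conv_norm_at_top)
qed

context hankel_polynomial begin

lemma wave_packet_spectrum:
  assumes "\<And>e. e > 0 \<Longrightarrow> \<exists>\<phi>. test \<phi> \<and> L2_norm lborel \<phi> > 0 \<and>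
      L2_norm lborel (\<lambda>s. symbol \<phi> s - z * \<phi> s) \<le> e * L2_norm lborel \<phi>"
  shows "z \<in> spectrum half_line (hankel_op P)"
proof -
  interpret closed_symmetric_operator half_line "hankel_op P" by (rule hankel_closed_symmetric)
  show ?thesis
  proof (rule spectrumI)
    fix e :: real assume "e > 0"
    from assms[OF this] obtain \<phi> where \<phi>: "test \<phi>" "L2_norm lborel \<phi> > 0"
        "L2_norm lborel (\<lambda>s. symbol \<phi> s - z * \<phi> s) \<le> e * L2_norm lborel \<phi>"
      by blast
    let ?\<psi> = "\<lambda>s. 1 * symbol \<phi> s + (- z) * \<phi> s"
    have \<psi>: "test ?\<psi>" by (intro test_add test_cmult test_symbol \<phi>(1))
    have "(\<lambda>t. mellin (symbol \<phi>) t - z * mellin \<phi> t) = mellin ?\<psi>"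
      unfolding mellin_combination[OF test_symbol[OF \<phi>(1)] \<phi>(1)] by simp
    then have "L2_norm half_line (\<lambda>t. mellin (symbol \<phi>) t - z * mellin \<phi> t) = sqrt (2 * pi) * L2_norm lborel ?\<psi>"
      using mellin_L2(2)[OF \<psi>] by simp
    also have "\<dots> \<le> sqrt (2 * pi) * (e * L2_norm lborel \<phi>)"
      using \<phi>(3) by (intro mult_left_mono) simp_all
    also have "\<dots> = e * L2_norm half_line (mellin \<phi>)" unfolding mellin_L2(2)[OF \<phi>(1)] by simp
    finally have "L2_norm half_line (\<lambda>t. mellin (symbol \<phi>) t - z * mellin \<phi> t) \<le> e * L2_norm half_line (mellin \<phi>)" .
    moreover have "L2_norm half_line (mellin \<phi>) > 0"
      unfolding mellin_L2(2)[OF \<phi>(1)] using \<phi>(2) by simp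
    ultimately show "\<exists>f g. (f, g) \<in> hankel_op P \<and> L2_norm half_line f > 0 \<and>
        L2_norm half_line (\<lambda>x. g x - z * f x) \<le> e * L2_norm half_line f"
      using mellin_mem_hankel[OF \<phi>(1)] by (intro exI conjI)
  qed
qed

text \<open>
  Frequencies tending to \<open>- \<infinity>\<close> reach the values \<open>l\<close> whose sign is opposite to that of the leading coefficient, provided that
  the degree is odd.
\<close>

lemma nonzero_wave_packet:
  fixes l :: real
  assumes "degree Q \<ge> 1" "l \<noteq> 0" "odd (degree Q) \<or> lead_coeff Q * l > 0" and e: "e > 0"
  shows "\<exists>\<phi>. test \<phi> \<and> L2_norm lborel \<phi> > 0 \<and>
      L2_norm lborel (\<lambda>s. symbol \<phi> s - of_real l * \<phi> s) \<le> e * L2_norm lborel \<phi>"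
proof -
  let ?p = "smult (1 / l) Q"
  have p: "degree ?p = degree Q" "lead_coeff ?p = lead_coeff Q / l" using assms(2) by simp_all
  have sign: "odd (degree Q) \<or> lead_coeff Q / l > 0"
    using assms(3) by (auto simp: zero_less_mult_iff zero_less_divide_iff)
  show ?thesis
  proof (cases "lead_coeff Q / l > 0")
    case True
    then have "filterlim (\<lambda>n. poly ?p (real n)) at_top sequentially"
      using assms(1) p by (intro filterlim_poly_at_top_sequence) simp_all
    then show ?thesis
      by (intro wave_packet[OF assms(1,2) e filterlim_signed_real_at_infinity(1)]) simp
  next
    case False
    let ?q = "pcompose ?p [:0, -1:]"
    have "lead_coeff Q / l \<noteq> 0" using Q_nonzero assms(2) by simp
    then have "lead_coeff Q / l < 0" using False by linarith
    moreover have "lead_coeff ?q = lead_coeff ?p * (-1) ^ degree ?p" by (subst lead_coeff_comp) simp_all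
    moreover have "(-1 :: real) ^ degree ?p = -1" using False sign p by simp
    ultimately have "lead_coeff ?q > 0" using p(2) by (simp only:)
    moreover have "degree ?q \<ge> 1" using assms(1) unfolding degree_pcompose p(1) by simp
    ultimately have "filterlim (\<lambda>n. poly ?q (real n)) at_top sequentially"
      by (intro filterlim_poly_at_top_sequence)
    then show ?thesis
      by (intro wave_packet[OF assms(1,2) e filterlim_signed_real_at_infinity(2)]) (simp add: poly_pcompose)
  qed
qed

lemma mem_spectrum:
  fixes l :: real
  assumes deg: "degree Q \<ge> 1" and l: "odd (degree Q) \<or> lead_coeff Q * l \<ge> 0"
  shows "of_real l \<in> spectrum half_line (hankel_op P)"
proof (rule wave_packet_spectrum)
  fix e :: real assume e: "e > 0"
  have lc: "lead_coeff Q \<noteq> 0" using Q_nonzero by simp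
  \<comment> \<open>the point \<open>0\<close> is approached by nonzero points of the right sign\<close>
  define k where "k = (if l = 0 then sgn (lead_coeff Q) * (e / 2) else l)"
  have k: "k \<noteq> 0" "\<bar>k - l\<bar> \<le> e / 2" using lc e by (auto simp: k_def abs_mult sgn_if)
  have "lead_coeff Q * k > 0" if "lead_coeff Q * l \<ge> 0"
  proof (cases "l = 0")
    case True
    have "lead_coeff Q * k = \<bar>lead_coeff Q\<bar> * (e / 2)" using True by (simp add: k_def abs_sgn)
    also have "\<dots> > 0" using lc e by (intro mult_pos_pos) simp_all
    finally show ?thesis .
  qed (use that lc in \<open>auto simp: k_def less_le\<close>)
  then have sign: "odd (degree Q) \<or> lead_coeff Q * k > 0" using l by blast
  obtain \<phi> where \<phi>: "test \<phi>" "L2_norm lborel \<phi> > 0"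
      "L2_norm lborel (\<lambda>s. symbol \<phi> s - of_real k * \<phi> s) \<le> e / 2 * L2_norm lborel \<phi>"
    using nonzero_wave_packet[OF deg k(1) sign, of "e / 2"] e by auto
  have "(\<lambda>s. 1 * symbol \<phi> s + (- of_real k) * \<phi> s) \<in> L2_space lborel"
    by (intro test_L2 test_add test_cmult test_symbol \<phi>(1))
  then have L: "(\<lambda>s. symbol \<phi> s - of_real k * \<phi> s) \<in> L2_space lborel" by simp
  have "L2_norm lborel (\<lambda>s. symbol \<phi> s - of_real l * \<phi> s) =
      L2_norm lborel (\<lambda>s. (symbol \<phi> s - of_real k * \<phi> s) + of_real (k - l) * \<phi> s)"
    by (simp add: algebra_simps)
  also have "\<dots> \<le> L2_norm lborel (\<lambda>s. symbol \<phi> s - of_real k * \<phi> s) + \<bar>k - l\<bar> * L2_norm lborel \<phi>"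
    using L2_triangle[OF L L2_scale[OF test_L2[OF \<phi>(1)], of "of_real (k - l)"]]
    unfolding L2_norm_scale norm_of_real .
  also have "\<dots> \<le> e / 2 * L2_norm lborel \<phi> + e / 2 * L2_norm lborel \<phi>"
    using \<phi> k(2) by (intro add_mono mult_right_mono) auto
  finally show "\<exists>\<phi>. test \<phi> \<and> L2_norm lborel \<phi> > 0 \<and>
      L2_norm lborel (\<lambda>s. symbol \<phi> s - of_real l * \<phi> s) \<le> e * L2_norm lborel \<phi>"
    using \<phi>(1,2) by (intro exI[of _ \<phi>]) simp
qed

end

theorem theorem4p7:
  fixes K :: nat and P :: "real poly"
  assumes "K \<ge> 1" and "degree P = K"
  shows "\<not> is_eigenvalue half_line (hankel_op P) 0 \<and>
    (odd K \<longrightarrow> spectrum half_line (hankel_op P) = \<real>) \<and>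
    (even K \<and> coeff P K > 0 \<longrightarrow>
       essential_spectrum half_line (hankel_op P) = complex_of_real ` {0..})"
proof -
  obtain Q where Q: "degree Q \<le> K" "coeff Q K = coeff P K"
      "\<And>t. t > 0 \<Longrightarrow> kernel_of Q t = of_real (poly P (ln t) / t)"
    using ex_laplace_density[of P K] assms(2) by blast
  have PK: "coeff P K \<noteq> 0" using assms by (metis degree_0 leading_coeff_0_iff not_one_le_zero)
  then have deg: "degree Q = K" "lead_coeff Q = coeff P K" using Q le_degree[of Q K] by auto
  interpret hankel_polynomial P Q
    by unfold_locales (use Q deg PK in \<open>auto simp: hankel_kernel_def\<close>)
  interpret selfadjoint_operator half_line "hankel_op P" by (rule hankel_selfadjoint)
  have mem: "complex_of_real l \<in> spectrum half_line (hankel_op P)" if "odd K \<or> coeff P K * l \<ge> 0" for l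
    using that assms(1) mem_spectrum[of l] deg by simp
  have odd: "spectrum half_line (hankel_op P) = \<real>" if "odd K"
    using spectrum_real mem that by (auto simp: Reals_def)
  have even: "essential_spectrum half_line (hankel_op P) = complex_of_real ` {0..}" if "even K" "coeff P K > 0"
  proof -
    have "even (degree Q)" "degree Q \<ge> 1" "lead_coeff Q > 0" using that assms(1) deg by simp_all
    then obtain r m where "r \<ge> 0" "m \<ge> 0" "\<And>y. \<bar>y\<bar> > r \<Longrightarrow> poly Q y \<ge> 0" "\<And>y. poly Q y \<ge> - m"
      by (rule even_poly_lower_bound) (use that in blast)
    then interpret compactly_bounded_below half_line "hankel_op P"
        "\<lambda>f. m * (L2_norm half_line (cut_laplace (exp (- r)) (exp r) f))\<^sup>2"
      by (rule compactly_bounded_below)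
    show ?thesis by (rule essential_spectrum_eq_nonneg) (use mem that in auto)
  qed
  show ?thesis using hankel_injective odd even by blast
qed

end
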